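(* Let $(P_t)_{t\ge0}$ be a non-explosive homogeneous PDMP semigroup on $\mathsf M$ with characteristics $(\varphi,\lambda,Q)$ which is smoothly and compactly approximable (defined in the context). Then $(P_t)_{t\ge0}$ is a Feller semigroup and $C^1_c(\mathsf M)$ is a core for the strong generator $\bar{\mathcal A}$ of $(P_t)_{t\ge0}$ seen as an operator on $C_0(\mathsf M)$.
   Context: $\mathsf M$ is a smooth closed Riemannian submanifold of $\mathbb R^N$ with Borel $\sigma$-field $\mathcal B(\mathsf M)$, Riemannian distance and closed balls $\overline B(x,r)$; $\infty\notin\mathsf M$ is a cemetery point; $\inf\emptyset=+\infty$. $B(\mathsf M)$: bounded measurable real functions with the uniform norm $\|\cdot\|_\infty$; $C_0(\mathsf M)$: continuous functions vanishing at infinity; $C^1(\mathsf M)$: continuously differentiable functions; $C^1_c(\mathsf M)$: those with compact support; $\|F\|_{\infty,K}=\sup_{x\in K}|F(x)|$. A homogeneous differential flow is a measurable map $(t,x)\mapsto\varphi_t(x)$ from $\mathbb R_+\times\mathsf M$ to $\mathsf M$ with $\varphi_0=\mathrm{Id}$, $\varphi_{t+s}=\varphi_s\circ\varphi_t$, $t\mapsto\varphi_t(x)$ continuously differentiable for all $x$, and each $\varphi_t$ a $C^1$-diffeomorphism of $\mathsf M$. A homogeneous jump rate is a measurable $\lambda:\mathsf M\to\mathbb R_+$ bounded on compact sets, and a homogeneous Markov kernel $Q$ is a Markov kernel on $(\mathsf M,\mathcal B(\mathsf M))$; $Qf(x)=\int f(y)Q(x,dy)$. Together $(\varphi,\lambda,Q)$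 are homogeneous characteristics. A PDMP with these characteristics and initial law $\mu_0$ is a process with the law of the following one. Let $G:\mathsf M\times[0,1]\to\mathsf M$ be measurable with $Q(x,A)=\mathbb P(G(x,U)\in A)$, $U$ uniform on $[0,1]$; let $W_0\sim\mu_0$ and, independently, $(E_k,U_k)_{k\ge1}$ i.i.d., $E_k$ exponential with parameter $1$, $U_k$ uniform on $[0,1]$, independent. Set $S_0=0$, $X_0=X'_0=W_0$; given $X_k'\in\mathsf M$, $S_k<\infty$, set $S_{k+1}=\inf\{t\ge S_k:E_{k+1}<\int_{S_k}^t\lambda(\varphi_{s-S_k}(X'_k))\,ds\}$; if $S_{k+1}=+\infty$, set $S_m=+\infty$ for $m>k$ and $X_t=\varphi_{t-S_k}(X_k')$ for $t\ge S_k$; otherwise $X_t=\varphi_{t-S_k}(X'_k)$ for $t\in(S_k,S_{k+1})$ and $X_{S_{k+1}}=X'_{k+1}=G(\varphi_{S_{k+1}-S_k}(X'_k),U_{k+1})$. For $t\ge\sup_kS_k$, $X_t=\infty$. The characteristics (and semigroup) are non-explosive if for every initial law $\inf\{t:X_t=\infty\}=+\infty$ a.s. The semigroup is $P_t(x,A)=\mathbb P(X_t\in A)$ with $X_0=x$, and $P_tf(x)=\mathbb E[f(X_t)]$. Bounded-displacement property of $(\varphi,\lambda,Q)$: the characteristics are non-explosive and for all $T\ge0$ there exists $r\ge0$ such that $\mathrm{supp}\,P_t(x,\cdot)\subset\overline B(x,r)$ for all $x\in\mathsf M$, $t\in[0,T]$. Compact compatibility: $\varphi$ and $Q$ are compactly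 compatible if for all compact $K\subset\mathsf M$ and $T\ge0$ there exists a compact set $\tilde K\subset\mathsf M$ such that: for all $n\in\{1,2,\dots\}$ and $(t_i)_{1\le i\le n}\in\mathbb R_+^n$ with $\sum_{i=1}^nt_i\le T$, there exist compact sets $(K_i)_{1\le i\le n}$ of $\mathsf M$ such that, setting $K_0=K$: (1) for all $i\in\{1,\dots,n\}$, $K_i$ only depends on $(t_j)_{1\le j\le i}$, and $\bigcup_{i=0}^nK_i\subset\tilde K$; (2) for all $i\in\{0,\dots,n-1\}$, $s_{i+1}\in[0,t_{i+1}]$ and $s_{n+1}\in[0,T-\sum_{j=1}^nt_j]$, $\bigcup_{x\in K_i}\mathrm{supp}\,Q(\varphi_{t_{i+1}}(x),\cdot)\subset K_{i+1}$, $\varphi_{s_{i+1}}(K_i)\subset\tilde K$ and $\varphi_{s_{n+1}}(K_n)\subset\tilde K$. Stability property of $(\varphi,\lambda,Q)$: (i) $\varphi$ and $Q$ are compactly compatible; (ii) $\lambda\in C^1(\mathsf M)$, $\lambda Qf\in C^1(\mathsf M)$ for all $f\in C^1(\mathsf M)$, and there exists a locally bounded function $\Psi:\mathsf M\to\mathbb R_+$ such that for all $f\in C^1(\mathsf M)$, all compact $K\subset\mathsf M$ and all $x\in K$, $\|\nabla(\lambda Qf)(x)\|\le\|\Psi\|_{\infty,K}\sup\{|f(y)|+\|\nabla f(y)\|:y\in\mathrm{supp}\,Q(x,\cdot)\}$; (iii) $(t,x)\mapsto\varphi_t(x)$ is $C^1$ on $\mathbb R_+\times\mathsf M$ and for all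 compact $K\subset\mathsf M$ and $t\ge0$, $\sup\{\|\nabla\varphi_s(x)\|:s\in[0,t],x\in K\}<+\infty$. The semigroup with characteristics $(\varphi,\lambda,Q)$ is smoothly and compactly approximable if for all $\varepsilon>0$ there exist characteristics $(\varphi,\lambda^\varepsilon,Q^\varepsilon)$ (same flow) with the bounded-displacement property and the stability property such that $$\sup_{x\in\mathsf M,\,A\in\mathcal B(\mathsf M)}\Big\{(\lambda^\varepsilon(x)\wedge\lambda(x))\,|Q^\varepsilon(x,A)-Q(x,A)|+|\lambda^\varepsilon(x)-\lambda(x)|\Big\}\le\varepsilon.$$ $(P_t)$ is Feller if $\lim_{t\to0}\|P_tf-f\|_\infty=0$ and $P_tf\in C_0(\mathsf M)$ for all $f\in C_0(\mathsf M)$, $t\ge0$. The strong generator of $(P_t)$ as an operator on $C_0(\mathsf M)$ has domain the set of $f\in C_0(\mathsf M)$ for which there is $g\in C_0(\mathsf M)$ with $\lim_{t\to0}\|t^{-1}(P_tf-f)-g\|_\infty=0$, and then $\bar{\mathcal A}f=g$. A core of a closed operator is a subset of its domain such that the closure of the restriction of the operator to it is the operator. *)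

theory Defs
  imports "HOL-Probability.Probability"
begin

section \<open>Submanifolds of a Euclidean space\<close>

text \<open>\<open>k\<close>-fold continuous differentiability; \<open>U\<close> is meant to be open.\<close>

primrec Ck_on :: "nat \<Rightarrow> 'a::euclidean_space set \<Rightarrow> ('a \<Rightarrow> 'b::euclidean_space) \<Rightarrow> bool" where
  "Ck_on 0 U f \<longleftrightarrow> continuous_on U f"
| "Ck_on (Suc k) U f \<longleftrightarrow>
     f differentiable_on U \<and> (\<forall>v. Ck_on k U (\<lambda>x. frechet_derivative f (at x) v))"

definition smooth_on :: "'a::euclidean_space set \<Rightarrow> ('a \<Rightarrow> 'b::euclidean_space) \<Rightarrow> bool" where
  "smooth_on U f \<longleftrightarrow> (\<forall>k. Ck_on k U f)"

text \<open>Embedded submanifolds without boundary, of constant dimension \<open>d\<close>, by slice charts.\<close>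

definition smooth_submanifold :: "'a::euclidean_space set \<Rightarrow> bool" where
  "smooth_submanifold M \<longleftrightarrow>
     (\<exists>d. \<forall>p\<in>M. \<exists>U V \<Phi> \<Psi> (W :: 'a set).
        open U \<and> p \<in> U \<and> open V \<and> homeomorphism U V \<Phi> \<Psi> \<and> smooth_on U \<Phi> \<and> smooth_on V \<Psi> \<and>
        subspace W \<and> dim W = d \<and> \<Phi> ` (U \<inter> M) = V \<inter> W)"

text \<open>On an arbitrary subset \<open>S\<close> (a submanifold, or a product of one with the half-line),
  \<open>C\<^sup>1\<close> means: locally the restriction of a \<open>C\<^sup>1\<close> map on an open set of the ambient space.\<close>

definition C1_on :: "'a::euclidean_space set \<Rightarrow> ('a \<Rightarrow> 'b::euclidean_space) \<Rightarrow> bool" where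
  "C1_on S f \<longleftrightarrow>
     (\<forall>p\<in>S. \<exists>U F. open U \<and> p \<in> U \<and> Ck_on 1 U F \<and> (\<forall>x\<in>S \<inter> U. F x = f x))"

definition tangent_space :: "'a::euclidean_space set \<Rightarrow> 'a \<Rightarrow> 'a set" where
  "tangent_space M x =
     {v. \<exists>\<gamma> e. 0 < e \<and> C1_on {-e<..<e} \<gamma> \<and> \<gamma> ` {-e<..<e} \<subseteq> M \<and> \<gamma> 0 = x \<and>
               (\<gamma> has_vector_derivative v) (at (0::real))}"

text \<open>The derivative within \<open>M\<close> is unique only on tangent vectors, so
  \<^term>\<open>frechet_derivative f (at x within M)\<close> is applied to tangent vectors only.
  The metric on \<open>M\<close> is induced by the ambient inner product.\<close>

definition riem_grad :: "'a::euclidean_space set \<Rightarrow> ('a \<Rightarrow> real) \<Rightarrow> 'a \<Rightarrow> 'a" where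
  "riem_grad M f x =
     (THE g. g \<in> tangent_space M x \<and>
             (\<forall>v\<in>tangent_space M x. g \<bullet> v = frechet_derivative f (at x within M) v))"

definition differential_norm ::
    "'a::euclidean_space set \<Rightarrow> ('a \<Rightarrow> 'b::euclidean_space) \<Rightarrow> 'a \<Rightarrow> ennreal" where
  "differential_norm M f x =
     (SUP v\<in>{v \<in> tangent_space M x. norm v \<le> 1}.
        ennreal (norm (frechet_derivative f (at x within M) v)))"

text \<open>The infimum of the empty set is \<open>\<infinity>\<close>: points in different components are at infinite distance.\<close>

definition riem_dist :: "'a::euclidean_space set \<Rightarrow> 'a \<Rightarrow> 'a \<Rightarrow> ennreal" where
  "riem_dist M x y =
     Inf {\<integral>\<^sup>+t\<in>{0..1}. ennreal (norm (vector_derivative \<gamma> (at t))) \<partial>lborel | \<gamma>.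
            \<gamma> piecewise_C1_differentiable_on {0..1} \<and> \<gamma> ` {0..1} \<subseteq> M \<and>
            pathstart \<gamma> = x \<and> pathfinish \<gamma> = y}"

definition riem_cball :: "'a::euclidean_space set \<Rightarrow> 'a \<Rightarrow> real \<Rightarrow> 'a set" where
  "riem_cball M x r = {y \<in> M. riem_dist M x y \<le> ennreal r}"


section \<open>Function spaces\<close>

text \<open>Functions on \<open>M\<close> are functions on the ambient space whose values off \<open>M\<close> are ignored.
  Suprema of possibly unbounded functions are taken in \<^typ>\<open>ennreal\<close>.\<close>

definition sup_norm :: "'a set \<Rightarrow> ('a \<Rightarrow> real) \<Rightarrow> ennreal" where
  "sup_norm K f = (SUP x\<in>K. ennreal \<bar>f x\<bar>)"

definition C0 :: "'a::euclidean_space set \<Rightarrow> ('a \<Rightarrow> real) set" where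
  "C0 M = {f. continuous_on M f \<and>
              (\<forall>e>0. \<exists>K. compact K \<and> K \<subseteq> M \<and> (\<forall>x\<in>M - K. \<bar>f x\<bar> < e))}"

definition C1 :: "'a::euclidean_space set \<Rightarrow> ('a \<Rightarrow> real) set" where
  "C1 M = {f. C1_on M f}"

definition C1c :: "'a::euclidean_space set \<Rightarrow> ('a \<Rightarrow> real) set" where
  "C1c M = {f \<in> C1 M. compact (M \<inter> closure {x \<in> M. f x \<noteq> 0})}"


section \<open>Characteristics\<close>

abbreviation borel_of :: "'a::euclidean_space set \<Rightarrow> 'a measure" where
  "borel_of M \<equiv> restrict_space borel M"

definition homogeneous_flow ::
    "'a::euclidean_space set \<Rightarrow> (real \<Rightarrow> 'a \<Rightarrow> 'a) \<Rightarrow> bool" where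
  "homogeneous_flow M \<phi> \<longleftrightarrow>
     (\<lambda>(t, x). \<phi> t x) \<in> borel_of {0..} \<Otimes>\<^sub>M borel_of M \<rightarrow>\<^sub>M borel_of M \<and>
     (\<forall>x\<in>M. \<phi> 0 x = x) \<and>
     (\<forall>t\<ge>0. \<forall>s\<ge>0. \<forall>x\<in>M. \<phi> (t + s) x = \<phi> s (\<phi> t x)) \<and>
     (\<forall>x\<in>M. C1_on {0..} (\<lambda>t. \<phi> t x)) \<and>
     (\<forall>t\<ge>0. bij_betw (\<phi> t) M M \<and> C1_on M (\<phi> t) \<and> C1_on M (inv_into M (\<phi> t)))"

definition jump_rate :: "'a::euclidean_space set \<Rightarrow> ('a \<Rightarrow> real) \<Rightarrow> bool" where
  "jump_rate M lam \<longleftrightarrow>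
     lam \<in> borel_measurable (borel_of M) \<and> (\<forall>x\<in>M. 0 \<le> lam x) \<and>
     (\<forall>K. compact K \<and> K \<subseteq> M \<longrightarrow> bounded (lam ` K))"

definition markov_kernel :: "'a::euclidean_space set \<Rightarrow> ('a \<Rightarrow> 'a measure) \<Rightarrow> bool" where
  "markov_kernel M Q \<longleftrightarrow> Q \<in> borel_of M \<rightarrow>\<^sub>M prob_algebra (borel_of M)"

definition characteristics ::
    "'a::euclidean_space set \<Rightarrow> (real \<Rightarrow> 'a \<Rightarrow> 'a) \<Rightarrow> ('a \<Rightarrow> real) \<Rightarrow> ('a \<Rightarrow> 'a measure) \<Rightarrow> bool" where
  "characteristics M \<phi> lam Q \<longleftrightarrow> homogeneous_flow M \<phi> \<and> jump_rate M lam \<and> markov_kernel M Q"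


section \<open>Construction of the process\<close>

text \<open>The laws below live on \<open>[0,1]\<close> itself because \<open>G\<close> is only constrained there.\<close>

abbreviation uniform01 :: "real measure" where
  "uniform01 \<equiv> restrict_space lborel {0..1}"

definition represents_kernel ::
    "'a::euclidean_space set \<Rightarrow> ('a \<Rightarrow> 'a measure) \<Rightarrow> ('a \<times> real \<Rightarrow> 'a) \<Rightarrow> bool" where
  "represents_kernel M Q G \<longleftrightarrow>
     G \<in> borel_of M \<Otimes>\<^sub>M borel_of {0..1} \<rightarrow>\<^sub>M borel_of M \<and>
     (\<forall>x\<in>M. \<forall>A\<in>sets (borel_of M). measure (Q x) A = measure uniform01 {u \<in> {0..1}. G (x, u) \<in> A})"

text \<open>An outcome \<open>(w, \<omega>)\<close> consists of the initial point \<open>w\<close> and the pairs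
  \<open>\<omega> k = (E\<^bsub>k+1\<^esub>, U\<^bsub>k+1\<^esub>)\<close>.\<close>

definition pdmp_space :: "'a measure \<Rightarrow> ('a \<times> (nat \<Rightarrow> real \<times> real)) measure" where
  "pdmp_space \<mu> =
     \<mu> \<Otimes>\<^sub>M (\<Pi>\<^sub>M k\<in>UNIV. density lborel (exponential_density 1) \<Otimes>\<^sub>M uniform01)"

text \<open>The pair \<open>(S\<^sub>k, X'\<^sub>k)\<close>; the second component is irrelevant once \<open>S\<^sub>k = \<infinity>\<close>.\<close>

primrec pdmp_jump ::
    "(real \<Rightarrow> 'a \<Rightarrow> 'a) \<Rightarrow> ('a \<Rightarrow> real) \<Rightarrow> ('a \<times> real \<Rightarrow> 'a) \<Rightarrow>
     'a \<times> (nat \<Rightarrow> real \<times> real) \<Rightarrow> nat \<Rightarrow> ereal \<times> 'a" where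
  "pdmp_jump \<phi> lam G w\<omega> 0 = (0, fst w\<omega>)"
| "pdmp_jump \<phi> lam G w\<omega> (Suc k) =
     (let (S, x) = pdmp_jump \<phi> lam G w\<omega> k;
          s = real_of_ereal S;
          (E, U) = snd w\<omega> k;
          S' = Inf {ereal t | t. s \<le> t \<and> E < (LINT u:{s..t}|lborel. lam (\<phi> (u - s) x))}
      in if S = \<infinity> \<or> S' = \<infinity> then (\<infinity>, x)
         else (S', G (\<phi> (real_of_ereal S' - s) x, U)))"

definition jump_time ::
    "(real \<Rightarrow> 'a \<Rightarrow> 'a) \<Rightarrow> ('a \<Rightarrow> real) \<Rightarrow> ('a \<times> real \<Rightarrow> 'a) \<Rightarrow>
     'a \<times> (nat \<Rightarrow> real \<times> real) \<Rightarrow> nat \<Rightarrow> ereal" where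
  "jump_time \<phi> lam G w\<omega> k = fst (pdmp_jump \<phi> lam G w\<omega> k)"

definition post_jump ::
    "(real \<Rightarrow> 'a \<Rightarrow> 'a) \<Rightarrow> ('a \<Rightarrow> real) \<Rightarrow> ('a \<times> real \<Rightarrow> 'a) \<Rightarrow>
     'a \<times> (nat \<Rightarrow> real \<times> real) \<Rightarrow> nat \<Rightarrow> 'a" where
  "post_jump \<phi> lam G w\<omega> k = snd (pdmp_jump \<phi> lam G w\<omega> k)"

text \<open>The cemetery point is \<^const>\<open>None\<close>.\<close>

definition pdmp ::
    "(real \<Rightarrow> 'a \<Rightarrow> 'a) \<Rightarrow> ('a \<Rightarrow> real) \<Rightarrow> ('a \<times> real \<Rightarrow> 'a) \<Rightarrow>
     real \<Rightarrow> 'a \<times> (nat \<Rightarrow> real \<times> real) \<Rightarrow> 'a option" where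
  "pdmp \<phi> lam G t w\<omega> =
     (if ereal t < (SUP k. jump_time \<phi> lam G w\<omega> k)
      then let k = (THE k. jump_time \<phi> lam G w\<omega> k \<le> ereal t \<and> ereal t < jump_time \<phi> lam G w\<omega> (Suc k))
           in Some (\<phi> (t - real_of_ereal (jump_time \<phi> lam G w\<omega> k)) (post_jump \<phi> lam G w\<omega> k))
      else None)"

definition non_explosive ::
    "'a::euclidean_space set \<Rightarrow> (real \<Rightarrow> 'a \<Rightarrow> 'a) \<Rightarrow> ('a \<Rightarrow> real) \<Rightarrow> ('a \<times> real \<Rightarrow> 'a) \<Rightarrow> bool" where
  "non_explosive M \<phi> lam G \<longleftrightarrow>
     (\<forall>\<mu>\<in>space (prob_algebra (borel_of M)).
        AE w\<omega> in pdmp_space \<mu>. Inf {ereal t | t. 0 \<le> t \<and> pdmp \<phi> lam G t w\<omega> = None} = \<infinity>)"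

definition pdmp_semigroup ::
    "'a::euclidean_space set \<Rightarrow> (real \<Rightarrow> 'a \<Rightarrow> 'a) \<Rightarrow> ('a \<Rightarrow> real) \<Rightarrow> ('a \<times> real \<Rightarrow> 'a) \<Rightarrow>
     real \<Rightarrow> 'a \<Rightarrow> 'a set \<Rightarrow> real" where
  "pdmp_semigroup M \<phi> lam G t x A =
     (let \<Omega> = pdmp_space (return (borel_of M) x)
      in measure \<Omega> {w\<omega> \<in> space \<Omega>. pdmp \<phi> lam G t w\<omega> \<in> Some ` A})"

text \<open>The action of the semigroup on functions, with the convention \<open>f \<infinity> = 0\<close>.\<close>

definition pdmp_operator ::
    "'a::euclidean_space set \<Rightarrow> (real \<Rightarrow> 'a \<Rightarrow> 'a) \<Rightarrow> ('a \<Rightarrow> real) \<Rightarrow> ('a \<times> real \<Rightarrow> 'a) \<Rightarrow>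
     real \<Rightarrow> ('a \<Rightarrow> real) \<Rightarrow> 'a \<Rightarrow> real" where
  "pdmp_operator M \<phi> lam G t f x =
     (LINT w\<omega>|pdmp_space (return (borel_of M) x).
        (case pdmp \<phi> lam G t w\<omega> of None \<Rightarrow> 0 | Some y \<Rightarrow> f y))"


section \<open>Approximability\<close>

definition supp :: "'a::euclidean_space set \<Rightarrow> ('a set \<Rightarrow> real) \<Rightarrow> 'a set" where
  "supp M m = {y \<in> M. \<forall>U. open U \<and> y \<in> U \<longrightarrow> 0 < m (U \<inter> M)}"

definition bounded_displacement ::
    "'a::euclidean_space set \<Rightarrow> (real \<Rightarrow> 'a \<Rightarrow> 'a) \<Rightarrow> ('a \<Rightarrow> real) \<Rightarrow> ('a \<Rightarrow> 'a measure) \<Rightarrow> bool" where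
  "bounded_displacement M \<phi> lam Q \<longleftrightarrow>
     (\<exists>G. represents_kernel M Q G \<and> non_explosive M \<phi> lam G \<and>
        (\<forall>T\<ge>0. \<exists>r\<ge>0. \<forall>x\<in>M. \<forall>t\<in>{0..T}. supp M (pdmp_semigroup M \<phi> lam G t x) \<subseteq> riem_cball M x r))"

text \<open>That \<open>K\<^sub>i\<close> depends only on \<open>t\<^sub>1, \<dots>, t\<^sub>i\<close> is expressed by a single map \<open>\<K>\<close>
  on finite sequences of times, with \<open>K\<^sub>i = \<K> [t\<^sub>1, \<dots>, t\<^sub>i]\<close>.\<close>

definition compactly_compatible ::
    "'a::euclidean_space set \<Rightarrow> (real \<Rightarrow> 'a \<Rightarrow> 'a) \<Rightarrow> ('a \<Rightarrow> 'a measure) \<Rightarrow> bool" where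
  "compactly_compatible M \<phi> Q \<longleftrightarrow>
     (\<forall>K T. compact K \<and> K \<subseteq> M \<and> 0 \<le> T \<longrightarrow>
       (\<exists>K' \<K>. compact K' \<and> K' \<subseteq> M \<and> \<K> [] = K \<and>
         (\<forall>ts. ts \<noteq> [] \<and> (\<forall>t\<in>set ts. 0 \<le> t) \<and> sum_list ts \<le> T \<longrightarrow>
            (\<forall>i\<le>length ts. compact (\<K> (take i ts)) \<and> \<K> (take i ts) \<subseteq> K') \<and>
            (\<forall>i<length ts.
               (\<Union>x\<in>\<K> (take i ts). supp M (measure (Q (\<phi> (ts ! i) x)))) \<subseteq> \<K> (take (Suc i) ts) \<and>
               (\<forall>s\<in>{0..ts ! i}. \<phi> s ` \<K> (take i ts) \<subseteq> K')) \<and>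
            (\<forall>s\<in>{0..T - sum_list ts}. \<phi> s ` \<K> ts \<subseteq> K'))))"

definition jump_op :: "('a \<Rightarrow> real) \<Rightarrow> ('a \<Rightarrow> 'a measure) \<Rightarrow> ('a \<Rightarrow> real) \<Rightarrow> 'a \<Rightarrow> real" where
  "jump_op lam Q f x = lam x * (LINT y|Q x. f y)"

definition locally_bounded_on :: "'a::euclidean_space set \<Rightarrow> ('a \<Rightarrow> real) \<Rightarrow> bool" where
  "locally_bounded_on M \<Psi> \<longleftrightarrow> (\<forall>x\<in>M. \<exists>U. open U \<and> x \<in> U \<and> bounded (\<Psi> ` (U \<inter> M)))"

definition stability ::
    "'a::euclidean_space set \<Rightarrow> (real \<Rightarrow> 'a \<Rightarrow> 'a) \<Rightarrow> ('a \<Rightarrow> real) \<Rightarrow> ('a \<Rightarrow> 'a measure) \<Rightarrow> bool" where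
  "stability M \<phi> lam Q \<longleftrightarrow>
     compactly_compatible M \<phi> Q \<and>
     lam \<in> C1 M \<and> (\<forall>f\<in>C1 M. jump_op lam Q f \<in> C1 M) \<and>
     (\<exists>\<Psi>. (\<forall>x\<in>M. 0 \<le> \<Psi> x) \<and> locally_bounded_on M \<Psi> \<and>
        (\<forall>f\<in>C1 M. \<forall>K. compact K \<and> K \<subseteq> M \<longrightarrow> (\<forall>x\<in>K.
           ennreal (norm (riem_grad M (jump_op lam Q f) x)) \<le>
             sup_norm K \<Psi> *
             (SUP y\<in>supp M (measure (Q x)). ennreal (\<bar>f y\<bar> + norm (riem_grad M f y)))))) \<and>
     C1_on ({0..} \<times> M) (\<lambda>(t, x). \<phi> t x) \<and>
     (\<forall>K t. compact K \<and> K \<subseteq> M \<and> 0 \<le> t \<longrightarrow>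
        (SUP s\<in>{0..t}. SUP x\<in>K. differential_norm M (\<phi> s) x) < \<infinity>)"

definition smoothly_compactly_approximable ::
    "'a::euclidean_space set \<Rightarrow> (real \<Rightarrow> 'a \<Rightarrow> 'a) \<Rightarrow> ('a \<Rightarrow> real) \<Rightarrow> ('a \<Rightarrow> 'a measure) \<Rightarrow> bool" where
  "smoothly_compactly_approximable M \<phi> lam Q \<longleftrightarrow>
     (\<forall>\<epsilon>>0. \<exists>lam' Q'. characteristics M \<phi> lam' Q' \<and>
        bounded_displacement M \<phi> lam' Q' \<and> stability M \<phi> lam' Q' \<and>
        (\<forall>x\<in>M. \<forall>A\<in>sets (borel_of M).
           min (lam' x) (lam x) * \<bar>measure (Q' x) A - measure (Q x) A\<bar> + \<bar>lam' x - lam x\<bar> \<le> \<epsilon>))"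


section \<open>Feller semigroups, generators and cores\<close>

definition feller ::
    "'a::euclidean_space set \<Rightarrow> (real \<Rightarrow> ('a \<Rightarrow> real) \<Rightarrow> 'a \<Rightarrow> real) \<Rightarrow> bool" where
  "feller M P \<longleftrightarrow>
     (\<forall>f\<in>C0 M. ((\<lambda>t. sup_norm M (\<lambda>x. P t f x - f x)) \<longlongrightarrow> 0) (at_right 0) \<and> (\<forall>t\<ge>0. P t f \<in> C0 M))"

text \<open>Operators on \<open>C\<^sub>0(M)\<close> are given by their graphs. Graphs are closed under changing
  functions off \<open>M\<close>, so that equality of graphs is equality of operators.\<close>

definition strong_generator ::
    "'a::euclidean_space set \<Rightarrow> (real \<Rightarrow> ('a \<Rightarrow> real) \<Rightarrow> 'a \<Rightarrow> real) \<Rightarrow> (('a \<Rightarrow> real) \<times> ('a \<Rightarrow> real)) set" where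
  "strong_generator M P =
     {(f, g). f \<in> C0 M \<and> g \<in> C0 M \<and>
        ((\<lambda>t. sup_norm M (\<lambda>x. (P t f x - f x) / t - g x)) \<longlongrightarrow> 0) (at_right 0)}"

definition graph_closure ::
    "'a::euclidean_space set \<Rightarrow> (('a \<Rightarrow> real) \<times> ('a \<Rightarrow> real)) set \<Rightarrow> (('a \<Rightarrow> real) \<times> ('a \<Rightarrow> real)) set" where
  "graph_closure M A =
     {(f, g). f \<in> C0 M \<and> g \<in> C0 M \<and>
        (\<exists>fs gs. (\<forall>n. (fs n, gs n) \<in> A) \<and>
           (\<lambda>n. sup_norm M (\<lambda>x. fs n x - f x)) \<longlonglongrightarrow> 0 \<and>
           (\<lambda>n. sup_norm M (\<lambda>x. gs n x - g x)) \<longlonglongrightarrow> 0)}"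

definition is_core ::
    "'a::euclidean_space set \<Rightarrow> ('a \<Rightarrow> real) set \<Rightarrow> (('a \<Rightarrow> real) \<times> ('a \<Rightarrow> real)) set \<Rightarrow> bool" where
  "is_core M D A \<longleftrightarrow> D \<subseteq> Domain A \<and> graph_closure M (A \<inter> D \<times> UNIV) = A"

end

(*
The function u(t, x) = P_t f(x) is the unique bounded solution of the first-jump renewal equation
u = exp(-Lambda_t) f(phi_t) + K u; uniqueness holds because K^n 1 is the probability that the n-th
jump happens before t, which tends to 0 by non-explosion. Rewriting the equation in mild form and
comparing two sets of characteristics with the same flow by Duhamel's formula gives
|P_t f - P^eps_t f| <= const * eps * t * |f|. So the semigroups P^eps converge uniformly on
bounded time intervals.

For the approximating characteristics, bounded displacement confines the flow and P^eps_t f to a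
neighbourhood of the support of f. Hence P^eps preserves the continuous functions with compact
support, and lambda^eps (Q^eps - 1) f is again such a function. The Feller property passes to the
uniform limit.

For the core, the resolvent of P^eps is approximated by Riemann sums. Their convergence in graph
norm needs no gradient estimate on P^eps_t f: averaging a function along the flow turns a uniform
approximation into one that also approximates the generator. This makes the range of
1 - h A^eps on C^1_c dense up to an error of order eps; dissipativity transfers density of the range
to A itself, and a dissipative operator whose restriction has dense range has that restriction as
a core.
*)

theory Submission
  imports Defs
begin

section \<open>Calculus of Lipschitz indefinite integrals\<close>

text \<open>The rate is bounded on compact sets but possibly unbounded on \<open>M\<close>, so the
  jumps are not a bounded perturbation of the flow and no contraction constant for \<open>K\<close>
  is at hand. Estimates are therefore comparisons: a bound holds because the excess over it is a
  bounded subsolution of the renewal equation, whose sign \<open>max_principle\<close> decides. The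
  same lack of uniformity shapes continuity in space: the iterates approach the semigroup from below
  with an error controlled at each point only, which yields lower semicontinuity; the upper half
  uses conservativeness, by applying the lower half to a cutoff minus the function. Confinement in
  space is measured by one radius \<open>r1\<close>, valid for times up to 1: it bounds the flow,
  because with positive probability no jump occurs, and the jumps, because a jump from farther away
  would show up in the semigroup at once. The core argument faces a circularity: the function that
  nearly solves the resolvent equation is chosen after eps, while the error is eps times its norm.
  Dissipativity of the approximating generator bounds that norm by the data alone.\<close>

lemma set_integrable_Icc_bounded:
  fixes f :: "real \<Rightarrow> real"
  assumes [measurable]: "f \<in> borel_measurable borel" and C: "\<And>s. s \<in> {a..b} \<Longrightarrow> \<bar>f s\<bar> \<le> C"
  shows "set_integrable lborel {a..b} f"
  unfolding set_integrable_def
proof (rule Bochner_Integration.integrable_bound[where f = "\<lambda>s. indicator {a..b} s * C"])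
  show "integrable lborel (\<lambda>s. indicator {a..b} s * C :: real)"
    by (intro integrable_mult_left integrable_real_indicator) (auto simp: emeasure_lborel_Icc_eq)
  show "AE x in lborel. norm (indicat_real {a..b} x *\<^sub>R f x) \<le> norm (indicator {a..b} x * C)"
    using C by (auto simp: indicator_def intro!: AE_I2 split: if_splits) fastforce
qed simp

lemma LINT_Icc_split:
  fixes f :: "real \<Rightarrow> real"
  assumes "set_integrable lborel {a..c} f" "a \<le> b" "b \<le> c"
  shows "(LINT s:{a..c}|lborel. f s) = (LINT s:{a..b}|lborel. f s) + (LINT s:{b..c}|lborel. f s)"
proof -
  have "{a..c} = {a..b} \<union> {b<..c}" using assms by auto
  moreover have "(LINT s:{a..b} \<union> {b<..c}|lborel. f s) = (LINT s:{a..b}|lborel. f s) + (LINT s:{b<..c}|lborel. f s)"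
    by (rule set_integral_Un) (use assms in \<open>auto intro: set_integrable_subset[OF assms(1)]\<close>)
  moreover have "(LINT s:{b<..c}|lborel. f s) = (LINT s:{b..c}|lborel. f s)"
    unfolding set_lebesgue_integral_def
  proof (rule integral_cong_AE)
    have "set_integrable lborel {b<..c} f" "set_integrable lborel {b..c} f"
      using assms by (auto intro: set_integrable_subset[OF assms(1)])
    then show "(\<lambda>x. indicat_real {b<..c} x *\<^sub>R f x) \<in> borel_measurable lborel"
      "(\<lambda>x. indicat_real {b..c} x *\<^sub>R f x) \<in> borel_measurable lborel"
      unfolding set_integrable_def by auto
    show "AE x in lborel. indicat_real {b<..c} x *\<^sub>R f x = indicat_real {b..c} x *\<^sub>R f x"
      using AE_lborel_singleton[of b] by eventually_elim (auto simp: indicator_def)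
  qed
  ultimately show ?thesis by simp
qed

lemma LINT_Icc_le:
  fixes f :: "real \<Rightarrow> real"
  assumes [measurable]: "f \<in> borel_measurable borel" and C: "\<And>s. s \<in> {a..b} \<Longrightarrow> \<bar>f s\<bar> \<le> C" and "a \<le> b"
  shows "\<bar>LINT s:{a..b}|lborel. f s\<bar> \<le> C * (b - a)"
proof -
  have "\<bar>LINT s:{a..b}|lborel. f s\<bar> \<le> (LINT s|lborel. indicator {a..b} s * C)"
    unfolding set_lebesgue_integral_def
  proof (rule order_trans[OF integral_abs_bound integral_mono'])
    show "integrable lborel (\<lambda>s. indicator {a..b} s * C :: real)"
      by (intro integrable_mult_left integrable_real_indicator) (auto simp: emeasure_lborel_Icc_eq)
    have "0 \<le> C" using C[of a] \<open>a \<le> b\<close> by auto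
    then show "\<And>x. 0 \<le> indicat_real {a..b} x * C" by simp
    show "\<bar>indicat_real {a..b} x *\<^sub>R f x\<bar> \<le> indicat_real {a..b} x * C" for x
      using C by (auto simp: indicator_def)
  qed
  also have "\<dots> = C * (b - a)" using \<open>a \<le> b\<close> by simp
  finally show ?thesis .
qed

lemma LINT_Icc_mono:
  fixes f g :: "real \<Rightarrow> real"
  assumes "set_integrable lborel {a..b} f" "set_integrable lborel {a..b} g"
    and "\<And>s. s \<in> {a..b} \<Longrightarrow> f s \<le> g s"
  shows "(LINT s:{a..b}|lborel. f s) \<le> (LINT s:{a..b}|lborel. g s)"
  using assms unfolding set_lebesgue_integral_def set_integrable_def
  by (intro integral_mono) (auto simp: indicator_def)

text \<open>Over \<open>n + 1\<close> equal pieces of [0, T] the increments add up to at most C *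
  T^2 / (n + 1), which tends to 0.\<close>

lemma eq_of_quadratic_increments:
  fixes w :: "real \<Rightarrow> real"
  assumes "\<And>s t. 0 \<le> s \<Longrightarrow> s \<le> t \<Longrightarrow> t \<le> T \<Longrightarrow> \<bar>w t - w s\<bar> \<le> C * (t - s)\<^sup>2" "0 \<le> T"
  shows "w T = w 0"
proof -
  have C: "\<bar>w T - w 0\<bar> \<le> C * T\<^sup>2 / real (Suc n)" for n
  proof -
    let ?d = "T / real (Suc n)"
    have d: "0 \<le> ?d" using assms(2) by simp
    have "w T - w 0 = (\<Sum>i<Suc n. w (real (Suc i) * ?d) - w (real i * ?d))"
      using sum_lessThan_telescope[of "\<lambda>i. w (real i * ?d)" "Suc n"]
      by (simp del: sum.lessThan_Suc of_nat_Suc)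
    also have "\<bar>\<dots>\<bar> \<le> (\<Sum>i<Suc n. \<bar>w (real (Suc i) * ?d) - w (real i * ?d)\<bar>)" by (rule sum_abs)
    also have "\<dots> \<le> (\<Sum>i<Suc n. C * ?d\<^sup>2)"
    proof (rule sum_mono)
      fix i assume i: "i \<in> {..<Suc n}"
      have "real (Suc i) * ?d \<le> real (Suc n) * ?d"
        using i d by (intro mult_right_mono) auto
      also have "\<dots> = T" by (rule nonzero_mult_div_cancel_left[THEN trans[OF times_divide_eq_right]]) simp
      finally have "real (Suc i) * ?d \<le> T" .
      moreover have "real (Suc i) * ?d - real i * ?d = ?d" by (simp only: left_diff_distrib[symmetric]) simp
      moreover have "0 \<le> real i * ?d" by (rule mult_nonneg_nonneg[OF _ d]) simp
      ultimately show "\<bar>w (real (Suc i) * ?d) - w (real i * ?d)\<bar> \<le> C * ?d\<^sup>2"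
        using assms(1)[of "real i * ?d" "real (Suc i) * ?d"] d by simp
    qed
    also have "\<dots> = C * T\<^sup>2 / real (Suc n)"
      by (simp add: power2_eq_square del: of_nat_Suc)
    finally show ?thesis .
  qed
  have "(\<lambda>n. C * T\<^sup>2 / real (Suc n)) \<longlonglongrightarrow> 0"
    using tendsto_mult_right_zero[OF LIMSEQ_inverse_real_of_nat, of "C * T\<^sup>2"]
    by (simp add: divide_inverse)
  then have "\<bar>w T - w 0\<bar> \<le> 0" by (rule LIMSEQ_le_const) (use C in auto)
  then show ?thesis by simp
qed

text \<open>Calculus for indefinite integrals of bounded measurable functions. Such functions are only
  differentiable almost everywhere, so instead of differentiating one shows that the defect of
  each identity has quadratically small increments.\<close>

lemma bounded_indefinite_integral:
  fixes X :: "real \<Rightarrow> real"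
  assumes "\<And>t. t \<in> {0..T} \<Longrightarrow> X t = X 0 + (LINT s:{0..t}|lborel. x s)"
    and [measurable]: "x \<in> borel_measurable borel" and C: "\<And>s. s \<in> {0..T} \<Longrightarrow> \<bar>x s\<bar> \<le> C"
    and s: "0 \<le> s" "s \<le> t" "t \<le> T"
  shows "X t - X s = (LINT s:{s..t}|lborel. x s)" "\<bar>X t - X s\<bar> \<le> C * (t - s)"
proof -
  show "X t - X s = (LINT s:{s..t}|lborel. x s)"
    using assms(1)[of s] assms(1)[of t] s LINT_Icc_split[of 0 t x s]
      set_integrable_Icc_bounded[of x 0 t C] C by auto
  then show "\<bar>X t - X s\<bar> \<le> C * (t - s)"
    using LINT_Icc_le[of x s t C] C s by auto
qed

lemma continuous_indefinite_integral:
  fixes X :: "real \<Rightarrow> real"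
  assumes "\<And>t. t \<in> {0..T} \<Longrightarrow> X t = X 0 + (LINT s:{0..t}|lborel. x s)"
    and "x \<in> borel_measurable borel" and "\<And>s. s \<in> {0..T} \<Longrightarrow> \<bar>x s\<bar> \<le> C"
  shows "continuous_on {0..T} X"
proof (cases "0 \<le> T")
  case True
  then have C: "0 \<le> C" using assms(3)[of 0] by auto
  have "C-lipschitz_on {0..T} X"
  proof (rule lipschitz_onI)
    fix s t assume "s \<in> {0..T}" "t \<in> {0..T}"
    then show "dist (X s) (X t) \<le> C * dist s t"
      using bounded_indefinite_integral(2)[OF assms, where s = s and t = t]
        bounded_indefinite_integral(2)[OF assms, where s = t and t = s]
      by (cases "s \<le> t") (auto simp: dist_real_def abs_minus_commute[of "X s" "X t"])
  qed (rule C)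
  then show ?thesis by (rule lipschitz_on_continuous_on)
qed simp

lemma indefinite_integral_mult:
  fixes X Y :: "real \<Rightarrow> real"
  assumes X: "\<And>t. t \<in> {0..T} \<Longrightarrow> X t = X 0 + (LINT s:{0..t}|lborel. x s)"
    and [measurable]: "x \<in> borel_measurable borel" and x: "\<And>s. s \<in> {0..T} \<Longrightarrow> \<bar>x s\<bar> \<le> C"
    and Y: "\<And>t. t \<in> {0..T} \<Longrightarrow> Y t = Y 0 + (LINT s:{0..t}|lborel. y s)"
    and [measurable]: "y \<in> borel_measurable borel" and y: "\<And>s. s \<in> {0..T} \<Longrightarrow> \<bar>y s\<bar> \<le> D"
    and [measurable]: "X \<in> borel_measurable borel" "Y \<in> borel_measurable borel"
    and "0 \<le> T"
  shows "X T * Y T = X 0 * Y 0 + (LINT s:{0..T}|lborel. x s * Y s + X s * y s)"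
proof -
  have CD: "0 \<le> C" "0 \<le> D" using x[of 0] y[of 0] \<open>0 \<le> T\<close> by auto
  note incX = bounded_indefinite_integral[OF X _ x, of T] bounded_indefinite_integral[OF X _ x]
  note incY = bounded_indefinite_integral[OF Y _ y, of T] bounded_indefinite_integral[OF Y _ y]
  have bX: "\<bar>X s\<bar> \<le> \<bar>X 0\<bar> + C * T" if "s \<in> {0..T}" for s
  proof -
    have "\<bar>X s - X 0\<bar> \<le> C * s" using incX(2)[of 0 s] that by auto
    also have "\<dots> \<le> C * T" using that CD by (intro mult_left_mono) auto
    finally show ?thesis by auto
  qed
  have bY: "\<bar>Y s\<bar> \<le> \<bar>Y 0\<bar> + D * T" if "s \<in> {0..T}" for s
  proof -
    have "\<bar>Y s - Y 0\<bar> \<le> D * s" using incY(2)[of 0 s] that by auto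
    also have "\<dots> \<le> D * T" using that CD by (intro mult_left_mono) auto
    finally show ?thesis by auto
  qed
  let ?z = "\<lambda>s. x s * Y s + X s * y s"
  let ?B = "C * (\<bar>Y 0\<bar> + D * T) + (\<bar>X 0\<bar> + C * T) * D"
  have bz: "\<bar>?z s\<bar> \<le> ?B" if "s \<in> {0..T}" for s
  proof -
    have "\<bar>?z s\<bar> \<le> \<bar>x s\<bar> * \<bar>Y s\<bar> + \<bar>X s\<bar> * \<bar>y s\<bar>" by (metis abs_mult abs_triangle_ineq)
    also have "\<dots> \<le> ?B" using that CD bX[OF that] bY[OF that] x[OF that] y[OF that]
      by (intro add_mono mult_mono) auto
    finally show ?thesis .
  qed
  let ?w = "\<lambda>t. X t * Y t - (LINT s:{0..t}|lborel. ?z s)"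
  have "?w T = ?w 0"
  proof (rule eq_of_quadratic_increments[where C = "2 * C * D"])
    fix s t assume st: "0 \<le> s" "s \<le> t" "t \<le> T"
    have sub: "r \<in> {0..T}" if "r \<in> {s..t}" for r using that st by auto
    have ix: "set_integrable lborel {s..t} x" by (rule set_integrable_Icc_bounded[of _ _ _ C]) (use x sub in auto)
    have iy: "set_integrable lborel {s..t} y" by (rule set_integrable_Icc_bounded[of _ _ _ D]) (use y sub in auto)
    have iz: "set_integrable lborel {s..t} ?z" by (rule set_integrable_Icc_bounded[of _ _ _ ?B]) (use bz sub in auto)
    have iz0: "set_integrable lborel {0..t} ?z" by (rule set_integrable_Icc_bounded[of _ _ _ ?B]) (use bz st in auto)
    have "?w t - ?w s = (X t - X s) * Y t + X s * (Y t - Y s) - (LINT r:{s..t}|lborel. ?z r)"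
      using LINT_Icc_split[OF iz0, of s] st by (simp add: algebra_simps)
    also have "\<dots> = (LINT r:{s..t}|lborel. x r * Y t + X s * y r - ?z r)"
    proof -
      have a: "set_integrable lborel {s..t} (\<lambda>r. x r * Y t)" using ix by (rule set_integrable_mult_left)
      have b: "set_integrable lborel {s..t} (\<lambda>r. X s * y r)" using iy by (rule set_integrable_mult_right)
      have "(LINT r:{s..t}|lborel. x r * Y t + X s * y r - ?z r) =
        (LINT r:{s..t}|lborel. x r * Y t) + (LINT r:{s..t}|lborel. X s * y r) - (LINT r:{s..t}|lborel. ?z r)"
        using set_integral_diff(2)[OF set_integral_add(1)[OF a b] iz] set_integral_add(2)[OF a b] by simp
      then show ?thesis using incX(1)[of s t] incY(1)[of s t] st by simp
    qed
    also have "\<bar>\<dots>\<bar> \<le> (2 * C * D * (t - s)) * (t - s)"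
    proof (rule LINT_Icc_le)
      fix r assume r: "r \<in> {s..t}"
      have "x r * Y t + X s * y r - ?z r = x r * (Y t - Y r) + (X s - X r) * y r" by (simp add: algebra_simps)
      also have "\<bar>\<dots>\<bar> \<le> \<bar>x r\<bar> * \<bar>Y t - Y r\<bar> + \<bar>X s - X r\<bar> * \<bar>y r\<bar>" by (metis abs_mult abs_triangle_ineq)
      also have "\<dots> \<le> C * (D * (t - s)) + (C * (t - s)) * D"
      proof (intro add_mono mult_mono)
        have "\<bar>Y t - Y r\<bar> \<le> D * (t - r)" using incY(2)[of r t] r st by auto
        also have "\<dots> \<le> D * (t - s)" using r CD by (intro mult_left_mono) auto
        finally show "\<bar>Y t - Y r\<bar> \<le> D * (t - s)" .
        have "\<bar>X r - X s\<bar> \<le> C * (r - s)" using incX(2)[of s r] r st by auto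
        also have "\<dots> \<le> C * (t - s)" using r CD by (intro mult_left_mono) auto
        finally show "\<bar>X s - X r\<bar> \<le> C * (t - s)" by simp
        show "\<bar>x r\<bar> \<le> C" "\<bar>y r\<bar> \<le> D" using x y sub[OF r] by auto
      qed (use CD st in auto)
      finally show "\<bar>x r * Y t + X s * y r - ?z r\<bar> \<le> 2 * C * D * (t - s)" by (simp add: algebra_simps)
    qed (use st in auto)
    finally show "\<bar>?w t - ?w s\<bar> \<le> 2 * C * D * (t - s)\<^sup>2" by (simp add: power2_eq_square mult.assoc)
  qed fact
  moreover have "(LINT s:{0..0::real}|lborel. ?z s) = 0"
    using LINT_Icc_le[of ?z 0 0 ?B] bz \<open>0 \<le> T\<close> by simp
  ultimately show ?thesis by simp
qed

lemma indefinite_integral_exp: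
  fixes A :: "real \<Rightarrow> real"
  assumes A: "\<And>t. t \<in> {0..T} \<Longrightarrow> A t = A 0 + (LINT s:{0..t}|lborel. a s)"
    and [measurable]: "a \<in> borel_measurable borel" and a: "\<And>s. s \<in> {0..T} \<Longrightarrow> \<bar>a s\<bar> \<le> C"
    and [measurable]: "A \<in> borel_measurable borel"
    and "0 \<le> T"
  shows "exp (A T) = exp (A 0) + (LINT s:{0..T}|lborel. a s * exp (A s))"
proof -
  have C: "0 \<le> C" using a[of 0] \<open>0 \<le> T\<close> by auto
  note inc = bounded_indefinite_integral[OF A _ a, of T] bounded_indefinite_integral[OF A _ a]
  let ?B = "\<bar>A 0\<bar> + C * T"
  have bA: "\<bar>A s\<bar> \<le> ?B" if "s \<in> {0..T}" for s
  proof -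
    have "\<bar>A s - A 0\<bar> \<le> C * s" using inc(2)[of 0 s] that by auto
    also have "\<dots> \<le> C * T" using that C by (intro mult_left_mono) auto
    finally show ?thesis by auto
  qed
  have lip: "\<bar>exp u - exp v\<bar> \<le> exp ?B * \<bar>u - v\<bar>" if "\<bar>u\<bar> \<le> ?B" "\<bar>v\<bar> \<le> ?B" for u v :: real
  proof -
    have "norm (exp u - exp v) \<le> exp ?B * norm (u - v)"
    proof (rule field_differentiable_bound[of "{-?B..?B}" exp exp])
      fix z assume "z \<in> {-?B..?B}"
      show "(exp has_field_derivative exp z) (at z within {-?B..?B})"
        by (rule DERIV_subset[OF DERIV_exp]) auto
      show "norm (exp z) \<le> exp ?B" using \<open>z \<in> _\<close> by simp
    qed (use that in auto)
    then show ?thesis by simp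
  qed
  let ?z = "\<lambda>s. a s * exp (A s)"
  have bz: "\<bar>?z s\<bar> \<le> C * exp ?B" if "s \<in> {0..T}" for s
    unfolding abs_mult using a[OF that] bA[OF that] C by (intro mult_mono) auto
  let ?w = "\<lambda>t. exp (A t) - (LINT s:{0..t}|lborel. ?z s)"
  have "?w T = ?w 0"
  proof (rule eq_of_quadratic_increments[where C = "C * (exp ?B * C)"])
    fix s t assume st: "0 \<le> s" "s \<le> t" "t \<le> T"
    have sub: "r \<in> {0..T}" if "r \<in> {s..t}" for r using that st by auto
    have ia: "set_integrable lborel {s..t} a" by (rule set_integrable_Icc_bounded[of _ _ _ C]) (use a sub in auto)
    have iz: "set_integrable lborel {s..t} ?z" by (rule set_integrable_Icc_bounded[of _ _ _ "C * exp ?B"]) (use bz sub in auto)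
    have iz0: "set_integrable lborel {0..t} ?z" by (rule set_integrable_Icc_bounded[of _ _ _ "C * exp ?B"]) (use bz st in auto)
    have cA: "continuous_on {s..t} A"
      using continuous_indefinite_integral[OF A _ a] by (rule continuous_on_subset) (use st in auto)
    \<comment> \<open>The mean value theorem for \<open>exp\<close> produces a value between
      \<open>A s\<close> and \<open>A t\<close>; continuity of \<open>A\<close> realises it as
      \<open>A \<xi>\<close> with \<open>\<xi>\<close> in the interval, so that only values of
      \<open>exp \<circ> A\<close> at two nearby times have to be compared.\<close>
    obtain \<xi> where \<xi>: "\<xi> \<in> {s..t}" and eq: "exp (A t) - exp (A s) = exp (A \<xi>) * (A t - A s)"
    proof -
      define lo hi where "lo = min (A s) (A t)" and "hi = max (A s) (A t)"
      have "\<exists>z. z \<in> {lo..hi} \<and> exp (A t) - exp (A s) = exp z * (A t - A s)"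
      proof (cases "A s = A t")
        case False
        then consider "A s < A t" | "A t < A s" by linarith
        then show ?thesis
        proof cases
          case 1
          from MVT2[OF 1, of exp exp] obtain z where "A s < z" "z < A t" "exp (A t) - exp (A s) = (A t - A s) * exp z"
            by (auto intro: DERIV_exp)
          then show ?thesis unfolding lo_def hi_def by (intro exI[of _ z]) (auto simp: mult.commute)
        next
          case 2
          from MVT2[OF 2, of exp exp] obtain z where "A t < z" "z < A s" "exp (A s) - exp (A t) = (A s - A t) * exp z"
            by (auto intro: DERIV_exp)
          then show ?thesis unfolding lo_def hi_def by (intro exI[of _ z]) (auto simp: algebra_simps)
        qed
      qed (auto simp: lo_def hi_def)
      then obtain z where z: "z \<in> {lo..hi}" "exp (A t) - exp (A s) = exp z * (A t - A s)" by auto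
      have "\<exists>\<xi>. \<xi> \<in> {s..t} \<and> A \<xi> = z"
      proof (cases "A s \<le> A t")
        case True
        then show ?thesis using IVT'[of A s z t] cA z st by (auto simp: lo_def hi_def)
      next
        case False
        then show ?thesis using IVT2'[of A t z s] cA z st by (auto simp: lo_def hi_def)
      qed
      then show ?thesis using z that by auto
    qed
    have "?w t - ?w s = exp (A \<xi>) * (A t - A s) - (LINT r:{s..t}|lborel. ?z r)"
      using LINT_Icc_split[OF iz0, of s] st eq by (simp add: algebra_simps)
    also have "\<dots> = (LINT r:{s..t}|lborel. exp (A \<xi>) * a r - ?z r)"
      using set_integral_diff(2)[OF set_integrable_mult_right[of "exp (A \<xi>)", OF ia] iz] inc(1)[of s t] st by simp
    also have "\<bar>\<dots>\<bar> \<le> (C * (exp ?B * (C * (t - s)))) * (t - s)"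
    proof (rule LINT_Icc_le)
      fix r assume r: "r \<in> {s..t}"
      have "exp (A \<xi>) * a r - ?z r = a r * (exp (A \<xi>) - exp (A r))" by (simp add: algebra_simps)
      also have "\<bar>\<dots>\<bar> \<le> C * (exp ?B * (C * (t - s)))"
        unfolding abs_mult
      proof (intro mult_mono)
        have "\<bar>A \<xi> - A r\<bar> \<le> C * \<bar>\<xi> - r\<bar>"
          using inc(2)[of \<xi> r] inc(2)[of r \<xi>] \<xi> r st by (cases "\<xi> \<le> r") auto
        also have "\<dots> \<le> C * (t - s)" using \<xi> r C by (intro mult_left_mono) auto
        finally have "exp ?B * \<bar>A \<xi> - A r\<bar> \<le> exp ?B * (C * (t - s))" by simp
        then show "\<bar>exp (A \<xi>) - exp (A r)\<bar> \<le> exp ?B * (C * (t - s))"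
          using lip[OF bA[of \<xi>] bA[of r]] sub[OF \<xi>] sub[OF r] by linarith
      qed (use C a sub r st in auto)
      finally show "\<bar>exp (A \<xi>) * a r - ?z r\<bar> \<le> C * (exp ?B * (C * (t - s)))" .
    qed (use st in auto)
    finally show "\<bar>?w t - ?w s\<bar> \<le> C * (exp ?B * C) * (t - s)\<^sup>2" by (simp add: power2_eq_square mult.assoc)
  qed fact
  moreover have "(LINT s:{0..0::real}|lborel. ?z s) = 0"
    using LINT_Icc_le[of ?z 0 0 "C * exp ?B"] bz \<open>0 \<le> T\<close> by simp
  ultimately show ?thesis by simp
qed

section \<open>The flow, the hazard and the first jump\<close>

text \<open>The dependence of the integrand on \<open>x\<close> is moved into the measure: pushing
  \<open>L x\<close> forward along \<open>\<lambda>y. (x, y)\<close> gives a kernel into the product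
  space, against which a fixed function is integrated.\<close>

lemma integral_kernel_measurable:
  fixes f :: "'x \<Rightarrow> 'y \<Rightarrow> real"
  assumes f: "(\<lambda>(x, y). f x y) \<in> borel_measurable (A \<Otimes>\<^sub>M N)"
    and L: "L \<in> A \<rightarrow>\<^sub>M subprob_algebra N"
  shows "(\<lambda>x. LINT y|L x. f x y) \<in> borel_measurable A"
proof -
  note integral_measurable_subprob_algebra[measurable] measurable_distr2[measurable] f[measurable] L[measurable]
  have "(\<lambda>x. integral\<^sup>L (distr (L x) (A \<Otimes>\<^sub>M N) (\<lambda>y. (x, y))) (\<lambda>(x, y). f x y)) \<in> borel_measurable A"
    by measurable
  then show ?thesis
  proof (rule measurable_cong[THEN iffD1, rotated])
    fix x assume x: "x \<in> space A"
    then have [simp]: "sets (L x) = sets N"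
      using sets_kernel[OF L] by simp
    have [measurable]: "(\<lambda>y. (x, y)) \<in> L x \<rightarrow>\<^sub>M A \<Otimes>\<^sub>M N"
      using x by (simp add: measurable_cong_sets[of "L x" N])
    show "integral\<^sup>L (distr (L x) (A \<Otimes>\<^sub>M N) (\<lambda>y. (x, y))) (\<lambda>(x, y). f x y) = (LINT y|L x. f x y)"
      by (subst integral_distr) auto
  qed
qed

text \<open>The open and the closed half-line are both stated because the event of a jump by time
  \<open>c\<close> lies between \<open>E < Lam c x\<close> and
  \<open>E \<le> Lam c x\<close>.\<close>

lemma exponential_less:
  assumes "0 \<le> a"
  shows "measure (density lborel (exponential_density 1)) {..<a} = 1 - exp (- a)"
    and "measure (density lborel (exponential_density 1)) {..a} = 1 - exp (- a)"
proof -
  interpret E: prob_space "density lborel (exponential_density 1)"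
    by (rule prob_space_exponential_density) simp
  have D: "distributed (density lborel (exponential_density 1)) lborel (\<lambda>x. x) (exponential_density 1)"
    by (auto simp: distributed_def distr_id2 intro!: measurable_ident_sets)
  have 1: "measure (density lborel (exponential_density 1)) {..a} = 1 - exp (- a)"
    using E.exponential_distributedD_le[OF D assms] by (simp add: atMost_def)
  have "AE x in lborel. x \<noteq> a" by (rule AE_lborel_singleton)
  then have "AE x in density lborel (exponential_density 1). x \<noteq> a"
    by (subst AE_density) auto
  then have "measure (density lborel (exponential_density 1)) {..<a} = measure (density lborel (exponential_density 1)) {..a}"
    by (intro measure_eq_AE) (auto elim: eventually_mono)
  with 1 show "measure (density lborel (exponential_density 1)) {..<a} = 1 - exp (- a)"
    "measure (density lborel (exponential_density 1)) {..a} = 1 - exp (- a)" by auto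
qed

lemma prob_space_uniform01: "prob_space uniform01"
  by (rule prob_spaceI) (simp add: emeasure_restrict_space space_restrict_space)

lemma C1_on_continuous: "C1_on S f \<Longrightarrow> continuous_on S f"
  unfolding continuous_on_def
proof
  fix p assume S: "C1_on S f" and p: "p \<in> S"
  then obtain U F where U: "open U" "p \<in> U" and F: "F differentiable_on U" and eq: "\<And>x. x \<in> S \<inter> U \<Longrightarrow> F x = f x"
    unfolding C1_on_def by (metis One_nat_def Ck_on.simps(2))
  have "F differentiable at p within U" using F U by (simp add: differentiable_on_def)
  then have "F differentiable at p" using U at_within_open by metis
  then have "(F \<longlongrightarrow> F p) (at p)" using differentiable_imp_continuous_within continuous_within by blast
  then have "(F \<longlongrightarrow> f p) (at p within S)"
    using eq[of p] p U by (auto intro: tendsto_within_subset)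
  then show "(f \<longlongrightarrow> f p) (at p within S)"
    by (rule Lim_transform_eventually) (use U eq in \<open>auto simp: eventually_at_topological\<close>)
qed

lemma set_lebesgue_integral_shift:
  fixes f :: "real \<Rightarrow> real"
  shows "(LINT u:{s..t}|lborel. f (u - s)) = (LINT u:{0..t - s}|lborel. f u)"
  unfolding set_lebesgue_integral_def
  by (subst lborel_integral_real_affine[of 1 _ s]) (auto simp: indicator_def intro!: Bochner_Integration.integral_cong)

section \<open>The deterministic flow and its cumulative hazard\<close>

locale pdmp_flow =
  fixes M :: "'a::euclidean_space set" and \<phi> :: "real \<Rightarrow> 'a \<Rightarrow> 'a"
    and lam :: "'a \<Rightarrow> real" and Q :: "'a \<Rightarrow> 'a measure"
  assumes closed_M: "closed M" and chars: "characteristics M \<phi> lam Q"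
begin

abbreviation "N \<equiv> borel_of M"

lemma sets_N_borel: "A \<in> sets N \<longleftrightarrow> A \<in> sets borel \<and> A \<subseteq> M"
  using closed_M by (auto simp: sets_restrict_space_iff)

lemma space_N [simp]: "space N = M"
  by (simp add: space_restrict_space)

lemma flow_add: "0 \<le> t \<Longrightarrow> 0 \<le> s \<Longrightarrow> x \<in> M \<Longrightarrow> \<phi> (t + s) x = \<phi> s (\<phi> t x)"
  and flow_0 [simp]: "x \<in> M \<Longrightarrow> \<phi> 0 x = x"
  and flow_C1_time: "x \<in> M \<Longrightarrow> C1_on {0..} (\<lambda>t. \<phi> t x)"
  and flow_C1_space: "0 \<le> t \<Longrightarrow> C1_on M (\<phi> t)"
  and flow_bij: "0 \<le> t \<Longrightarrow> bij_betw (\<phi> t) M M"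
  using chars unfolding characteristics_def homogeneous_flow_def by auto

lemma flow_in [intro]: "0 \<le> t \<Longrightarrow> x \<in> M \<Longrightarrow> \<phi> t x \<in> M"
  using flow_bij[of t] unfolding bij_betw_def by auto

lemma lam_measurable [measurable]: "lam \<in> borel_measurable N"
  and lam_nonneg: "x \<in> M \<Longrightarrow> 0 \<le> lam x"
  and lam_bounded: "compact K \<Longrightarrow> K \<subseteq> M \<Longrightarrow> bounded (lam ` K)"
  using chars unfolding characteristics_def jump_rate_def by auto

lemma Q_prob_measurable: "Q \<in> N \<rightarrow>\<^sub>M prob_algebra N"
  using chars unfolding characteristics_def markov_kernel_def by auto

lemma Q_measurable [measurable]: "Q \<in> N \<rightarrow>\<^sub>M subprob_algebra N"
  by (rule measurable_prob_algebraD[OF Q_prob_measurable])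

lemma Q_prob: "x \<in> M \<Longrightarrow> prob_space (Q x)" and sets_Q: "x \<in> M \<Longrightarrow> sets (Q x) = sets N"
  using measurable_space[OF Q_prob_measurable, of x] by (auto simp: space_prob_algebra)

lemma space_Q: "x \<in> M \<Longrightarrow> space (Q x) = M"
  using sets_eq_imp_space_eq[OF sets_Q] by simp

lemma Q_integrable:
  fixes f :: "'a \<Rightarrow> real"
  assumes "f \<in> borel_measurable N" "\<And>y. y \<in> M \<Longrightarrow> \<bar>f y\<bar> \<le> B" "x \<in> M"
  shows "integrable (Q x) f"
proof -
  interpret prob_space "Q x" by (rule Q_prob[OF assms(3)])
  show ?thesis
    using assms by (intro integrable_const_bound[where B = B])
      (auto simp: space_Q measurable_cong_sets[OF sets_Q refl] intro!: AE_I2)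
qed

lemma Q_abs_le:
  fixes f :: "'a \<Rightarrow> real"
  assumes "f \<in> borel_measurable N" "\<And>y. y \<in> M \<Longrightarrow> \<bar>f y\<bar> \<le> B" "x \<in> M"
  shows "\<bar>LINT y|Q x. f y\<bar> \<le> B"
proof -
  interpret prob_space "Q x" by (rule Q_prob[OF assms(3)])
  have i: "integrable (Q x) f" by (rule Q_integrable[OF assms])
  have "(LINT y|Q x. f y) \<le> B" "- B \<le> (LINT y|Q x. f y)"
    using assms by (auto simp: space_Q abs_le_iff intro!: integral_le_const integral_ge_const i AE_I2) 
      (use assms in fastforce)+
  then show ?thesis by auto
qed

text \<open>Times are clamped at \<open>0\<close> so that everything is measurable on the whole real line.\<close>

definition flow :: "real \<Rightarrow> 'a \<Rightarrow> 'a" where "flow t x = \<phi> (max 0 t) x"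

lemma flow_eq: "0 \<le> t \<Longrightarrow> flow t x = \<phi> t x" by (simp add: flow_def)

lemma flow_in' [intro, simp]: "x \<in> M \<Longrightarrow> flow t x \<in> M"
  unfolding flow_def by (rule flow_in) auto

lemma flow_flow: "0 \<le> t \<Longrightarrow> 0 \<le> s \<Longrightarrow> x \<in> M \<Longrightarrow> flow s (flow t x) = flow (t + s) x"
  by (simp add: flow_eq flow_add)

lemma flow_measurable [measurable (raw)]:
  assumes [measurable]: "f \<in> borel_measurable A" "g \<in> A \<rightarrow>\<^sub>M N"
  shows "(\<lambda>z. flow (f z) (g z)) \<in> A \<rightarrow>\<^sub>M N"
proof -
  have "(\<lambda>(t, x). \<phi> t x) \<in> borel_of {0..} \<Otimes>\<^sub>M N \<rightarrow>\<^sub>M N"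
    using chars unfolding characteristics_def homogeneous_flow_def by auto
  moreover have "(\<lambda>z. (max 0 (f z), g z)) \<in> A \<rightarrow>\<^sub>M borel_of {0..} \<Otimes>\<^sub>M N"
    by (intro measurable_Pair[OF _ assms(2)] measurable_restrict_space2) auto
  ultimately have "(\<lambda>(t, x). \<phi> t x) \<circ> (\<lambda>z. (max 0 (f z), g z)) \<in> A \<rightarrow>\<^sub>M N"
    by (rule measurable_comp[rotated])
  then show ?thesis by (simp add: comp_def flow_def)
qed

lemma flow_continuous_time: "x \<in> M \<Longrightarrow> continuous_on {0..} (\<lambda>t. flow t x)"
  using C1_on_continuous[OF flow_C1_time, of x]
  by (rule continuous_on_eq) (auto simp: flow_def)

lemma flow_continuous_space: "continuous_on M (flow t)"
  using C1_on_continuous[OF flow_C1_space[of "max 0 t"]] by (simp add: flow_def[abs_def])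

lemma rate_bounded:
  assumes "x \<in> M"
  obtains C where "0 \<le> C" "\<And>s. s \<in> {0..T} \<Longrightarrow> \<bar>lam (flow s x)\<bar> \<le> C"
proof -
  have "compact ((\<lambda>t. flow t x) ` {0..T})"
    by (rule compact_continuous_image[OF continuous_on_subset[OF flow_continuous_time[OF assms]]]) auto
  then have "bounded (lam ` (\<lambda>t. flow t x) ` {0..T})"
    by (rule lam_bounded) (use assms in auto)
  then obtain C where "\<And>s. s \<in> {0..T} \<Longrightarrow> \<bar>lam (flow s x)\<bar> \<le> C"
    unfolding bounded_iff real_norm_def by blast
  then show ?thesis using that[of "\<bar>C\<bar>"] by fastforce
qed

lemma rate_measurable: "x \<in> M \<Longrightarrow> (\<lambda>s. lam (flow s x)) \<in> borel_measurable borel"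
  by measurable

text \<open>The cumulative hazard along the flow line of \<open>x\<close>: for nonnegative
  \<open>t\<close>, \<open>exp (- Lam t x)\<close> is the probability that no jump has occurred by
  time \<open>t\<close>.\<close>

definition Lam :: "real \<Rightarrow> 'a \<Rightarrow> real" where
  "Lam t x = (LINT s:{0..t}|lborel. lam (flow s x))"

lemma LINT_Icc_measurable:
  fixes h :: "'z \<Rightarrow> real \<Rightarrow> real"
  assumes [measurable]: "f \<in> borel_measurable A" "(\<lambda>(z, s). h z s) \<in> borel_measurable (A \<Otimes>\<^sub>M borel)"
  shows "(\<lambda>z. LINT s:{0..f z}|lborel. h z s) \<in> borel_measurable A"
proof -
  have "(\<lambda>(z, s). (if 0 \<le> s \<and> s \<le> f z then h z s else 0)) \<in> borel_measurable (A \<Otimes>\<^sub>M lborel)"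
    by measurable
  then have "(\<lambda>z. LINT s|lborel. (if 0 \<le> s \<and> s \<le> f z then h z s else 0)) \<in> borel_measurable A"
    by (rule lborel.borel_measurable_lebesgue_integral)
  also have "(\<lambda>z. LINT s|lborel. (if 0 \<le> s \<and> s \<le> f z then h z s else 0)) = (\<lambda>z. LINT s:{0..f z}|lborel. h z s)"
    unfolding set_lebesgue_integral_def by (intro ext Bochner_Integration.integral_cong) (auto simp: indicator_def)
  finally show ?thesis .
qed

lemma Lam_measurable [measurable (raw)]:
  assumes [measurable]: "f \<in> borel_measurable A" "g \<in> A \<rightarrow>\<^sub>M N"
  shows "(\<lambda>z. Lam (f z) (g z)) \<in> borel_measurable A"
  unfolding Lam_def by (rule LINT_Icc_measurable) measurable

lemma Lam_nonpos [simp]: "t \<le> 0 \<Longrightarrow> Lam t x = 0"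
  unfolding Lam_def set_lebesgue_integral_def
  by (rule integral_eq_zero_AE, rule AE_mp[OF AE_lborel_singleton[of 0]]) (auto simp: indicator_def)

lemma Lam_repr: "t \<in> {0..T} \<Longrightarrow> Lam t x = Lam 0 x + (LINT s:{0..t}|lborel. lam (flow s x))"
  by simp (simp add: Lam_def)

lemma Lam_add:
  assumes "x \<in> M" "0 \<le> s" "0 \<le> t"
  shows "Lam (s + t) x = Lam s x + Lam t (flow s x)"
proof -
  obtain C where C: "\<And>r. r \<in> {0..s + t} \<Longrightarrow> \<bar>lam (flow r x)\<bar> \<le> C" using rate_bounded[OF assms(1)] by metis
  have "Lam (s + t) x - Lam s x = (LINT r:{s..s + t}|lborel. lam (flow r x))"
    by (rule bounded_indefinite_integral(1)[where T = "s + t", OF Lam_repr rate_measurable[OF assms(1)] C])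
      (use assms in auto)
  also have "\<dots> = (LINT r:{s..s + t}|lborel. lam (flow (r - s) (flow s x)))"
    using assms by (intro set_lebesgue_integral_cong) (auto simp: flow_flow)
  also have "\<dots> = Lam t (flow s x)"
    unfolding Lam_def using set_lebesgue_integral_shift[of s "s + t" "\<lambda>r. lam (flow r (flow s x))"] by simp
  finally show ?thesis by simp
qed

lemma Lam_nonneg: "x \<in> M \<Longrightarrow> 0 \<le> Lam t x"
  unfolding Lam_def set_lebesgue_integral_def
  by (rule Bochner_Integration.integral_nonneg) (simp add: lam_nonneg)

lemma Lam_mono: "x \<in> M \<Longrightarrow> s \<le> t \<Longrightarrow> Lam s x \<le> Lam t x"
  using Lam_add[of x s "t - s"] Lam_nonneg[of "flow s x" "t - s"] Lam_nonneg[of x t]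
  by (cases "0 \<le> s") auto

lemma Lam_continuous: "x \<in> M \<Longrightarrow> continuous_on {0..T} (\<lambda>t. Lam t x)"
proof -
  assume x: "x \<in> M"
  obtain C where C: "\<And>r. r \<in> {0..T} \<Longrightarrow> \<bar>lam (flow r x)\<bar> \<le> C" using rate_bounded[OF x] by metis
  show ?thesis by (rule continuous_indefinite_integral[OF Lam_repr rate_measurable[OF x] C])
qed

text \<open>The survival probability is one minus the mass of the first-jump density. The rate is
  only bounded and measurable along a flow line, so the chain rule is taken in the form for
  indefinite integrals.\<close>

lemma exp_Lam:
  assumes x: "x \<in> M" and "0 \<le> t"
  shows "exp (- Lam t x) = 1 - (LINT s:{0..t}|lborel. lam (flow s x) * exp (- Lam s x))"
proof -
  obtain C where C: "\<And>r. r \<in> {0..t} \<Longrightarrow> \<bar>lam (flow r x)\<bar> \<le> C" using rate_bounded[OF x] by metis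
  have "exp (- Lam t x) = exp (- Lam 0 x) + (LINT s:{0..t}|lborel. - lam (flow s x) * exp (- Lam s x))"
  proof (rule indefinite_integral_exp)
    show "- Lam s x = - Lam 0 x + (LINT r:{0..s}|lborel. - lam (flow r x))" if "s \<in> {0..t}" for s
      using that by simp (simp add: Lam_def set_lebesgue_integral_def)
    show "\<bar>- lam (flow r x)\<bar> \<le> C" if "r \<in> {0..t}" for r using C[OF that] by simp
    show "(\<lambda>s. - lam (flow s x)) \<in> borel_measurable borel" "(\<lambda>s. - Lam s x) \<in> borel_measurable borel"
      using x by simp_all
  qed fact
  then show ?thesis using \<open>0 \<le> t\<close> by (simp add: set_lebesgue_integral_def)
qed

section \<open>The law of the first jump time\<close>

definition tau :: "'a \<Rightarrow> real \<Rightarrow> ereal" where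
  "tau x e = Inf {ereal t | t. 0 \<le> t \<and> e < Lam t x}"

lemma tau_nonneg: "0 \<le> tau x e"
  unfolding tau_def by (rule Inf_greatest) auto

lemma tau_leI: "0 \<le> t \<Longrightarrow> e < Lam t x \<Longrightarrow> tau x e \<le> ereal t"
  unfolding tau_def by (rule Inf_lower) auto

text \<open>\<open>Lam\<close> is nondecreasing in time, so a real witness can be moved up to a
  rational one that is still below \<open>y\<close>. The event becomes a countable union, which is
  what measurability of \<open>tau\<close> rests on.\<close>

lemma tau_less_iff:
  assumes "x \<in> M"
  shows "tau x e < y \<longleftrightarrow> (\<exists>q\<in>{q \<in> \<rat>. 0 \<le> q}. ereal q < y \<and> e < Lam q x)"
proof
  assume "tau x e < y"
  then obtain t where t: "0 \<le> t" "e < Lam t x" "ereal t < y" unfolding tau_def Inf_less_iff by auto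
  obtain b where b: "t < b" "ereal b < y"
    using ereal_dense2[OF t(3)] by auto
  obtain q where q: "q \<in> \<rat>" "t < q" "q < b" using Rats_dense_in_real[OF b(1)] by auto
  have "ereal q < y" using q(3) b(2) less_trans[of "ereal q" "ereal b" y] by simp
  moreover have "e < Lam q x" using t(2) q(2) Lam_mono[OF assms, of t q] by simp
  ultimately show "\<exists>q\<in>{q \<in> \<rat>. 0 \<le> q}. ereal q < y \<and> e < Lam q x"
    using q t by (intro bexI[of _ q]) auto
next
  assume "\<exists>q\<in>{q \<in> \<rat>. 0 \<le> q}. ereal q < y \<and> e < Lam q x"
  then obtain q where q: "0 \<le> q" "ereal q < y" "e < Lam q x" by auto
  show "tau x e < y" by (rule le_less_trans[OF tau_leI[OF q(1,3)] q(2)])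
qed

text \<open>The infimum need not be attained: the hazard may exceed \<open>e\<close> only at times
  after \<open>c\<close>, though arbitrarily close to it. Continuity of \<open>Lam\<close> then
  leaves the weak inequality at \<open>c\<close>.\<close>

lemma tau_leD:
  assumes "x \<in> M" "tau x e \<le> ereal c" "0 \<le> c"
  shows "e \<le> Lam c x"
proof (rule ccontr)
  assume "\<not> e \<le> Lam c x"
  obtain d where d: "d > 0" "\<And>t. t \<in> {0..c + 1} \<Longrightarrow> \<bar>t - c\<bar> < d \<Longrightarrow> \<bar>Lam t x - Lam c x\<bar> < e - Lam c x"
  proof -
    have cont: "continuous_on {0..c + 1} (\<lambda>t. Lam t x)" by (rule Lam_continuous[OF assms(1)])
    have "c \<in> {0..c + 1}" "0 < e - Lam c x" using \<open>\<not> e \<le> Lam c x\<close> assms(3) by auto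
    with cont obtain d where "d > 0" "\<forall>t\<in>{0..c + 1}. dist t c < d \<longrightarrow> dist (Lam t x) (Lam c x) < e - Lam c x"
      unfolding continuous_on_iff by blast
    then show thesis using that by (auto simp: dist_real_def)
  qed
  define t where "t = c + min (d / 2) 1"
  have "tau x e < ereal t" using assms(2) d by (auto simp: t_def intro: le_less_trans)
  then obtain q where q: "0 \<le> q" "q < t" "e < Lam q x" using tau_less_iff[OF assms(1)] by auto
  then have "e < Lam t x" using Lam_mono[OF assms(1), of q t] by auto
  moreover have "\<bar>Lam t x - Lam c x\<bar> < e - Lam c x"
    by (rule d(2)) (use d(1) assms in \<open>auto simp: t_def min_def\<close>)
  ultimately show False by linarith
qed

lemma tau_measurable [measurable (raw)]:
  assumes [measurable]: "f \<in> A \<rightarrow>\<^sub>M N" "g \<in> borel_measurable A"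
  shows "(\<lambda>z. tau (f z) (g z)) \<in> borel_measurable A"
proof (rule borel_measurableI_less)
  fix y
  have c: "countable {q::real \<in> \<rat>. 0 \<le> q}" by (rule countable_subset[OF _ countable_rat]) auto
  have "{z \<in> space A. tau (f z) (g z) < y} = {z \<in> space A. \<exists>q\<in>{q \<in> \<rat>. 0 \<le> q}. ereal q < y \<and> g z < Lam q (f z)}"
    using measurable_space[OF assms(1)] by (auto simp: tau_less_iff)
  also have "\<dots> \<in> sets A"
    by (rule sets.sets_Collect_countable_Ex'[OF _ c]) measurable
  finally show "{z \<in> space A. tau (f z) (g z) < y} \<in> sets A" .
qed

end

text \<open>A nonintegrable \<open>f\<close> has integral 0, and \<open>0 \<le> B\<close> because a
  probability space is nonempty; the bound thus carries no side condition of integrability.\<close>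

lemma (in prob_space) abs_integral_le:
  fixes f :: "'a \<Rightarrow> real"
  assumes B: "\<And>x. x \<in> space M \<Longrightarrow> \<bar>f x\<bar> \<le> B"
  shows "\<bar>integral\<^sup>L M f\<bar> \<le> B"
proof (cases "integrable M f")
  case True
  have "integral\<^sup>L M f \<le> B" "- B \<le> integral\<^sup>L M f"
    using B by (auto intro!: integral_le_const[OF True] integral_ge_const[OF True] AE_I2 simp: abs_le_iff)
      (metis B abs_le_iff minus_le_iff)
  then show ?thesis by simp
next
  case False
  obtain x where "x \<in> space M" using not_empty by auto
  then have "0 \<le> B" using B[of x] by simp
  then show ?thesis using False by (simp add: not_integrable_integral_eq)
qed

abbreviation expm :: "real measure" where "expm \<equiv> density lborel (exponential_density 1)"

lemma prob_space_expm: "prob_space expm"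
  by (rule prob_space_exponential_density) simp

context pdmp_flow
begin

lemma measure_tau_le:
  assumes x: "x \<in> M" and "0 \<le> c"
  shows "measure expm {E. tau x E \<le> ereal c} = 1 - exp (- Lam c x)"
proof -
  interpret E: prob_space expm by (rule prob_space_expm)
  have m: "{E. tau x E \<le> ereal c} \<in> sets expm"
    using x by (simp add: pred_def[symmetric])
  have "measure expm {..<Lam c x} \<le> measure expm {E. tau x E \<le> ereal c}"
    by (rule E.finite_measure_mono[OF _ m]) (use assms tau_leI in auto)
  moreover have "measure expm {E. tau x E \<le> ereal c} \<le> measure expm {..Lam c x}"
    by (rule E.finite_measure_mono) (use assms tau_leD in auto)
  ultimately show ?thesis
    using exponential_less[OF Lam_nonneg[OF x, of c]] by simp
qed

text \<open>The density of the first jump time from \<open>x\<close>. It may be defective, since a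
  jump may never occur: its mass on [0, t] is \<open>1 - exp (- Lam t x)\<close>.\<close>

definition rate_density :: "'a \<Rightarrow> real \<Rightarrow> real" where
  "rate_density x s = lam (flow s x) * exp (- Lam s x)"

lemma rate_density_measurable [measurable (raw)]:
  assumes [measurable]: "f \<in> A \<rightarrow>\<^sub>M N" "g \<in> borel_measurable A"
  shows "(\<lambda>z. rate_density (f z) (g z)) \<in> borel_measurable A"
  unfolding rate_density_def by measurable

lemma rate_density_nonneg: "x \<in> M \<Longrightarrow> 0 \<le> rate_density x s"
  unfolding rate_density_def by (simp add: lam_nonneg)

lemma rate_density_bounded:
  assumes "x \<in> M"
  obtains C where "0 \<le> C" "\<And>s. s \<in> {0..T} \<Longrightarrow> \<bar>rate_density x s\<bar> \<le> C"
proof -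
  obtain C where C: "0 \<le> C" "\<And>s. s \<in> {0..T} \<Longrightarrow> \<bar>lam (flow s x)\<bar> \<le> C" using rate_bounded[OF assms] by metis
  have "\<bar>rate_density x s\<bar> \<le> C * 1" if "s \<in> {0..T}" for s
    unfolding rate_density_def abs_mult
    using C(2)[OF that] C(1) Lam_nonneg[OF assms, of s] by (intro mult_mono) auto
  then show ?thesis using that C by auto
qed

lemma rate_density_integral:
  assumes x: "x \<in> M" and "0 \<le> t"
  shows "(LINT s:{0..t}|lborel. rate_density x s) = 1 - exp (- Lam t x)"
  using exp_Lam[OF assms] unfolding rate_density_def by simp

lemma rate_density_integrable:
  assumes x: "x \<in> M" and "0 \<le> a"
  shows "set_integrable lborel {a..t} (rate_density x)"
proof -
  obtain C where C: "\<And>s. s \<in> {0..t} \<Longrightarrow> \<bar>rate_density x s\<bar> \<le> C" using rate_density_bounded[OF x] by metis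
  show ?thesis using C assms(2) x by (intro set_integrable_Icc_bounded[of _ _ _ C]) auto
qed

text \<open>The event of a jump by time \<open>t\<close> is cut out before passing to real numbers,
  because \<open>real_of_ereal\<close> would send an infinite jump time to 0. Both sides are
  measures finite on half-lines, so it is enough to compare them there.\<close>

lemma tau_law:
  assumes x: "x \<in> M" and t: "0 \<le> t"
  shows "distr (density expm (indicator {E. tau x E \<le> ereal t})) borel (\<lambda>E. real_of_ereal (tau x E))
    = density lborel (\<lambda>s. ennreal (indicator {0..t} s * rate_density x s))" (is "?M1 = ?M2")
proof (rule measure_eqI_lessThan)
  interpret E: prob_space expm by (rule prob_space_expm)
  have rtau [measurable]: "(\<lambda>E. real_of_ereal (tau x E)) \<in> borel_measurable borel" using x by simp
  have [measurable]: "{E. tau x E \<le> ereal u} \<in> sets borel" for u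
    using x by (simp add: pred_def[symmetric])
  have [measurable]: "rate_density x \<in> borel_measurable borel" using x by simp
  show "sets ?M1 = sets borel" "sets ?M2 = sets borel" by auto
  fix c :: real
  \<comment> \<open>Both measures are carried by [0, t], so a negative \<open>c\<close> acts like
    0.\<close>
  define d where "d = max 0 c"
  have e1: "emeasure ?M1 {c<..} = emeasure expm {E. tau x E \<le> ereal t \<and> c < real_of_ereal (tau x E)}"
  proof -
    have "emeasure ?M1 {c<..} = emeasure (density expm (indicator {E. tau x E \<le> ereal t})) {E. c < real_of_ereal (tau x E)}"
      by (subst emeasure_distr) (auto intro!: arg_cong2[where f=emeasure])
    also have "\<dots> = (\<integral>\<^sup>+E. indicator {E. tau x E \<le> ereal t} E * indicator {E. c < real_of_ereal (tau x E)} E \<partial>expm)"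
      by (subst emeasure_density) (auto simp: pred_def[symmetric])
    also have "\<dots> = (\<integral>\<^sup>+E. indicator {E. tau x E \<le> ereal t \<and> c < real_of_ereal (tau x E)} E \<partial>expm)"
      by (intro nn_integral_cong) (auto simp: indicator_def)
    also have "\<dots> = emeasure expm {E. tau x E \<le> ereal t \<and> c < real_of_ereal (tau x E)}"
    proof (rule nn_integral_indicator)
      have "{E. tau x E \<le> ereal t} \<inter> ((\<lambda>E. real_of_ereal (tau x E)) -` {c<..} \<inter> space borel) \<in> sets borel"
        by (rule sets.Int[OF _ measurable_sets[OF rtau]]) auto
      also have "{E. tau x E \<le> ereal t} \<inter> ((\<lambda>E. real_of_ereal (tau x E)) -` {c<..} \<inter> space borel) =
        {E. tau x E \<le> ereal t \<and> c < real_of_ereal (tau x E)}" by auto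
      finally show "{E. tau x E \<le> ereal t \<and> c < real_of_ereal (tau x E)} \<in> sets expm" by simp
    qed
    finally show ?thesis .
  qed
  have e2: "emeasure ?M2 {c<..} = ennreal (LINT s:{d..t}|lborel. rate_density x s)"
  proof -
    have "emeasure ?M2 {c<..} = (\<integral>\<^sup>+s. ennreal (indicator {0..t} s * rate_density x s) * indicator {c<..} s \<partial>lborel)"
      by (subst emeasure_density) auto
    also have "\<dots> = (\<integral>\<^sup>+s. ennreal (indicator {d..t} s *\<^sub>R rate_density x s) \<partial>lborel)"
      by (intro nn_integral_cong_AE, rule AE_mp[OF AE_lborel_singleton[of c]])
        (auto simp: indicator_def d_def max_def)
    also have "\<dots> = ennreal (LINT s:{d..t}|lborel. rate_density x s)"
      unfolding set_lebesgue_integral_def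
      using rate_density_integrable[OF x, of d t] rate_density_nonneg[OF x]
      by (intro nn_integral_eq_integral) (auto simp: set_integrable_def d_def)
    finally show ?thesis .
  qed
  have *: "emeasure expm {E. tau x E \<le> ereal t \<and> c < real_of_ereal (tau x E)} = ennreal (LINT s:{d..t}|lborel. rate_density x s)"
  proof -
    have fin: "tau x E \<le> ereal t \<longleftrightarrow> (\<exists>r. tau x E = ereal r \<and> 0 \<le> r \<and> r \<le> t)" for E
      using tau_nonneg[of x E] by (cases "tau x E") auto
    consider "t \<le> c" | "c < 0" | "0 \<le> c" "c < t" using t by linarith
    then show ?thesis
    proof cases
      case 1
      have e: "{E. tau x E \<le> ereal t \<and> c < real_of_ereal (tau x E)} = {}" using 1 by (auto simp: fin)
      have "(LINT s:{d..t}|lborel. rate_density x s) = 0"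
      proof -
        have "AE s in lborel. indicator {d..t} s *\<^sub>R rate_density x s = 0"
          by (rule AE_mp[OF AE_lborel_singleton[of t]]) (use 1 in \<open>auto simp: indicator_def d_def\<close>)
        then show ?thesis unfolding set_lebesgue_integral_def by (rule integral_eq_zero_AE)
      qed
      then show ?thesis unfolding e by simp
    next
      case 2
      then have "{E. tau x E \<le> ereal t \<and> c < real_of_ereal (tau x E)} = {E. tau x E \<le> ereal t}" by (auto simp: fin)
      then show ?thesis
        using 2 measure_tau_le[OF x t] rate_density_integral[OF x t] by (simp add: E.emeasure_eq_measure d_def)
    next
      case 3
      then have "{E. tau x E \<le> ereal t \<and> c < real_of_ereal (tau x E)} = {E. tau x E \<le> ereal t} - {E. tau x E \<le> ereal c}"
        using tau_nonneg by (auto simp: fin)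
      moreover have "measure expm ({E. tau x E \<le> ereal t} - {E. tau x E \<le> ereal c}) =
          measure expm {E. tau x E \<le> ereal t} - measure expm {E. tau x E \<le> ereal c}"
        by (rule E.finite_measure_Diff) (use 3 in \<open>auto elim: order_trans\<close>)
      moreover have "(LINT s:{d..t}|lborel. rate_density x s) = exp (- Lam c x) - exp (- Lam t x)"
        using LINT_Icc_split[OF rate_density_integrable[OF x, of 0 t], of c] 3
          rate_density_integral[OF x, of t] rate_density_integral[OF x, of c] by (simp add: d_def)
      ultimately show ?thesis
        using measure_tau_le[OF x, of t] measure_tau_le[OF x, of c] 3 by (simp add: E.emeasure_eq_measure)
    qed
  qed
  show "emeasure ?M1 {c<..} < \<infinity>" unfolding e1 by (simp add: E.emeasure_eq_measure less_top[symmetric])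
  show "emeasure ?M1 {c<..} = emeasure ?M2 {c<..}" unfolding e1 e2 * ..
qed

lemma tau_expectation:
  assumes x: "x \<in> M" and t: "0 \<le> t" and q [measurable]: "q \<in> borel_measurable borel" and B: "\<And>s. \<bar>q s\<bar> \<le> B"
  shows "(LINT E|expm. (if tau x E \<le> ereal t then q (real_of_ereal (tau x E)) else c)) =
    exp (- Lam t x) * c + (LINT s:{0..t}|lborel. rate_density x s * q s)"
proof -
  interpret E: prob_space expm by (rule prob_space_expm)
  have [measurable]: "(\<lambda>E. real_of_ereal (tau x E)) \<in> borel_measurable borel" using x by simp
  have T [measurable]: "{E. tau x E \<le> ereal t} \<in> sets borel"
    using x by (simp add: pred_def[symmetric])
  have [measurable]: "rate_density x \<in> borel_measurable borel" using x by simp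
  have "(LINT E|expm. (if tau x E \<le> ereal t then q (real_of_ereal (tau x E)) else c)) =
    (LINT E|expm. indicator {E. tau x E \<le> ereal t} E * q (real_of_ereal (tau x E)) + c * indicator (- {E. tau x E \<le> ereal t}) E)"
    by (intro Bochner_Integration.integral_cong) (auto simp: indicator_def)
  also have "\<dots> = (LINT E|expm. indicator {E. tau x E \<le> ereal t} E * q (real_of_ereal (tau x E)))
      + c * measure expm (- {E. tau x E \<le> ereal t})"
  proof (subst Bochner_Integration.integral_add)
    show "integrable expm (\<lambda>E. indicator {E. tau x E \<le> ereal t} E * q (real_of_ereal (tau x E)))"
    proof (rule E.integrable_const_bound)
      have "0 \<le> B" using B[of 0] by simp
      then show "AE E in expm. norm (indicator {E. tau x E \<le> ereal t} E * q (real_of_ereal (tau x E))) \<le> B"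
        using B by (auto simp: indicator_def intro!: AE_I2)
    qed measurable
    show "integrable expm (\<lambda>E. c * indicator (- {E. tau x E \<le> ereal t}) E)"
      by (intro integrable_mult_right integrable_real_indicator) (auto simp: E.emeasure_eq_measure less_top[symmetric])
  qed simp
  also have "(LINT E|expm. indicator {E. tau x E \<le> ereal t} E * q (real_of_ereal (tau x E)))
    = integral\<^sup>L (distr (density expm (indicator {E. tau x E \<le> ereal t})) borel (\<lambda>E. real_of_ereal (tau x E))) q"
    using integral_density[of "\<lambda>E. q (real_of_ereal (tau x E))" expm "indicator {E. tau x E \<le> ereal t}"]
    by (subst integral_distr) (auto simp: ennreal_indicator)
  also have "\<dots> = (LINT s:{0..t}|lborel. rate_density x s * q s)"
    unfolding tau_law[OF x t] set_lebesgue_integral_def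
    by (subst integral_density) (auto simp: rate_density_nonneg[OF x] mult.assoc)
  also have "measure expm (- {E. tau x E \<le> ereal t}) = exp (- Lam t x)"
    using E.prob_compl[of "{E. tau x E \<le> ereal t}"] measure_tau_le[OF x t] by (simp add: Compl_eq_Diff_UNIV)
  finally show ?thesis by simp
qed

end

section \<open>The marks and the Markov property at the first jump\<close>

definition mark :: "(real \<times> real) measure" where "mark = expm \<Otimes>\<^sub>M uniform01"
abbreviation marks :: "(nat \<Rightarrow> real \<times> real) measure" where "marks \<equiv> \<Pi>\<^sub>M k\<in>UNIV. mark"

lemma measurable_compose3:
  assumes "(\<lambda>(t, x, \<omega>). H t x \<omega>) \<in> A \<Otimes>\<^sub>M B \<Otimes>\<^sub>M C \<rightarrow>\<^sub>M D"
    and [measurable]: "f \<in> Z \<rightarrow>\<^sub>M A" "g \<in> Z \<rightarrow>\<^sub>M B" "h \<in> Z \<rightarrow>\<^sub>M C"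
  shows "(\<lambda>z. H (f z) (g z) (h z)) \<in> Z \<rightarrow>\<^sub>M D"
  using measurable_compose[OF _ assms(1), of "\<lambda>z. (f z, g z, h z)" Z] by simp

lemma prob_space_mark: "prob_space mark"
proof -
  interpret E: prob_space expm by (rule prob_space_expm)
  interpret U: prob_space uniform01 by (rule prob_space_uniform01)
  interpret pair_prob_space expm uniform01 ..
  show ?thesis unfolding mark_def by (rule prob_space_axioms)
qed

lemma fst_mark [measurable]: "fst \<in> borel_measurable mark"
  and snd_mark [measurable]: "snd \<in> mark \<rightarrow>\<^sub>M uniform01"
  unfolding mark_def by simp_all

lemma sequence_space_mark: "sequence_space mark"
  unfolding sequence_space_def product_prob_space_def product_prob_space_axioms_def product_sigma_finite_def
  using prob_space_mark by (simp add: prob_space_imp_sigma_finite)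

lemma prob_space_marks: "prob_space marks"
  by (rule prob_space_PiM) (rule prob_space_mark)

lemma marks_nth [measurable]: "(\<lambda>\<omega>. \<omega> k) \<in> marks \<rightarrow>\<^sub>M mark"
  by (rule measurable_component_singleton) simp

lemma marks_shift: "(\<lambda>\<omega> n. \<omega> (Suc n)) \<in> marks \<rightarrow>\<^sub>M marks"
  by (rule measurable_PiM_single') (auto simp: space_PiM PiE_iff)

text \<open>An i.i.d. sequence is its first term followed by an independent copy of the whole
  sequence (\<open>PiM_iter\<close>); boundedness makes Fubini applicable.\<close>

lemma integral_marks_shift:
  fixes f :: "(nat \<Rightarrow> real \<times> real) \<Rightarrow> real"
  assumes [measurable]: "f \<in> borel_measurable marks" and B: "\<And>\<omega>. \<omega> \<in> space marks \<Longrightarrow> \<bar>f \<omega>\<bar> \<le> B"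
  shows "(LINT \<omega>|marks. f \<omega>) = (LINT p|mark. LINT \<omega>|marks. f (case_nat p \<omega>))"
proof -
  interpret sequence_space mark by (rule sequence_space_mark)
  interpret S: prob_space marks by (rule prob_space_marks)
  interpret K: prob_space mark by (rule prob_space_mark)
  interpret P: pair_prob_space mark marks ..
  have "(LINT \<omega>|marks. f \<omega>) = integral\<^sup>L (distr (mark \<Otimes>\<^sub>M marks) marks (\<lambda>(s, \<omega>). case_nat s \<omega>)) f"
    by (simp only: PiM_iter)
  also have "\<dots> = (LINT z|(mark \<Otimes>\<^sub>M marks). f (case_nat (fst z) (snd z)))"
    by (subst integral_distr) (auto simp: split_beta')
  also have "\<dots> = (LINT p|mark. LINT \<omega>|marks. f (case_nat p \<omega>))"
  proof (subst P.integral_fst'[symmetric])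
    show "integrable (mark \<Otimes>\<^sub>M marks) (\<lambda>z. f (case_nat (fst z) (snd z)))"
    proof (rule P.integrable_const_bound)
      show "AE z in mark \<Otimes>\<^sub>M marks. norm (f (case_nat (fst z) (snd z))) \<le> B"
        using B by (auto intro!: AE_I2 simp: space_pair_measure space_PiM PiE_iff split: nat.split)
    qed measurable
  qed simp
  finally show ?thesis .
qed

locale pdmp_process = pdmp_flow +
  fixes G :: "'a \<times> real \<Rightarrow> 'a"
  assumes rep: "represents_kernel M Q G" and nonexpl: "non_explosive M \<phi> lam G"
begin

lemma G_measurable [measurable (raw)]:
  assumes [measurable]: "f \<in> A \<rightarrow>\<^sub>M N" "g \<in> A \<rightarrow>\<^sub>M uniform01"
  shows "(\<lambda>z. G (f z, g z)) \<in> A \<rightarrow>\<^sub>M N"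
proof -
  have "G \<in> N \<Otimes>\<^sub>M borel_of {0..1} \<rightarrow>\<^sub>M N" using rep by (simp add: represents_kernel_def)
  also have "N \<Otimes>\<^sub>M borel_of {0..1} \<rightarrow>\<^sub>M N = N \<Otimes>\<^sub>M uniform01 \<rightarrow>\<^sub>M N"
    by (intro measurable_cong_sets sets_pair_measure_cong sets_restrict_space_cong) auto
  finally have [measurable]: "G \<in> N \<Otimes>\<^sub>M uniform01 \<rightarrow>\<^sub>M N" .
  show ?thesis by measurable
qed

lemma G_in: "x \<in> M \<Longrightarrow> 0 \<le> u \<Longrightarrow> u \<le> 1 \<Longrightarrow> G (x, u) \<in> M"
  using measurable_space[OF G_measurable[of "\<lambda>_. x" uniform01 "\<lambda>u. u"], of u]
  by (auto simp: space_restrict_space)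

text \<open>The setwise identity in \<open>represents_kernel\<close> says that \<open>Q x\<close> is
  the image of the uniform law under \<open>\<lambda>u. G (x, u)\<close>.\<close>

lemma integral_G:
  fixes f :: "'a \<Rightarrow> real"
  assumes x: "x \<in> M" and f: "f \<in> borel_measurable N"
  shows "(LINT u|uniform01. f (G (x, u))) = (LINT y|Q x. f y)"
proof -
  interpret U: prob_space uniform01 by (rule prob_space_uniform01)
  have G: "(\<lambda>u. G (x, u)) \<in> uniform01 \<rightarrow>\<^sub>M N" using x by simp
  interpret D: prob_space "distr uniform01 N (\<lambda>u. G (x, u))" by (rule U.prob_space_distr[OF G])
  interpret Qx: prob_space "Q x" by (rule Q_prob[OF x])
  have "distr uniform01 N (\<lambda>u. G (x, u)) = Q x"
  proof (rule measure_eqI)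
    fix A assume "A \<in> sets (distr uniform01 N (\<lambda>u. G (x, u)))"
    then have A: "A \<in> sets N" by simp
    have "measure (distr uniform01 N (\<lambda>u. G (x, u))) A = measure uniform01 {u \<in> {0..1}. G (x, u) \<in> A}"
      by (subst measure_distr[OF G A]) (auto simp: space_restrict_space intro!: arg_cong[where f="measure _"])
    also have "\<dots> = measure (Q x) A"
      using rep x A by (simp add: represents_kernel_def)
    finally show "emeasure (distr uniform01 N (\<lambda>u. G (x, u))) A = emeasure (Q x) A"
      by (simp add: D.emeasure_eq_measure Qx.emeasure_eq_measure)
  qed (simp add: sets_Q[OF x])
  then show ?thesis by (metis integral_distr[OF G f])
qed

definition jump_to :: "'a \<Rightarrow> real \<times> real \<Rightarrow> 'a" where
  "jump_to x p = G (flow (real_of_ereal (tau x (fst p))) x, snd p)"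

lemma jump_to_measurable [measurable (raw)]:
  assumes [measurable]: "f \<in> A \<rightarrow>\<^sub>M N" "g \<in> A \<rightarrow>\<^sub>M mark"
  shows "(\<lambda>z. jump_to (f z) (g z)) \<in> A \<rightarrow>\<^sub>M N"
  unfolding jump_to_def by measurable

text \<open>The renewal operator: the expectation of \<open>u\<close> at the remaining time and the
  post-jump point, on the event that the first jump happens by time \<open>t\<close>.\<close>

definition K :: "(real \<Rightarrow> 'a \<Rightarrow> real) \<Rightarrow> real \<Rightarrow> 'a \<Rightarrow> real" where
  "K u t x = (LINT s:{0..t}|lborel. rate_density x s * (LINT y|Q (flow s x). u (t - s) y))"

text \<open>The Markov property at the first jump. \<open>H\<close> may depend on the remaining
  time, the post-jump point and the shifted marks, because the lemma serves twice: for the value of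
  the process at time \<open>t\<close> and for the indicator that further jumps occur in
  time.\<close>

lemma first_jump:
  assumes x: "x \<in> M" and t: "0 \<le> t"
    and H [measurable]: "(\<lambda>(t, x, \<omega>). H t x \<omega>) \<in> borel_measurable (borel \<Otimes>\<^sub>M N \<Otimes>\<^sub>M marks)"
    and B: "\<And>t x \<omega>. \<bar>H t x \<omega>\<bar> \<le> B"
  shows "(LINT \<omega>|marks. (if tau x (fst (\<omega> 0)) \<le> ereal t
        then H (t - real_of_ereal (tau x (fst (\<omega> 0)))) (jump_to x (\<omega> 0)) (\<lambda>n. \<omega> (Suc n)) else c))
    = exp (- Lam t x) * c + K (\<lambda>t x. LINT \<omega>|marks. H t x \<omega>) t x" (is "integral\<^sup>L marks ?F = _")
proof -
  interpret S: prob_space marks by (rule prob_space_marks)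
  interpret E: prob_space expm by (rule prob_space_expm)
  interpret U: prob_space uniform01 by (rule prob_space_uniform01)
  interpret EU: pair_prob_space expm uniform01 ..
  define h where "h t x = (LINT \<omega>|marks. H t x \<omega>)" for t x
  have h [measurable]: "(\<lambda>(t, x). h t x) \<in> borel_measurable (borel \<Otimes>\<^sub>M N)"
  proof -
    have "(\<lambda>z. H (fst (fst z)) (snd (fst z)) (snd z)) \<in> borel_measurable ((borel \<Otimes>\<^sub>M N) \<Otimes>\<^sub>M marks)"
      by (rule measurable_compose3[OF H]) simp_all
    then have "(\<lambda>(p, \<omega>). H (fst p) (snd p) \<omega>) \<in> borel_measurable ((borel \<Otimes>\<^sub>M N) \<Otimes>\<^sub>M marks)"
      unfolding split_beta' .
    then have "(\<lambda>p. LINT \<omega>|marks. H (fst p) (snd p) \<omega>) \<in> borel_measurable (borel \<Otimes>\<^sub>M N)"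
      by (rule S.borel_measurable_lebesgue_integral)
    then show ?thesis unfolding h_def split_beta' .
  qed
  have Hx: "(\<lambda>\<omega>. H t y \<omega>) \<in> borel_measurable marks" if "y \<in> M" for t y
    by (rule measurable_compose3[OF H]) (use that in simp_all)
  have B0: "0 \<le> B" using B[of 0 undefined undefined] by simp
  have hB: "\<bar>h t y\<bar> \<le> B" for t y
    unfolding h_def by (rule S.abs_integral_le) (rule B)
  have "integral\<^sup>L marks ?F = (LINT p|mark. LINT \<omega>|marks. ?F (case_nat p \<omega>))"
  proof (rule integral_marks_shift)
    have [measurable]: "(\<lambda>\<omega>. tau x (fst (\<omega> 0))) \<in> borel_measurable marks"
      by (rule tau_measurable[OF _ measurable_compose[OF marks_nth fst_mark]]) (simp add: x)
    have [measurable]: "(\<lambda>\<omega>. jump_to x (\<omega> 0)) \<in> marks \<rightarrow>\<^sub>M N"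
      by (rule jump_to_measurable[OF _ marks_nth]) (simp add: x)
    have "(\<lambda>\<omega>. H (t - real_of_ereal (tau x (fst (\<omega> 0)))) (jump_to x (\<omega> 0)) (\<lambda>n. \<omega> (Suc n))) \<in> borel_measurable marks"
      by (rule measurable_compose3[OF H, of "\<lambda>\<omega>. t - real_of_ereal (tau x (fst (\<omega> 0)))" marks "\<lambda>\<omega>. jump_to x (\<omega> 0)", OF _ _ marks_shift]) measurable
    then show "?F \<in> borel_measurable marks" by measurable
    show "\<bar>?F \<omega>\<bar> \<le> B + \<bar>c\<bar>" for \<omega> using B B0 by (auto intro: add_increasing2 order_trans[OF B])
  qed
  also have "\<dots> = (LINT p|mark. (if tau x (fst p) \<le> ereal t then h (t - real_of_ereal (tau x (fst p))) (jump_to x p) else c))"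
    using S.prob_space by (intro Bochner_Integration.integral_cong) (auto simp: h_def)
  also have "\<dots> = (LINT E|expm. LINT U|uniform01. (if tau x E \<le> ereal t
      then h (t - real_of_ereal (tau x E)) (G (flow (real_of_ereal (tau x E)) x, U)) else c))"
  proof (subst mark_def, subst EU.integral_fst'[symmetric])
    show "integrable (expm \<Otimes>\<^sub>M uniform01) (\<lambda>p. (if tau x (fst p) \<le> ereal t then h (t - real_of_ereal (tau x (fst p))) (jump_to x p) else c))"
    proof (rule EU.integrable_const_bound)
      show "AE p in expm \<Otimes>\<^sub>M uniform01. norm (if tau x (fst p) \<le> ereal t then h (t - real_of_ereal (tau x (fst p))) (jump_to x p) else c) \<le> B + \<bar>c\<bar>"
        using hB B0 by (intro AE_I2) (auto intro: add_increasing2 order_trans[OF hB])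
      show "(\<lambda>p. (if tau x (fst p) \<le> ereal t then h (t - real_of_ereal (tau x (fst p))) (jump_to x p) else c)) \<in> borel_measurable (expm \<Otimes>\<^sub>M uniform01)"
      proof -
        have [measurable]: "(\<lambda>p. tau x (fst p)) \<in> borel_measurable mark"
          by (rule tau_measurable[OF _ fst_mark]) (simp add: x)
        have [measurable]: "jump_to x \<in> mark \<rightarrow>\<^sub>M N"
          using jump_to_measurable[of "\<lambda>_. x" mark "\<lambda>p. p"] x by simp
        show "(\<lambda>p. (if tau x (fst p) \<le> ereal t then h (t - real_of_ereal (tau x (fst p))) (jump_to x p) else c)) \<in> borel_measurable (expm \<Otimes>\<^sub>M uniform01)"
          unfolding mark_def[symmetric] by measurable
      qed
    qed
  qed (simp add: jump_to_def cong: if_cong)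
  also have "\<dots> = (LINT E|expm. (if tau x E \<le> ereal t
      then (LINT y|Q (flow (real_of_ereal (tau x E)) x). h (t - real_of_ereal (tau x E)) y) else c))"
  proof (intro Bochner_Integration.integral_cong refl)
    fix E
    have m: "h r \<in> borel_measurable N" for r by measurable
    show "(LINT U|uniform01. (if tau x E \<le> ereal t
      then h (t - real_of_ereal (tau x E)) (G (flow (real_of_ereal (tau x E)) x, U)) else c)) =
      (if tau x E \<le> ereal t
      then (LINT y|Q (flow (real_of_ereal (tau x E)) x). h (t - real_of_ereal (tau x E)) y) else c)"
      using integral_G[OF flow_in'[OF x] m] U.prob_space by simp
  qed
  also have "\<dots> = exp (- Lam t x) * c + (LINT s:{0..t}|lborel. rate_density x s * (LINT y|Q (flow s x). h (t - s) y))"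
  proof (rule tau_expectation[OF x t])
    show "(\<lambda>s. LINT y|Q (flow s x). h (t - s) y) \<in> borel_measurable borel"
      by (rule integral_kernel_measurable[where N = N]) (simp_all add: x split_beta')
    show "\<bar>LINT y|Q (flow s x). h (t - s) y\<bar> \<le> B" for s
      by (rule Q_abs_le) (use hB x in auto)
  qed
  finally show ?thesis unfolding K_def h_def .
qed

end

section \<open>The jump chain and the semigroup\<close>

context pdmp_process
begin

definition J :: "nat \<Rightarrow> 'a \<Rightarrow> (nat \<Rightarrow> real \<times> real) \<Rightarrow> ereal \<times> 'a" where
  "J k x \<omega> = pdmp_jump \<phi> lam G (x, \<omega>) k"

abbreviation "JT k x \<omega> \<equiv> fst (J k x \<omega>)"
abbreviation "JX k x \<omega> \<equiv> snd (J k x \<omega>)"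

lemma J_0 [simp]: "J 0 x \<omega> = (0, x)" by (simp add: J_def)

text \<open>\<open>pdmp_jump\<close> minimises over absolute times with the hazard started at
  \<open>s\<close>. Translating by \<open>s\<close> turns this into the waiting time
  \<open>tau\<close> from the current point.\<close>

lemma Inf_shift:
  assumes "y \<in> M" "0 \<le> s"
  shows "Inf {ereal t | t. s \<le> t \<and> e < (LINT u:{s..t}|lborel. lam (\<phi> (u - s) y))} = ereal s + tau y e"
proof -
  have eq: "(LINT u:{s..t}|lborel. lam (\<phi> (u - s) y)) = Lam (t - s) y" for t
  proof -
    have "(LINT u:{s..t}|lborel. lam (\<phi> (u - s) y)) = (LINT u:{s..t}|lborel. lam (flow (u - s) y))"
      by (intro set_lebesgue_integral_cong) (auto simp: flow_eq)
    then show ?thesis using set_lebesgue_integral_shift[of s t "\<lambda>u. lam (flow u y)"] by (simp add: Lam_def)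
  qed
  let ?A = "{ereal t | t. s \<le> t \<and> e < Lam (t - s) y}"
  have "Inf ?A = ereal s + tau y e"
  proof (rule antisym)
    show "ereal s + tau y e \<le> Inf ?A"
    proof (rule Inf_greatest)
      fix z assume "z \<in> ?A"
      then obtain t where t: "z = ereal t" "s \<le> t" "e < Lam (t - s) y" by auto
      then have "tau y e \<le> ereal (t - s)" by (intro tau_leI) auto
      then have "ereal s + tau y e \<le> ereal s + ereal (t - s)" by (rule add_left_mono)
      then show "ereal s + tau y e \<le> z" using t by simp
    qed
    show "Inf ?A \<le> ereal s + tau y e"
    proof (rule dense_ge)
      fix w assume "ereal s + tau y e < w"
      then have "tau y e < w - ereal s" by (simp add: ereal_less_minus_iff add.commute)
      then obtain t where t: "0 \<le> t" "e < Lam t y" "ereal t < w - ereal s"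
        unfolding tau_def Inf_less_iff by auto
      have "Inf ?A \<le> ereal (s + t)" by (rule Inf_lower) (use t in auto)
      also have "\<dots> \<le> w" using t(3) by (cases w) auto
      finally show "Inf ?A \<le> w" .
    qed
  qed
  then show ?thesis by (simp add: eq)
qed

lemma J_step:
  assumes "J k x \<omega> = (S, y)" "y \<in> M" "0 \<le> S"
  shows "J (Suc k) x \<omega> = (if S = \<infinity> \<or> tau y (fst (\<omega> k)) = \<infinity> then (\<infinity>, y)
    else (S + tau y (fst (\<omega> k)), jump_to y (\<omega> k)))"
proof (cases S)
  case (real s)
  then have s: "0 \<le> s" using assms by simp
  show ?thesis
    using assms(1) tau_nonneg[of y "fst (\<omega> k)"] unfolding J_def
    by (cases "tau y (fst (\<omega> k))")
      (auto simp: real Inf_shift[OF assms(2) s] split_beta jump_to_def flow_eq Let_def)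
qed (use assms in \<open>auto simp: J_def split: prod.splits\<close>)

text \<open>Read off from \<open>pdmp_jump\<close> itself, so that it holds for every starting point
  and every outcome, also off \<open>M\<close> and off the space of marks. The definition of
  \<open>F\<close> is meaningful for all outcomes thanks to this.\<close>

lemma T_mono_Suc: "JT k x \<omega> \<le> JT (Suc k) x \<omega>"
proof -
  obtain S y where J: "J k x \<omega> = (S, y)" by (cases "J k x \<omega>")
  have "S \<le> ereal (real_of_ereal S)" if "S \<noteq> \<infinity>" using that by (cases S) auto
  then have "S \<le> Inf {ereal t | t. real_of_ereal S \<le> t \<and> e < h t}" if "S \<noteq> \<infinity>" for e :: real and h
    using that by (intro Inf_greatest) (auto elim: order_trans)
  then show ?thesis using J unfolding J_def
    by (auto simp: Let_def split_beta)
qed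

lemma T_mono: "i \<le> j \<Longrightarrow> JT i x \<omega> \<le> JT j x \<omega>"
  by (rule lift_Suc_mono_le[of "\<lambda>k. JT k x \<omega>"]) (rule T_mono_Suc)

lemma T_nonneg: "0 \<le> JT k x \<omega>"
  using T_mono[of 0 k x \<omega>] by simp

lemma marks_snd:
  assumes "\<omega> \<in> space marks"
  shows "0 \<le> snd (\<omega> k)" "snd (\<omega> k) \<le> 1"
  using measurable_space[OF measurable_compose[OF marks_nth snd_mark] assms, of k]
  by (auto simp: space_restrict_space)

lemma jump_to_in: "x \<in> M \<Longrightarrow> \<omega> \<in> space marks \<Longrightarrow> jump_to x (\<omega> k) \<in> M"
  unfolding jump_to_def by (intro G_in flow_in') (auto intro: marks_snd)

lemma X_in: "x \<in> M \<Longrightarrow> \<omega> \<in> space marks \<Longrightarrow> JX k x \<omega> \<in> M"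
proof (induction k)
  case (Suc k)
  then show ?case
    using J_step[of k x \<omega> "JT k x \<omega>" "JX k x \<omega>"] T_nonneg[of k x \<omega>] jump_to_in[of "JX k x \<omega>" \<omega> k] by auto
qed simp

lemma J_Suc:
  assumes "x \<in> M" "\<omega> \<in> space marks"
  shows "J (Suc k) x \<omega> = (if JT k x \<omega> = \<infinity> \<or> tau (JX k x \<omega>) (fst (\<omega> k)) = \<infinity> then (\<infinity>, JX k x \<omega>)
    else (JT k x \<omega> + tau (JX k x \<omega>) (fst (\<omega> k)), jump_to (JX k x \<omega>) (\<omega> k)))"
  by (rule J_step) (use X_in[OF assms] T_nonneg in auto)

lemma J_measurable: "(\<lambda>z. J k (fst z) (snd z)) \<in> N \<Otimes>\<^sub>M marks \<rightarrow>\<^sub>M borel \<Otimes>\<^sub>M N"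
proof (induction k)
  case 0
  then show ?case by simp
next
  case (Suc k)
  note JT = measurable_compose[OF Suc measurable_fst]
  note JX = measurable_compose[OF Suc measurable_snd]
  have w: "(\<lambda>z. snd z k) \<in> N \<Otimes>\<^sub>M marks \<rightarrow>\<^sub>M mark"
    by (rule measurable_compose[OF measurable_snd marks_nth])
  note tau = tau_measurable[OF JX measurable_compose[OF w fst_mark]]
  note jump = jump_to_measurable[OF JX w]
  have "(\<lambda>z. if JT k (fst z) (snd z) = \<infinity> \<or> tau (JX k (fst z) (snd z)) (fst (snd z k)) = \<infinity> then (\<infinity>, JX k (fst z) (snd z))
    else (JT k (fst z) (snd z) + tau (JX k (fst z) (snd z)) (fst (snd z k)), jump_to (JX k (fst z) (snd z)) (snd z k)))
    \<in> N \<Otimes>\<^sub>M marks \<rightarrow>\<^sub>M borel \<Otimes>\<^sub>M N"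
  proof (rule measurable_If)
    show "{z \<in> space (N \<Otimes>\<^sub>M marks). JT k (fst z) (snd z) = \<infinity> \<or> tau (JX k (fst z) (snd z)) (fst (snd z k)) = \<infinity>}
      \<in> sets (N \<Otimes>\<^sub>M marks)"
      using JT tau by measurable
  qed (intro measurable_Pair JT JX tau jump borel_measurable_ereal_add measurable_const; simp)+
  then show ?case
    by (rule measurable_cong[THEN iffD1, rotated]) (auto simp: space_pair_measure J_Suc)
qed

text \<open>After the first jump the chain restarts at the post-jump point, driven by the remaining
  marks, with its clock advanced by \<open>tau\<close>. This is the pathwise half of the renewal
  equation.\<close>

lemma J_shift:
  assumes x: "x \<in> M" and \<omega>: "\<omega> \<in> space marks"
  shows "tau x (fst (\<omega> 0)) = \<infinity> \<Longrightarrow> JT (Suc k) x \<omega> = \<infinity>"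
    and "tau x (fst (\<omega> 0)) \<noteq> \<infinity> \<Longrightarrow>
      JT (Suc k) x \<omega> = tau x (fst (\<omega> 0)) + JT k (jump_to x (\<omega> 0)) (\<lambda>n. \<omega> (Suc n)) \<and>
      (JT (Suc k) x \<omega> \<noteq> \<infinity> \<longrightarrow> JX (Suc k) x \<omega> = JX k (jump_to x (\<omega> 0)) (\<lambda>n. \<omega> (Suc n)))"
proof -
  assume "tau x (fst (\<omega> 0)) = \<infinity>"
  then have "JT (Suc 0) x \<omega> = \<infinity>" using J_Suc[OF x \<omega>, of 0] by simp
  then show "JT (Suc k) x \<omega> = \<infinity>" using T_mono[of "Suc 0" "Suc k" x \<omega>] by simp
next
  assume fin: "tau x (fst (\<omega> 0)) \<noteq> \<infinity>"
  let ?x = "jump_to x (\<omega> 0)" and ?\<omega> = "\<lambda>n. \<omega> (Suc n)"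
  have x': "?x \<in> M" by (rule jump_to_in[OF x \<omega>])
  have \<omega>': "?\<omega> \<in> space marks" by (rule measurable_space[OF marks_shift \<omega>])
  show "JT (Suc k) x \<omega> = tau x (fst (\<omega> 0)) + JT k ?x ?\<omega> \<and>
      (JT (Suc k) x \<omega> \<noteq> \<infinity> \<longrightarrow> JX (Suc k) x \<omega> = JX k ?x ?\<omega>)"
  proof (induction k)
    case 0
    then show ?case using J_Suc[OF x \<omega>, of 0] fin by simp
  next
    case (Suc k)
    show ?case
      using Suc fin J_Suc[OF x \<omega>, of "Suc k"] J_Suc[OF x' \<omega>', of k]
      by (cases "JT k ?x ?\<omega> = \<infinity>") (auto simp: add.assoc)
  qed
qed

lemma T_measurable: "(\<lambda>z. JT k (fst z) (snd z)) \<in> borel_measurable (N \<Otimes>\<^sub>M marks)"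
  by (rule measurable_compose[OF J_measurable measurable_fst])

lemma X_measurable: "(\<lambda>z. JX k (fst z) (snd z)) \<in> N \<Otimes>\<^sub>M marks \<rightarrow>\<^sub>M N"
  by (rule measurable_compose[OF J_measurable measurable_snd])

text \<open>The value of \<open>f\<close> at the position at time \<open>t\<close>, and 0 after
  explosion. At most one summand is nonzero; as a series it is jointly measurable in time, start and
  marks. The test for \<open>M\<close> keeps a bound on \<open>f\<close> valid for every outcome,
  not just almost surely.\<close>

definition F :: "('a \<Rightarrow> real) \<Rightarrow> real \<Rightarrow> 'a \<Rightarrow> (nat \<Rightarrow> real \<times> real) \<Rightarrow> real" where
  "F f t x \<omega> = (\<Sum>k. if JT k x \<omega> \<le> ereal t \<and> ereal t < JT (Suc k) x \<omega> \<and> flow (t - real_of_ereal (JT k x \<omega>)) (JX k x \<omega>) \<in> M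
     then f (flow (t - real_of_ereal (JT k x \<omega>)) (JX k x \<omega>)) else 0)"

lemma T_interval_unique:
  assumes "JT k x \<omega> \<le> t" "t < JT (Suc k) x \<omega>" "JT l x \<omega> \<le> t" "t < JT (Suc l) x \<omega>"
  shows "k = l"
proof (rule ccontr)
  assume "k \<noteq> l"
  then consider "Suc k \<le> l" | "Suc l \<le> k" by linarith
  then show False
    using T_mono[of "Suc k" l x \<omega>] T_mono[of "Suc l" k x \<omega>] assms by cases auto
qed

lemma F_eq:
  assumes "JT k x \<omega> \<le> ereal t" "ereal t < JT (Suc k) x \<omega>"
  shows "F f t x \<omega> = (if flow (t - real_of_ereal (JT k x \<omega>)) (JX k x \<omega>) \<in> M
    then f (flow (t - real_of_ereal (JT k x \<omega>)) (JX k x \<omega>)) else 0)"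
  unfolding F_def
  by (subst suminf_finite[of "{k}"]) (auto simp: assms dest: T_interval_unique[OF assms])

lemma F_0: "\<forall>k. JT k x \<omega> \<le> ereal t \<Longrightarrow> F f t x \<omega> = 0"
  unfolding F_def by (subst suminf_finite[of "{}"]) (auto simp: leD)

lemma T_cases:
  assumes "0 \<le> t"
  obtains (interval) k where "JT k x \<omega> \<le> ereal t" "ereal t < JT (Suc k) x \<omega>" | (exploded) "\<forall>k. JT k x \<omega> \<le> ereal t"
proof (cases "\<forall>k. JT k x \<omega> \<le> ereal t")
  case False
  define k where "k = (LEAST k. ereal t < JT k x \<omega>)"
  have k: "ereal t < JT k x \<omega>" unfolding k_def using False by (metis (mono_tags, lifting) LeastI not_less)
  then obtain j where j: "k = Suc j" using assms by (cases k) auto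
  have "\<not> ereal t < JT j x \<omega>" using not_less_Least[of j "\<lambda>k. ereal t < JT k x \<omega>"] j k_def by simp
  then show ?thesis using interval[of j] k j by (simp add: not_less)
qed (rule exploded)

lemma pdmp_eq_None_iff:
  assumes "0 \<le> t"
  shows "pdmp \<phi> lam G t (x, \<omega>) = None \<longleftrightarrow> (\<forall>k. JT k x \<omega> \<le> ereal t)"
  unfolding pdmp_def jump_time_def J_def[symmetric] less_SUP_iff by (simp add: Let_def) (meson not_le)

lemma pdmp_eq:
  assumes "JT k x \<omega> \<le> ereal t" "ereal t < JT (Suc k) x \<omega>"
  shows "pdmp \<phi> lam G t (x, \<omega>) = Some (\<phi> (t - real_of_ereal (JT k x \<omega>)) (JX k x \<omega>))"
proof -
  have "(THE k. JT k x \<omega> \<le> ereal t \<and> ereal t < JT (Suc k) x \<omega>) = k"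
    by (rule the_equality) (auto simp: assms dest: T_interval_unique[OF assms])
  moreover have "ereal t < (SUP k. JT k x \<omega>)"
    using assms(2) unfolding less_SUP_iff by auto
  ultimately show ?thesis
    unfolding pdmp_def jump_time_def post_jump_def J_def[symmetric] Let_def by simp
qed

lemma time_nonneg: "JT k x \<omega> \<le> ereal t \<Longrightarrow> 0 \<le> t - real_of_ereal (JT k x \<omega>)"
  using T_nonneg[of k x \<omega>] by (cases "JT k x \<omega>") auto

lemma pdmp_F:
  assumes "x \<in> M" "\<omega> \<in> space marks" "0 \<le> t"
  shows "(case pdmp \<phi> lam G t (x, \<omega>) of None \<Rightarrow> 0 | Some y \<Rightarrow> f y) = F f t x \<omega>"
  using assms(3)
proof (cases rule: T_cases[of t x \<omega>])
  case (interval k)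
  then show ?thesis
    using flow_in'[OF X_in[OF assms(1,2)]]
    by (simp add: F_eq[OF interval] pdmp_eq[OF interval] flow_eq[OF time_nonneg[OF interval(1)], symmetric])
next
  case exploded
  then show ?thesis using pdmp_eq_None_iff[OF assms(3), of x \<omega>] by (simp add: F_0)
qed

lemma F_cases:
  obtains (alive) y where "y \<in> M" "\<And>f. F f t x \<omega> = f y" | (dead) "\<And>f. F f t x \<omega> = 0"
proof (cases "\<exists>k. JT k x \<omega> \<le> ereal t \<and> ereal t < JT (Suc k) x \<omega>")
  case True
  then obtain k where k: "JT k x \<omega> \<le> ereal t" "ereal t < JT (Suc k) x \<omega>" by auto
  let ?y = "flow (t - real_of_ereal (JT k x \<omega>)) (JX k x \<omega>)"
  show thesis
  proof (cases "?y \<in> M")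
    case True
    show thesis by (rule alive[OF True]) (simp add: F_eq[OF k] True)
  next
    case False
    show thesis by (rule dead) (simp add: F_eq[OF k] False)
  qed
next
  case False
  show thesis by (rule dead, unfold F_def, subst suminf_finite[of "{}"]) (use False in auto)
qed

lemma F_abs_le:
  assumes "\<And>y. y \<in> M \<Longrightarrow> \<bar>f y\<bar> \<le> B" "0 \<le> B"
  shows "\<bar>F f t x \<omega>\<bar> \<le> B"
  by (cases rule: F_cases[where t = t and x = x and \<omega> = \<omega>]) (simp_all add: assms)

lemma F_nonneg:
  assumes "\<And>y. y \<in> M \<Longrightarrow> 0 \<le> f y"
  shows "0 \<le> F f t x \<omega>"
  by (cases rule: F_cases[where t = t and x = x and \<omega> = \<omega>]) (simp_all add: assms)

lemma F_shift:
  assumes x: "x \<in> M" and \<omega>: "\<omega> \<in> space marks" and t: "0 \<le> t"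
  shows "F f t x \<omega> = (if tau x (fst (\<omega> 0)) \<le> ereal t
    then F f (t - real_of_ereal (tau x (fst (\<omega> 0)))) (jump_to x (\<omega> 0)) (\<lambda>n. \<omega> (Suc n)) else f (flow t x))"
proof (cases "tau x (fst (\<omega> 0)) \<le> ereal t")
  case False
  have "JT (Suc 0) x \<omega> = tau x (fst (\<omega> 0))"
    using J_Suc[OF x \<omega>, of 0] by simp
  then show ?thesis
    using F_eq[of 0 x \<omega> t f] False t x by (auto simp: not_le)
next
  case True
  then obtain r where r: "tau x (fst (\<omega> 0)) = ereal r" "0 \<le> r" "r \<le> t"
    using tau_nonneg[of x "fst (\<omega> 0)"] by (cases "tau x (fst (\<omega> 0))") auto
  let ?x = "jump_to x (\<omega> 0)" and ?\<omega> = "\<lambda>n. \<omega> (Suc n)"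
  have TS: "JT (Suc k) x \<omega> = ereal r + JT k ?x ?\<omega>" and XS: "JT (Suc k) x \<omega> \<noteq> \<infinity> \<Longrightarrow> JX (Suc k) x \<omega> = JX k ?x ?\<omega>" for k
    using J_shift(2)[OF x \<omega>, of k] r by auto
  have tr: "0 \<le> t - r" using r by simp
  have "F f t x \<omega> = F f (t - r) ?x ?\<omega>"
    using tr
  proof (cases rule: T_cases[of "t - r" ?x ?\<omega>])
    case (interval k)
    obtain s where s: "JT k ?x ?\<omega> = ereal s" using interval T_nonneg[of k ?x ?\<omega>] by (cases "JT k ?x ?\<omega>") auto
    have "JT (Suc k) x \<omega> \<le> ereal t" "ereal t < JT (Suc (Suc k)) x \<omega>"
      using interval unfolding TS s by (simp_all, cases "JT (Suc k) ?x ?\<omega>", auto)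
    then show ?thesis
      using F_eq[of "Suc k" x \<omega> t f] F_eq[OF interval, of f] XS[of k] TS[of k] s by (simp add: algebra_simps)
  next
    case exploded
    have "JT k x \<omega> \<le> ereal t" for k
    proof (cases k)
      case (Suc j)
      show ?thesis using exploded[rule_format, of j] unfolding Suc TS by (cases "JT j ?x ?\<omega>") auto
    qed (use t in simp)
    then show ?thesis using exploded by (simp add: F_0)
  qed
  then show ?thesis using True r by simp
qed

lemma F_measurable:
  assumes [measurable]: "f \<in> borel_measurable N"
  shows "(\<lambda>(t, x, \<omega>). F f t x \<omega>) \<in> borel_measurable (borel \<Otimes>\<^sub>M N \<Otimes>\<^sub>M marks)"
proof -
  have f0 [measurable]: "(\<lambda>y. if y \<in> M then f y else 0) \<in> borel_measurable N"
    by (rule measurable_cong[THEN iffD1, OF _ assms]) auto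
  let ?P = "borel \<Otimes>\<^sub>M N \<Otimes>\<^sub>M marks"
  have JT [measurable]: "(\<lambda>z. JT k (fst (snd z)) (snd (snd z))) \<in> borel_measurable ?P" for k
    by (rule measurable_compose[OF measurable_snd T_measurable])
  have JX [measurable]: "(\<lambda>z. JX k (fst (snd z)) (snd (snd z))) \<in> ?P \<rightarrow>\<^sub>M N" for k
    by (rule measurable_compose[OF measurable_snd X_measurable])
  have [measurable]: "(\<lambda>z. flow (fst z - real_of_ereal (JT k (fst (snd z)) (snd (snd z)))) (JX k (fst (snd z)) (snd (snd z)))) \<in> ?P \<rightarrow>\<^sub>M N" for k
    by (rule flow_measurable) measurable
  have Y: "(\<lambda>z. (\<lambda>y. if y \<in> M then f y else 0) (flow (fst z - real_of_ereal (JT k (fst (snd z)) (snd (snd z)))) (JX k (fst (snd z)) (snd (snd z)))))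
     \<in> borel_measurable ?P" for k
    by (rule measurable_compose[OF _ f0]) measurable
  have [measurable]: "Measurable.pred ?P (\<lambda>z. JT k (fst (snd z)) (snd (snd z)) \<le> ereal (fst z) \<and>
      ereal (fst z) < JT (Suc k) (fst (snd z)) (snd (snd z)))" for k
    by measurable
  have "(\<lambda>z. if JT k (fst (snd z)) (snd (snd z)) \<le> ereal (fst z) \<and> ereal (fst z) < JT (Suc k) (fst (snd z)) (snd (snd z))
     then (\<lambda>y. if y \<in> M then f y else 0) (flow (fst z - real_of_ereal (JT k (fst (snd z)) (snd (snd z)))) (JX k (fst (snd z)) (snd (snd z))))
     else 0) \<in> borel_measurable ?P" for k
    using Y[of k] by measurable
  from borel_measurable_suminf[OF this] show ?thesis
    unfolding F_def split_beta'
    by (rule measurable_cong[THEN iffD1, rotated]) (auto intro!: suminf_cong)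
qed

lemma F_measurable_marks:
  assumes "f \<in> borel_measurable N" "x \<in> M"
  shows "F f t x \<in> borel_measurable marks"
  by (rule measurable_compose3[OF F_measurable[OF assms(1)], of "\<lambda>_. t" _ "\<lambda>_. x" "\<lambda>\<omega>. \<omega>"]) (use assms in auto)

section \<open>The semigroup and the probability of at least n jumps\<close>

definition U :: "('a \<Rightarrow> real) \<Rightarrow> real \<Rightarrow> 'a \<Rightarrow> real" where
  "U f t x = (LINT \<omega>|marks. F f t x \<omega>)"

definition V :: "nat \<Rightarrow> real \<Rightarrow> 'a \<Rightarrow> real" where
  "V n t x = (LINT \<omega>|marks. (if JT n x \<omega> \<le> ereal t then 1 else 0))"

lemma integral_marks_measurable:
  fixes H :: "real \<Rightarrow> 'a \<Rightarrow> (nat \<Rightarrow> real \<times> real) \<Rightarrow> real"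
  assumes H: "(\<lambda>(t, x, \<omega>). H t x \<omega>) \<in> borel_measurable (borel \<Otimes>\<^sub>M N \<Otimes>\<^sub>M marks)"
  shows "(\<lambda>(t, x). LINT \<omega>|marks. H t x \<omega>) \<in> borel_measurable (borel \<Otimes>\<^sub>M N)"
proof -
  interpret S: prob_space marks by (rule prob_space_marks)
  have "(\<lambda>z. H (fst (fst z)) (snd (fst z)) (snd z)) \<in> borel_measurable ((borel \<Otimes>\<^sub>M N) \<Otimes>\<^sub>M marks)"
    by (rule measurable_compose3[OF H]) simp_all
  then have "(\<lambda>(p, \<omega>). H (fst p) (snd p) \<omega>) \<in> borel_measurable ((borel \<Otimes>\<^sub>M N) \<Otimes>\<^sub>M marks)"
    unfolding split_beta' .
  then have "(\<lambda>p. LINT \<omega>|marks. H (fst p) (snd p) \<omega>) \<in> borel_measurable (borel \<Otimes>\<^sub>M N)"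
    by (rule S.borel_measurable_lebesgue_integral)
  then show ?thesis unfolding split_beta' .
qed

lemma U_measurable: "f \<in> borel_measurable N \<Longrightarrow> (\<lambda>(t, x). U f t x) \<in> borel_measurable (borel \<Otimes>\<^sub>M N)"
  unfolding U_def by (rule integral_marks_measurable[OF F_measurable])

lemma U_abs_le:
  assumes "\<And>y. y \<in> M \<Longrightarrow> \<bar>f y\<bar> \<le> B" "0 \<le> B"
  shows "\<bar>U f t x\<bar> \<le> B"
  unfolding U_def by (rule prob_space.abs_integral_le[OF prob_space_marks]) (rule F_abs_le[OF assms])

lemma U_renewal:
  assumes f: "f \<in> borel_measurable N" and B: "\<And>y. y \<in> M \<Longrightarrow> \<bar>f y\<bar> \<le> B" and x: "x \<in> M" and t: "0 \<le> t"
  shows "U f t x = exp (- Lam t x) * f (flow t x) + K (U f) t x"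
proof -
  have "0 \<le> B" using B[OF x] by simp
  then have "\<And>t x \<omega>. \<bar>F f t x \<omega>\<bar> \<le> B" using B by (intro F_abs_le)
  from first_jump[OF x t F_measurable[OF f] this, of "f (flow t x)"]
  show ?thesis
    unfolding U_def by (subst Bochner_Integration.integral_cong[OF refl F_shift[OF x _ t]]) auto
qed

lemma V_pred_measurable:
  "(\<lambda>(t, x, \<omega>). (if JT n x \<omega> \<le> ereal t then 1 else 0 :: real)) \<in> borel_measurable (borel \<Otimes>\<^sub>M N \<Otimes>\<^sub>M marks)"
proof -
  have [measurable]: "(\<lambda>z. JT n (fst (snd z)) (snd (snd z))) \<in> borel_measurable (borel \<Otimes>\<^sub>M N \<Otimes>\<^sub>M marks)"
    by (rule measurable_compose[OF measurable_snd T_measurable])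
  show ?thesis unfolding split_beta' by measurable
qed

lemma V_measurable: "(\<lambda>(t, x). V n t x) \<in> borel_measurable (borel \<Otimes>\<^sub>M N)"
  unfolding V_def by (rule integral_marks_measurable[OF V_pred_measurable])

lemma V_bounds: "0 \<le> V n t x" "V n t x \<le> 1"
proof -
  show "0 \<le> V n t x" unfolding V_def by (rule Bochner_Integration.integral_nonneg) simp
  have "\<bar>V n t x\<bar> \<le> 1" unfolding V_def by (rule prob_space.abs_integral_le[OF prob_space_marks]) simp
  then show "V n t x \<le> 1" by simp
qed

lemma V_0: "0 \<le> t \<Longrightarrow> V 0 t x = 1"
  unfolding V_def using prob_space.prob_space[OF prob_space_marks] by simp

text \<open>To have \<open>n + 1\<close> jumps by time \<open>t\<close> is to have a first jump by
  \<open>t\<close> and \<open>n\<close> more in the remaining time. Together with \<open>V_0\<close>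
  this identifies \<open>V n\<close> with the n-fold iterate of \<open>K\<close> on the constant
  1.\<close>

lemma V_Suc:
  assumes x: "x \<in> M" and t: "0 \<le> t"
  shows "V (Suc n) t x = K (V n) t x"
proof -
  have "(if JT (Suc n) x \<omega> \<le> ereal t then 1 else 0 :: real) = (if tau x (fst (\<omega> 0)) \<le> ereal t
    then (if JT n (jump_to x (\<omega> 0)) (\<lambda>n. \<omega> (Suc n)) \<le> ereal (t - real_of_ereal (tau x (fst (\<omega> 0)))) then 1 else 0) else 0)"
    (is "?a = ?b") if \<omega>: "\<omega> \<in> space marks" for \<omega>
  proof (cases "tau x (fst (\<omega> 0)) \<le> ereal t")
    case True
    then obtain r where r: "tau x (fst (\<omega> 0)) = ereal r" using tau_nonneg[of x "fst (\<omega> 0)"]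
      by (cases "tau x (fst (\<omega> 0))") auto
    then have "JT (Suc n) x \<omega> = ereal r + JT n (jump_to x (\<omega> 0)) (\<lambda>n. \<omega> (Suc n))"
      using J_shift(2)[OF x \<omega>, of n] by simp
    then show ?thesis
      using True r by (cases "JT n (jump_to x (\<omega> 0)) (\<lambda>n. \<omega> (Suc n))") auto
  next
    case False
    have "tau x (fst (\<omega> 0)) \<le> JT (Suc n) x \<omega>"
      using J_shift[OF x \<omega>, of n] T_nonneg[of n "jump_to x (\<omega> 0)" "\<lambda>n. \<omega> (Suc n)"]
      by (cases "tau x (fst (\<omega> 0)) = \<infinity>") (auto simp: add_increasing2)
    then have "\<not> JT (Suc n) x \<omega> \<le> ereal t" using False by (meson order_trans)
    then show ?thesis using False by simp
  qed
  then have "V (Suc n) t x = (LINT \<omega>|marks. (if tau x (fst (\<omega> 0)) \<le> ereal t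
    then (if JT n (jump_to x (\<omega> 0)) (\<lambda>n. \<omega> (Suc n)) \<le> ereal (t - real_of_ereal (tau x (fst (\<omega> 0)))) then 1 else 0) else 0))"
    unfolding V_def by (intro Bochner_Integration.integral_cong refl)
  also have "\<dots> = exp (- Lam t x) * 0 + K (V n) t x"
    unfolding V_def by (rule first_jump[OF x t V_pred_measurable[of n], of 1]) auto
  finally show ?thesis by simp
qed

lemma pdmp_space_return: "pdmp_space (return N x) = return N x \<Otimes>\<^sub>M marks"
  unfolding pdmp_space_def mark_def ..

lemma integral_pdmp_space:
  fixes g :: "'a \<times> (nat \<Rightarrow> real \<times> real) \<Rightarrow> real"
  assumes x: "x \<in> M" and g: "g \<in> borel_measurable (N \<Otimes>\<^sub>M marks)" and B: "\<And>z. \<bar>g z\<bar> \<le> B"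
  shows "integral\<^sup>L (pdmp_space (return N x)) g = (LINT \<omega>|marks. g (x, \<omega>))"
proof -
  interpret S: prob_space marks by (rule prob_space_marks)
  interpret R: prob_space "return N x" by (rule prob_space_return) (simp add: x)
  interpret P: pair_prob_space "return N x" marks ..
  have g': "g \<in> borel_measurable (return N x \<Otimes>\<^sub>M marks)"
    using g by (simp add: measurable_cong_sets[OF sets_pair_measure_cong[OF sets_return refl] refl])
  have "integrable (return N x \<Otimes>\<^sub>M marks) g"
    by (rule P.integrable_const_bound[of _ B]) (use B g' in auto)
  then have "integral\<^sup>L (pdmp_space (return N x)) g = (LINT y|return N x. LINT \<omega>|marks. g (y, \<omega>))"
    unfolding pdmp_space_return by (rule P.integral_fst'[symmetric])
  also have "\<dots> = (LINT \<omega>|marks. g (x, \<omega>))"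
  proof (rule integral_return)
    show "(\<lambda>y. LINT \<omega>|marks. g (y, \<omega>)) \<in> borel_measurable N"
      by (rule S.borel_measurable_lebesgue_integral) (use g in simp)
  qed (simp add: x)
  finally show ?thesis .
qed

lemma pair_measurable_fix_time:
  assumes "(\<lambda>(t, x, \<omega>). H t x \<omega>) \<in> borel_measurable (borel \<Otimes>\<^sub>M N \<Otimes>\<^sub>M marks)"
  shows "(\<lambda>z. H t (fst z) (snd z)) \<in> borel_measurable (N \<Otimes>\<^sub>M marks)"
  by (rule measurable_compose3[OF assms]) auto

lemma space_pdmp_space: "space (pdmp_space (return N x)) = M \<times> space marks"
  by (simp add: pdmp_space_return space_pair_measure)

lemma pdmp_operator_eq:
  assumes x: "x \<in> M" and t: "0 \<le> t" and f: "f \<in> borel_measurable N" and B: "\<And>y. y \<in> M \<Longrightarrow> \<bar>f y\<bar> \<le> B"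
  shows "pdmp_operator M \<phi> lam G t f x = U f t x"
proof -
  have "pdmp_operator M \<phi> lam G t f x = (LINT z|pdmp_space (return N x). F f t (fst z) (snd z))"
    unfolding pdmp_operator_def
    by (intro Bochner_Integration.integral_cong refl)
      (auto simp: space_pdmp_space pdmp_F[OF _ _ t, symmetric])
  also have "\<dots> = U f t x"
    unfolding U_def using B[OF x]
    by (subst integral_pdmp_space[OF x pair_measurable_fix_time[OF F_measurable[OF f]], of _ B])
      (auto intro!: F_abs_le B)
  finally show ?thesis .
qed

text \<open>Non-explosion is applied to the Dirac law at \<open>x\<close>: on almost every path some
  jump time exceeds \<open>t\<close>, hence all later ones do, and the indicators vanish eventually.
  Dominated convergence gives the limit at this \<open>x\<close>, without uniformity in
  \<open>x\<close>.\<close>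

lemma V_tendsto_0:
  assumes x: "x \<in> M" and t: "0 \<le> t"
  shows "(\<lambda>n. V n t x) \<longlonglongrightarrow> 0"
proof -
  let ?\<Omega> = "pdmp_space (return N x)"
  interpret S: prob_space marks by (rule prob_space_marks)
  interpret R: prob_space "return N x" by (rule prob_space_return) (simp add: x)
  interpret P: pair_prob_space "return N x" marks ..
  interpret W: prob_space ?\<Omega> unfolding pdmp_space_return by (rule P.prob_space_axioms)
  have m: "(\<lambda>z. if JT n (fst z) (snd z) \<le> ereal t then 1 else 0 :: real) \<in> borel_measurable (N \<Otimes>\<^sub>M marks)" for n
    by (rule pair_measurable_fix_time[OF V_pred_measurable])
  have "return N x \<in> space (prob_algebra N)"
    by (auto simp: space_prob_algebra R.prob_space_axioms)
  then have ne: "AE z in ?\<Omega>. Inf {ereal t | t. 0 \<le> t \<and> pdmp \<phi> lam G t z = None} = \<infinity>"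
    using nonexpl unfolding non_explosive_def by blast
  have "(\<lambda>n. LINT z|?\<Omega>. (if JT n (fst z) (snd z) \<le> ereal t then 1 else 0 :: real)) \<longlonglongrightarrow> (LINT z|?\<Omega>. 0 :: real)"
  proof (rule integral_dominated_convergence[where w = "\<lambda>_. 1 :: real"])
    show "(\<lambda>z. if JT n (fst z) (snd z) \<le> ereal t then 1 else 0 :: real) \<in> borel_measurable ?\<Omega>" for n
      using m[of n] unfolding pdmp_space_return
      by (simp add: measurable_cong_sets[OF sets_pair_measure_cong[OF sets_return refl] refl])
    show "AE z in ?\<Omega>. (\<lambda>n. if JT n (fst z) (snd z) \<le> ereal t then 1 else 0 :: real) \<longlonglongrightarrow> 0"
      using ne
    proof eventually_elim
      case (elim z)
      have "pdmp \<phi> lam G t z \<noteq> None"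
      proof
        assume "pdmp \<phi> lam G t z = None"
        then have "Inf {ereal t | t. 0 \<le> t \<and> pdmp \<phi> lam G t z = None} \<le> ereal t"
          using t by (intro Inf_lower) auto
        then show False using elim by simp
      qed
      then obtain k where k: "\<not> JT k (fst z) (snd z) \<le> ereal t"
        using pdmp_eq_None_iff[OF t, of "fst z" "snd z"] by auto
      have "eventually (\<lambda>n. (if JT n (fst z) (snd z) \<le> ereal t then 1 else 0 :: real) = 0) sequentially"
        unfolding eventually_sequentially
        using k T_mono[of k _ "fst z" "snd z"] by (intro exI[of _ k]) (auto dest: order_trans)
      then show ?case by (rule tendsto_eventually)
    qed
  qed auto
  moreover have "(LINT z|?\<Omega>. (if JT n (fst z) (snd z) \<le> ereal t then 1 else 0 :: real)) = V n t x" for n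
    unfolding V_def by (subst integral_pdmp_space[OF x m, of _ 1]) auto
  ultimately show ?thesis by simp
qed

end

section \<open>The first-jump renewal equation\<close>

context pdmp_process
begin

text \<open>Measurability is global while boundedness concerns times up to \<open>T\<close>; this
  admits comparison functions such as \<open>\<lambda>t x. c * t\<close>.\<close>

definition bdd :: "real \<Rightarrow> (real \<Rightarrow> 'a \<Rightarrow> real) \<Rightarrow> bool" where
  "bdd T u \<longleftrightarrow> (\<lambda>(t, x). u t x) \<in> borel_measurable (borel \<Otimes>\<^sub>M N) \<and>
     (\<exists>B. \<forall>r\<in>{0..T}. \<forall>y\<in>M. \<bar>u r y\<bar> \<le> B)"

lemma bdd_compose:
  assumes "bdd T u" "f \<in> borel_measurable A" "g \<in> A \<rightarrow>\<^sub>M N"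
  shows "(\<lambda>z. u (f z) (g z)) \<in> borel_measurable A"
  using measurable_compose[OF measurable_Pair[OF assms(2,3)], of "\<lambda>(t, x). u t x"] assms(1)
  by (simp add: bdd_def)

lemma bdd_slice: "bdd T u \<Longrightarrow> u t \<in> borel_measurable N"
  by (rule bdd_compose[of T u "\<lambda>_. t" N "\<lambda>x. x"]) auto

lemma bdd_bound:
  assumes "bdd T u"
  obtains B where "0 \<le> B" "\<And>r y. r \<in> {0..T} \<Longrightarrow> y \<in> M \<Longrightarrow> \<bar>u r y\<bar> \<le> B"
proof -
  obtain B where B: "\<forall>r\<in>{0..T}. \<forall>y\<in>M. \<bar>u r y\<bar> \<le> B" using assms unfolding bdd_def by blast
  have "\<bar>u r y\<bar> \<le> max 0 B" if "r \<in> {0..T}" "y \<in> M" for r y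
    using B that by (simp add: le_max_iff_disj)
  then show ?thesis using that[of "max 0 B"] by simp
qed

lemma bddI:
  assumes "(\<lambda>(t, x). u t x) \<in> borel_measurable (borel \<Otimes>\<^sub>M N)"
    and "\<And>r y. r \<in> {0..T} \<Longrightarrow> y \<in> M \<Longrightarrow> \<bar>u r y\<bar> \<le> B"
  shows "bdd T u"
  using assms unfolding bdd_def by blast

lemma bdd_lin:
  assumes u: "bdd T u" and v: "bdd T v"
  shows "bdd T (\<lambda>t x. a * u t x + b * v t x)"
proof -
  obtain B C where B: "0 \<le> B" "\<And>r y. r \<in> {0..T} \<Longrightarrow> y \<in> M \<Longrightarrow> \<bar>u r y\<bar> \<le> B"
    and C: "0 \<le> C" "\<And>r y. r \<in> {0..T} \<Longrightarrow> y \<in> M \<Longrightarrow> \<bar>v r y\<bar> \<le> C"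
    using bdd_bound[OF u] bdd_bound[OF v] by metis
  show ?thesis
  proof (rule bddI)
    show "(\<lambda>(t, x). a * u t x + b * v t x) \<in> borel_measurable (borel \<Otimes>\<^sub>M N)"
      unfolding split_beta'
      by (intro borel_measurable_add borel_measurable_times borel_measurable_const
          bdd_compose[OF u measurable_fst measurable_snd] bdd_compose[OF v measurable_fst measurable_snd])
    fix r y assume "r \<in> {0..T}" "y \<in> M"
    have "\<bar>a * u r y + b * v r y\<bar> \<le> \<bar>a\<bar> * \<bar>u r y\<bar> + \<bar>b\<bar> * \<bar>v r y\<bar>"
      by (metis abs_mult abs_triangle_ineq)
    also have "\<dots> \<le> \<bar>a\<bar> * B + \<bar>b\<bar> * C"
      using B C \<open>r \<in> _\<close> \<open>y \<in> M\<close> by (intro add_mono mult_left_mono) auto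
    finally show "\<bar>a * u r y + b * v r y\<bar> \<le> \<bar>a\<bar> * B + \<bar>b\<bar> * C" .
  qed
qed

lemma bdd_abs:
  assumes u: "bdd T u"
  shows "bdd T (\<lambda>t x. \<bar>u t x\<bar>)"
proof -
  obtain B where B: "\<And>r y. r \<in> {0..T} \<Longrightarrow> y \<in> M \<Longrightarrow> \<bar>u r y\<bar> \<le> B" using bdd_bound[OF u] by metis
  show ?thesis
  proof (rule bddI)
    show "(\<lambda>(t, x). \<bar>u t x\<bar>) \<in> borel_measurable (borel \<Otimes>\<^sub>M N)"
      unfolding split_beta' by (rule borel_measurable_abs[OF bdd_compose[OF u measurable_fst measurable_snd]])
  qed (use B in simp)
qed

lemma bdd_time: "bdd T (\<lambda>t x. c * t)"
proof (rule bddI)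
  fix r :: real and y assume "r \<in> {0..T}"
  then show "\<bar>c * r\<bar> \<le> \<bar>c\<bar> * T" by (auto simp: abs_mult intro!: mult_left_mono)
qed (simp add: split_beta')

lemma bdd_mono: "bdd T u \<Longrightarrow> t \<le> T \<Longrightarrow> bdd t u"
  unfolding bdd_def by (meson atLeastAtMost_iff order_trans)

definition q :: "(real \<Rightarrow> 'a \<Rightarrow> real) \<Rightarrow> 'a \<Rightarrow> real \<Rightarrow> real \<Rightarrow> real" where
  "q u x T s = (LINT y|Q (flow s x). u (T - s) y)"

lemma K_eq: "K u t x = (LINT s:{0..t}|lborel. rate_density x s * q u x t s)"
  by (simp add: K_def q_def)

lemma q_measurable:
  assumes u: "bdd T u" and f: "f \<in> A \<rightarrow>\<^sub>M N" and g: "g \<in> borel_measurable A" and h: "h \<in> borel_measurable A"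
  shows "(\<lambda>z. q u (f z) (g z) (h z)) \<in> borel_measurable A"
  unfolding q_def
proof (rule integral_kernel_measurable[where N = N])
  show "(\<lambda>z. Q (flow (h z) (f z))) \<in> A \<rightarrow>\<^sub>M subprob_algebra N"
    by (rule measurable_compose[OF flow_measurable[OF h f] Q_measurable])
  show "(\<lambda>(z, y). u (g z - h z) y) \<in> borel_measurable (A \<Otimes>\<^sub>M N)"
    unfolding split_beta' by (rule bdd_compose[OF u]) (use g h in auto)
qed

lemma q_abs_le:
  assumes u: "bdd T u" and B: "\<And>r y. r \<in> {0..T} \<Longrightarrow> y \<in> M \<Longrightarrow> \<bar>u r y\<bar> \<le> B" and x: "x \<in> M" and s: "0 \<le> s" "s \<le> t" "t \<le> T"
  shows "\<bar>q u x t s\<bar> \<le> B"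
  unfolding q_def by (rule Q_abs_le[OF bdd_slice[OF u]]) (use B s x in auto)

lemma K_integrand:
  assumes u: "bdd T u" and x: "x \<in> M" and t: "t \<le> T"
  shows "(\<lambda>s. rate_density x s * q u x t s) \<in> borel_measurable borel"
    and "\<exists>C. \<forall>s\<in>{0..t}. \<bar>rate_density x s * q u x t s\<bar> \<le> C"
    and "0 \<le> a \<Longrightarrow> set_integrable lborel {a..t} (\<lambda>s. rate_density x s * q u x t s)"
proof -
  have "(\<lambda>s. q u x t s) \<in> borel_measurable borel" by (rule q_measurable[OF u]) (use x in auto)
  moreover have "rate_density x \<in> borel_measurable borel" using x by simp
  ultimately show m: "(\<lambda>s. rate_density x s * q u x t s) \<in> borel_measurable borel" by simp
  obtain B where B: "0 \<le> B" "\<And>r y. r \<in> {0..T} \<Longrightarrow> y \<in> M \<Longrightarrow> \<bar>u r y\<bar> \<le> B" using bdd_bound[OF u] by metis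
  obtain C where C: "0 \<le> C" "\<And>s. s \<in> {0..t} \<Longrightarrow> \<bar>rate_density x s\<bar> \<le> C" using rate_density_bounded[OF x] by metis
  have CB: "\<bar>rate_density x s * q u x t s\<bar> \<le> C * B" if "s \<in> {0..t}" for s
    unfolding abs_mult using that C B t by (intro mult_mono q_abs_le[OF u _ x]) auto
  then show "\<exists>C. \<forall>s\<in>{0..t}. \<bar>rate_density x s * q u x t s\<bar> \<le> C" by blast
  show "set_integrable lborel {a..t} (\<lambda>s. rate_density x s * q u x t s)" if "0 \<le> a"
    by (rule set_integrable_Icc_bounded[OF m, where C = "C * B"]) (use CB that in auto)
qed

lemma K_measurable:
  assumes u: "bdd T u"
  shows "(\<lambda>(t, x). K u t x) \<in> borel_measurable (borel \<Otimes>\<^sub>M N)"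
  unfolding split_beta' K_eq
proof (rule LINT_Icc_measurable)
  have "(\<lambda>z. q u (snd (fst z)) (fst (fst z)) (snd z)) \<in> borel_measurable ((borel \<Otimes>\<^sub>M N) \<Otimes>\<^sub>M borel)"
    by (rule q_measurable[OF u]) auto
  moreover have "(\<lambda>z. rate_density (snd (fst z)) (snd z)) \<in> borel_measurable ((borel \<Otimes>\<^sub>M N) \<Otimes>\<^sub>M borel)"
    by (rule rate_density_measurable) auto
  ultimately show "(\<lambda>(z, s). rate_density (snd z) s * q u (snd z) (fst z) s) \<in> borel_measurable ((borel \<Otimes>\<^sub>M N) \<Otimes>\<^sub>M borel)"
    unfolding split_beta' by simp
qed simp

lemma q_mono:
  assumes u: "bdd T u" and v: "bdd T v" and le: "\<And>r y. r \<in> {0..t} \<Longrightarrow> y \<in> M \<Longrightarrow> u r y \<le> v r y"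
    and x: "x \<in> M" and s: "0 \<le> s" "s \<le> t" "t \<le> T"
  shows "q u x t s \<le> q v x t s"
proof -
  obtain B where B: "0 \<le> B" "\<And>r y. r \<in> {0..T} \<Longrightarrow> y \<in> M \<Longrightarrow> \<bar>u r y\<bar> \<le> B" using bdd_bound[OF u] by metis
  obtain C where C: "0 \<le> C" "\<And>r y. r \<in> {0..T} \<Longrightarrow> y \<in> M \<Longrightarrow> \<bar>v r y\<bar> \<le> C" using bdd_bound[OF v] by metis
  show ?thesis unfolding q_def
    by (intro integral_mono Q_integrable[OF bdd_slice[OF u], of _ B] Q_integrable[OF bdd_slice[OF v], of _ C])
      (use B C s x le in \<open>auto simp: space_Q\<close>)
qed

lemma K_mono:
  assumes u: "bdd T u" and v: "bdd T v" and le: "\<And>r y. r \<in> {0..t} \<Longrightarrow> y \<in> M \<Longrightarrow> u r y \<le> v r y"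
    and x: "x \<in> M" and t: "t \<le> T"
  shows "K u t x \<le> K v t x"
  unfolding K_eq
  by (rule LINT_Icc_mono[OF K_integrand(3)[OF u x t] K_integrand(3)[OF v x t]])
    (use q_mono[OF u v le x] rate_density_nonneg[OF x] t in \<open>auto intro!: mult_left_mono\<close>)

lemma q_lin:
  assumes u: "bdd T u" and v: "bdd T v" and x: "x \<in> M" and s: "0 \<le> s" "s \<le> t" "t \<le> T"
  shows "q (\<lambda>t x. a * u t x + b * v t x) x t s = a * q u x t s + b * q v x t s"
proof -
  obtain B where B: "0 \<le> B" "\<And>r y. r \<in> {0..T} \<Longrightarrow> y \<in> M \<Longrightarrow> \<bar>u r y\<bar> \<le> B" using bdd_bound[OF u] by metis
  obtain C where C: "0 \<le> C" "\<And>r y. r \<in> {0..T} \<Longrightarrow> y \<in> M \<Longrightarrow> \<bar>v r y\<bar> \<le> C" using bdd_bound[OF v] by metis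
  have "integrable (Q (flow s x)) (u (t - s))" "integrable (Q (flow s x)) (v (t - s))"
    by (intro Q_integrable[OF bdd_slice[OF u], of _ B] Q_integrable[OF bdd_slice[OF v], of _ C]; use B C s x in auto)+
  then show ?thesis unfolding q_def by simp
qed

text \<open>Linearity is stated once, with two coefficients. To match it, differences are written
  \<open>1 * u t x + (-1) * v t x\<close> and multiples \<open>a * u t x + 0 * v t x\<close> from
  here on.\<close>

lemma K_lin:
  assumes u: "bdd T u" and v: "bdd T v" and x: "x \<in> M" and t: "t \<le> T"
  shows "K (\<lambda>t x. a * u t x + b * v t x) t x = a * K u t x + b * K v t x"
proof -
  have "K (\<lambda>t x. a * u t x + b * v t x) t x = (LINT s:{0..t}|lborel. a * (rate_density x s * q u x t s) + b * (rate_density x s * q v x t s))"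
    unfolding K_eq by (intro set_lebesgue_integral_cong) (use q_lin[OF u v x] t in \<open>auto simp: algebra_simps\<close>)
  also have "\<dots> = a * K u t x + b * K v t x"
    using K_integrand(3)[OF u x t, of 0] K_integrand(3)[OF v x t, of 0]
    by (subst set_integral_add(2)) (auto simp: K_eq)
  finally show ?thesis .
qed

lemma bdd_V: "bdd T (V n)"
  by (rule bddI[OF V_measurable, of _ _ 1]) (use V_bounds in auto)

text \<open>A bounded subsolution lies below \<open>B * V 0\<close>. Applying the monotone operator
  \<open>K\<close> to the bound \<open>B * V n\<close> turns it into \<open>B * V (Suc n)\<close>,
  and these bounds tend to 0 at every point.\<close>

lemma max_principle:
  assumes u: "bdd T u" and le: "\<And>t x. t \<in> {0..T} \<Longrightarrow> x \<in> M \<Longrightarrow> u t x \<le> K u t x"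
    and t: "t \<in> {0..T}" and x: "x \<in> M"
  shows "u t x \<le> 0"
proof -
  obtain B where B: "0 \<le> B" "\<And>r y. r \<in> {0..T} \<Longrightarrow> y \<in> M \<Longrightarrow> \<bar>u r y\<bar> \<le> B" using bdd_bound[OF u] by metis
  have "\<forall>t\<in>{0..T}. \<forall>x\<in>M. u t x \<le> B * V n t x" for n
  proof (induction n)
    case 0
    then show ?case using B(2) by (auto simp: V_0 abs_le_iff)
  next
    case (Suc n)
    show ?case
    proof (intro ballI)
      fix t x assume t: "t \<in> {0..T}" and x: "x \<in> M"
      have "u t x \<le> K u t x" by (rule le[OF t x])
      also have "\<dots> \<le> K (\<lambda>t x. B * V n t x + 0 * V n t x) t x"
        by (rule K_mono[OF u bdd_lin[OF bdd_V bdd_V]]) (use Suc t x in auto)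
      also have "\<dots> = B * V (Suc n) t x"
        using t x by (subst K_lin[OF bdd_V bdd_V x, of t T]) (auto simp: V_Suc)
      finally show "u t x \<le> B * V (Suc n) t x" .
    qed
  qed
  then have "u t x \<le> B * V n t x" for n using t x by blast
  moreover have "(\<lambda>n. B * V n t x) \<longlonglongrightarrow> 0"
    using tendsto_mult_left[OF V_tendsto_0[OF x, of t], of B] t by simp
  ultimately show ?thesis by (intro LIMSEQ_le_const) auto
qed

lemma renewal_unique:
  assumes u: "bdd T u" and v: "bdd T v"
    and ru: "\<And>t x. t \<in> {0..T} \<Longrightarrow> x \<in> M \<Longrightarrow> u t x = g t x + K u t x"
    and rv: "\<And>t x. t \<in> {0..T} \<Longrightarrow> x \<in> M \<Longrightarrow> v t x = g t x + K v t x"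
    and t: "t \<in> {0..T}" and x: "x \<in> M"
  shows "u t x = v t x"
proof -
  have "1 * u t x + (-1) * v t x \<le> 0"
    by (rule max_principle[OF bdd_lin[OF u v] _ t x], subst K_lin[OF u v]) (auto simp: ru rv)
  moreover have "1 * v t x + (-1) * u t x \<le> 0"
    by (rule max_principle[OF bdd_lin[OF v u] _ t x], subst K_lin[OF v u]) (auto simp: ru rv)
  ultimately show ?thesis by simp
qed

lemma bdd_U:
  assumes "f \<in> borel_measurable N" "\<And>y. y \<in> M \<Longrightarrow> \<bar>f y\<bar> \<le> B"
  shows "bdd T (U f)"
proof (rule bddI[OF U_measurable[OF assms(1)]])
  fix r y assume "y \<in> M"
  then have "0 \<le> B" using assms(2)[of y] by simp
  then show "\<bar>U f r y\<bar> \<le> B" by (intro U_abs_le assms(2))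
qed

lemma U_slice:
  assumes "f \<in> borel_measurable N" "\<And>y. y \<in> M \<Longrightarrow> \<bar>f y\<bar> \<le> B"
  shows "U f t \<in> borel_measurable N"
  by (rule bdd_slice[OF bdd_U[OF assms]])

lemma bdd_const: "bdd T (\<lambda>t x. c)"
  by (rule bddI[where B = "\<bar>c\<bar>"]) simp_all

text \<open>Conservativeness: the constant solves the renewal equation because the survival
  probability and the mass of the first-jump density add up to one, and uniqueness does the
  rest.\<close>

lemma U_const:
  assumes t: "0 \<le> t" and x: "x \<in> M"
  shows "U (\<lambda>_. c) t x = c"
proof (rule renewal_unique[where T = t and u = "U (\<lambda>_. c)" and g = "\<lambda>t x. exp (- Lam t x) * c" and v = "\<lambda>_ _. c"])
  show "bdd t (U (\<lambda>_. c))" by (rule bdd_U[where B = "\<bar>c\<bar>"]) auto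
  show "bdd t (\<lambda>_ _. c)" by (rule bdd_const)
  fix s y assume s: "s \<in> {0..t}" and y: "y \<in> M"
  show "U (\<lambda>_. c) s y = exp (- Lam s y) * c + K (U (\<lambda>_. c)) s y"
    by (rule U_renewal[where B = "\<bar>c\<bar>"]) (use s y in auto)
  have "K (\<lambda>_ _. c) s y = (LINT r:{0..s}|lborel. rate_density y r * c)"
    unfolding K_def by (intro set_lebesgue_integral_cong) (auto simp: y prob_space.prob_space[OF Q_prob])
  also have "\<dots> = (1 - exp (- Lam s y)) * c"
    using rate_density_integral[OF y, of s] s by simp
  finally show "c = exp (- Lam s y) * c + K (\<lambda>_ _. c) s y" by (simp add: algebra_simps)
qed (use t x in auto)

lemma U_lin:
  assumes f: "f \<in> borel_measurable N" "\<And>y. y \<in> M \<Longrightarrow> \<bar>f y\<bar> \<le> B"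
    and g: "g \<in> borel_measurable N" "\<And>y. y \<in> M \<Longrightarrow> \<bar>g y\<bar> \<le> C"
    and t: "0 \<le> t" and x: "x \<in> M"
  shows "U (\<lambda>y. a * f y + b * g y) t x = a * U f t x + b * U g t x"
proof (rule renewal_unique[where T = t and g = "\<lambda>t x. exp (- Lam t x) * (a * f (flow t x) + b * g (flow t x))"
      and v = "\<lambda>t x. a * U f t x + b * U g t x"])
  have m: "(\<lambda>y. a * f y + b * g y) \<in> borel_measurable N" using f g by simp
  have bound: "\<bar>a * f y + b * g y\<bar> \<le> \<bar>a\<bar> * B + \<bar>b\<bar> * C" if "y \<in> M" for y
  proof -
    have "\<bar>a * f y + b * g y\<bar> \<le> \<bar>a\<bar> * \<bar>f y\<bar> + \<bar>b\<bar> * \<bar>g y\<bar>" by (metis abs_mult abs_triangle_ineq)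
    also have "\<dots> \<le> \<bar>a\<bar> * B + \<bar>b\<bar> * C" using f g that by (intro add_mono mult_left_mono) auto
    finally show ?thesis .
  qed
  note bf = bdd_U[OF f, of t] and bg = bdd_U[OF g, of t]
  show "bdd t (U (\<lambda>y. a * f y + b * g y))" by (rule bdd_U[OF m bound])
  show "bdd t (\<lambda>t x. a * U f t x + b * U g t x)" by (rule bdd_lin[OF bf bg])
  fix s y assume s: "s \<in> {0..t}" and y: "y \<in> M"
  show "U (\<lambda>y. a * f y + b * g y) s y = exp (- Lam s y) * (a * f (flow s y) + b * g (flow s y)) + K (U (\<lambda>y. a * f y + b * g y)) s y"
    by (rule U_renewal[OF m bound]) (use s y in auto)
  show "a * U f s y + b * U g s y = exp (- Lam s y) * (a * f (flow s y) + b * g (flow s y)) + K (\<lambda>t x. a * U f t x + b * U g t x) s y"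
    using s by (subst K_lin[OF bf bg y]) (auto simp: U_renewal[OF f y] U_renewal[OF g y] algebra_simps)
qed (use t x in auto)

lemma U_nonneg: "(\<And>y. y \<in> M \<Longrightarrow> 0 \<le> f y) \<Longrightarrow> 0 \<le> U f t x"
  unfolding U_def by (rule Bochner_Integration.integral_nonneg) (rule F_nonneg)

lemma U_cong: "(\<And>y. y \<in> M \<Longrightarrow> f y = g y) \<Longrightarrow> U f t x = U g t x"
proof -
  assume fg: "\<And>y. y \<in> M \<Longrightarrow> f y = g y"
  have "F f t x \<omega> = F g t x \<omega>" for \<omega>
    unfolding F_def by (intro suminf_cong) (simp add: fg)
  then have "F f t x = F g t x" by (rule ext)
  then show ?thesis unfolding U_def by simp
qed

lemma U_0: "f \<in> borel_measurable N \<Longrightarrow> (\<And>y. y \<in> M \<Longrightarrow> \<bar>f y\<bar> \<le> B) \<Longrightarrow> x \<in> M \<Longrightarrow> U f 0 x = f x"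
proof -
  assume f: "f \<in> borel_measurable N" "\<And>y. y \<in> M \<Longrightarrow> \<bar>f y\<bar> \<le> B" and x: "x \<in> M"
  have "K (U f) 0 x = 0"
    unfolding K_def set_lebesgue_integral_def
    by (rule integral_eq_zero_AE, rule AE_mp[OF AE_lborel_singleton[of 0]]) (auto simp: indicator_def)
  then show ?thesis using U_renewal[OF f x, of 0] x by (simp add: flow_eq)
qed

end

section \<open>Perturbation of the characteristics\<close>

context pdmp_process
begin

text \<open>A bounded solution \<open>u\<close> of the renewal equation is read along the flow line
  \<open>s \<mapsto> u (T - s) (flow s x)\<close>, on which everything reduces to calculus in one variable.\<close>

lemma path_measurable:
  assumes "bdd T u" "x \<in> M"
  shows "(\<lambda>s. u (T - s) (flow s x)) \<in> borel_measurable borel"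
  by (rule bdd_compose[OF assms(1)]) (use assms(2) in auto)

text \<open>Weighting the equation at \<open>flow s x\<close> by the survival factor up to
  \<open>s\<close>, and using that \<open>Lam\<close> is additive and the flow a semigroup,
  expresses all points of the flow line by one integrand. The variable \<open>s\<close> then enters
  on the right only as lower endpoint.\<close>

lemma renewal_path:
  assumes u: "bdd T u" and ren: "\<And>t x. t \<in> {0..T} \<Longrightarrow> x \<in> M \<Longrightarrow> u t x = exp (- Lam t x) * f (flow t x) + K u t x"
    and x: "x \<in> M" and s: "s \<in> {0..T}"
  shows "exp (- Lam s x) * u (T - s) (flow s x) = exp (- Lam T x) * f (flow T x) + (LINT r:{s..T}|lborel. rate_density x r * q u x T r)"
proof -
  have s': "0 \<le> s" "s \<le> T" using s by auto
  have Lam: "Lam T x = Lam s x + Lam (T - s) (flow s x)" using Lam_add[OF x s'(1), of "T - s"] s' by simp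
  have fl: "flow (T - s) (flow s x) = flow T x" using flow_flow[of s "T - s" x] s' x by simp
  have "exp (- Lam s x) * K u (T - s) (flow s x) = exp (- Lam s x) * (LINT r:{s..T}|lborel. rate_density (flow s x) (r - s) * q u (flow s x) (T - s) (r - s))"
    unfolding K_eq by (subst set_lebesgue_integral_shift) simp
  also have "\<dots> = (LINT r:{s..T}|lborel. exp (- Lam s x) * (rate_density (flow s x) (r - s) * q u (flow s x) (T - s) (r - s)))"
    by simp
  also have "\<dots> = (LINT r:{s..T}|lborel. rate_density x r * q u x T r)"
  proof (intro set_lebesgue_integral_cong allI impI)
    fix r assume r: "r \<in> {s..T}"
    have "flow (r - s) (flow s x) = flow r x" using flow_flow[of s "r - s" x] s' r x by simp
    moreover have "Lam r x = Lam s x + Lam (r - s) (flow s x)" using Lam_add[OF x s'(1), of "r - s"] r by simp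
    ultimately show "exp (- Lam s x) * (rate_density (flow s x) (r - s) * q u (flow s x) (T - s) (r - s)) = rate_density x r * q u x T r"
      by (simp add: rate_density_def q_def exp_add[symmetric] algebra_simps)
  qed simp
  finally show ?thesis
    using ren[of "T - s" "flow s x"] s' x Lam fl by (simp add: algebra_simps exp_add[symmetric])
qed

lemma q_path:
  assumes u: "bdd T u" and x: "x \<in> M"
  shows "(\<lambda>s. q u x T s) \<in> borel_measurable borel"
    and "\<exists>B\<ge>0. \<forall>s\<in>{0..T}. \<bar>q u x T s\<bar> \<le> B \<and> \<bar>u (T - s) (flow s x)\<bar> \<le> B"
proof -
  show "(\<lambda>s. q u x T s) \<in> borel_measurable borel" by (rule q_measurable[OF u]) (use x in auto)
  obtain B where B: "0 \<le> B" "\<And>r y. r \<in> {0..T} \<Longrightarrow> y \<in> M \<Longrightarrow> \<bar>u r y\<bar> \<le> B" using bdd_bound[OF u] by metis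
  show "\<exists>B\<ge>0. \<forall>s\<in>{0..T}. \<bar>q u x T s\<bar> \<le> B \<and> \<bar>u (T - s) (flow s x)\<bar> \<le> B"
    by (rule exI[of _ B]) (use B x q_abs_le[OF u B(2) x] in auto)
qed

text \<open>By \<open>renewal_path\<close> the product of \<open>exp (- Lam s x)\<close> and the
  solution along the flow line is an indefinite integral. Multiplying by
  \<open>exp (Lam s x)\<close> with the product rule removes the integrating factor and leaves the
  jump part of the generator under the integral.\<close>

lemma mild_form:
  assumes u: "bdd T u" and ren: "\<And>t x. t \<in> {0..T} \<Longrightarrow> x \<in> M \<Longrightarrow> u t x = exp (- Lam t x) * f (flow t x) + K u t x"
    and x: "x \<in> M" and T: "0 \<le> T"
  shows "u T x = f (flow T x) + (LINT s:{0..T}|lborel. lam (flow s x) * (q u x T s - u (T - s) (flow s x)))"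
proof -
  define w where "w s = u (T - s) (flow s x)" for s
  have w [measurable]: "w \<in> borel_measurable borel" unfolding w_def by (rule path_measurable[OF u x])
  have q [measurable]: "(\<lambda>s. q u x T s) \<in> borel_measurable borel" by (rule q_path(1)[OF u x])
  obtain B where B: "0 \<le> B" "\<And>s. s \<in> {0..T} \<Longrightarrow> \<bar>q u x T s\<bar> \<le> B" "\<And>s. s \<in> {0..T} \<Longrightarrow> \<bar>w s\<bar> \<le> B"
    using q_path(2)[OF u x] unfolding w_def by metis
  obtain C where C: "0 \<le> C" "\<And>s. s \<in> {0..T} \<Longrightarrow> \<bar>lam (flow s x)\<bar> \<le> C" using rate_bounded[OF x] by metis
  have LamT: "Lam s x \<le> C * T" if "s \<in> {0..T}" for s
  proof -
    have "Lam s x \<le> Lam T x" using that by (intro Lam_mono x) auto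
    also have "\<dots> \<le> C * T"
      using LINT_Icc_le[OF rate_measurable[OF x] C(2) T] unfolding Lam_def by simp
    finally show ?thesis .
  qed
  have rd [measurable]: "rate_density x \<in> borel_measurable borel" using x by simp
  have lamm [measurable]: "(\<lambda>s. lam (flow s x)) \<in> borel_measurable borel" by (rule rate_measurable[OF x])
  have Lamm [measurable]: "(\<lambda>s. Lam s x) \<in> borel_measurable borel" using x by simp
  note int = K_integrand[OF u x order_refl]
  obtain D where D: "\<And>s. s \<in> {0..T} \<Longrightarrow> \<bar>rate_density x s * q u x T s\<bar> \<le> D" using int(2) by blast
  have "(exp (- Lam T x) * w T) * exp (Lam T x) = (exp (- Lam 0 x) * w 0) * exp (Lam 0 x) +
    (LINT s:{0..T}|lborel. - (rate_density x s * q u x T s) * exp (Lam s x) + (exp (- Lam s x) * w s) * (lam (flow s x) * exp (Lam s x)))"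
  proof (rule indefinite_integral_mult[where X = "\<lambda>s. exp (- Lam s x) * w s" and Y = "\<lambda>s. exp (Lam s x)"
        and C = D and D = "C * exp (C * T)"])
    show "exp (- Lam t x) * w t = exp (- Lam 0 x) * w 0 + (LINT s:{0..t}|lborel. - (rate_density x s * q u x T s))" if "t \<in> {0..T}" for t
      using renewal_path[OF u ren x that] renewal_path[OF u ren x, of 0] that LINT_Icc_split[OF int(3)[of 0], of t]
      unfolding w_def by (simp add: set_lebesgue_integral_def)
    show "\<bar>- (rate_density x s * q u x T s)\<bar> \<le> D" if "s \<in> {0..T}" for s using D[OF that] by simp
    show "exp (Lam t x) = exp (Lam 0 x) + (LINT s:{0..t}|lborel. lam (flow s x) * exp (Lam s x))" if "t \<in> {0..T}" for t
      by (rule indefinite_integral_exp[OF Lam_repr lamm C(2) Lamm]) (use that in auto)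
    show "\<bar>lam (flow s x) * exp (Lam s x)\<bar> \<le> C * exp (C * T)" if "s \<in> {0..T}" for s
      unfolding abs_mult using C LamT[OF that] that by (intro mult_mono) auto
  qed (use T int(1) in simp_all)
  also have "(exp (- Lam T x) * w T) * exp (Lam T x) = f (flow T x)"
    using renewal_path[OF u ren x, of T] T rate_density_integrable
    unfolding w_def by (simp add: exp_minus)
      (simp add: set_lebesgue_integral_def integral_eq_zero_AE[OF AE_mp[OF AE_lborel_singleton[of T]]] indicator_def)
  also have "(LINT s:{0..T}|lborel. - (rate_density x s * q u x T s) * exp (Lam s x) + (exp (- Lam s x) * w s) * (lam (flow s x) * exp (Lam s x)))
    = (LINT s:{0..T}|lborel. - (lam (flow s x) * (q u x T s - w s)))"
    by (intro set_lebesgue_integral_cong) (auto simp: rate_density_def exp_minus field_simps)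
  finally show ?thesis using x T by (simp add: w_def flow_eq set_lebesgue_integral_def)
qed

text \<open>Duhamel's formula: a solution of a mild equation with another source term \<open>g\<close> solves the
  renewal equation of \<open>(\<phi>, lam, Q)\<close> up to a remainder.\<close>

lemma perturbed_renewal:
  assumes u: "bdd T u"
    and mild: "\<And>t x. t \<in> {0..T} \<Longrightarrow> x \<in> M \<Longrightarrow> u t x = f (flow t x) + (LINT s:{0..t}|lborel. g (t - s) (flow s x))"
    and g: "\<And>x. x \<in> M \<Longrightarrow> (\<lambda>s. g (T - s) (flow s x)) \<in> borel_measurable borel"
    and gb: "\<And>x. x \<in> M \<Longrightarrow> \<exists>C. \<forall>s\<in>{0..T}. \<bar>g (T - s) (flow s x)\<bar> \<le> C"
    and x: "x \<in> M" and T: "0 \<le> T"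
  shows "u T x = exp (- Lam T x) * f (flow T x) + K u T x +
    (LINT s:{0..T}|lborel. exp (- Lam s x) * (g (T - s) (flow s x) - lam (flow s x) * (q u x T s - u (T - s) (flow s x))))"
proof -
  define w where "w s = u (T - s) (flow s x)" for s
  define h where "h s = g (T - s) (flow s x)" for s
  have w [measurable]: "w \<in> borel_measurable borel" unfolding w_def by (rule path_measurable[OF u x])
  have h [measurable]: "h \<in> borel_measurable borel" unfolding h_def by (rule g[OF x])
  have q [measurable]: "(\<lambda>s. q u x T s) \<in> borel_measurable borel" by (rule q_path(1)[OF u x])
  obtain B where B: "0 \<le> B" "\<And>s. s \<in> {0..T} \<Longrightarrow> \<bar>q u x T s\<bar> \<le> B" "\<And>s. s \<in> {0..T} \<Longrightarrow> \<bar>w s\<bar> \<le> B"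
    using q_path(2)[OF u x] unfolding w_def by metis
  obtain C where C: "0 \<le> C" "\<And>s. s \<in> {0..T} \<Longrightarrow> \<bar>lam (flow s x)\<bar> \<le> C" using rate_bounded[OF x] by metis
  obtain D where D: "\<And>s. s \<in> {0..T} \<Longrightarrow> \<bar>h s\<bar> \<le> D" using gb[OF x] unfolding h_def by blast
  obtain E where E: "0 \<le> E" "\<And>s. s \<in> {0..T} \<Longrightarrow> \<bar>rate_density x s\<bar> \<le> E" using rate_density_bounded[OF x] by metis
  have rd [measurable]: "rate_density x \<in> borel_measurable borel" using x by simp
  have lamm [measurable]: "(\<lambda>s. lam (flow s x)) \<in> borel_measurable borel" by (rule rate_measurable[OF x])
  have Lamm [measurable]: "(\<lambda>s. Lam s x) \<in> borel_measurable borel" using x by simp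
  have ih: "set_integrable lborel {0..T} h" by (rule set_integrable_Icc_bounded[OF h D])
  have wT: "w s = f (flow T x) + (LINT r:{s..T}|lborel. h r)" if s: "s \<in> {0..T}" for s
  proof -
    have "w s = f (flow T x) + (LINT r:{0..T - s}|lborel. g (T - s - r) (flow r (flow s x)))"
      unfolding w_def using mild[of "T - s" "flow s x"] s x by (simp add: flow_flow)
    also have "(LINT r:{0..T - s}|lborel. g (T - s - r) (flow r (flow s x))) = (LINT r:{s..T}|lborel. g (T - s - (r - s)) (flow (r - s) (flow s x)))"
      by (rule set_lebesgue_integral_shift[symmetric])
    also have "\<dots> = (LINT r:{s..T}|lborel. h r)"
      unfolding h_def by (intro set_lebesgue_integral_cong) (use s x in \<open>auto simp: flow_flow\<close>)
    finally show ?thesis .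
  qed
  have "w T * exp (- Lam T x) = w 0 * exp (- Lam 0 x) +
    (LINT s:{0..T}|lborel. - h s * exp (- Lam s x) + w s * - rate_density x s)"
  proof (rule indefinite_integral_mult[where X = w and Y = "\<lambda>s. exp (- Lam s x)" and C = D and D = E])
    show "w t = w 0 + (LINT s:{0..t}|lborel. - h s)" if "t \<in> {0..T}" for t
      using wT[OF that] wT[of 0] that LINT_Icc_split[OF ih, of t] by (simp add: set_lebesgue_integral_def)
    show "exp (- Lam t x) = exp (- Lam 0 x) + (LINT s:{0..t}|lborel. - rate_density x s)" if "t \<in> {0..T}" for t
      using rate_density_integral[OF x, of t] that by (simp add: set_lebesgue_integral_def)
    show "\<bar>- h s\<bar> \<le> D" "\<bar>- rate_density x s\<bar> \<le> E" if "s \<in> {0..T}" for s using D[OF that] E(2)[OF that] by auto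
  qed (use T in simp_all)
  moreover have "w 0 = u T x" using x by (simp add: w_def flow_eq)
  moreover have "w T = f (flow T x)"
    using mild[of 0 "flow T x"] T x
    by (simp add: w_def set_lebesgue_integral_def flow_flow integral_eq_zero_AE[OF AE_mp[OF AE_lborel_singleton[of 0]]] indicator_def)
  moreover have "(LINT s:{0..T}|lborel. - h s * exp (- Lam s x) + w s * - rate_density x s) =
    - (K u T x + (LINT s:{0..T}|lborel. exp (- Lam s x) * (h s - lam (flow s x) * (q u x T s - w s))))"
  proof -
    have i2: "set_integrable lborel {0..T} (\<lambda>s. exp (- Lam s x) * (h s - lam (flow s x) * (q u x T s - w s)))"
    proof (rule set_integrable_Icc_bounded[where C = "1 * (D + C * (B + B))"])
      fix s assume s: "s \<in> {0..T}"
      show "\<bar>exp (- Lam s x) * (h s - lam (flow s x) * (q u x T s - w s))\<bar> \<le> 1 * (D + C * (B + B))"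
        unfolding abs_mult
      proof (intro mult_mono)
        have "\<bar>h s - lam (flow s x) * (q u x T s - w s)\<bar> \<le> \<bar>h s\<bar> + \<bar>lam (flow s x)\<bar> * \<bar>q u x T s - w s\<bar>"
          by (metis abs_mult abs_triangle_ineq4)
        also have "\<dots> \<le> D + C * (B + B)"
          using D[OF s] C(2)[OF s] C(1) B(2,3)[OF s] by (intro add_mono mult_mono) auto
        finally show "\<bar>h s - lam (flow s x) * (q u x T s - w s)\<bar> \<le> D + C * (B + B)" .
      qed (use Lam_nonneg[OF x, of s] in auto)
    qed measurable
    have "K u T x + (LINT s:{0..T}|lborel. exp (- Lam s x) * (h s - lam (flow s x) * (q u x T s - w s))) =
      (LINT s:{0..T}|lborel. rate_density x s * q u x T s + exp (- Lam s x) * (h s - lam (flow s x) * (q u x T s - w s)))"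
      unfolding K_eq by (rule set_integral_add(2)[symmetric, OF K_integrand(3)[OF u x order_refl order_refl] i2])
    also have "\<dots> = (LINT s:{0..T}|lborel. - (- h s * exp (- Lam s x) + w s * - rate_density x s))"
      by (intro set_lebesgue_integral_cong) (auto simp: rate_density_def algebra_simps)
    also have "\<dots> = - (LINT s:{0..T}|lborel. - h s * exp (- Lam s x) + w s * - rate_density x s)"
      by (simp only: set_lebesgue_integral_def scaleR_minus_right Bochner_Integration.integral_minus)
    finally show ?thesis by simp
  qed
  ultimately show ?thesis unfolding h_def w_def by (simp add: algebra_simps)
qed

text \<open>The time-shifted function solves the renewal equation with \<open>U f s\<close> in place
  of \<open>f\<close>: for horizon \<open>r + s\<close>, subtracting \<open>renewal_path\<close> at
  \<open>r\<close> from \<open>renewal_path\<close> at 0 leaves exactly the term with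
  \<open>K\<close>. Uniqueness identifies the two solutions.\<close>

lemma U_semigroup:
  assumes f: "f \<in> borel_measurable N" "\<And>y. y \<in> M \<Longrightarrow> \<bar>f y\<bar> \<le> B"
    and s: "0 \<le> s" and t: "0 \<le> t" and x: "x \<in> M"
  shows "U f (t + s) x = U (U f s) t x"
proof -
  have B0: "0 \<le> B" using f(2)[OF x] by simp
  have g: "U f s \<in> borel_measurable N" by (rule U_slice[OF f])
  have gB: "\<bar>U f s y\<bar> \<le> B" if "y \<in> M" for y by (rule U_abs_le[OF f(2) B0])
  let ?v = "\<lambda>r y. U f (r + s) y"
  note bU = bdd_U[OF f]
  have bv: "bdd t ?v"
  proof (rule bddI)
    show "(\<lambda>(r, y). U f (r + s) y) \<in> borel_measurable (borel \<Otimes>\<^sub>M N)"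
      unfolding split_beta' by (rule bdd_compose[OF bU[of 0]]) auto
    show "\<bar>U f (r + s) y\<bar> \<le> B" for r y by (rule U_abs_le[OF f(2) B0])
  qed
  have rv: "?v r y = exp (- Lam r y) * U f s (flow r y) + K ?v r y" if r: "r \<in> {0..t}" and y: "y \<in> M" for r y
  proof -
    have ren: "U f t x = exp (- Lam t x) * f (flow t x) + K (U f) t x" if "t \<in> {0..r + s}" "x \<in> M" for t x
      by (rule U_renewal[OF f that(2)]) (use that in auto)
    have "exp (- Lam 0 y) * U f (r + s - 0) (flow 0 y) - exp (- Lam r y) * U f (r + s - r) (flow r y) =
      (LINT a:{0..r + s}|lborel. rate_density y a * q (U f) y (r + s) a) - (LINT a:{r..r + s}|lborel. rate_density y a * q (U f) y (r + s) a)"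
    proof -
      have "0 \<in> {0..r + s}" "r \<in> {0..r + s}" using r s by auto
      from renewal_path[OF bU ren y this(1)] renewal_path[OF bU ren y this(2)] show ?thesis by linarith
    qed
    also have "\<dots> = (LINT a:{0..r}|lborel. rate_density y a * q (U f) y (r + s) a)"
    proof -
      have "0 \<le> r" "r \<le> r + s" using r s by auto
      from LINT_Icc_split[OF K_integrand(3)[OF bU y order_refl order_refl] this] show ?thesis by linarith
    qed
    also have "\<dots> = K ?v r y"
      unfolding K_eq q_def by (intro set_lebesgue_integral_cong) (auto simp: algebra_simps)
    finally show ?thesis using y by (simp add: flow_eq)
  qed
  show ?thesis
  proof (rule renewal_unique[where T = t and u = ?v and v = "U (U f s)" and g = "\<lambda>r y. exp (- Lam r y) * U f s (flow r y)"])
    show "U (U f s) r y = exp (- Lam r y) * U f s (flow r y) + K (U (U f s)) r y" if "r \<in> {0..t}" "y \<in> M" for r y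
      by (rule U_renewal[OF g gB that(2)]) (use that(1) in auto)
  qed (use t x in \<open>auto intro: bv bdd_U[OF g gB] rv\<close>)
qed

text \<open>The Duhamel remainder is at most \<open>c\<close> times the integral of the survival
  factor, and this is exactly the amount by which \<open>c * t\<close> exceeds its image under
  \<open>K\<close>. Hence the absolute difference minus \<open>c * t\<close> is a subsolution,
  whatever the size of the rate.\<close>

lemma perturbation_bound:
  assumes u: "bdd T u" and f: "f \<in> borel_measurable N" "\<And>y. y \<in> M \<Longrightarrow> \<bar>f y\<bar> \<le> B"
    and mild: "\<And>t x. t \<in> {0..T} \<Longrightarrow> x \<in> M \<Longrightarrow> u t x = f (flow t x) + (LINT s:{0..t}|lborel. g (t - s) (flow s x))"
    and g: "\<And>t x. x \<in> M \<Longrightarrow> (\<lambda>s. g (t - s) (flow s x)) \<in> borel_measurable borel"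
    and gb: "\<And>t x. t \<in> {0..T} \<Longrightarrow> x \<in> M \<Longrightarrow> \<exists>C. \<forall>s\<in>{0..t}. \<bar>g (t - s) (flow s x)\<bar> \<le> C"
    and c: "\<And>r y. r \<in> {0..T} \<Longrightarrow> y \<in> M \<Longrightarrow> \<bar>g r y - lam y * ((LINT z|Q y. u r z) - u r y)\<bar> \<le> c"
    and x: "x \<in> M" and T: "0 \<le> T"
  shows "\<bar>u T x - U f T x\<bar> \<le> c * T"
proof -
  have c0: "0 \<le> c" using c[of 0 x] x T by (auto intro: order_trans[OF abs_ge_zero])
  have bUf: "bdd T (U f)" by (rule bdd_U[OF f])
  let ?d = "\<lambda>t x. 1 * u t x + (-1) * U f t x"
  let ?e = "\<lambda>t x. 1 * \<bar>?d t x\<bar> + (-1) * (c * t)"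
  have bd: "bdd T ?d" by (rule bdd_lin[OF u bUf])
  have be: "bdd T ?e" by (rule bdd_lin[OF bdd_abs[OF bd] bdd_time])
  have "?e t y \<le> K ?e t y" if t: "t \<in> {0..T}" and y: "y \<in> M" for t y
  proof -
    have t': "0 \<le> t" "t \<le> T" using t by auto
    let ?\<rho> = "LINT s:{0..t}|lborel. exp (- Lam s y) * (g (t - s) (flow s y) - lam (flow s y) * (q u y t s - u (t - s) (flow s y)))"
    have Lamm [measurable]: "(\<lambda>s. Lam s y) \<in> borel_measurable borel" using y by simp
    have iE: "set_integrable lborel {0..t} (\<lambda>s. exp (- Lam s y))"
      by (rule set_integrable_Icc_bounded[where C = 1]) (use Lam_nonneg[OF y] in auto)
    have "u t y = exp (- Lam t y) * f (flow t y) + K u t y + ?\<rho>"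
      by (rule perturbed_renewal[OF bdd_mono[OF u t'(2)] mild g gb y t'(1)]) (use t' in auto)
    then have "?d t y = K ?d t y + ?\<rho>"
      using U_renewal[OF f y t'(1)] K_lin[OF u bUf y t'(2), of 1 "-1"] by simp
    moreover have "\<bar>?\<rho>\<bar> \<le> (LINT s:{0..t}|lborel. c * exp (- Lam s y))"
    proof -
      have "norm ?\<rho> \<le> (LINT s|lborel. norm (indicator {0..t} s *\<^sub>R (exp (- Lam s y) * (g (t - s) (flow s y) - lam (flow s y) * (q u y t s - u (t - s) (flow s y))))))"
        unfolding set_lebesgue_integral_def by (rule integral_norm_bound)
      also have "\<dots> \<le> (LINT s:{0..t}|lborel. c * exp (- Lam s y))"
        unfolding set_lebesgue_integral_def
      proof (rule integral_mono')
        show "integrable lborel (\<lambda>s. indicator {0..t} s *\<^sub>R (c * exp (- Lam s y)))"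
          using set_integrable_mult_right[of c, OF iE] unfolding set_integrable_def .
        show "0 \<le> indicat_real {0..t} s *\<^sub>R (c * exp (- Lam s y))" for s using c0 by simp
        show "norm (indicator {0..t} s *\<^sub>R (exp (- Lam s y) * (g (t - s) (flow s y) - lam (flow s y) * (q u y t s - u (t - s) (flow s y)))))
          \<le> indicat_real {0..t} s *\<^sub>R (c * exp (- Lam s y))" for s
        proof (cases "s \<in> {0..t}")
          case True
          then have "\<bar>g (t - s) (flow s y) - lam (flow s y) * (q u y t s - u (t - s) (flow s y))\<bar> \<le> c"
            unfolding q_def by (intro c) (use t' y in auto)
          then show ?thesis using True by (simp add: abs_mult mult.commute)
        qed simp
      qed
      finally show ?thesis by simp
    qed
    moreover have "\<bar>K ?d t y\<bar> \<le> K (\<lambda>t x. \<bar>?d t x\<bar>) t y"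
    proof -
      have "K ?d t y \<le> K (\<lambda>t x. \<bar>?d t x\<bar>) t y"
        by (rule K_mono[OF bd bdd_abs[OF bd]]) (use y t' in auto)
      moreover have "K (\<lambda>t x. (-1) * ?d t x + 0 * ?d t x) t y \<le> K (\<lambda>t x. \<bar>?d t x\<bar>) t y"
        by (rule K_mono[OF bdd_lin[OF bd bd] bdd_abs[OF bd]]) (use y t' in auto)
      ultimately show ?thesis using K_lin[OF bd bd y t'(2), of "-1" 0] by simp
    qed
    \<comment> \<open>Integration by parts of the survival factor against the linear function
      \<open>t - s\<close>.\<close>
    moreover have "K (\<lambda>t x. c * t) t y = c * (t - (LINT s:{0..t}|lborel. exp (- Lam s y)))"
    proof -
      obtain E where E: "0 \<le> E" "\<And>s. s \<in> {0..t} \<Longrightarrow> \<bar>rate_density y s\<bar> \<le> E" using rate_density_bounded[OF y] by metis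
      have rd [measurable]: "rate_density y \<in> borel_measurable borel" using y by simp
      have "exp (- Lam t y) * (t - t) = exp (- Lam 0 y) * (t - 0) + (LINT s:{0..t}|lborel. - rate_density y s * (t - s) + exp (- Lam s y) * (- 1))"
      proof (rule indefinite_integral_mult[where X = "\<lambda>s. exp (- Lam s y)" and Y = "\<lambda>s. t - s" and C = E and D = 1])
        show "exp (- Lam s y) = exp (- Lam 0 y) + (LINT s:{0..s}|lborel. - rate_density y s)" if "s \<in> {0..t}" for s
          using rate_density_integral[OF y, of s] that by (simp add: set_lebesgue_integral_def)
        show "\<bar>- rate_density y s\<bar> \<le> E" if "s \<in> {0..t}" for s using E that by simp
        show "t - s = t - 0 + (LINT s:{0..s}|lborel. - 1)" if "s \<in> {0..t}" for s
          using that by (simp add: set_lebesgue_integral_def)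
      qed (use t' in simp_all)
      moreover have "set_integrable lborel {0..t} (\<lambda>s. rate_density y s * (t - s))"
      proof (rule set_integrable_Icc_bounded[where C = "E * t"])
        show "\<bar>rate_density y s * (t - s)\<bar> \<le> E * t" if "s \<in> {0..t}" for s
          unfolding abs_mult using E that by (intro mult_mono) auto
      qed measurable
      then have "(LINT s:{0..t}|lborel. - (rate_density y s * (t - s)) + - exp (- Lam s y)) =
        - (LINT s:{0..t}|lborel. rate_density y s * (t - s)) - (LINT s:{0..t}|lborel. exp (- Lam s y))"
        using iE by (subst set_integral_add(2)) (auto simp: set_integrable_def set_lebesgue_integral_def)
      ultimately have "(LINT s:{0..t}|lborel. rate_density y s * (t - s)) = t - (LINT s:{0..t}|lborel. exp (- Lam s y))"
        by simp
      moreover have "K (\<lambda>t x. c * t) t y = (LINT s:{0..t}|lborel. c * (rate_density y s * (t - s)))"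
        unfolding K_def by (intro set_lebesgue_integral_cong) (auto simp: y prob_space.prob_space[OF Q_prob])
      ultimately show ?thesis by simp
    qed
    moreover have "K ?e t y = K (\<lambda>t x. \<bar>?d t x\<bar>) t y - K (\<lambda>t x. c * t) t y"
      using K_lin[OF bdd_abs[OF bd] bdd_time y t'(2), of 1 "-1" c] by simp
    moreover have "(LINT s:{0..t}|lborel. c * exp (- Lam s y)) = c * (LINT s:{0..t}|lborel. exp (- Lam s y))" by simp
    ultimately show ?thesis by (simp add: algebra_simps)
  qed
  then have "?e T x \<le> 0" by (rule max_principle[OF be _ _ x]) (use T in auto)
  then show ?thesis by simp
qed

lemma U_mild:
  assumes f: "f \<in> borel_measurable N" "\<And>y. y \<in> M \<Longrightarrow> \<bar>f y\<bar> \<le> B" and x: "x \<in> M" and t: "0 \<le> t"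
  shows "U f t x = f (flow t x) + (LINT s:{0..t}|lborel. lam (flow s x) * ((LINT z|Q (flow s x). U f (t - s) z) - U f (t - s) (flow s x)))"
  using mild_form[OF bdd_U[OF f] U_renewal[OF f], of t x] x t unfolding q_def by simp

end

section \<open>From setwise closeness of kernels to closeness of semigroups\<close>

lemma integral_layer_cake:
  fixes w :: "'b \<Rightarrow> real"
  assumes "prob_space \<mu>" and [measurable]: "w \<in> borel_measurable \<mu>" and w: "\<And>y. y \<in> space \<mu> \<Longrightarrow> 0 \<le> w y \<and> w y \<le> 1"
  shows "(LINT y|\<mu>. w y) = (LINT s|uniform01. measure \<mu> {y \<in> space \<mu>. s < w y})"
    and "integrable uniform01 (\<lambda>s. measure \<mu> {y \<in> space \<mu>. s < w y})"
proof -
  interpret m: prob_space \<mu> by fact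
  interpret u: prob_space uniform01 by (rule prob_space_uniform01)
  interpret P: pair_prob_space \<mu> uniform01 ..
  have [measurable]: "(\<lambda>s. s) \<in> borel_measurable uniform01"
    by (rule measurable_restrict_space1) simp
  have meas: "(\<lambda>(y, s). if s < w y then 1 else 0 :: real) \<in> borel_measurable (\<mu> \<Otimes>\<^sub>M uniform01)"
  proof -
    have [measurable]: "snd \<in> borel_measurable (\<mu> \<Otimes>\<^sub>M uniform01)"
      using measurable_compose[OF measurable_snd[of \<mu> uniform01], of "\<lambda>s. s" borel] by simp
    have [measurable]: "(\<lambda>z. w (fst z)) \<in> borel_measurable (\<mu> \<Otimes>\<^sub>M uniform01)" by measurable
    show ?thesis unfolding split_beta' by measurable
  qed
  have int: "integrable (\<mu> \<Otimes>\<^sub>M uniform01) (\<lambda>(y, s). if s < w y then 1 else 0 :: real)"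
    by (rule P.integrable_const_bound[OF _ meas, of 1]) (auto intro!: AE_I2)
  have inner: "(LINT y|\<mu>. (if s < w y then 1 else 0)) = measure \<mu> {y \<in> space \<mu>. s < w y}" for s :: real
  proof -
    have "(LINT y|\<mu>. (if s < w y then 1 else 0)) = (LINT y|\<mu>. indicat_real {y \<in> space \<mu>. s < w y} y)"
      by (intro Bochner_Integration.integral_cong) (auto simp: indicator_def)
    then show ?thesis by simp
  qed
  have outer: "(LINT s|uniform01. (if s < r then 1 else 0)) = r" if "0 \<le> r" "r \<le> 1" for r :: real
  proof -
    have "(LINT s|uniform01. (if s < r then 1 else 0)) = (LINT s|uniform01. indicat_real {0..<r} s)"
      by (intro Bochner_Integration.integral_cong) (auto simp: indicator_def space_restrict_space)
    also have "\<dots> = measure uniform01 {0..<r}"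
      using that by (subst Bochner_Integration.integral_indicator) (auto simp: space_restrict_space Int_absorb1 intro!: arg_cong2[where f=measure])
    also have "\<dots> = r" using that by (subst measure_restrict_space) auto
    finally show ?thesis .
  qed
  have "(LINT y|\<mu>. w y) = (LINT y|\<mu>. LINT s|uniform01. (if s < w y then 1 else 0))"
    by (intro Bochner_Integration.integral_cong) (use w outer in auto)
  also have "\<dots> = (LINT s|uniform01. LINT y|\<mu>. (if s < w y then 1 else 0))"
    by (rule P.Fubini_integral[OF int, symmetric])
  finally show "(LINT y|\<mu>. w y) = (LINT s|uniform01. measure \<mu> {y \<in> space \<mu>. s < w y})" by (simp add: inner)
  show "integrable uniform01 (\<lambda>s. measure \<mu> {y \<in> space \<mu>. s < w y})"
    using P.integrable_snd[OF int] by (simp add: inner)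
qed

text \<open>The weight \<open>m\<close> stays in a product with the differences: it is a rate that
  may vanish, and where it does the two kernels can be far apart.\<close>

lemma integral_diff_le_total_variation:
  fixes v :: "'b \<Rightarrow> real"
  assumes \<mu>: "prob_space \<mu>" and \<nu>: "prob_space \<nu>" and sets: "sets \<mu> = sets \<nu>"
    and v: "v \<in> borel_measurable \<mu>" and B: "\<And>y. y \<in> space \<mu> \<Longrightarrow> \<bar>v y\<bar> \<le> B"
    and eps: "\<And>A. A \<in> sets \<mu> \<Longrightarrow> m * \<bar>measure \<mu> A - measure \<nu> A\<bar> \<le> \<epsilon>" and m: "0 \<le> m"
  shows "m * \<bar>(LINT y|\<mu>. v y) - (LINT y|\<nu>. v y)\<bar> \<le> 2 * B * \<epsilon>"
proof -
  interpret m: prob_space \<mu> by fact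
  interpret n: prob_space \<nu> by fact
  interpret u: prob_space uniform01 by (rule prob_space_uniform01)
  have sp: "space \<mu> = space \<nu>" by (rule sets_eq_imp_space_eq[OF sets])
  have v': "v \<in> borel_measurable \<nu>" using v by (simp add: measurable_cong_sets[OF sets refl])
  obtain z where "z \<in> space \<mu>" using m.not_empty by auto
  then have B0: "0 \<le> B" using B[of z] by simp
  show ?thesis
  proof (cases "B = 0")
    case True
    then have "(LINT y|\<mu>. v y) = 0" "(LINT y|\<nu>. v y) = 0"
      using B sp by (auto intro!: integral_eq_zero_AE AE_I2)
    then show ?thesis using True by simp
  next
    case False
    then have Bp: "0 < B" using B0 by simp
    \<comment> \<open>An affine change of values into [0, 1]. There the layer-cake formula writes
      both integrals as averages of the two measures over the same level sets.\<close>
    define w where "w y = (v y + B) / (2 * B)" for y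
    have w: "0 \<le> w y \<and> w y \<le> 1" if "y \<in> space \<mu>" for y
      using B[OF that] Bp by (auto simp: w_def field_simps abs_le_iff)
    have wm: "w \<in> borel_measurable \<mu>" "w \<in> borel_measurable \<nu>" unfolding w_def using v v' by auto
    note lm = integral_layer_cake[OF \<mu> wm(1) w]
    note ln = integral_layer_cake[OF \<nu> wm(2) w[unfolded sp]]
    have iv: "integrable \<mu> v" "integrable \<nu> v"
      using v v' B sp by (auto intro!: m.integrable_const_bound[where B = B] n.integrable_const_bound[where B = B])
    have "(LINT y|\<mu>. v y) = 2 * B * (LINT y|\<mu>. w y) - B" "(LINT y|\<nu>. v y) = 2 * B * (LINT y|\<nu>. w y) - B"
      unfolding w_def using iv Bp m.prob_space n.prob_space by (auto simp: field_simps)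
    then have "m * \<bar>(LINT y|\<mu>. v y) - (LINT y|\<nu>. v y)\<bar> = 2 * B * \<bar>m * (LINT y|\<mu>. w y) - m * (LINT y|\<nu>. w y)\<bar>"
      using Bp m by (simp add: abs_mult right_diff_distrib[symmetric] del: right_diff_distrib_numeral)
    also have "m * (LINT y|\<mu>. w y) - m * (LINT y|\<nu>. w y) =
      (LINT s|uniform01. m * (measure \<mu> {y \<in> space \<mu>. s < w y} - measure \<nu> {y \<in> space \<nu>. s < w y}))"
      using Bochner_Integration.integral_diff[OF integrable_mult_right[OF lm(2), of m] integrable_mult_right[OF ln(2), of m]]
      by (simp add: right_diff_distrib lm(1)[symmetric] ln(1)[symmetric])
    also have "2 * B * \<bar>\<dots>\<bar> \<le> 2 * B * \<epsilon>"
    proof (intro mult_left_mono u.abs_integral_le)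
      fix s :: real
      have "{y \<in> space \<mu>. s < w y} \<in> sets \<mu>" using wm by measurable
      from eps[OF this] show "\<bar>m * (measure \<mu> {y \<in> space \<mu>. s < w y} - measure \<nu> {y \<in> space \<nu>. s < w y})\<bar> \<le> \<epsilon>"
        using m by (simp add: abs_mult sp)
    qed (use Bp in simp)
    finally show ?thesis .
  qed
qed

locale pdmp_pair = P: pdmp_process M \<phi> lam Q G + P': pdmp_process M \<phi> lam' Q' G'
  for M :: "'a::euclidean_space set" and \<phi> lam Q G lam' Q' G' +
  fixes \<epsilon> :: real
  assumes close: "\<And>x A. x \<in> M \<Longrightarrow> A \<in> sets (borel_of M) \<Longrightarrow>
    min (lam' x) (lam x) * \<bar>measure (Q' x) A - measure (Q x) A\<bar> + \<bar>lam' x - lam x\<bar> \<le> \<epsilon>"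
begin

text \<open>The constant 4 collects twice \<epsilon> * B from the kernels, once from the rates in
  front of the integral of \<open>v\<close>, and once from the rates in front of
  \<open>v x\<close>.\<close>

lemma generator_diff:
  assumes v: "v \<in> borel_measurable (borel_of M)" and B: "\<And>y. y \<in> M \<Longrightarrow> \<bar>v y\<bar> \<le> B" and x: "x \<in> M"
  shows "\<bar>lam' x * ((LINT y|Q' x. v y) - v x) - lam x * ((LINT y|Q x. v y) - v x)\<bar> \<le> 4 * \<epsilon> * B"
proof -
  have B0: "0 \<le> B" using B[OF x] by simp
  let ?m = "min (lam' x) (lam x)"
  have m0: "0 \<le> ?m" using P.lam_nonneg[OF x] P'.lam_nonneg[OF x] by simp
  have rate: "\<bar>lam' x - lam x\<bar> \<le> \<epsilon>"
    using close[OF x, of "{}"] by simp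
  have kern: "?m * \<bar>(LINT y|Q' x. v y) - (LINT y|Q x. v y)\<bar> \<le> 2 * B * \<epsilon>"
  proof (rule integral_diff_le_total_variation)
    show "sets (Q' x) = sets (Q x)" using P.sets_Q[OF x] P'.sets_Q[OF x] by simp
    show "v \<in> borel_measurable (Q' x)" using v by (simp add: measurable_cong_sets[OF P'.sets_Q[OF x] refl])
    show "?m * \<bar>measure (Q' x) A - measure (Q x) A\<bar> \<le> \<epsilon>" if "A \<in> sets (Q' x)" for A
      using close[OF x, of A] that by (auto simp: P'.sets_Q[OF x])
    show "\<bar>v y\<bar> \<le> B" if "y \<in> space (Q' x)" for y using B that by (simp add: P'.space_Q[OF x])
  qed (rule P'.Q_prob[OF x] P.Q_prob[OF x] m0)+
  \<comment> \<open>The difference of the integrals is controlled only after multiplication by the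
    smaller rate. The product is therefore split so that this rate multiplies it, and the rate
    difference goes with the other term.\<close>
  have le: "\<bar>a * p - b * r\<bar> \<le> 2 * B * \<epsilon> + \<epsilon> * B"
    if "min a b * \<bar>p - r\<bar> \<le> 2 * B * \<epsilon>" "\<bar>a - b\<bar> \<le> \<epsilon>" "\<bar>p\<bar> \<le> B" "\<bar>r\<bar> \<le> B" "0 \<le> a" "0 \<le> b" for a b p r
  proof (cases "a \<le> b")
    case True
    have "a * p - b * r = a * (p - r) + (a - b) * r" by (simp add: algebra_simps)
    also have "\<bar>\<dots>\<bar> \<le> a * \<bar>p - r\<bar> + \<bar>a - b\<bar> * \<bar>r\<bar>" using that by (metis abs_mult abs_of_nonneg abs_triangle_ineq)
    also have "\<dots> \<le> 2 * B * \<epsilon> + \<epsilon> * B"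
    proof (rule add_mono)
      show "a * \<bar>p - r\<bar> \<le> 2 * B * \<epsilon>" using that(1) True by simp
      show "\<bar>a - b\<bar> * \<bar>r\<bar> \<le> \<epsilon> * B" using that(2,4) by (intro mult_mono) auto
    qed
    finally show ?thesis .
  next
    case False
    have "a * p - b * r = b * (p - r) + (a - b) * p" by (simp add: algebra_simps)
    also have "\<bar>\<dots>\<bar> \<le> b * \<bar>p - r\<bar> + \<bar>a - b\<bar> * \<bar>p\<bar>" using that by (metis abs_mult abs_of_nonneg abs_triangle_ineq)
    also have "\<dots> \<le> 2 * B * \<epsilon> + \<epsilon> * B"
    proof (rule add_mono)
      show "b * \<bar>p - r\<bar> \<le> 2 * B * \<epsilon>" using that(1) False by simp
      show "\<bar>a - b\<bar> * \<bar>p\<bar> \<le> \<epsilon> * B" using that(2,3) by (intro mult_mono) auto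
    qed
    finally show ?thesis .
  qed
  have "\<bar>lam' x * (LINT y|Q' x. v y) - lam x * (LINT y|Q x. v y)\<bar> \<le> 2 * B * \<epsilon> + \<epsilon> * B"
    by (rule le[OF kern rate P'.Q_abs_le[OF v B x] P.Q_abs_le[OF v B x] P'.lam_nonneg[OF x] P.lam_nonneg[OF x]])
  moreover have "\<bar>(lam' x - lam x) * v x\<bar> \<le> \<epsilon> * B"
    unfolding abs_mult using rate B[OF x] by (intro mult_mono) auto
  moreover have "lam' x * ((LINT y|Q' x. v y) - v x) - lam x * ((LINT y|Q x. v y) - v x) =
    (lam' x * (LINT y|Q' x. v y) - lam x * (LINT y|Q x. v y)) - (lam' x - lam x) * v x"
    by (simp add: algebra_simps)
  ultimately show ?thesis by (simp add: algebra_simps)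
qed

text \<open>The perturbed semigroup enters \<open>perturbation_bound\<close> through its own mild
  equation along the common flow. The factor \<open>t\<close> in the bound is what lets the
  comparison survive division by \<open>t\<close> in difference quotients.\<close>

lemma semigroup_diff:
  assumes f: "f \<in> borel_measurable (borel_of M)" and B: "\<And>y. y \<in> M \<Longrightarrow> \<bar>f y\<bar> \<le> B" and x: "x \<in> M" and t: "0 \<le> t"
  shows "\<bar>P'.U f t x - P.U f t x\<bar> \<le> 4 * \<epsilon> * B * t"
proof -
  have B0: "0 \<le> B" using B[OF x] by simp
  have bound: "\<bar>P'.U f r y\<bar> \<le> B" for r y by (rule P'.U_abs_le[OF B B0])
  note bU = P'.bdd_U[OF f B]
  show ?thesis
  proof (rule P.perturbation_bound[OF _ f B, where g = "\<lambda>r y. lam' y * ((LINT z|Q' y. P'.U f r z) - P'.U f r y)"])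
    show "P.bdd t (P'.U f)" using bU[of t] unfolding P.bdd_def P'.bdd_def .
    show "P'.U f s y = f (P.flow s y) + (LINT r:{0..s}|lborel. lam' (P.flow r y) *
        ((LINT z|Q' (P.flow r y). P'.U f (s - r) z) - P'.U f (s - r) (P.flow r y)))" if "s \<in> {0..t}" "y \<in> M" for s y
      by (rule P'.U_mild[OF f B]) (use that in auto)
    show "(\<lambda>r. lam' (P.flow r y) * ((LINT z|Q' (P.flow r y). P'.U f (s - r) z) - P'.U f (s - r) (P.flow r y))) \<in> borel_measurable borel"
      if "y \<in> M" for s y
      by (intro borel_measurable_times borel_measurable_diff P'.rate_measurable P'.path_measurable[OF bU]
          P'.q_path(1)[OF bU, unfolded P'.q_def] that)
    show "\<exists>C. \<forall>r\<in>{0..s}. \<bar>lam' (P.flow r y) * ((LINT z|Q' (P.flow r y). P'.U f (s - r) z) - P'.U f (s - r) (P.flow r y))\<bar> \<le> C"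
      if "s \<in> {0..t}" and y: "y \<in> M" for s y
    proof -
      obtain C where C: "0 \<le> C" "\<And>r. r \<in> {0..s} \<Longrightarrow> \<bar>lam' (P.flow r y)\<bar> \<le> C" using P'.rate_bounded[OF y] by metis
      have "\<bar>(LINT z|Q' (P.flow r y). P'.U f (s - r) z) - P'.U f (s - r) (P.flow r y)\<bar> \<le> B + B" for r
        using P'.Q_abs_le[OF P'.U_slice[OF f B] bound P'.flow_in'[OF y]] bound
        by (intro order_trans[OF abs_triangle_ineq4] add_mono) auto
      then show ?thesis using C
        by (intro exI[of _ "C * (B + B)"]) (auto simp: abs_mult intro!: mult_mono)
    qed
    show "\<bar>lam' y * ((LINT z|Q' y. P'.U f r z) - P'.U f r y) - lam y * ((LINT z|Q y. P'.U f r z) - P'.U f r y)\<bar> \<le> 4 * \<epsilon> * B"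
      if "y \<in> M" for r y
      by (rule generator_diff[OF P'.U_slice[OF f B] bound that])
  qed (use x t in auto)
qed

end

section \<open>Continuously differentiable functions on subsets\<close>

text \<open>In finite dimension, continuity of the derivative in each direction is continuity in
  operator norm. The bounded linear form is the one in which chain rule and pairing are
  convenient.\<close>

lemma Ck_on_1_iff:
  fixes F :: "'a::euclidean_space \<Rightarrow> 'b::euclidean_space"
  assumes U: "open U"
  shows "Ck_on 1 U F \<longleftrightarrow> (\<exists>F'. continuous_on U F' \<and> (\<forall>x\<in>U. (F has_derivative blinfun_apply (F' x)) (at x)))"
proof
  assume "Ck_on 1 U F"
  then have d: "F differentiable_on U" and c: "\<And>v. continuous_on U (\<lambda>x. frechet_derivative F (at x) v)" by auto
  have w: "(F has_derivative frechet_derivative F (at x)) (at x)" if "x \<in> U" for x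
    using d that at_within_open[OF that U] unfolding differentiable_on_def frechet_derivative_works[symmetric] by auto
  then have bl: "bounded_linear (frechet_derivative F (at x))" if "x \<in> U" for x
    using that has_derivative_bounded_linear by blast
  define F' where "F' x = Blinfun (frechet_derivative F (at x))" for x
  have ap: "blinfun_apply (F' x) = frechet_derivative F (at x)" if "x \<in> U" for x
    unfolding F'_def by (rule bounded_linear_Blinfun_apply[OF bl[OF that]])
  have "continuous_on U F'"
    by (rule continuous_on_blinfun_componentwise, rule continuous_on_eq[OF c]) (simp add: ap)
  then show "\<exists>F'. continuous_on U F' \<and> (\<forall>x\<in>U. (F has_derivative blinfun_apply (F' x)) (at x))"
    using w ap by (intro exI[of _ F']) simp
next
  assume "\<exists>F'. continuous_on U F' \<and> (\<forall>x\<in>U. (F has_derivative blinfun_apply (F' x)) (at x))"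
  then obtain F' where c: "continuous_on U F'" and d: "\<And>x. x \<in> U \<Longrightarrow> (F has_derivative blinfun_apply (F' x)) (at x)" by auto
  have "F differentiable_on U"
    using d by (auto simp: differentiable_on_def differentiable_def intro: has_derivative_at_withinI)
  moreover have "continuous_on U (\<lambda>x. frechet_derivative F (at x) v)" for v
  proof (rule continuous_on_eq)
    show "continuous_on U (\<lambda>x. blinfun_apply (F' x) v)" by (intro continuous_intros c)
    show "blinfun_apply (F' x) v = frechet_derivative F (at x) v" if "x \<in> U" for x
      using frechet_derivative_at[OF d[OF that]] by simp
  qed
  ultimately show "Ck_on 1 U F" by simp
qed

lemma C1_on_iff:
  "C1_on S f \<longleftrightarrow> (\<forall>p\<in>S. \<exists>U F F'. open U \<and> p \<in> U \<and> continuous_on U F' \<and>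
    (\<forall>x\<in>U. (F has_derivative blinfun_apply (F' x)) (at x)) \<and> (\<forall>x\<in>S \<inter> U. F x = f x))"
  unfolding C1_on_def using Ck_on_1_iff by metis

lemma C1_onE:
  assumes "C1_on S f" "p \<in> S"
  obtains U F F' where "open U" "p \<in> U" "continuous_on U F'"
    "\<And>x. x \<in> U \<Longrightarrow> (F has_derivative blinfun_apply (F' x)) (at x)" "\<And>x. x \<in> S \<Longrightarrow> x \<in> U \<Longrightarrow> F x = f x"
  using assms unfolding C1_on_iff by (metis IntI)

lemma C1_on_compose:
  assumes f: "C1_on S f" and g: "C1_on T g" and ST: "f ` S \<subseteq> T"
  shows "C1_on S (\<lambda>x. g (f x))"
  unfolding C1_on_iff
proof
  fix p assume p: "p \<in> S"
  obtain U F' F where U: "open U" "p \<in> U" "continuous_on U F'"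
    and F: "\<And>x. x \<in> U \<Longrightarrow> (F has_derivative blinfun_apply (F' x)) (at x)" and Ff: "\<And>x. x \<in> S \<Longrightarrow> x \<in> U \<Longrightarrow> F x = f x"
    by (rule C1_onE[OF f p]) metis
  have "f p \<in> T" using ST p by auto
  then obtain V H' H where V: "open V" "f p \<in> V" "continuous_on V H'"
    and H: "\<And>x. x \<in> V \<Longrightarrow> (H has_derivative blinfun_apply (H' x)) (at x)" and Hg: "\<And>x. x \<in> T \<Longrightarrow> x \<in> V \<Longrightarrow> H x = g x"
    by (rule C1_onE[OF g]) metis
  have cF: "continuous_on U F"
    using F by (meson continuous_at_imp_continuous_on has_derivative_continuous)
  let ?W = "U \<inter> F -` V"
  have "open ?W" by (rule continuous_open_preimage[OF cF U(1) V(1)])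
  moreover have "p \<in> ?W" using U V Ff[OF p] by simp
  moreover have "continuous_on ?W (\<lambda>x. H' (F x) o\<^sub>L F' x)"
    by (intro continuous_intros continuous_on_compose2[OF V(3)] continuous_on_subset[OF cF] continuous_on_subset[OF U(3)]) auto
  moreover have "((\<lambda>x. H (F x)) has_derivative blinfun_apply (H' (F x) o\<^sub>L F' x)) (at x)" if "x \<in> ?W" for x
  proof -
    have "blinfun_apply (H' (F x) o\<^sub>L F' x) = (\<lambda>v. H' (F x) (F' x v))" by (rule ext) simp
    then show ?thesis using has_derivative_compose[OF F H, of x] that by simp
  qed
  moreover have "H (F x) = g (f x)" if "x \<in> S \<inter> ?W" for x
    using that Ff[of x] Hg[of "f x"] ST by auto
  ultimately show "\<exists>U F F'. open U \<and> p \<in> U \<and> continuous_on U F' \<and>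
    (\<forall>x\<in>U. (F has_derivative blinfun_apply (F' x)) (at x)) \<and> (\<forall>x\<in>S \<inter> U. F x = g (f x))"
    by (intro exI[of _ ?W] exI[of _ "\<lambda>x. H (F x)"] exI[of _ "\<lambda>x. H' (F x) o\<^sub>L F' x"]) auto
qed

lemma C1_on_global:
  assumes "continuous_on UNIV F'" "\<And>x. (f has_derivative blinfun_apply (F' x)) (at x)"
  shows "C1_on S f"
  unfolding C1_on_iff using assms by (intro ballI exI[of _ UNIV] exI[of _ f] exI[of _ F']) auto

lemma C1_on_const [simp]: "C1_on S (\<lambda>_::'a::euclidean_space. c::'b::euclidean_space)"
proof (rule C1_on_global)
  have "blinfun_apply (0 :: 'a \<Rightarrow>\<^sub>L 'b) = (\<lambda>_. 0)" by (rule ext) simp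
  then show "((\<lambda>_::'a. c::'b) has_derivative blinfun_apply 0) (at x)" for x by simp
qed simp

lemma C1_on_bounded_linear: "bounded_linear f \<Longrightarrow> C1_on S f"
  by (rule C1_on_global[of "\<lambda>_. Blinfun f"])
    (auto simp: bounded_linear_Blinfun_apply bounded_linear_imp_has_derivative)

lemma C1_on_Pair:
  assumes f: "C1_on S f" and g: "C1_on S g"
  shows "C1_on S (\<lambda>x. (f x, g x))"
  unfolding C1_on_iff
proof
  fix p assume p: "p \<in> S"
  obtain U F' F where U: "open U" "p \<in> U" "continuous_on U F'"
    and F: "\<And>x. x \<in> U \<Longrightarrow> (F has_derivative blinfun_apply (F' x)) (at x)" and Ff: "\<And>x. x \<in> S \<Longrightarrow> x \<in> U \<Longrightarrow> F x = f x"
    by (rule C1_onE[OF f p]) metis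
  obtain V H' H where V: "open V" "p \<in> V" "continuous_on V H'"
    and H: "\<And>x. x \<in> V \<Longrightarrow> (H has_derivative blinfun_apply (H' x)) (at x)" and Hg: "\<And>x. x \<in> S \<Longrightarrow> x \<in> V \<Longrightarrow> H x = g x"
    by (rule C1_onE[OF g p]) metis
  define L where "L x = Blinfun (\<lambda>v. (F' x v, H' x v))" for x
  have L: "blinfun_apply (L x) = (\<lambda>v. (F' x v, H' x v))" for x
    unfolding L_def by (rule bounded_linear_Blinfun_apply) (intro bounded_linear_Pair blinfun.bounded_linear_right)
  have "continuous_on (U \<inter> V) L"
    by (rule continuous_on_blinfun_componentwise)
      (auto simp: L intro!: continuous_intros continuous_on_subset[OF U(3)] continuous_on_subset[OF V(3)])
  moreover have "((\<lambda>x. (F x, H x)) has_derivative blinfun_apply (L x)) (at x)" if "x \<in> U \<inter> V" for x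
    unfolding L using that by (intro has_derivative_Pair F H) auto
  ultimately show "\<exists>U F F'. open U \<and> p \<in> U \<and> continuous_on U F' \<and>
    (\<forall>x\<in>U. (F has_derivative blinfun_apply (F' x)) (at x)) \<and> (\<forall>x\<in>S \<inter> U. F x = (f x, g x))"
    using U V Ff Hg by (intro exI[of _ "U \<inter> V"] exI[of _ "\<lambda>x. (F x, H x)"] exI[of _ L]) auto
qed

lemma C1_on_add: "C1_on S f \<Longrightarrow> C1_on S g \<Longrightarrow> C1_on S (\<lambda>x. f x + g x)"
  using C1_on_compose[OF C1_on_Pair, of S f g UNIV "\<lambda>z. fst z + snd z"]
  by (simp add: C1_on_bounded_linear bounded_linear_add bounded_linear_fst bounded_linear_snd)

lemma C1_on_mult:
  fixes f g :: "'a::euclidean_space \<Rightarrow> real"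
  assumes "C1_on S f" "C1_on S g"
  shows "C1_on S (\<lambda>x. f x * g x)"
proof -
  have "C1_on UNIV (\<lambda>z::real \<times> real. fst z * snd z)"
  proof (rule C1_on_global)
    let ?L = "\<lambda>z::real \<times> real. fst z *\<^sub>R Blinfun (snd :: real \<times> real \<Rightarrow> real) + snd z *\<^sub>R Blinfun (fst :: real \<times> real \<Rightarrow> real)"
    show "continuous_on UNIV ?L" by (intro continuous_intros)
    show "((\<lambda>z::real \<times> real. fst z * snd z) has_derivative blinfun_apply (?L x)) (at x)" for x
      by (auto intro!: derivative_eq_intros simp: blinfun.add_left blinfun.scaleR_left
          bounded_linear_Blinfun_apply bounded_linear_fst bounded_linear_snd)
  qed
  from C1_on_compose[OF C1_on_Pair[OF assms] this] show ?thesis by simp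
qed

lemma C1_on_sum: "finite I \<Longrightarrow> (\<And>i. i \<in> I \<Longrightarrow> C1_on S (f i)) \<Longrightarrow> C1_on S (\<lambda>x. \<Sum>i\<in>I. f i x)"
  by (induction rule: finite_induct) (auto intro: C1_on_add)

lemma C1_on_real_polynomial: "real_polynomial_function p \<Longrightarrow> C1_on S p"
  by (induction rule: real_polynomial_function.induct)
    (auto intro: C1_on_bounded_linear C1_on_add C1_on_mult)

text \<open>The square of the positive part has derivative \<open>2 * max 0 s\<close>, which is
  continuous across 0; this gives an elementary cutoff of class C1 with an explicit formula.\<close>

lemma C1_on_bump: "C1_on S (\<lambda>x. (max 0 (c - x \<bullet> x))\<^sup>2 :: real)"
proof -
  have 1: "C1_on UNIV (\<lambda>s::real. (max 0 s)\<^sup>2)"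
  proof (rule C1_on_global)
    let ?L = "\<lambda>s::real. (2 * max 0 s) *\<^sub>R (id_blinfun :: real \<Rightarrow>\<^sub>L real)"
    show "continuous_on UNIV ?L" by (intro continuous_intros)
    fix s :: real
    have "((\<lambda>s::real. (max 0 s)\<^sup>2) has_field_derivative 2 * max 0 s) (at s)"
    proof (cases "s = 0")
      case True
      have "((\<lambda>t::real. max 0 t) \<longlongrightarrow> max 0 0) (at 0)" by (intro tendsto_intros)
      then have "((\<lambda>t::real. ((max 0 t)\<^sup>2 - (max 0 0)\<^sup>2) / (t - 0)) \<longlongrightarrow> max 0 0) (at 0)"
        by (rule Lim_transform_eventually) (auto simp: eventually_at max_def power2_eq_square intro!: exI[of _ 1])
      then show ?thesis using True by (simp add: has_field_derivative_iff)
    next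
      case False
      then consider "s > 0" | "s < 0" by linarith
      then show ?thesis
      proof cases
        case 1
        have "((\<lambda>s::real. s\<^sup>2) has_field_derivative 2 * max 0 s) (at s)"
          using 1 by (auto intro!: derivative_eq_intros)
        then show ?thesis
          by (rule has_field_derivative_transform_within_open[of _ _ _ "{0<..}"]) (use 1 in auto)
      next
        case 2
        have "((\<lambda>s::real. 0) has_field_derivative 2 * max 0 s) (at s)"
          using 2 by auto
        then show ?thesis
          by (rule has_field_derivative_transform_within_open[of _ _ _ "{..<0}"]) (use 2 in auto)
      qed
    qed
    moreover have "((\<lambda>s::real. (max 0 s)\<^sup>2) has_derivative blinfun_apply (?L s)) (at s)"
      if "((\<lambda>s::real. (max 0 s)\<^sup>2) has_field_derivative 2 * max 0 s) (at s)"
    proof -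
      have "blinfun_apply (?L s) = (*) (2 * max 0 s)" by (rule ext) (simp add: blinfun.scaleR_left)
      with that show ?thesis by (simp add: has_field_derivative_def)
    qed
    ultimately show "((\<lambda>s::real. (max 0 s)\<^sup>2) has_derivative blinfun_apply (?L s)) (at s)" by blast
  qed
  have "C1_on S (\<lambda>x. c - x \<bullet> x)"
  proof (rule C1_on_global)
    let ?L = "\<lambda>x::'a. (- 2) *\<^sub>R blinfun_inner_right x"
    show "continuous_on UNIV ?L" by (intro continuous_intros)
    show "((\<lambda>x. c - x \<bullet> x) has_derivative blinfun_apply (?L x)) (at x)" for x
    proof -
      have "blinfun_apply (?L x) = (\<lambda>v. - (2 * (v \<bullet> x)))" by (rule ext) (simp add: blinfun.minus_left blinfun.scaleR_left inner_commute)
      then show ?thesis by (auto intro!: derivative_eq_intros simp: inner_commute)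
    qed
  qed
  from C1_on_compose[OF this 1] show ?thesis by simp
qed

section \<open>Uniform density of compactly supported C1 functions\<close>

definition cs :: "'a::euclidean_space set \<Rightarrow> real \<Rightarrow> ('a \<Rightarrow> real) \<Rightarrow> bool" where
  "cs M R f \<longleftrightarrow> continuous_on M f \<and> (\<forall>x\<in>M. R < norm x \<longrightarrow> f x = 0)"

text \<open>A polynomial has no compact support, so Stone-Weierstrass is applied to
  \<open>f / chi\<close> on a ball and the polynomial is multiplied by the cutoff \<open>chi\<close>
  afterwards. The tolerance is divided by the bound (R + 1)^4 of \<open>chi\<close>.\<close>

lemma cs_C1_dense:
  assumes M: "closed M" and f: "cs M R f" and R: "0 \<le> R" and e: "0 < e"
  obtains g where "g \<in> C1 M" "cs M (R + 1) g" "\<And>x. x \<in> M \<Longrightarrow> \<bar>g x - f x\<bar> \<le> e"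
proof -
  define chi where "chi x = (max 0 ((R + 1)\<^sup>2 - x \<bullet> x))\<^sup>2" for x :: 'a
  let ?S = "M \<inter> cball 0 (R + 1)"
  have S: "compact ?S" using M by (intro closed_Int_compact) auto
  have dot: "x \<bullet> x = (norm x)\<^sup>2" for x :: 'a by (simp add: dot_square_norm)
  have pos: "0 < chi x" if "norm x < R + 1" for x
    using that R power_strict_mono[of "norm x" "R + 1" 2] by (simp add: chi_def dot)
  have zero: "chi x = 0" if "R + 1 \<le> norm x" for x
    using that R power_mono[of "R + 1" "norm x" 2] by (simp add: chi_def dot)
  have bound: "0 \<le> chi x" "chi x \<le> (R + 1)^4" for x
  proof -
    have "chi x \<le> ((R + 1)\<^sup>2)\<^sup>2" unfolding chi_def by (intro power_mono) (auto simp: R)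
    then show "0 \<le> chi x" "chi x \<le> (R + 1)^4" by (auto simp: chi_def power_mult[symmetric])
  qed
  \<comment> \<open>\<open>f\<close> vanishes beyond radius \<open>R\<close>, before
    \<open>chi\<close> reaches 0 at radius \<open>R + 1\<close>. On the outer piece the quotient is
    therefore 0, including the boundary where it reads 0 / 0 and division by zero yields 0.\<close>
  have "continuous_on ((?S \<inter> cball 0 (R + 1/2)) \<union> (?S \<inter> {x. R + 1/2 \<le> norm x})) (\<lambda>x. f x / chi x)"
  proof (rule continuous_on_closed_Un)
    show "closed (?S \<inter> cball 0 (R + 1/2))" using M by auto
    show "closed (?S \<inter> {x. R + 1/2 \<le> norm x})" using M by (intro closed_Int closed_Collect_le continuous_intros) auto
    show "continuous_on (?S \<inter> cball 0 (R + 1/2)) (\<lambda>x. f x / chi x)"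
    proof (rule continuous_on_divide)
      show "continuous_on (?S \<inter> cball 0 (R + 1/2)) f"
        by (rule continuous_on_subset[of M]) (use f in \<open>auto simp: cs_def\<close>)
      show "continuous_on (?S \<inter> cball 0 (R + 1/2)) chi" unfolding chi_def by (intro continuous_intros)
      show "\<forall>x\<in>?S \<inter> cball 0 (R + 1/2). chi x \<noteq> 0"
      proof
        fix x assume "x \<in> ?S \<inter> cball 0 (R + 1/2)"
        then have "norm x < R + 1" by auto
        then show "chi x \<noteq> 0" using pos[of x] by simp
      qed
    qed
    show "continuous_on (?S \<inter> {x. R + 1/2 \<le> norm x}) (\<lambda>x. f x / chi x)"
      by (rule continuous_on_eq[of _ "\<lambda>_. 0"]) (use f in \<open>auto simp: cs_def\<close>)
  qed
  moreover have "(?S \<inter> cball 0 (R + 1/2)) \<union> (?S \<inter> {x. R + 1/2 \<le> norm x}) = ?S" by auto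
  ultimately have c: "continuous_on ?S (\<lambda>x. f x / chi x)" by simp
  have R4: "0 < (R + 1)^4" using R by simp
  obtain p where p: "real_polynomial_function p" "\<And>x. x \<in> ?S \<Longrightarrow> \<bar>f x / chi x - p x\<bar> < e / (R + 1)^4"
    using Stone_Weierstrass_real_polynomial_function[OF S c, of "e / (R + 1)^4"] e R4 by auto
  have C1: "C1_on M (\<lambda>x. p x * chi x)"
    unfolding chi_def by (intro C1_on_mult C1_on_real_polynomial p C1_on_bump)
  show thesis
  proof (rule that)
    show "(\<lambda>x. p x * chi x) \<in> C1 M" using C1 by (simp add: C1_def)
    show "cs M (R + 1) (\<lambda>x. p x * chi x)" using C1_on_continuous[OF C1] zero by (auto simp: cs_def)
    fix x assume x: "x \<in> M"
    show "\<bar>p x * chi x - f x\<bar> \<le> e"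
    proof (cases "norm x < R + 1")
      case True
      then have "p x * chi x - f x = - ((f x / chi x - p x) * chi x)" using pos[OF True] by (simp add: field_simps)
      also have "\<bar>\<dots>\<bar> = \<bar>f x / chi x - p x\<bar> * chi x" using bound by (simp add: abs_mult)
      also have "\<dots> \<le> (e / (R + 1)^4) * (R + 1)^4"
        using p(2)[of x] x True bound[of x] by (intro mult_mono) auto
      finally show ?thesis using R4 by simp
    next
      case False
      then show ?thesis using zero[of x] f x e by (auto simp: cs_def)
    qed
  qed
qed

text \<open>The derivative along the flow exists locally uniformly, by the mean value theorem in time
  applied to a local extension of \<open>(t, x) \<mapsto> f (\<phi> t x)\<close>.\<close>

lemma flow_derivative_local:
  fixes M :: "'a::euclidean_space set" and h :: "real \<times> 'a \<Rightarrow> real"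
  assumes h: "C1_on ({0..} \<times> M) h" and p: "p \<in> M"
  shows "\<exists>c. \<forall>e>0. \<exists>d>0. \<forall>x\<in>M. \<forall>t. dist x p < d \<longrightarrow> 0 < t \<longrightarrow> t < d \<longrightarrow> \<bar>(h (t, x) - h (0, x)) / t - c\<bar> \<le> e"
proof -
  have "(0::real, p) \<in> {0..} \<times> M" using p by simp
  then obtain U F' F where U: "open U" "(0, p) \<in> U" "continuous_on U F'"
    and F: "\<And>z. z \<in> U \<Longrightarrow> (F has_derivative blinfun_apply (F' z)) (at z)"
    and Fh: "\<And>z. z \<in> {0..} \<times> M \<Longrightarrow> z \<in> U \<Longrightarrow> F z = h z"
    by (rule C1_onE[OF h]) metis
  define c where "c = F' (0, p) (1, 0)"
  have cont: "continuous_on U (\<lambda>z. F' z (1, 0))" by (intro continuous_intros U(3))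
  show ?thesis
  proof (rule exI[of _ c], intro allI impI)
    fix e :: real assume e: "0 < e"
    obtain d1 where d1: "0 < d1" "ball (0, p) d1 \<subseteq> U" using U openE by blast
    obtain d2 where d2: "0 < d2" "\<And>z. z \<in> U \<Longrightarrow> dist z (0, p) < d2 \<Longrightarrow> dist (F' z (1, 0)) c < e"
      using cont U(2) e unfolding continuous_on_iff c_def by meson
    define d where "d = min d1 d2 / 2"
    have d: "0 < d" using d1 d2 by (simp add: d_def)
    have near: "dist (s, x) (0, p) < min d1 d2" if "0 \<le> s" "s < d" "dist x p < d" for s x
    proof -
      have "dist (s, x) (0, p) \<le> dist s 0 + dist x p"
        unfolding dist_Pair_Pair by (rule sqrt_sum_squares_le_sum) auto
      then show ?thesis using that by (simp add: d_def dist_real_def)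
    qed
    show "\<exists>d>0. \<forall>x\<in>M. \<forall>t. dist x p < d \<longrightarrow> 0 < t \<longrightarrow> t < d \<longrightarrow> \<bar>(h (t, x) - h (0, x)) / t - c\<bar> \<le> e"
    proof (rule exI[of _ d], intro conjI d ballI allI impI)
      fix x t assume x: "x \<in> M" "dist x p < d" and t: "0 < t" "t < d"
      have inU: "(s, x) \<in> U" if "0 \<le> s" "s \<le> t" for s
        using near[of s x] that x t d1(2) by (auto simp: dist_commute subset_iff)
      have der: "((\<lambda>s. F (s, x)) has_real_derivative F' (s, x) (1, 0)) (at s)" if "0 \<le> s" "s \<le> t" for s
      proof -
        have g: "((\<lambda>s. (s, x)) has_derivative (\<lambda>v. (v, 0))) (at s)"
          by (intro has_derivative_Pair has_derivative_ident has_derivative_const)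
        have "((\<lambda>s. F (s, x)) has_derivative (\<lambda>v. F' (s, x) (v, 0))) (at s)"
          using has_derivative_compose[OF g, of F "F' (s, x)"] F[OF inU[OF that]] by simp
        moreover have "(\<lambda>v. F' (s, x) (v, 0)) = (*) (F' (s, x) (1, 0))"
        proof
          fix v :: real
          have "F' (s, x) (v, 0) = F' (s, x) (v *\<^sub>R (1, 0))" by simp
          then show "F' (s, x) (v, 0) = F' (s, x) (1, 0) * v" by (simp only: blinfun.scaleR_right) simp
        qed
        ultimately show ?thesis by (simp add: has_field_derivative_def)
      qed
      obtain z where z: "0 < z" "z < t" "F (t, x) - F (0, x) = (t - 0) * F' (z, x) (1, 0)"
        using MVT2[OF t(1), of "\<lambda>s. F (s, x)" "\<lambda>s. F' (s, x) (1, 0)"] der by auto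
      have "F (t, x) = h (t, x)" "F (0, x) = h (0, x)" using Fh inU x t by auto
      then have "(h (t, x) - h (0, x)) / t = F' (z, x) (1, 0)" using z t by simp
      moreover have "dist (F' (z, x) (1, 0)) c < e"
        by (rule d2(2)) (use inU[of z] near[of z x] z t x in auto)
      ultimately show "\<bar>(h (t, x) - h (0, x)) / t - c\<bar> \<le> e" by (simp add: dist_real_def)
    qed
  qed
qed

text \<open>The local limits are uniform near each point. Comparing quotients at a common small time
  makes \<open>D\<close> continuous, and a finite subcover makes the convergence uniform on compact
  sets.\<close>

lemma flow_derivative:
  fixes M :: "'a::euclidean_space set" and h :: "real \<times> 'a \<Rightarrow> real"
  assumes h: "C1_on ({0..} \<times> M) h"
  obtains D where "continuous_on M D"
    "\<And>C e. compact C \<Longrightarrow> C \<subseteq> M \<Longrightarrow> 0 < e \<Longrightarrow>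
      \<exists>d>0. \<forall>x\<in>C. \<forall>t. 0 < t \<longrightarrow> t < d \<longrightarrow> \<bar>(h (t, x) - h (0, x)) / t - D x\<bar> \<le> e"
proof -
  obtain D where D: "\<forall>p\<in>M. \<forall>e>0. \<exists>d>0. \<forall>x\<in>M. \<forall>t. dist x p < d \<longrightarrow> 0 < t \<longrightarrow> t < d \<longrightarrow> \<bar>(h (t, x) - h (0, x)) / t - D p\<bar> \<le> e"
    using bchoice[of M "\<lambda>p c. \<forall>e>0. \<exists>d>0. \<forall>x\<in>M. \<forall>t. dist x p < d \<longrightarrow> 0 < t \<longrightarrow> t < d \<longrightarrow> \<bar>(h (t, x) - h (0, x)) / t - c\<bar> \<le> e"]
      flow_derivative_local[OF h] by blast
  have close: "\<exists>d>0. \<forall>x\<in>M. dist x p < d \<longrightarrow> \<bar>D x - D p\<bar> \<le> e \<and> (\<forall>t. 0 < t \<longrightarrow> t < d \<longrightarrow> \<bar>(h (t, x) - h (0, x)) / t - D p\<bar> \<le> e)"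
    if p: "p \<in> M" and e: "0 < e" for p e
  proof -
    have e2: "0 < e / 2" using e by simp
    obtain d where d: "d > 0" "\<And>x t. x \<in> M \<Longrightarrow> dist x p < d \<Longrightarrow> 0 < t \<Longrightarrow> t < d \<Longrightarrow> \<bar>(h (t, x) - h (0, x)) / t - D p\<bar> \<le> e / 2"
      using D[rule_format, OF p e2] by blast
    have "\<bar>D x - D p\<bar> \<le> e" if x: "x \<in> M" "dist x p < d" for x
    proof -
      obtain d' where d': "d' > 0" "\<And>y t. y \<in> M \<Longrightarrow> dist y x < d' \<Longrightarrow> 0 < t \<Longrightarrow> t < d' \<Longrightarrow> \<bar>(h (t, y) - h (0, y)) / t - D x\<bar> \<le> e / 2"
        using D[rule_format, OF x(1) e2] by blast
      define t where "t = min d d' / 2"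
      have t: "0 < t" "t < d" "t < d'" using d(1) d'(1) by (auto simp: t_def)
      have "\<bar>(h (t, x) - h (0, x)) / t - D x\<bar> \<le> e / 2" by (rule d'(2)) (use x t d' in auto)
      moreover have "\<bar>(h (t, x) - h (0, x)) / t - D p\<bar> \<le> e / 2" by (rule d(2)) (use x t in auto)
      ultimately show ?thesis by linarith
    qed
    moreover have "\<bar>(h (t, x) - h (0, x)) / t - D p\<bar> \<le> e" if "x \<in> M" "dist x p < d" "0 < t" "t < d" for x t
      using d(2)[OF that] e by linarith
    ultimately show ?thesis using d(1) by blast
  qed
  show thesis
  proof (rule that)
    show "continuous_on M D"
      unfolding continuous_on_iff
    proof (intro ballI allI impI)
      fix p and e :: real assume "p \<in> M" "0 < e"
      then obtain d where "d > 0" "\<And>x. x \<in> M \<Longrightarrow> dist x p < d \<Longrightarrow> \<bar>D x - D p\<bar> \<le> e / 2"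
        using close[of p "e / 2"] by auto
      then have "dist (D x) (D p) < e" if "x \<in> M" "dist x p < d" for x
        using \<open>0 < e\<close> that by (fastforce simp: dist_real_def intro: le_less_trans)
      then show "\<exists>d>0. \<forall>x\<in>M. dist x p < d \<longrightarrow> dist (D x) (D p) < e"
        using \<open>d > 0\<close> by blast
    qed
    fix C and e :: real assume C: "compact C" "C \<subseteq> M" and e: "0 < e"
    have e2: "0 < e / 2" using e by simp
    have "\<forall>p\<in>C. \<exists>d>0. \<forall>x\<in>M. dist x p < d \<longrightarrow> \<bar>D x - D p\<bar> \<le> e / 2 \<and> (\<forall>t. 0 < t \<longrightarrow> t < d \<longrightarrow> \<bar>(h (t, x) - h (0, x)) / t - D p\<bar> \<le> e / 2)"
      using close[OF _ e2] C(2) by blast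
    then obtain \<delta> where \<delta>: "\<forall>p\<in>C. \<delta> p > 0 \<and> (\<forall>x\<in>M. dist x p < \<delta> p \<longrightarrow> \<bar>D x - D p\<bar> \<le> e / 2 \<and> (\<forall>t. 0 < t \<longrightarrow> t < \<delta> p \<longrightarrow> \<bar>(h (t, x) - h (0, x)) / t - D p\<bar> \<le> e / 2))"
      unfolding bchoice_iff by blast
    obtain C' where C': "C' \<subseteq> C" "finite C'" "C \<subseteq> (\<Union>p\<in>C'. ball p (\<delta> p))"
    proof (rule compactE_image[OF C(1), of C "\<lambda>p. ball p (\<delta> p)"])
      show "C \<subseteq> (\<Union>p\<in>C. ball p (\<delta> p))" using \<delta> by force
    qed auto
    define d where "d = Min (insert 1 (\<delta> ` C'))"
    have "0 < d" using C' \<delta> by (auto simp: d_def)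
    moreover have "\<bar>(h (t, x) - h (0, x)) / t - D x\<bar> \<le> e" if x: "x \<in> C" and t: "0 < t" "t < d" for x t
    proof -
      obtain p where p: "p \<in> C'" "dist x p < \<delta> p" using C'(3) x by (auto simp: dist_commute)
      have "d \<le> \<delta> p" using C' p by (auto simp: d_def)
      moreover have pC: "p \<in> C" and xM: "x \<in> M" using p C' C x by auto
      ultimately have "\<bar>D x - D p\<bar> \<le> e / 2" "\<bar>(h (t, x) - h (0, x)) / t - D p\<bar> \<le> e / 2"
        using \<delta>[rule_format, OF pC] xM p(2) t by auto
      then show ?thesis by linarith
    qed
    ultimately show "\<exists>d>0. \<forall>x\<in>C. \<forall>t. 0 < t \<longrightarrow> t < d \<longrightarrow> \<bar>(h (t, x) - h (0, x)) / t - D x\<bar> \<le> e"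
      by blast
  qed
qed

text \<open>A path is at least as long as the segment between its endpoints.\<close>

lemma riem_cball_subset_cball:
  assumes y: "y \<in> riem_cball M x r" and r: "0 \<le> r"
  shows "norm (y - x) \<le> r"
proof (rule field_le_epsilon)
  fix e :: real assume e: "0 < e"
  have "riem_dist M x y < ennreal (r + e)"
    using y r e unfolding riem_cball_def by (auto intro: le_less_trans simp: ennreal_less_iff)
  then obtain \<gamma> where len: "(\<integral>\<^sup>+t\<in>{0..1}. ennreal (norm (vector_derivative \<gamma> (at t))) \<partial>lborel) < ennreal (r + e)"
    and pc: "\<gamma> piecewise_C1_differentiable_on {0..1}" and ends: "pathstart \<gamma> = x" "pathfinish \<gamma> = y"
    unfolding riem_dist_def Inf_less_iff by auto
  obtain S where S: "finite S" "\<gamma> C1_differentiable_on ({0..1} - S)" and cont: "continuous_on {0..1} \<gamma>"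
    using pc unfolding piecewise_C1_differentiable_on_def by auto
  let ?D = "\<lambda>t. vector_derivative \<gamma> (at t)"
  have "\<exists>D. (\<forall>t\<in>{0..1} - S. (\<gamma> has_vector_derivative D t) (at t)) \<and> continuous_on ({0..1} - S) D"
    using S(2) unfolding C1_differentiable_on_def .
  then obtain D where D: "\<forall>t\<in>{0..1} - S. (\<gamma> has_vector_derivative D t) (at t)" and cD: "continuous_on ({0..1} - S) D"
    by auto
  have DD: "?D t = D t" if "t \<in> {0..1} - S" for t using D that by (blast intro: vector_derivative_at)
  \<comment> \<open>Setting the derivative to 0 on the finite exceptional set makes it Borel, leaves
    the fundamental theorem of calculus intact and does not increase the length.\<close>
  define g where "g t = indicat_real ({0..1} - S) t *\<^sub>R D t" for t
  have "(D has_integral (\<gamma> 1 - \<gamma> 0)) {0..1}"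
    by (rule fundamental_theorem_of_calculus_strong[OF S(1) _ _ cont])
      (use D in \<open>auto intro: has_vector_derivative_at_within\<close>)
  then have "(g has_integral (\<gamma> 1 - \<gamma> 0)) {0..1}"
    by (rule has_integral_spike_finite[OF S(1), rotated]) (auto simp: g_def)
  then have "((\<lambda>t. if t \<in> {0..1} then g t else 0) has_integral (\<gamma> 1 - \<gamma> 0)) UNIV"
    by (simp only: has_integral_restrict_UNIV)
  moreover have "(\<lambda>t. if t \<in> {0..1} then g t else 0) = g" by (auto simp: g_def indicator_def)
  ultimately have hi: "(g has_integral (\<gamma> 1 - \<gamma> 0)) UNIV" by simp
  have gm: "g \<in> borel_measurable borel"
    unfolding g_def by (rule borel_measurable_continuous_on_indicator[OF _ cD])
      (intro sets.Diff borel_closed finite_imp_closed S(1) closed_atLeastAtMost)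
  have gl: "(\<integral>\<^sup>+t. ennreal (norm (g t)) \<partial>lborel) < ennreal (r + e)"
    by (rule le_less_trans[OF nn_integral_mono len]) (auto simp: g_def indicator_def DD)
  have gi: "integrable lborel g"
    by (rule integrableI_bounded) (use gm gl in \<open>auto intro: less_trans\<close>)
  have "\<gamma> 1 - \<gamma> 0 = integral\<^sup>L lborel g"
    by (rule has_integral_unique[OF hi has_integral_integral_lborel[OF gi]])
  then have "ennreal (norm (\<gamma> 1 - \<gamma> 0)) \<le> (\<integral>\<^sup>+t. ennreal (norm (g t)) \<partial>lborel)"
    using integral_norm_bound_ennreal[OF gi] by simp
  then have "ennreal (norm (y - x)) < ennreal (r + e)"
    using gl ends by (auto simp: pathstart_def pathfinish_def intro: le_less_trans)
  then show "norm (y - x) \<le> r + e" using r e by (simp add: ennreal_less_iff del: ennreal_plus)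
qed

section \<open>Bounded displacement and compact supports\<close>

lemma cs_bounded:
  assumes "closed M" "cs M R f"
  obtains B where "0 \<le> B" "\<And>y. y \<in> M \<Longrightarrow> \<bar>f y\<bar> \<le> B"
proof -
  have "compact (M \<inter> cball 0 R)" using assms by (intro closed_Int_compact) auto
  moreover have "continuous_on (M \<inter> cball 0 R) f"
    by (rule continuous_on_subset[of M]) (use assms in \<open>auto simp: cs_def\<close>)
  ultimately have "bounded (f ` (M \<inter> cball 0 R))"
    using compact_continuous_image compact_imp_bounded by blast
  then obtain B where B: "\<And>y. y \<in> M \<inter> cball 0 R \<Longrightarrow> \<bar>f y\<bar> \<le> B" unfolding bounded_iff real_norm_def by blast
  have "\<bar>f y\<bar> \<le> max 0 B" if "y \<in> M" for y
    using B[of y] assms(2) that by (cases "norm y \<le> R") (auto simp: cs_def le_max_iff_disj)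
  then show ?thesis using that[of "max 0 B"] by simp
qed

lemma cs_mono: "cs M R f \<Longrightarrow> R \<le> R' \<Longrightarrow> cs M R' f"
  by (auto simp: cs_def)

lemma cs_lin: "cs M R f \<Longrightarrow> cs M R g \<Longrightarrow> cs M R (\<lambda>x. a * f x + b * g x)"
  by (auto simp: cs_def intro!: continuous_intros)

lemma cs_measurable: "cs M R f \<Longrightarrow> f \<in> borel_measurable (borel_of M)"
  by (auto simp: cs_def intro: borel_measurable_continuous_on_restrict)

text \<open>The setting of the approximating characteristics: the C1 property of the flow and the
  two continuity assumptions are consequences of \<open>stability\<close>, and \<open>disp\<close>
  comes from \<open>bounded_displacement\<close> for the representation \<open>G\<close> that it
  provides.\<close>

locale nice_pdmp = pdmp_process +
  assumes flow_C1: "C1_on ({0..} \<times> M) (\<lambda>(t, x). \<phi> t x)"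
    and lam_cont: "continuous_on M lam"
    and jump_cont: "\<And>f. f \<in> C1 M \<Longrightarrow> continuous_on M (jump_op lam Q f)"
    and disp: "\<And>T. 0 \<le> T \<Longrightarrow> \<exists>r\<ge>0. \<forall>x\<in>M. \<forall>t\<in>{0..T}.
      supp M (pdmp_semigroup M \<phi> lam G t x) \<subseteq> riem_cball M x r"
begin

lemma pdmp_semigroup_eq:
  assumes x: "x \<in> M" and t: "0 \<le> t" and A: "A \<in> sets N"
  shows "pdmp_semigroup M \<phi> lam G t x A = U (indicator A) t x"
proof -
  let ?\<Omega> = "pdmp_space (return N x)"
  let ?E = "{z \<in> space ?\<Omega>. pdmp \<phi> lam G t z \<in> Some ` A}"
  have im: "indicator A \<in> borel_measurable N" using A by simp
  note Fm = pair_measurable_fix_time[OF F_measurable[OF im], of t]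
  have ind: "indicator ?E z = F (indicator A) t (fst z) (snd z)" if z: "z \<in> space ?\<Omega>" for z
  proof -
    have "(case pdmp \<phi> lam G t (fst z, snd z) of None \<Rightarrow> 0 | Some y \<Rightarrow> indicator A y) = F (indicator A) t (fst z) (snd z)"
      by (rule pdmp_F) (use z t in \<open>auto simp: space_pdmp_space\<close>)
    then show ?thesis using z by (cases "pdmp \<phi> lam G t z") (auto simp: indicator_def image_iff)
  qed
  have "pdmp_semigroup M \<phi> lam G t x A = measure ?\<Omega> ?E"
    by (simp add: pdmp_semigroup_def Let_def)
  also have "\<dots> = (LINT z|?\<Omega>. indicator ?E z)"
    by (simp add: Int_absorb2 subset_eq)
  also have "\<dots> = (LINT z|?\<Omega>. F (indicator A) t (fst z) (snd z))"
    by (intro Bochner_Integration.integral_cong refl ind)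
  also have "\<dots> = U (indicator A) t x"
    unfolding U_def by (subst integral_pdmp_space[OF x Fm, of 1]) (auto intro!: F_abs_le simp: indicator_def)
  finally show ?thesis .
qed

lemma F_integrable:
  assumes f: "f \<in> borel_measurable N" "\<And>y. y \<in> M \<Longrightarrow> \<bar>f y\<bar> \<le> B" and x: "x \<in> M"
  shows "integrable marks (F f t x)"
proof -
  interpret S: prob_space marks by (rule prob_space_marks)
  have "0 \<le> B" using f(2)[OF x] by simp
  then show ?thesis
    by (intro S.integrable_const_bound[of _ B] F_measurable_marks f(1) x AE_I2)
      (simp add: F_abs_le[OF f(2)])
qed

text \<open>The displacement bound for the horizon 1, restated for functions and in Euclidean
  distance: a function that vanishes on the ball about the starting point is not seen by the
  semigroup.\<close>

definition reach :: "real \<Rightarrow> bool" where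
  "reach r \<longleftrightarrow> 0 \<le> r \<and> (\<forall>(f :: 'a \<Rightarrow> real) B x t. f \<in> borel_measurable N \<longrightarrow> (\<forall>y\<in>M. \<bar>f y\<bar> \<le> B) \<longrightarrow>
     x \<in> M \<longrightarrow> 0 \<le> t \<longrightarrow> t \<le> 1 \<longrightarrow> (\<forall>y\<in>M. norm (y - x) \<le> r \<longrightarrow> f y = 0) \<longrightarrow> U f t x = 0)"

text \<open>Each point of \<open>M\<close> outside the ball has a neighbourhood of mass zero. By
  Lindelof countably many of these cover the outside, so almost surely the process avoids it; the
  Riemannian ball lies in the Euclidean one of the same radius.\<close>

lemma ex_reach: "\<exists>r. reach r"
proof -
  obtain r where r: "0 \<le> r" "\<And>x t. x \<in> M \<Longrightarrow> t \<in> {0..1} \<Longrightarrow> supp M (pdmp_semigroup M \<phi> lam G t x) \<subseteq> riem_cball M x r"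
    using disp[OF zero_le_one] by blast
  have "reach r"
    unfolding reach_def
  proof (intro conjI allI impI r(1))
    fix f :: "'a \<Rightarrow> real" and B :: real and x and t :: real
    assume f: "f \<in> borel_measurable N" and "\<forall>y\<in>M. \<bar>f y\<bar> \<le> B" and x: "x \<in> M" and t: "0 \<le> t" "t \<le> 1"
      and f0': "\<forall>y\<in>M. norm (y - x) \<le> r \<longrightarrow> f y = 0"
    have f0: "f y = 0" if "y \<in> M" "norm (y - x) \<le> r" for y using f0' that by blast
    define \<U> where "\<U> = {W. open W \<and> U (indicator (W \<inter> M)) t x = 0}"
    have WM: "W \<inter> M \<in> sets N" if "open W" for W
      using that closed_M by (auto simp: sets_N_borel intro!: sets.Int borel_open borel_closed)
    obtain \<V> where V: "\<V> \<subseteq> \<U>" "countable \<V>" "\<Union>\<V> = \<Union>\<U>"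
      using Lindelof[of \<U>] by (auto simp: \<U>_def)
    have cover: "y \<in> \<Union>\<U>" if y: "y \<in> M" "\<not> norm (y - x) \<le> r" for y
    proof -
      have "y \<notin> riem_cball M x r" using riem_cball_subset_cball[of y M x r] y r(1) by auto
      then have "y \<notin> supp M (pdmp_semigroup M \<phi> lam G t x)" using r(2)[OF x, of t] t by auto
      then obtain W where W: "open W" "y \<in> W" "\<not> 0 < pdmp_semigroup M \<phi> lam G t x (W \<inter> M)"
        using y by (auto simp: supp_def)
      have "U (indicator (W \<inter> M)) t x = 0"
        using W(3) pdmp_semigroup_eq[OF x t(1) WM[OF W(1)]] U_nonneg[of "indicator (W \<inter> M)" t x] by simp
      then show ?thesis using W by (auto simp: \<U>_def)
    qed
    have "AE \<omega> in marks. F (indicator (W \<inter> M)) t x \<omega> = 0" if "W \<in> \<V>" for W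
    proof -
      have W: "open W" "U (indicator (W \<inter> M)) t x = 0" using that V(1) by (auto simp: \<U>_def)
      have m: "indicat_real (W \<inter> M) \<in> borel_measurable N" using WM[OF W(1)] by simp
      have "0 \<le> F (indicator (W \<inter> M)) t x \<omega>" for \<omega> by (rule F_nonneg) simp
      moreover have "integrable marks (F (indicator (W \<inter> M)) t x)"
        by (rule F_integrable[OF m _ x, of 1]) (auto simp: indicator_def)
      ultimately show ?thesis
        using integral_nonneg_eq_0_iff_AE[of marks "F (indicator (W \<inter> M)) t x"] W(2) by (simp add: U_def)
    qed
    then have "AE \<omega> in marks. \<forall>W\<in>\<V>. F (indicator (W \<inter> M)) t x \<omega> = 0"
      using V(2) by (simp add: AE_ball_countable)
    then have "AE \<omega> in marks. F f t x \<omega> = 0"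
    proof eventually_elim
      case (elim \<omega>)
      show ?case
      proof (cases rule: F_cases[where t = t and x = x and \<omega> = \<omega>])
        case (alive y)
        have "\<not> y \<in> \<Union>\<V>" using elim alive by force
        then show ?thesis using cover[OF alive(1)] f0[OF alive(1)] V(3) by (auto simp: alive(2))
      qed simp
    qed
    then show "U f t x = 0" unfolding U_def by (rule integral_eq_zero_AE)
  qed
  then show ?thesis ..
qed

lemma K_nonneg:
  assumes "\<And>r y. y \<in> M \<Longrightarrow> 0 \<le> u r y" "x \<in> M"
  shows "0 \<le> K u t x"
  unfolding K_def set_lebesgue_integral_def
proof (rule Bochner_Integration.integral_nonneg)
  fix s
  have "0 \<le> (LINT y|Q (flow s x). u (t - s) y)"
    by (rule Bochner_Integration.integral_nonneg_AE) (use assms in \<open>auto simp: space_Q intro!: AE_I2\<close>)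
  then show "0 \<le> indicat_real {0..t} s *\<^sub>R (rate_density x s * (LINT y|Q (flow s x). u (t - s) y))"
    using rate_density_nonneg[OF assms(2)] by simp
qed

lemma U_ge_no_jump:
  assumes f: "f \<in> borel_measurable N" "\<And>y. y \<in> M \<Longrightarrow> \<bar>f y\<bar> \<le> B" and nn: "\<And>y. y \<in> M \<Longrightarrow> 0 \<le> f y"
    and x: "x \<in> M" and t: "0 \<le> t"
  shows "exp (- Lam t x) * f (flow t x) \<le> U f t x"
  using U_renewal[OF f x t] K_nonneg[of "U f" x t] U_nonneg[OF nn] x by simp

definition r1 :: real where
  "r1 = (SOME r. reach r)"

lemma r1_nonneg: "0 \<le> r1"
  and U_eq_0: "\<And>(f :: 'a \<Rightarrow> real) B x t. f \<in> borel_measurable N \<Longrightarrow> (\<And>y. y \<in> M \<Longrightarrow> \<bar>f y\<bar> \<le> B) \<Longrightarrow> x \<in> M \<Longrightarrow>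
    0 \<le> t \<Longrightarrow> t \<le> 1 \<Longrightarrow> (\<And>y. y \<in> M \<Longrightarrow> norm (y - x) \<le> r1 \<Longrightarrow> f y = 0) \<Longrightarrow> U f t x = 0"
proof -
  have r: "reach r1" unfolding r1_def by (rule someI_ex[OF ex_reach])
  then show "0 \<le> r1" by (simp add: reach_def)
  fix f :: "'a \<Rightarrow> real" and B :: real and x and t :: real
  assume "f \<in> borel_measurable N" "\<And>y. y \<in> M \<Longrightarrow> \<bar>f y\<bar> \<le> B" "x \<in> M" "0 \<le> t" "t \<le> 1"
    "\<And>y. y \<in> M \<Longrightarrow> norm (y - x) \<le> r1 \<Longrightarrow> f y = 0"
  then show "U f t x = 0" using r unfolding reach_def by blast
qed

text \<open>No jump has occurred by time \<open>t\<close> with probability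
  \<open>exp (- Lam t x) > 0\<close>, so the flow line itself must obey the displacement bound. The
  test function is the indicator of the complement of the ball.\<close>

lemma norm_flow_diff:
  assumes x: "x \<in> M" and t: "0 \<le> t" "t \<le> 1"
  shows "norm (flow t x - x) \<le> r1"
proof (rule ccontr)
  assume far: "\<not> norm (flow t x - x) \<le> r1"
  define f where "f y = (if norm (y - x) \<le> r1 then 0 else 1 :: real)" for y
  have "f \<in> borel_measurable borel" unfolding f_def by measurable
  then have m: "f \<in> borel_measurable N" by (rule measurable_restrict_space1)
  have b: "\<bar>f y\<bar> \<le> 1" "0 \<le> f y" for y by (auto simp: f_def)
  have "U f t x = 0" by (rule U_eq_0[OF m b(1) x t]) (simp add: f_def)
  moreover have "exp (- Lam t x) * f (flow t x) \<le> U f t x" by (rule U_ge_no_jump[OF m b(1,2) x t(1)])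
  ultimately show False using far by (simp add: f_def)
qed

lemma flow_cont: "continuous_on ({0..} \<times> M) (\<lambda>(t, x). flow t x)"
  using C1_on_continuous[OF flow_C1] by (rule continuous_on_eq) (auto simp: flow_eq)

lemma flow_C1_slice: "C1_on M (flow t)"
  using flow_C1_space[of "max 0 t"] by (simp add: flow_def[abs_def])

lemma compact_M_cball: "compact (M \<inter> cball 0 R)"
  using closed_M by (intro closed_Int_compact) auto

lemma norm_flow:
  assumes "x \<in> M" "0 \<le> t" "t \<le> 1"
  shows "norm (flow t x) \<le> norm x + r1" "norm x \<le> norm (flow t x) + r1"
  using norm_flow_diff[OF assms] norm_triangle_ineq2[of "flow t x" x] norm_triangle_ineq2[of x "flow t x"]
  by (auto simp: norm_minus_commute)

text \<open>Beyond radius \<open>R + r1\<close> both \<open>f x\<close> and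
  \<open>f (flow t x)\<close> vanish for times up to 1, which leaves a compact set where uniform
  continuity applies.\<close>

lemma flow_uniform:
  assumes f: "cs M R f" and e: "0 < e"
  obtains d where "0 < d" "d \<le> 1" "\<And>t x. 0 \<le> t \<Longrightarrow> t \<le> d \<Longrightarrow> x \<in> M \<Longrightarrow> \<bar>f (flow t x) - f x\<bar> \<le> e"
proof -
  let ?C = "{0..1::real} \<times> (M \<inter> cball 0 (R + r1))"
  have C: "compact ?C" by (intro compact_Times compact_M_cball) auto
  have "continuous_on ?C (\<lambda>z. f (case z of (t, x) \<Rightarrow> flow t x))"
  proof (rule continuous_on_compose2[of M f])
    show "continuous_on M f" using f by (simp add: cs_def)
    show "continuous_on ?C (\<lambda>(t, x). flow t x)" by (rule continuous_on_subset[OF flow_cont]) auto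
  qed auto
  then have "uniformly_continuous_on ?C (\<lambda>z. f (case z of (t, x) \<Rightarrow> flow t x))"
    using C by (rule compact_uniformly_continuous)
  then obtain d where d: "d > 0" "\<And>z z'. z \<in> ?C \<Longrightarrow> z' \<in> ?C \<Longrightarrow> dist z' z < d \<Longrightarrow>
    dist (f (case z' of (t, x) \<Rightarrow> flow t x)) (f (case z of (t, x) \<Rightarrow> flow t x)) < e"
    unfolding uniformly_continuous_on_def using e by meson
  show thesis
  proof (rule that[of "min 1 (d / 2)"])
    fix t x assume t: "0 \<le> t" "t \<le> min 1 (d / 2)" and x: "x \<in> M"
    show "\<bar>f (flow t x) - f x\<bar> \<le> e"
    proof (cases "norm x \<le> R + r1")
      case True
      have "dist (f (case (t, x) of (t, x) \<Rightarrow> flow t x)) (f (case (0, x) of (t, x) \<Rightarrow> flow t x)) < e"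
        by (rule d(2)) (use True t x d(1) in \<open>auto simp: dist_Pair_Pair\<close>)
      then show ?thesis using x by (simp add: dist_real_def flow_eq)
    next
      case False
      then have "f x = 0" "f (flow t x) = 0"
        using f x t r1_nonneg norm_flow(2)[OF x, of t] by (auto simp: cs_def)
      then show ?thesis using e by simp
    qed
  qed (use d in auto)
qed

lemma jump_op_abs_le:
  assumes f: "f \<in> borel_measurable N" "\<And>y. y \<in> M \<Longrightarrow> \<bar>f y\<bar> \<le> B" and x: "x \<in> M"
  shows "\<bar>jump_op lam Q f x\<bar> \<le> lam x * B"
  unfolding jump_op_def abs_mult using Q_abs_le[OF f x] lam_nonneg[OF x] by (auto intro!: mult_left_mono)

lemma jump_op_diff:
  assumes f: "f \<in> borel_measurable N" "\<And>y. y \<in> M \<Longrightarrow> \<bar>f y\<bar> \<le> B"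
    and g: "g \<in> borel_measurable N" "\<And>y. y \<in> M \<Longrightarrow> \<bar>g y\<bar> \<le> C" and x: "x \<in> M"
  shows "jump_op lam Q (\<lambda>y. a * f y + b * g y) x = a * jump_op lam Q f x + b * jump_op lam Q g x"
  using Q_integrable[OF f x] Q_integrable[OF g x] by (simp add: jump_op_def algebra_simps)

lemma rate_compact:
  obtains C where "0 \<le> C" "\<And>x. x \<in> M \<Longrightarrow> norm x \<le> R \<Longrightarrow> lam x \<le> C"
proof -
  have "bounded (lam ` (M \<inter> cball 0 R))" by (rule lam_bounded[OF compact_M_cball]) auto
  then obtain C where "\<And>x. x \<in> M \<inter> cball 0 R \<Longrightarrow> \<bar>lam x\<bar> \<le> C" unfolding bounded_iff real_norm_def by blast
  then have "lam x \<le> max 0 C" if "x \<in> M" "norm x \<le> R" for x using that by (force simp: le_max_iff_disj)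
  then show ?thesis using that[of "max 0 C"] by simp
qed

text \<open>Continuity is known for C1 functions. Uniform approximation transfers it to
  \<open>f\<close> near each \<open>p\<close>, because the rate is bounded on the ball of radius
  \<open>norm p + 1\<close>.\<close>

lemma jump_op_continuous:
  assumes f: "cs M R f" and R: "0 \<le> R"
  shows "continuous_on M (jump_op lam Q f)"
  unfolding continuous_on_iff
proof (intro ballI allI impI)
  fix p and e :: real assume p: "p \<in> M" and e: "0 < e"
  obtain C where C: "0 \<le> C" "\<And>x. x \<in> M \<Longrightarrow> norm x \<le> norm p + 1 \<Longrightarrow> lam x \<le> C" using rate_compact by metis
  define e' where "e' = e / (4 * (C + 1))"
  have e': "0 < e'" "C * e' \<le> e / 4" using e C by (auto simp: e'_def field_simps)
  obtain g where g: "g \<in> C1 M" "cs M (R + 1) g" "\<And>x. x \<in> M \<Longrightarrow> \<bar>g x - f x\<bar> \<le> e'"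
    by (rule cs_C1_dense[OF closed_M f R e'(1)]) metis
  obtain B where B: "\<And>y. y \<in> M \<Longrightarrow> \<bar>f y\<bar> \<le> B" by (rule cs_bounded[OF closed_M f]) metis
  obtain B' where B': "\<And>y. y \<in> M \<Longrightarrow> \<bar>g y\<bar> \<le> B'" by (rule cs_bounded[OF closed_M g(2)]) metis
  note fm = cs_measurable[OF f] and gm = cs_measurable[OF g(2)]
  have close: "\<bar>jump_op lam Q g x - jump_op lam Q f x\<bar> \<le> e / 4" if x: "x \<in> M" "norm x \<le> norm p + 1" for x
  proof -
    have "\<bar>jump_op lam Q (\<lambda>y. 1 * g y + (-1) * f y) x\<bar> \<le> lam x * e'"
      by (rule jump_op_abs_le) (use gm fm g(3) x in auto)
    also have "\<dots> \<le> C * e'" using C x e' by (intro mult_right_mono) auto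
    finally show ?thesis using e'(2) jump_op_diff[OF gm B' fm B x(1), of 1 "-1"] by simp
  qed
  obtain d where d: "d > 0" "\<And>x. x \<in> M \<Longrightarrow> dist x p < d \<Longrightarrow> dist (jump_op lam Q g x) (jump_op lam Q g p) < e / 4"
    using jump_cont[OF g(1)] p e unfolding continuous_on_iff by (metis divide_pos_pos zero_less_numeral)
  show "\<exists>d>0. \<forall>x\<in>M. dist x p < d \<longrightarrow> dist (jump_op lam Q f x) (jump_op lam Q f p) < e"
  proof (rule exI[of _ "min d 1"], intro conjI ballI impI)
    fix x assume x: "x \<in> M" "dist x p < min d 1"
    have "norm x \<le> norm p + 1" using x(2) norm_triangle_ineq2[of x p] by (simp add: dist_norm)
    then show "dist (jump_op lam Q f x) (jump_op lam Q f p) < e"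
    proof -
      assume "norm x \<le> norm p + 1"
      then have 1: "\<bar>jump_op lam Q g x - jump_op lam Q f x\<bar> \<le> e / 4" by (rule close[OF x(1)])
      have 2: "\<bar>jump_op lam Q g p - jump_op lam Q f p\<bar> \<le> e / 4" by (rule close[OF p]) simp
      have 3: "\<bar>jump_op lam Q g x - jump_op lam Q g p\<bar> < e / 4" using d(2)[OF x(1)] x(2) by (simp add: dist_real_def)
      show ?thesis unfolding dist_real_def using 1 2 3 e by linarith
    qed
  qed (use d in auto)
qed

end

lemma LINT_Icc_tendsto:
  fixes f :: "nat \<Rightarrow> real \<Rightarrow> real"
  assumes f: "\<And>n. f n \<in> borel_measurable borel" and g: "g \<in> borel_measurable borel"
    and C: "\<And>n s. s \<in> {a..b} \<Longrightarrow> \<bar>f n s\<bar> \<le> C"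
    and lim: "\<And>s. s \<in> {a..b} \<Longrightarrow> (\<lambda>n. f n s) \<longlonglongrightarrow> g s"
  shows "(\<lambda>n. LINT s:{a..b}|lborel. f n s) \<longlonglongrightarrow> (LINT s:{a..b}|lborel. g s)"
  unfolding set_lebesgue_integral_def
proof (rule integral_dominated_convergence[where w = "\<lambda>s. indicator {a..b} s *\<^sub>R C"])
  show "integrable lborel (\<lambda>s. indicat_real {a..b} s *\<^sub>R C)"
    using set_integrable_Icc_bounded[of "\<lambda>_. C" a b "\<bar>C\<bar>"] unfolding set_integrable_def by simp
  show "AE s in lborel. (\<lambda>n. indicat_real {a..b} s *\<^sub>R f n s) \<longlonglongrightarrow> indicat_real {a..b} s *\<^sub>R g s"
    by (intro AE_I2) (auto simp: indicator_def lim)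
  show "AE s in lborel. norm (indicat_real {a..b} s *\<^sub>R f n s) \<le> indicat_real {a..b} s *\<^sub>R C" for n
    by (intro AE_I2) (auto simp: indicator_def C)
qed (use f g in auto)

lemma LINT_Icc_const: "a \<le> b \<Longrightarrow> (LINT s:{a..b}|lborel. c :: real) = c * (b - a)"
  by (simp add: set_lebesgue_integral_def)

section \<open>Locality of the jumps\<close>

context nice_pdmp
begin

text \<open>A jump from far away into the support of \<open>v\<close> would show up in the semigroup after an arbitrarily
  short time, against the bounded displacement.\<close>

lemma jump_op_vanishes:
  assumes v: "cs M R v" and nn: "\<And>y. y \<in> M \<Longrightarrow> 0 \<le> v y" and R: "0 \<le> R" and x: "x \<in> M" and far: "R + r1 < norm x"
  shows "jump_op lam Q v x \<le> 0"
proof -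
  note vm = cs_measurable[OF v]
  obtain B where B: "0 \<le> B" "\<And>y. y \<in> M \<Longrightarrow> \<bar>v y\<bar> \<le> B" by (rule cs_bounded[OF closed_M v]) metis
  obtain C where C: "0 \<le> C" "\<And>x. x \<in> M \<Longrightarrow> norm x \<le> R + 2 * r1 \<Longrightarrow> lam x \<le> C" using rate_compact by metis
  \<comment> \<open>The slack 2 * \<eta> pays for replacing \<open>v\<close> by \<open>U v\<close>
    after a jump: one \<eta> for the motion along the flow and one for a further jump. It carries
    the factor \<open>lam x\<close> because the replacement takes place under the jump
    integral.\<close>
  have small: "jump_op lam Q v x \<le> 2 * \<eta> * lam x" if \<eta>: "0 < \<eta>" for \<eta>
  proof (rule ccontr)
    assume "\<not> jump_op lam Q v x \<le> 2 * \<eta> * lam x"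
    define k where "k y = jump_op lam Q v y - 2 * \<eta> * lam y" for y
    have k0: "0 < k x" using \<open>\<not> _\<close> by (simp add: k_def)
    have kc: "continuous_on M k"
      unfolding k_def by (intro continuous_intros jump_op_continuous[OF v R] lam_cont)
    have "continuous_on {0..} (\<lambda>s. k (flow s x))"
      by (rule continuous_on_compose2[OF kc flow_continuous_time[OF x]]) (use x in auto)
    moreover have "k (flow 0 x) = k x" using x by (simp add: flow_eq)
    ultimately obtain d1 where d1: "d1 > 0" "\<And>s. 0 \<le> s \<Longrightarrow> s < d1 \<Longrightarrow> \<bar>k (flow s x) - k x\<bar> < k x / 2"
      using k0 unfolding continuous_on_iff dist_real_def
      by (metis abs_of_nonneg atLeast_iff diff_zero half_gt_zero_iff order_refl)
    obtain d2 where d2: "0 < d2" "d2 \<le> 1" "\<And>t x. 0 \<le> t \<Longrightarrow> t \<le> d2 \<Longrightarrow> x \<in> M \<Longrightarrow> \<bar>v (flow t x) - v x\<bar> \<le> \<eta>"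
      by (rule flow_uniform[OF v \<eta>]) metis
    \<comment> \<open>Up to time \<open>d3\<close> the hazard is at most \<open>C * d3\<close>, so
      the loss caused by a further jump is at most \<open>C * d3 * B \<le> \<eta>\<close>.\<close>
    define d3 where "d3 = \<eta> / (C * B + 1)"
    have d3: "0 < d3" "d3 * (C * B) \<le> \<eta>"
    proof -
      have "0 < C * B + 1" using C B by (simp add: add_nonneg_pos)
      then show "0 < d3" "d3 * (C * B) \<le> \<eta>" using \<eta> by (auto simp: d3_def field_simps)
    qed
    have lower: "v y - 2 * \<eta> \<le> U v h y" if h: "0 \<le> h" "h \<le> d2" "h \<le> d3" and y: "y \<in> M" for h y
    proof (cases "norm y \<le> R + r1")
      case False
      then have "v y = 0" using v y r1_nonneg by (auto simp: cs_def)
      then show ?thesis using U_nonneg[of v h y, OF nn] \<eta> by linarith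
    next
      case True
      have h1: "h \<le> 1" using h d2 by simp
      have "\<bar>LINT s:{0..h}|lborel. lam (flow s y)\<bar> \<le> C * (h - 0)"
      proof (rule LINT_Icc_le[OF rate_measurable[OF y]])
        fix s assume s: "s \<in> {0..h}"
        have "norm (flow s y) \<le> R + 2 * r1" using norm_flow(1)[OF y, of s] s h1 True by auto
        then show "\<bar>lam (flow s y)\<bar> \<le> C" using C(2)[of "flow s y"] lam_nonneg[of "flow s y"] y by simp
      qed (use h in simp)
      then have "Lam h y \<le> C * h" using Lam_nonneg[OF y, of h] by (simp add: Lam_def)
      also have "\<dots> \<le> C * d3" using C h by (intro mult_left_mono) auto
      finally have L: "Lam h y \<le> C * d3" .
      have "Lam h y * v (flow h y) \<le> (C * d3) * B"
        using L C d3 B(1) B(2)[of "flow h y"] nn[of "flow h y"] y by (intro mult_mono) auto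
      then have "Lam h y * v (flow h y) \<le> \<eta>" using d3(2) by (simp add: mult.commute mult.left_commute)
      moreover have "(1 - Lam h y) * v (flow h y) \<le> exp (- Lam h y) * v (flow h y)"
        using exp_ge_add_one_self[of "- Lam h y"] nn[of "flow h y"] y by (intro mult_right_mono) auto
      moreover have "exp (- Lam h y) * v (flow h y) \<le> U v h y" by (rule U_ge_no_jump[OF vm B(2) nn y h(1)])
      moreover have "\<bar>v (flow h y) - v y\<bar> \<le> \<eta>" by (rule d2(3)[OF h(1,2) y])
      ultimately show ?thesis by (simp add: algebra_simps)
    qed
    define t where "t = min (d1 / 2) (min d2 d3)"
    have t: "0 < t" "t < d1" "t \<le> d2" "t \<le> d3" "t \<le> 1" using d1 d2 d3 by (auto simp: t_def)
    have "U v t x = 0"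
    proof (rule U_eq_0[OF vm B(2) x])
      fix y assume y: "y \<in> M" "norm (y - x) \<le> r1"
      then have "R < norm y" using far norm_triangle_ineq2[of x y] by (simp add: norm_minus_commute)
      then show "v y = 0" using v y by (simp add: cs_def)
    qed (use t in auto)
    moreover have "0 \<le> exp (- Lam t x) * v (flow t x)" using nn x by simp
    ultimately have "K (U v) t x \<le> 0" using U_renewal[OF vm B(2) x, of t] t by linarith
    \<comment> \<open>By continuity \<open>k\<close> stays above half its value at \<open>x\<close>
      along the flow until \<open>t\<close>, which forces a contribution of first jumps proportional
      to \<open>t\<close>. The support of \<open>v\<close> being farther than \<open>r1\<close> from
      \<open>x\<close>, the renewal equation has just shown this contribution to be
      nonpositive.\<close>
    moreover have "exp (- Lam t x) * (k x / 2) * t \<le> K (U v) t x"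
    proof -
      have "(LINT s:{0..t}|lborel. exp (- Lam t x) * (k x / 2)) \<le> (LINT s:{0..t}|lborel. rate_density x s * q (U v) x t s)"
      proof (rule LINT_Icc_mono)
        show "set_integrable lborel {0..t} (\<lambda>s. exp (- Lam t x) * (k x / 2))"
          by (rule set_integrable_Icc_bounded[where C = "\<bar>exp (- Lam t x) * (k x / 2)\<bar>"]) auto
        show "set_integrable lborel {0..t} (\<lambda>s. rate_density x s * q (U v) x t s)"
          by (rule K_integrand(3)[OF bdd_U[OF vm B(2)] x order_refl]) auto
        fix s assume s: "s \<in> {0..t}"
        have fM: "flow s x \<in> M" using x by simp
        have "(LINT y|Q (flow s x). v y) - 2 * \<eta> \<le> q (U v) x t s"
        proof -
          interpret Qx: prob_space "Q (flow s x)" by (rule Q_prob[OF fM])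
          have "integrable (Q (flow s x)) v" by (rule Q_integrable[OF vm B(2) fM])
          moreover have "integrable (Q (flow s x)) (U v (t - s))"
            by (rule Q_integrable[OF U_slice[OF vm B(2)] U_abs_le[OF B(2,1)] fM])
          ultimately have "(LINT y|Q (flow s x). v y - 2 * \<eta>) \<le> q (U v) x t s"
            unfolding q_def by (intro integral_mono lower) (use s t in \<open>auto simp: space_Q[OF fM]\<close>)
          then show ?thesis using \<open>integrable (Q (flow s x)) v\<close> Qx.prob_space by simp
        qed
        then have "lam (flow s x) * ((LINT y|Q (flow s x). v y) - 2 * \<eta>) \<le> lam (flow s x) * q (U v) x t s"
          by (rule mult_left_mono[OF _ lam_nonneg[OF fM]])
        then have "k (flow s x) \<le> lam (flow s x) * q (U v) x t s"
          by (simp add: k_def jump_op_def algebra_simps)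
        moreover have "k x / 2 \<le> k (flow s x)" using d1(2)[of s] s t unfolding abs_less_iff by auto
        ultimately have "exp (- Lam t x) * (k x / 2) \<le> exp (- Lam s x) * (lam (flow s x) * q (U v) x t s)"
          using Lam_mono[OF x, of s t] s k0 by (intro mult_mono) auto
        then show "exp (- Lam t x) * (k x / 2) \<le> rate_density x s * q (U v) x t s"
          by (simp add: rate_density_def mult.assoc mult.left_commute)
      qed
      then show ?thesis using t LINT_Icc_const[of 0 t] by (simp only: K_eq) simp
    qed
    moreover have "0 < exp (- Lam t x) * (k x / 2) * t" using k0 t by simp
    ultimately show False by simp
  qed
  show ?thesis
  proof (rule field_le_epsilon)
    fix e :: real assume e: "0 < e"
    have l: "0 \<le> lam x" by (rule lam_nonneg[OF x])
    have "jump_op lam Q v x \<le> 2 * (e / (2 * (lam x + 1))) * lam x" by (rule small) (use e l in auto)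
    also have "\<dots> \<le> e" using e l by (simp add: field_simps)
    finally show "jump_op lam Q v x \<le> 0 + e" by simp
  qed
qed

lemma jump_op_cs:
  assumes v: "cs M R v" and R: "0 \<le> R"
  shows "cs M (R + r1) (jump_op lam Q v)"
  unfolding cs_def
proof (intro conjI ballI impI jump_op_continuous[OF v R])
  fix x assume x: "x \<in> M" and far: "R + r1 < norm x"
  obtain B where B: "0 \<le> B" "\<And>y. y \<in> M \<Longrightarrow> \<bar>v y\<bar> \<le> B" by (rule cs_bounded[OF closed_M v]) metis
  have va: "cs M R (\<lambda>y. \<bar>v y\<bar>)" using v by (auto simp: cs_def intro!: continuous_intros)
  have "\<bar>jump_op lam Q v x\<bar> \<le> jump_op lam Q (\<lambda>y. \<bar>v y\<bar>) x"
    unfolding jump_op_def abs_mult using lam_nonneg[OF x] integral_abs_bound[of "Q x" v] by (auto intro!: mult_left_mono)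
  also have "\<dots> \<le> 0" by (rule jump_op_vanishes[OF va _ R x far]) simp
  finally show "jump_op lam Q v x = 0" by simp
qed

definition jmp :: "('a \<Rightarrow> real) \<Rightarrow> 'a \<Rightarrow> real" where
  "jmp v x = lam x * ((LINT y|Q x. v y) - v x)"

lemma jmp_eq: "jmp v x = jump_op lam Q v x - lam x * v x"
  by (simp add: jmp_def jump_op_def algebra_simps)

lemma jmp_cs:
  assumes v: "cs M R v" and R: "0 \<le> R"
  shows "cs M (R + r1) (jmp v)"
proof -
  have "cs M (R + r1) (\<lambda>x. lam x * v x)"
    using v lam_cont r1_nonneg by (auto simp: cs_def intro!: continuous_intros)
  from cs_lin[OF jump_op_cs[OF v R] this, of 1 "-1"] show ?thesis by (simp add: jmp_eq[abs_def])
qed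

lemma jmp_diff:
  assumes f: "f \<in> borel_measurable N" "\<And>y. y \<in> M \<Longrightarrow> \<bar>f y\<bar> \<le> B"
    and g: "g \<in> borel_measurable N" "\<And>y. y \<in> M \<Longrightarrow> \<bar>g y\<bar> \<le> C" and x: "x \<in> M"
  shows "jmp (\<lambda>y. a * f y + b * g y) x = a * jmp f x + b * jmp g x"
  using Q_integrable[OF f x] Q_integrable[OF g x] by (simp add: jmp_def algebra_simps)

lemma jmp_abs_le:
  assumes f: "f \<in> borel_measurable N" "\<And>y. y \<in> M \<Longrightarrow> \<bar>f y\<bar> \<le> B" and x: "x \<in> M"
  shows "\<bar>jmp f x\<bar> \<le> lam x * (2 * B)"
proof -
  have "\<bar>(LINT y|Q x. f y) - f x\<bar> \<le> 2 * B" using Q_abs_le[OF f x] f(2)[OF x] by linarith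
  then show ?thesis unfolding jmp_def abs_mult using lam_nonneg[OF x] by (auto intro!: mult_left_mono)
qed

lemma U_vanishes:
  assumes f: "cs M R f" and x: "x \<in> M" "R + r1 < norm x" and t: "0 \<le> t" "t \<le> 1"
  shows "U f t x = 0"
proof -
  obtain B where B: "0 \<le> B" "\<And>y. y \<in> M \<Longrightarrow> \<bar>f y\<bar> \<le> B" by (rule cs_bounded[OF closed_M f]) metis
  show ?thesis
  proof (rule U_eq_0[OF cs_measurable[OF f] B(2) x(1) t])
    fix y assume y: "y \<in> M" "norm (y - x) \<le> r1"
    then have "R < norm y" using x(2) norm_triangle_ineq2[of x y] by (simp add: norm_minus_commute)
    then show "f y = 0" using f y by (simp add: cs_def)
  qed
qed

section \<open>Continuity of the semigroup in space\<close>

lemma sequence_rate_bounded: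
  assumes X: "\<And>n. X n \<in> M" and lim: "X \<longlonglongrightarrow> p"
  obtains C where "0 \<le> C" "\<And>n s. s \<in> {0..1} \<Longrightarrow> \<bar>lam (flow s (X n))\<bar> \<le> C"
proof -
  obtain \<rho> where \<rho>: "\<And>n. norm (X n) \<le> \<rho>"
    using convergent_imp_Bseq[of X] lim by (auto simp: convergent_def Bseq_def)
  obtain C where C: "0 \<le> C" "\<And>x. x \<in> M \<Longrightarrow> norm x \<le> \<rho> + r1 \<Longrightarrow> lam x \<le> C" using rate_compact by metis
  have "\<bar>lam (flow s (X n))\<bar> \<le> C" if "s \<in> {0..1}" for n s
    using C(2)[of "flow s (X n)"] norm_flow(1)[OF X[of n], of s] \<rho>[of n] that lam_nonneg[of "flow s (X n)"] X[of n] by auto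
  with C(1) that show thesis by blast
qed

lemma tendsto_on_M:
  assumes "continuous_on M h" "\<And>n. X n \<in> M" "X \<longlonglongrightarrow> p" "p \<in> M"
  shows "(\<lambda>n. h (X n)) \<longlonglongrightarrow> h p"
  by (rule continuous_on_tendsto_compose[OF assms(1,3,4)]) (use assms(2) in auto)

lemma Lam_tendsto:
  assumes X: "\<And>n. X n \<in> M" and lim: "X \<longlonglongrightarrow> p" and p: "p \<in> M" and t: "t \<le> 1"
  shows "(\<lambda>n. Lam t (X n)) \<longlonglongrightarrow> Lam t p"
proof -
  obtain C where C: "0 \<le> C" "\<And>n s. s \<in> {0..1} \<Longrightarrow> \<bar>lam (flow s (X n))\<bar> \<le> C"
    by (rule sequence_rate_bounded[OF X lim]) metis
  show ?thesis unfolding Lam_def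
  proof (rule LINT_Icc_tendsto[OF rate_measurable[OF X] rate_measurable[OF p]])
    show "\<bar>lam (flow s (X n))\<bar> \<le> C" if "s \<in> {0..t}" for n s using C(2) that t by auto
    show "(\<lambda>n. lam (flow s (X n))) \<longlonglongrightarrow> lam (flow s p)" for s
      by (rule tendsto_on_M[OF lam_cont _ tendsto_on_M[OF flow_continuous_space X lim p]]) (use X p in auto)
  qed
qed

text \<open>Argued along sequences, so that dominated convergence applies: a convergent sequence
  stays in a ball, on which flow and rate are bounded up to time 1.\<close>

lemma K_continuous:
  assumes v: "bdd 1 v" and cs: "\<And>s. s \<in> {0..1} \<Longrightarrow> cs M R (v s)" and R: "0 \<le> R" and t: "t \<in> {0..1}"
  shows "continuous_on M (K v t)"
  unfolding continuous_on_sequentially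
proof (intro ballI allI impI)
  fix p X assume p: "p \<in> M" and "(\<forall>n. X n \<in> M) \<and> X \<longlonglongrightarrow> p"
  then have X: "\<And>n. X n \<in> M" and lim: "X \<longlonglongrightarrow> p" by auto
  obtain C where C: "0 \<le> C" "\<And>n s. s \<in> {0..1} \<Longrightarrow> \<bar>lam (flow s (X n))\<bar> \<le> C"
    by (rule sequence_rate_bounded[OF X lim]) metis
  obtain B where B: "0 \<le> B" "\<And>r y. r \<in> {0..1} \<Longrightarrow> y \<in> M \<Longrightarrow> \<bar>v r y\<bar> \<le> B" using bdd_bound[OF v] by metis
  have t1: "t \<le> 1" using t by simp
  have eq: "rate_density y s * q v y t s = exp (- Lam s y) * jump_op lam Q (v (t - s)) (flow s y)" for y s
    by (simp add: rate_density_def q_def jump_op_def)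
  have "(\<lambda>n. LINT s:{0..t}|lborel. rate_density (X n) s * q v (X n) t s) \<longlonglongrightarrow> (LINT s:{0..t}|lborel. rate_density p s * q v p t s)"
  proof (rule LINT_Icc_tendsto[OF K_integrand(1)[OF v X t1] K_integrand(1)[OF v p t1], where C = "C * B"])
    fix n s assume s: "s \<in> {0..t}"
    have "\<bar>rate_density (X n) s\<bar> \<le> C * 1"
      unfolding rate_density_def abs_mult using C s t Lam_nonneg[OF X, of s n] by (intro mult_mono) auto
    then show "\<bar>rate_density (X n) s * q v (X n) t s\<bar> \<le> C * B"
      unfolding abs_mult using q_abs_le[OF v B(2) X, of s t n] s t C(1) by (intro mult_mono) auto
  next
    fix s assume s: "s \<in> {0..t}"
    have "continuous_on M (jump_op lam Q (v (t - s)))" by (rule jump_op_continuous[OF cs R]) (use s t in auto)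
    then have "(\<lambda>n. jump_op lam Q (v (t - s)) (flow s (X n))) \<longlonglongrightarrow> jump_op lam Q (v (t - s)) (flow s p)"
      by (rule tendsto_on_M[OF _ _ tendsto_on_M[OF flow_continuous_space X lim p]]) (use X p in auto)
    then show "(\<lambda>n. rate_density (X n) s * q v (X n) t s) \<longlonglongrightarrow> rate_density p s * q v p t s"
      unfolding eq by (intro tendsto_intros Lam_tendsto[OF X lim p]) (use s t in auto)
  qed
  then show "((K v t) \<circ> X) \<longlonglongrightarrow> K v t p" by (simp add: K_eq comp_def)
qed

text \<open>The n-th iterate is the contribution to \<open>U f t x\<close> of the paths with at most
  \<open>n\<close> jumps by time \<open>t\<close>.\<close>

primrec picard :: "('a \<Rightarrow> real) \<Rightarrow> nat \<Rightarrow> real \<Rightarrow> 'a \<Rightarrow> real" where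
  "picard f 0 = (\<lambda>t x. exp (- Lam t x) * f (flow t x))"
| "picard f (Suc n) = (\<lambda>t x. exp (- Lam t x) * f (flow t x) + K (picard f n) t x)"

text \<open>The claims need one joint induction: continuity of \<open>K (picard f n)\<close>
  requires a support radius for \<open>picard f n\<close>, and this comes from domination by
  \<open>U f\<close>, which vanishes beyond \<open>R + r1\<close>. The radius thus does not grow
  with \<open>n\<close>. What is missing from \<open>U f\<close> is at most \<open>B\<close> times
  the probability of \<open>n + 1\<close> jumps.\<close>

lemma picard_props:
  assumes f: "cs M R f" and R: "0 \<le> R" and B: "0 \<le> B" "\<And>y. y \<in> M \<Longrightarrow> \<bar>f y\<bar> \<le> B" and nn: "\<And>y. y \<in> M \<Longrightarrow> 0 \<le> f y"
  shows "bdd 1 (picard f n) \<and> (\<forall>t\<in>{0..1}. cs M (R + r1) (picard f n t) \<and>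
    (\<forall>x\<in>M. 0 \<le> picard f n t x \<and> picard f n t x \<le> U f t x \<and> U f t x - picard f n t x \<le> B * V (Suc n) t x))"
proof -
  note fm = cs_measurable[OF f]
  have bU: "bdd 1 (U f)" by (rule bdd_U[OF fm B(2)])
  have R': "0 \<le> R + r1" using R r1_nonneg by simp
  let ?init = "\<lambda>t x. exp (- Lam t x) * f (flow t x)"
  have b0: "bdd 1 ?init"
  proof (rule bddI[where B = B])
    have "(\<lambda>z. f (flow (fst z) (snd z))) \<in> borel_measurable (borel \<Otimes>\<^sub>M N)"
      by (rule measurable_compose[OF _ fm]) simp
    then show "(\<lambda>(t, x). ?init t x) \<in> borel_measurable (borel \<Otimes>\<^sub>M N)" unfolding split_beta' by simp
    show "\<bar>?init t y\<bar> \<le> B" if "y \<in> M" for t y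
      unfolding abs_mult using Lam_nonneg[OF that, of t] B(2)[of "flow t y"] that B(1)
      by (intro mult_left_le_one_le[THEN order_trans]) auto
  qed
  have c0: "continuous_on M (?init t)" if t: "t \<in> {0..1}" for t
    unfolding continuous_on_sequentially
  proof (intro ballI allI impI)
    fix p X assume p: "p \<in> M" and "(\<forall>n. X n \<in> M) \<and> X \<longlonglongrightarrow> p"
    then have X: "\<And>n. X n \<in> M" and lim: "X \<longlonglongrightarrow> p" by auto
    have "continuous_on M f" using f by (simp add: cs_def)
    then have "(\<lambda>n. f (flow t (X n))) \<longlonglongrightarrow> f (flow t p)"
      by (rule tendsto_on_M[OF _ _ tendsto_on_M[OF flow_continuous_space X lim p]]) (use X p in auto)
    then show "(?init t \<circ> X) \<longlonglongrightarrow> ?init t p"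
      unfolding comp_def by (intro tendsto_intros Lam_tendsto[OF X lim p]) (use t in auto)
  qed
  have ren: "U f t x = ?init t x + K (U f) t x" if "t \<in> {0..1}" "x \<in> M" for t x
    by (rule U_renewal[OF fm B(2) that(2)]) (use that in auto)
  have van: "U f t x = 0" if "t \<in> {0..1}" "x \<in> M" "R + r1 < norm x" for t x
    by (rule U_vanishes[OF f that(2,3)]) (use that(1) in auto)
  have conv: "cs M (R + r1) u" if "continuous_on M u" "t \<in> {0..1}" "\<And>x. x \<in> M \<Longrightarrow> 0 \<le> u x \<and> u x \<le> U f t x" for u t
    unfolding cs_def
  proof (intro conjI ballI impI that(1))
    fix x assume x: "x \<in> M" "R + r1 < norm x"
    show "u x = 0" using that(3)[OF x(1)] van[OF that(2) x] by simp
  qed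
  show ?thesis
  proof (induction n)
    case 0
    have bounds: "0 \<le> ?init t x \<and> ?init t x \<le> U f t x \<and> U f t x - ?init t x \<le> B * V (Suc 0) t x"
      if t: "t \<in> {0..1}" and x: "x \<in> M" for t x
    proof -
      have "K (U f) t x \<le> K (\<lambda>t x. B * V 0 t x + 0 * V 0 t x) t x"
      proof (rule K_mono[OF bU bdd_lin[OF bdd_V bdd_V] _ x])
        fix r y assume "r \<in> {0..t}" "y \<in> M"
        then show "U f r y \<le> B * V 0 r y + 0 * V 0 r y"
          using U_abs_le[of f B r y, OF B(2,1)] by (simp add: V_0 abs_le_iff)
      qed (use t in simp)
      also have "\<dots> = B * V (Suc 0) t x"
        using t x by (subst K_lin[OF bdd_V bdd_V x, of t 1]) (auto simp: V_Suc)
      finally have "K (U f) t x \<le> B * V (Suc 0) t x" .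
      moreover have "0 \<le> K (U f) t x" by (rule K_nonneg[OF U_nonneg[of f, OF nn] x])
      moreover have "0 \<le> ?init t x" using nn x by simp
      ultimately show ?thesis using ren[OF t x] by linarith
    qed
    have "cs M (R + r1) (?init t)" if t: "t \<in> {0..1}" for t
      by (rule conv[OF c0[OF t] t]) (use bounds[OF t] in blast)
    then show ?case unfolding picard.simps using b0 bounds by blast
  next
    case (Suc n)
    let ?p = "picard f n"
    let ?u = "\<lambda>t x. ?init t x + K ?p t x"
    have bp: "bdd 1 ?p" using Suc by blast
    have p: "\<And>t. t \<in> {0..1} \<Longrightarrow> cs M (R + r1) (?p t)"
      "\<And>t x. t \<in> {0..1} \<Longrightarrow> x \<in> M \<Longrightarrow> 0 \<le> ?p t x"
      "\<And>t x. t \<in> {0..1} \<Longrightarrow> x \<in> M \<Longrightarrow> ?p t x \<le> U f t x"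
      "\<And>t x. t \<in> {0..1} \<Longrightarrow> x \<in> M \<Longrightarrow> U f t x - ?p t x \<le> B * V (Suc n) t x"
      using Suc by blast+
    have bounds: "0 \<le> ?u t x \<and> ?u t x \<le> U f t x \<and> U f t x - ?u t x \<le> B * V (Suc (Suc n)) t x"
      if t: "t \<in> {0..1}" and x: "x \<in> M" for t x
    proof -
      have t1: "t \<le> 1" using t by simp
      have "K ?p t x \<le> K (U f) t x" by (rule K_mono[OF bp bU p(3) x t1]) (use t in auto)
      moreover have "K (\<lambda>t x. 0 * V 0 t x + 0 * V 0 t x) t x \<le> K ?p t x"
        by (rule K_mono[OF bdd_lin[OF bdd_V bdd_V] bp _ x t1]) (use t p(2) in auto)
      then have "0 \<le> K ?p t x" using K_lin[OF bdd_V bdd_V x t1, of 0 0 0 0] by simp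
      moreover have "K (\<lambda>t x. 1 * U f t x + (-1) * ?p t x) t x \<le> K (\<lambda>t x. B * V (Suc n) t x + 0 * V 0 t x) t x"
        by (rule K_mono[OF bdd_lin[OF bU bp] bdd_lin[OF bdd_V bdd_V] _ x t1]) (use t p(4) in auto)
      then have "K (U f) t x - K ?p t x \<le> B * V (Suc (Suc n)) t x"
        using K_lin[OF bU bp x t1, of 1 "-1"] K_lin[OF bdd_V bdd_V x t1, of B "Suc n" 0 0] V_Suc[OF x, of t "Suc n"] t by simp
      moreover have "0 \<le> ?init t x" using nn x by simp
      ultimately show ?thesis using ren[OF t x] by linarith
    qed
    have "continuous_on M (?u t)" if t: "t \<in> {0..1}" for t
      by (intro continuous_on_add c0[OF t] K_continuous[OF bp p(1) R' t])
    then have "cs M (R + r1) (?u t)" if t: "t \<in> {0..1}" for t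
      by (rule conv) (use bounds[OF t] t in blast)+
    moreover have "bdd 1 ?u"
    proof (rule bddI[where B = B])
      have "(\<lambda>z. ?init (fst z) (snd z)) \<in> borel_measurable (borel \<Otimes>\<^sub>M N)"
        using b0 by (simp add: bdd_def split_beta')
      moreover have "(\<lambda>z. K ?p (fst z) (snd z)) \<in> borel_measurable (borel \<Otimes>\<^sub>M N)"
        using K_measurable[OF bp] by (simp add: split_beta')
      ultimately show "(\<lambda>(t, x). ?u t x) \<in> borel_measurable (borel \<Otimes>\<^sub>M N)"
        unfolding split_beta' by (rule borel_measurable_add)
      show "\<bar>?u t y\<bar> \<le> B" if "t \<in> {0..1}" "y \<in> M" for t y
        using bounds[OF that] U_abs_le[of f B t y, OF B(2,1)] by linarith
    qed
    ultimately show ?case unfolding picard.simps using bounds by blast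
  qed
qed

text \<open>The iterates are continuous minorants of \<open>U f t\<close>, and the error is made
  small at \<open>p\<close> alone. Control at a single point suffices for the lower half of
  continuity.\<close>

lemma U_lower_semicontinuous:
  assumes f: "cs M R f" and R: "0 \<le> R" and nn: "\<And>y. y \<in> M \<Longrightarrow> 0 \<le> f y" and t: "t \<in> {0..1}"
    and p: "p \<in> M" and e: "0 < e"
  shows "\<exists>d>0. \<forall>x\<in>M. dist x p < d \<longrightarrow> U f t p - e < U f t x"
proof -
  obtain B where B: "0 \<le> B" "\<And>y. y \<in> M \<Longrightarrow> \<bar>f y\<bar> \<le> B" by (rule cs_bounded[OF closed_M f]) metis
  note pic = picard_props[OF f R B nn]
  have "(\<lambda>n. B * V (Suc n) t p) \<longlonglongrightarrow> B * 0"
    by (intro tendsto_intros LIMSEQ_Suc V_tendsto_0[OF p]) (use t in auto)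
  then have "eventually (\<lambda>n. B * V (Suc n) t p < e / 2) sequentially"
    using e by (intro order_tendstoD) auto
  then obtain n where n: "B * V (Suc n) t p < e / 2" unfolding eventually_sequentially by auto
  have c: "continuous_on M (picard f n t)" using pic t by (auto simp: cs_def)
  obtain d where d: "d > 0" "\<And>x. x \<in> M \<Longrightarrow> dist x p < d \<Longrightarrow> dist (picard f n t x) (picard f n t p) < e / 2"
    using c p e unfolding continuous_on_iff by (meson half_gt_zero)
  have "U f t p - e < U f t x" if x: "x \<in> M" "dist x p < d" for x
  proof -
    have "U f t p - picard f n t p \<le> B * V (Suc n) t p" "picard f n t x \<le> U f t x" using pic t p x(1) by blast+
    moreover have "\<bar>picard f n t x - picard f n t p\<bar> < e / 2" using d(2)[OF x] by (simp add: dist_real_def)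
    ultimately show ?thesis using n by linarith
  qed
  with d(1) show ?thesis by blast
qed

text \<open>Upper semicontinuity follows from lower semicontinuity of the semigroup at \<open>g - f\<close>, where the
  cutoff \<open>g\<close> equals the constant \<open>B\<close> on everything that can be reached from near \<open>p\<close>.\<close>

lemma U_continuous_nonneg:
  assumes f: "cs M R f" and R: "0 \<le> R" and nn: "\<And>y. y \<in> M \<Longrightarrow> 0 \<le> f y" and t: "t \<in> {0..1}"
  shows "continuous_on M (U f t)"
  unfolding continuous_on_iff
proof (intro ballI allI impI)
  fix p and e :: real assume p: "p \<in> M" and e: "0 < e"
  obtain B where B: "0 \<le> B" "\<And>y. y \<in> M \<Longrightarrow> \<bar>f y\<bar> \<le> B" by (rule cs_bounded[OF closed_M f]) metis
  note fm = cs_measurable[OF f]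
  \<comment> \<open>Large enough that \<open>g\<close> dominates \<open>f\<close>, and that
    \<open>g\<close> equals \<open>B\<close> at every point within \<open>r1\<close> of the unit
    ball about \<open>p\<close>.\<close>
  define \<rho> where "\<rho> = max R (norm p + 1 + r1)"
  define g where "g y = B * max 0 (min 1 (\<rho> + 1 - norm y))" for y :: 'a
  have g: "cs M (\<rho> + 1) g" unfolding cs_def g_def by (auto intro!: continuous_intros)
  have g1: "g y = B" if "norm y \<le> \<rho>" for y using that by (simp add: g_def)
  have gB: "\<bar>g y\<bar> \<le> B" "0 \<le> g y" for y
    using B(1) by (auto simp: g_def abs_mult intro!: mult_left_le)
  have gf: "0 \<le> g y - f y" if y: "y \<in> M" for y
  proof (cases "norm y \<le> R")
    case True
    then show ?thesis using g1[of y] B(2)[OF y] by (auto simp: \<rho>_def)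
  next
    case False
    then show ?thesis using f y gB(2)[of y] by (auto simp: cs_def)
  qed
  have \<rho>R: "R \<le> \<rho> + 1" "0 \<le> \<rho> + 1" using R by (auto simp: \<rho>_def)
  note gm = cs_measurable[OF g]
  have h: "cs M (\<rho> + 1) (\<lambda>y. 1 * g y + (-1) * f y)" by (rule cs_lin[OF g cs_mono[OF f \<rho>R(1)]])
  have sum: "U f t x + U (\<lambda>y. 1 * g y + (-1) * f y) t x = B" if x: "x \<in> M" "dist x p < 1" for x
  proof -
    have cB: "(\<lambda>_. B) \<in> borel_measurable N" by simp
    have "U (\<lambda>y. 1 * B + (-1) * g y) t x = 0"
    proof (rule U_eq_0[of _ "2 * B", OF _ _ x(1)])
      show "(\<lambda>y. 1 * B + - 1 * g y) \<in> borel_measurable N" using gm by simp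
      show "\<bar>1 * B + - 1 * g y\<bar> \<le> 2 * B" for y using gB[of y] by auto
      fix y assume "norm (y - x) \<le> r1"
      moreover have "norm x \<le> norm p + 1" using x(2) norm_triangle_ineq2[of x p] by (simp add: dist_norm)
      ultimately have "norm y \<le> \<rho>" using norm_triangle_ineq2[of y x] by (simp add: \<rho>_def)
      then show "1 * B + - 1 * g y = 0" using g1 by simp
    qed (use t in auto)
    moreover have "U (\<lambda>y. 1 * B + (-1) * g y) t x = 1 * U (\<lambda>_. B) t x + (-1) * U g t x"
      by (rule U_lin[OF cB _ gm gB(1), where B = B]) (use t x B in auto)
    ultimately have "U g t x = B" using U_const[of t x B] t x by simp
    moreover have "U (\<lambda>y. 1 * g y + (-1) * f y) t x = 1 * U g t x + (-1) * U f t x"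
      by (rule U_lin[OF gm gB(1) fm B(2)]) (use t x in auto)
    ultimately show ?thesis by simp
  qed
  obtain d1 where d1: "d1 > 0" "\<And>x. x \<in> M \<Longrightarrow> dist x p < d1 \<Longrightarrow> U f t p - e < U f t x"
    using U_lower_semicontinuous[OF f R nn t p e] by blast
  obtain d2 where d2: "d2 > 0" "\<And>x. x \<in> M \<Longrightarrow> dist x p < d2 \<Longrightarrow>
      U (\<lambda>y. 1 * g y + (-1) * f y) t p - e < U (\<lambda>y. 1 * g y + (-1) * f y) t x"
    using U_lower_semicontinuous[OF h \<rho>R(2) _ t p e] gf by auto
  show "\<exists>d>0. \<forall>x\<in>M. dist x p < d \<longrightarrow> dist (U f t x) (U f t p) < e"
  proof (rule exI[of _ "min 1 (min d1 d2)"], intro conjI ballI impI)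
    fix x assume x: "x \<in> M" "dist x p < min 1 (min d1 d2)"
    have "U f t p - e < U f t x" using d1(2)[OF x(1)] x(2) by simp
    moreover have "U (\<lambda>y. 1 * g y + (-1) * f y) t p - e < U (\<lambda>y. 1 * g y + (-1) * f y) t x" using d2(2)[OF x(1)] x(2) by simp
    moreover have "U f t x + U (\<lambda>y. 1 * g y + (-1) * f y) t x = B" by (rule sum[OF x(1)]) (use x in simp)
    moreover have "U f t p + U (\<lambda>y. 1 * g y + (-1) * f y) t p = B" by (rule sum[OF p]) simp
    ultimately show "dist (U f t x) (U f t p) < e" unfolding dist_real_def by linarith
  qed (use d1 d2 in auto)
qed

lemma U_cs_1:
  assumes f: "cs M R f" and R: "0 \<le> R" and t: "0 \<le> t" "t \<le> 1"
  shows "cs M (R + r1) (U f t)"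
  unfolding cs_def
proof (intro conjI ballI impI)
  have t': "t \<in> {0..1}" using t by simp
  obtain B where B: "0 \<le> B" "\<And>y. y \<in> M \<Longrightarrow> \<bar>f y\<bar> \<le> B" by (rule cs_bounded[OF closed_M f]) metis
  have fp: "cs M R (\<lambda>y. max 0 (f y))" and fn: "cs M R (\<lambda>y. max 0 (- f y))"
    using f by (auto simp: cs_def intro!: continuous_intros)
  have "continuous_on M (\<lambda>x. 1 * U (\<lambda>y. max 0 (f y)) t x + (-1) * U (\<lambda>y. max 0 (- f y)) t x)"
    by (intro continuous_on_add continuous_on_mult continuous_on_const U_continuous_nonneg[OF fp R _ t'] U_continuous_nonneg[OF fn R _ t']) auto
  moreover have "1 * U (\<lambda>y. max 0 (f y)) t x + (-1) * U (\<lambda>y. max 0 (- f y)) t x = U f t x" if x: "x \<in> M" for x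
  proof -
    have "U (\<lambda>y. 1 * max 0 (f y) + (-1) * max 0 (- f y)) t x = 1 * U (\<lambda>y. max 0 (f y)) t x + (-1) * U (\<lambda>y. max 0 (- f y)) t x"
      by (rule U_lin[OF cs_measurable[OF fp] _ cs_measurable[OF fn] _ t(1) x, of B B]) (use B in \<open>force simp: abs_le_iff\<close>)+
    moreover have "U (\<lambda>y. 1 * max 0 (f y) + (-1) * max 0 (- f y)) t x = U f t x"
      by (rule U_cong) (auto simp: max_def)
    ultimately show ?thesis by simp
  qed
  ultimately show "continuous_on M (U f t)" by (rule continuous_on_eq)
  show "U f t x = 0" if "x \<in> M" "R + r1 < norm x" for x by (rule U_vanishes[OF f that t])
qed

text \<open>\<open>r1\<close> is a radius for times up to 1, so the time is cut into steps of length
  at most 1; each step enlarges the support radius by \<open>r1\<close>.\<close>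

lemma U_cs:
  assumes f: "cs M R f" and R: "0 \<le> R" and t: "0 \<le> t"
  shows "\<exists>R'\<ge>0. cs M R' (U f t)"
proof -
  obtain n :: nat where n: "t \<le> real n" "0 < n" using real_arch_simple[of t] by (metis gr0I le_zero_eq of_nat_0 of_nat_le_iff order_trans zero_less_one less_numeral_extra(1) of_nat_1 zero_le_one)
  define s where "s = t / real n"
  have s: "0 \<le> s" "s \<le> 1" using t n by (auto simp: s_def field_simps)
  obtain B where B: "0 \<le> B" "\<And>y. y \<in> M \<Longrightarrow> \<bar>f y\<bar> \<le> B" by (rule cs_bounded[OF closed_M f]) metis
  note fm = cs_measurable[OF f]
  have "\<exists>R'\<ge>0. cs M R' (U f (real k * s))" for k
  proof (induction k)
    case 0
    have "cs M R (U f 0)" using f U_0[OF fm B(2)] by (auto simp: cs_def intro: continuous_on_eq)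
    then show ?case using R by auto
  next
    case (Suc k)
    then obtain R' where R': "R' \<ge> 0" "cs M R' (U f (real k * s))" by auto
    have "cs M (R' + r1) (U (U f (real k * s)) s)" by (rule U_cs_1[OF R'(2,1) s])
    moreover have "U f (real (Suc k) * s) x = U (U f (real k * s)) s x" if "x \<in> M" for x
      using U_semigroup[OF fm B(2) _ s(1) that, of "real k * s"] s by (simp add: algebra_simps)
    ultimately have "cs M (R' + r1) (U f (real (Suc k) * s))"
      unfolding cs_def by (metis (no_types, lifting) continuous_on_cong)
    then show ?case using R'(1) r1_nonneg by (intro exI[of _ "R' + r1"]) simp
  qed
  from this[of n] show ?thesis using n by (simp add: s_def)
qed

section \<open>Short-time behaviour of the approximating semigroup\<close>

lemma U_strong:
  assumes f: "cs M R f" and R: "0 \<le> R" and e: "0 < e"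
  obtains d where "0 < d" "d \<le> 1" "\<And>t x. 0 \<le> t \<Longrightarrow> t \<le> d \<Longrightarrow> x \<in> M \<Longrightarrow> \<bar>U f t x - f x\<bar> \<le> e"
proof -
  obtain B where B: "0 \<le> B" "\<And>y. y \<in> M \<Longrightarrow> \<bar>f y\<bar> \<le> B" by (rule cs_bounded[OF closed_M f]) metis
  note fm = cs_measurable[OF f]
  obtain C where C: "0 \<le> C" "\<And>x. x \<in> M \<Longrightarrow> norm x \<le> R + 2 * r1 \<Longrightarrow> lam x \<le> C" using rate_compact by metis
  have e2: "0 < e / 2" using e by simp
  obtain d1 where d1: "0 < d1" "d1 \<le> 1" "\<And>t x. 0 \<le> t \<Longrightarrow> t \<le> d1 \<Longrightarrow> x \<in> M \<Longrightarrow> \<bar>f (flow t x) - f x\<bar> \<le> e / 2"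
    by (rule flow_uniform[OF f e2]) metis
  define d2 where "d2 = (e / 2) / (C * (2 * B) + 1)"
  have d2: "0 < d2" "C * (2 * B) * d2 \<le> e / 2"
  proof -
    have "0 < C * (2 * B) + 1" using C B by (simp add: add_nonneg_pos)
    then show "0 < d2" "C * (2 * B) * d2 \<le> e / 2" using e by (auto simp: d2_def field_simps)
  qed
  show thesis
  proof (rule that[of "min d1 d2"])
    fix t x assume t: "0 \<le> t" "t \<le> min d1 d2" and x: "x \<in> M"
    show "\<bar>U f t x - f x\<bar> \<le> e"
    proof (cases "norm x \<le> R + r1")
      case False
      then have "U f t x = 0" by (intro U_vanishes[OF f x]) (use t d1 in auto)
      moreover have "f x = 0" using f x False r1_nonneg by (auto simp: cs_def)
      ultimately show ?thesis using e by simp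
    next
      case True
      have "\<bar>LINT s:{0..t}|lborel. lam (flow s x) * ((LINT z|Q (flow s x). U f (t - s) z) - U f (t - s) (flow s x))\<bar> \<le> C * (2 * B) * (t - 0)"
      proof (rule LINT_Icc_le)
        note bU = bdd_U[OF fm B(2), of t]
        show "(\<lambda>s. lam (flow s x) * ((LINT z|Q (flow s x). U f (t - s) z) - U f (t - s) (flow s x))) \<in> borel_measurable borel"
          by (intro borel_measurable_times borel_measurable_diff rate_measurable path_measurable[OF bU] q_path(1)[OF bU, unfolded q_def] x)
        fix s assume s: "s \<in> {0..t}"
        have fM: "flow s x \<in> M" using x by simp
        have "norm (flow s x) \<le> R + 2 * r1" using norm_flow(1)[OF x, of s] s t d1 True by auto
        then have "lam (flow s x) \<le> C" using C(2) fM by simp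
        then have "lam (flow s x) * (2 * B) \<le> C * (2 * B)" using B by (intro mult_right_mono) auto
        with jmp_abs_le[OF U_slice[OF fm B(2)] U_abs_le[OF B(2,1)] fM, of "t - s"]
        show "\<bar>lam (flow s x) * ((LINT z|Q (flow s x). U f (t - s) z) - U f (t - s) (flow s x))\<bar> \<le> C * (2 * B)"
          unfolding jmp_def by linarith
      qed (use t in simp)
      also have "\<dots> \<le> C * (2 * B) * d2" using t C B by (intro mult_left_mono) auto
      finally have "\<bar>U f t x - f (flow t x)\<bar> \<le> e / 2" using U_mild[OF fm B(2) x t(1)] d2(2) by simp
      moreover have "\<bar>f (flow t x) - f x\<bar> \<le> e / 2" by (rule d1(3)[OF t(1) _ x]) (use t in simp)
      ultimately show ?thesis by linarith
    qed
  qed (use d1 d2 in auto)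
qed

text \<open>Neither the quotient of the semigroup nor that of the flow need converge for a function
  that is merely continuous with compact support. By the mild form their difference is a time
  average of jump terms, which converges uniformly to \<open>jmp f\<close>. This is what allows the
  flow to be treated separately in \<open>C1_approximation\<close>.\<close>

lemma U_split:
  assumes f: "cs M R f" and R: "0 \<le> R" and e: "0 < e"
  obtains d where "0 < d" "d \<le> 1"
    "\<And>t x. 0 < t \<Longrightarrow> t \<le> d \<Longrightarrow> x \<in> M \<Longrightarrow> \<bar>(U f t x - f x) / t - (f (flow t x) - f x) / t - jmp f x\<bar> \<le> e"
proof -
  obtain B where B: "0 \<le> B" "\<And>y. y \<in> M \<Longrightarrow> \<bar>f y\<bar> \<le> B" by (rule cs_bounded[OF closed_M f]) metis
  note fm = cs_measurable[OF f]
  \<comment> \<open>In the nontrivial case \<open>x\<close> lies within radius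
    \<open>R + 2 * r1\<close>, and the flow adds at most another \<open>r1\<close>.\<close>
  obtain C where C: "0 \<le> C" "\<And>x. x \<in> M \<Longrightarrow> norm x \<le> R + 3 * r1 \<Longrightarrow> lam x \<le> C" using rate_compact by metis
  define e1 where "e1 = e / (4 * (C + 1))"
  have e1: "0 < e1" "C * (2 * e1) \<le> e / 2" using e C by (auto simp: e1_def field_simps)
  have e2: "0 < e / 2" using e by simp
  note jc = jmp_cs[OF f R]
  obtain d1 where d1: "0 < d1" "d1 \<le> 1" "\<And>t x. 0 \<le> t \<Longrightarrow> t \<le> d1 \<Longrightarrow> x \<in> M \<Longrightarrow> \<bar>U f t x - f x\<bar> \<le> e1"
    by (rule U_strong[OF f R e1(1)]) metis
  obtain d2 where d2: "0 < d2" "d2 \<le> 1" "\<And>t x. 0 \<le> t \<Longrightarrow> t \<le> d2 \<Longrightarrow> x \<in> M \<Longrightarrow> \<bar>jmp f (flow t x) - jmp f x\<bar> \<le> e / 2"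
    by (rule flow_uniform[OF jc e2]) metis
  show thesis
  proof (rule that[of "min d1 d2"])
    fix t x assume t: "0 < t" "t \<le> min d1 d2" and x: "x \<in> M"
    have t0: "0 \<le> t" using t by simp
    show "\<bar>(U f t x - f x) / t - (f (flow t x) - f x) / t - jmp f x\<bar> \<le> e"
    proof (cases "norm x \<le> R + 2 * r1")
      case False
      then have far: "R + 2 * r1 < norm x" by simp
      have "U f t x = 0" by (rule U_vanishes[OF f x]) (use far r1_nonneg t d1 in auto)
      moreover have "f x = 0" using f x far r1_nonneg by (auto simp: cs_def)
      moreover have "f (flow t x) = 0" using f x far r1_nonneg norm_flow(2)[OF x, of t] t d1 by (auto simp: cs_def)
      moreover have "jmp f x = 0" using jc x far r1_nonneg by (auto simp: cs_def)
      ultimately show ?thesis using e by simp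
    next
      case True
      let ?h = "\<lambda>s. jmp (U f (t - s)) (flow s x)"
      note bU = bdd_U[OF fm B(2), of t]
      have hm: "?h \<in> borel_measurable borel"
        unfolding jmp_def
        by (intro borel_measurable_times borel_measurable_diff rate_measurable path_measurable[OF bU] q_path(1)[OF bU, unfolded q_def] x)
      have diff: "\<bar>?h s - jmp f x\<bar> \<le> e" if s: "s \<in> {0..t}" for s
      proof -
        have fM: "flow s x \<in> M" using x by simp
        have "norm (flow s x) \<le> R + 3 * r1" using norm_flow(1)[OF x, of s] s t d1 True by auto
        then have lC: "lam (flow s x) \<le> C" using C(2) fM by simp
        have "\<bar>jmp (\<lambda>y. 1 * U f (t - s) y + (-1) * f y) (flow s x)\<bar> \<le> lam (flow s x) * (2 * e1)"
        proof (rule jmp_abs_le[OF _ _ fM])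
          show "(\<lambda>y. 1 * U f (t - s) y + (-1) * f y) \<in> borel_measurable N"
            using U_slice[OF fm B(2)] fm by simp
          show "\<bar>1 * U f (t - s) y + (-1) * f y\<bar> \<le> e1" if "y \<in> M" for y
            using d1(3)[of "t - s" y] s t that by simp
        qed
        also have "\<dots> \<le> C * (2 * e1)" using lC e1 by (intro mult_right_mono) auto
        finally have "\<bar>?h s - jmp f (flow s x)\<bar> \<le> e / 2"
          using jmp_diff[OF U_slice[OF fm B(2)] U_abs_le[OF B(2,1)] fm B(2) fM, of 1 "t - s" "-1"] e1(2) by simp
        moreover have "\<bar>jmp f (flow s x) - jmp f x\<bar> \<le> e / 2" by (rule d2(3)[OF _ _ x]) (use s t in auto)
        ultimately show ?thesis by linarith
      qed
      have "U f t x - f (flow t x) = (LINT s:{0..t}|lborel. ?h s)"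
        using U_mild[OF fm B(2) x t0] by (simp add: jmp_def)
      moreover have "(LINT s:{0..t}|lborel. ?h s - jmp f x) = (LINT s:{0..t}|lborel. ?h s) - t * jmp f x"
      proof -
        have 1: "set_integrable lborel {0..t} ?h"
        proof (rule set_integrable_Icc_bounded[OF hm])
          show "\<bar>?h s\<bar> \<le> e + \<bar>jmp f x\<bar>" if "s \<in> {0..t}" for s using diff[OF that] by linarith
        qed
        have 2: "set_integrable lborel {0..t} (\<lambda>s. jmp f x)"
          by (rule set_integrable_Icc_bounded[where C = "\<bar>jmp f x\<bar>"]) auto
        show ?thesis using set_integral_diff(2)[OF 1 2] t0 by (simp add: LINT_Icc_const mult.commute)
      qed
      moreover have "\<bar>LINT s:{0..t}|lborel. ?h s - jmp f x\<bar> \<le> e * (t - 0)"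
        by (rule LINT_Icc_le[OF _ diff t0]) (use hm in simp)
      ultimately have "\<bar>(U f t x - f (flow t x)) - t * jmp f x\<bar> \<le> e * t" by simp
      moreover have "(U f t x - f x) / t - (f (flow t x) - f x) / t - jmp f x = ((U f t x - f (flow t x)) - t * jmp f x) / t"
        using t by (simp add: field_simps)
      ultimately show ?thesis using t by (simp add: abs_divide field_simps)
    qed
  qed (use d1 d2 in auto)
qed

end

section \<open>Generators and cores\<close>

text \<open>The limit defining the generator with the supremum norm unfolded and without membership
  in \<open>C0\<close>. The family \<open>S\<close> is a parameter, so that original and
  approximating semigroups are covered alike.\<close>

definition unif_gen :: "'a set \<Rightarrow> (('a \<Rightarrow> real) \<Rightarrow> real \<Rightarrow> 'a \<Rightarrow> real) \<Rightarrow> ('a \<Rightarrow> real) \<Rightarrow> ('a \<Rightarrow> real) \<Rightarrow> bool" where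
  "unif_gen M S f g \<longleftrightarrow> (\<forall>e>0. \<exists>d>0. \<forall>t x. 0 < t \<longrightarrow> t \<le> d \<longrightarrow> x \<in> M \<longrightarrow> \<bar>(S f t x - f x) / t - g x\<bar> \<le> e)"

lemma unif_genD:
  assumes "unif_gen M S f g" "0 < e"
  obtains d where "0 < d" "\<And>t x. 0 < t \<Longrightarrow> t \<le> d \<Longrightarrow> x \<in> M \<Longrightarrow> \<bar>(S f t x - f x) / t - g x\<bar> \<le> e"
  using assms unfolding unif_gen_def by blast

context pdmp_process
begin

lemma unif_gen_lin:
  assumes f: "f \<in> borel_measurable N" "\<And>y. y \<in> M \<Longrightarrow> \<bar>f y\<bar> \<le> B"
    and g: "g \<in> borel_measurable N" "\<And>y. y \<in> M \<Longrightarrow> \<bar>g y\<bar> \<le> C"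
    and uf: "unif_gen M U f k" and ug: "unif_gen M U g l"
  shows "unif_gen M U (\<lambda>x. a * f x + b * g x) (\<lambda>x. a * k x + b * l x)"
  unfolding unif_gen_def
proof (intro allI impI)
  fix e :: real assume e: "0 < e"
  define e' where "e' = e / (\<bar>a\<bar> + \<bar>b\<bar> + 1)"
  have e': "0 < e'" "(\<bar>a\<bar> + \<bar>b\<bar>) * e' \<le> e" using e by (auto simp: e'_def field_simps)
  obtain d1 where d1: "0 < d1" "\<And>t x. 0 < t \<Longrightarrow> t \<le> d1 \<Longrightarrow> x \<in> M \<Longrightarrow> \<bar>(U f t x - f x) / t - k x\<bar> \<le> e'"
    by (rule unif_genD[OF uf e'(1)]) metis
  obtain d2 where d2: "0 < d2" "\<And>t x. 0 < t \<Longrightarrow> t \<le> d2 \<Longrightarrow> x \<in> M \<Longrightarrow> \<bar>(U g t x - g x) / t - l x\<bar> \<le> e'"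
    by (rule unif_genD[OF ug e'(1)]) metis
  show "\<exists>d>0. \<forall>t x. 0 < t \<longrightarrow> t \<le> d \<longrightarrow> x \<in> M \<longrightarrow>
    \<bar>(U (\<lambda>x. a * f x + b * g x) t x - (a * f x + b * g x)) / t - (a * k x + b * l x)\<bar> \<le> e"
  proof (rule exI[of _ "min d1 d2"], intro conjI allI impI)
    fix t x assume t: "0 < t" "t \<le> min d1 d2" and x: "x \<in> M"
    have "U (\<lambda>x. a * f x + b * g x) t x = a * U f t x + b * U g t x"
      by (rule U_lin[OF f g _ x]) (use t in auto)
    then have "(U (\<lambda>x. a * f x + b * g x) t x - (a * f x + b * g x)) / t - (a * k x + b * l x)
      = a * ((U f t x - f x) / t - k x) + b * ((U g t x - g x) / t - l x)"
      using t by (simp add: field_simps)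
    also have "\<bar>\<dots>\<bar> \<le> \<bar>a\<bar> * \<bar>(U f t x - f x) / t - k x\<bar> + \<bar>b\<bar> * \<bar>(U g t x - g x) / t - l x\<bar>"
      by (metis abs_mult abs_triangle_ineq)
    also have "\<dots> \<le> \<bar>a\<bar> * e' + \<bar>b\<bar> * e'"
      using d1(2)[of t x] d2(2)[of t x] t x by (intro add_mono mult_left_mono) auto
    also have "\<dots> \<le> e" using e'(2) by (simp add: algebra_simps)
    finally show "\<bar>(U (\<lambda>x. a * f x + b * g x) t x - (a * f x + b * g x)) / t - (a * k x + b * l x)\<bar> \<le> e" .
  qed (use d1 d2 in auto)
qed

lemma U_diff_le:
  assumes f: "f \<in> borel_measurable N" "\<And>y. y \<in> M \<Longrightarrow> \<bar>f y\<bar> \<le> B"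
    and g: "g \<in> borel_measurable N" "\<And>y. y \<in> M \<Longrightarrow> \<bar>g y\<bar> \<le> C"
    and c: "\<And>y. y \<in> M \<Longrightarrow> \<bar>f y - g y\<bar> \<le> c" and x: "x \<in> M" and t: "0 \<le> t"
  shows "\<bar>U f t x - U g t x\<bar> \<le> c"
proof -
  have "\<bar>U (\<lambda>y. 1 * f y + (-1) * g y) t x\<bar> \<le> c"
    by (rule U_abs_le) (use c[of x] c x in \<open>auto intro: order_trans[OF abs_ge_zero]\<close>)
  then show ?thesis using U_lin[OF f g t x, of 1 "-1"] by simp
qed

text \<open>\<open>U (U f t) h\<close> equals \<open>U (U f h) t\<close>, so the new quotient is the
  semigroup at time \<open>t\<close> applied to the old one; as a contraction it preserves the
  uniform error.\<close>

lemma unif_gen_U: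
  assumes f: "f \<in> borel_measurable N" "\<And>y. y \<in> M \<Longrightarrow> \<bar>f y\<bar> \<le> B"
    and k: "k \<in> borel_measurable N" "\<And>y. y \<in> M \<Longrightarrow> \<bar>k y\<bar> \<le> C"
    and gen: "unif_gen M U f k" and t: "0 \<le> t"
  shows "unif_gen M U (U f t) (U k t)"
  unfolding unif_gen_def
proof (intro allI impI)
  fix e :: real assume e: "0 < e"
  obtain d where d: "0 < d" "\<And>t x. 0 < t \<Longrightarrow> t \<le> d \<Longrightarrow> x \<in> M \<Longrightarrow> \<bar>(U f t x - f x) / t - k x\<bar> \<le> e"
    by (rule unif_genD[OF gen e]) metis
  show "\<exists>d>0. \<forall>h x. 0 < h \<longrightarrow> h \<le> d \<longrightarrow> x \<in> M \<longrightarrow> \<bar>(U (U f t) h x - U f t x) / h - U k t x\<bar> \<le> e"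
  proof (rule exI[of _ d], intro conjI allI impI d(1))
    fix h x assume h: "0 < h" "h \<le> d" and x: "x \<in> M"
    have B0: "0 \<le> B" using f(2)[OF x] by simp
    have Uh: "U f h \<in> borel_measurable N" "\<And>y. y \<in> M \<Longrightarrow> \<bar>U f h y\<bar> \<le> B"
      by (auto intro: U_slice[OF f] U_abs_le[OF f(2) B0])
    have "U (U f t) h x = U (U f h) t x"
      using U_semigroup[OF f t _ x, of h] U_semigroup[OF f _ t x, of h] h by (simp add: add.commute)
    moreover have fm: "(\<lambda>y. 1 * U f h y + (-1) * f y) \<in> borel_measurable N" using Uh f by simp
    have fB: "\<bar>1 * U f h y + (-1) * f y\<bar> \<le> 2 * B" if "y \<in> M" for y using Uh(2)[OF that] f(2)[OF that] by simp
    have "U (\<lambda>y. 1 * U f h y + (-1) * f y) t x = 1 * U (U f h) t x + (-1) * U f t x"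
      by (rule U_lin[OF Uh f t x])
    moreover have "U (\<lambda>y. (1 / h) * (1 * U f h y + (-1) * f y) + (-1) * k y) t x = (1 / h) * U (\<lambda>y. 1 * U f h y + (-1) * f y) t x + (-1) * U k t x"
      by (rule U_lin[OF fm fB k t x])
    moreover have "\<bar>U (\<lambda>y. (1 / h) * (1 * U f h y + (-1) * f y) + (-1) * k y) t x\<bar> \<le> e"
      by (rule U_abs_le) (use d(2)[OF h] e in auto)
    ultimately show "\<bar>(U (U f t) h x - U f t x) / h - U k t x\<bar> \<le> e" by simp
  qed
qed

end

section \<open>The generator on C1 functions and the range condition\<close>

context nice_pdmp
begin

lemma flow_generator:
  assumes f: "f \<in> C1 M" "cs M R f"
  obtains D where "cs M (R + r1) D"
    "\<And>e. 0 < e \<Longrightarrow> \<exists>d>0. \<forall>t x. 0 < t \<longrightarrow> t \<le> d \<longrightarrow> x \<in> M \<longrightarrow> \<bar>(f (flow t x) - f x) / t - D x\<bar> \<le> e"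
proof -
  let ?h = "\<lambda>z. f (case z of (t, x) \<Rightarrow> \<phi> t x)"
  have "C1_on M f" using f by (simp add: C1_def)
  then have "C1_on ({0..} \<times> M) ?h"
    by (rule C1_on_compose[OF flow_C1]) auto
  then obtain D where D: "continuous_on M D"
    "\<And>C e. compact C \<Longrightarrow> C \<subseteq> M \<Longrightarrow> 0 < e \<Longrightarrow>
      \<exists>d>0. \<forall>x\<in>C. \<forall>t. 0 < t \<longrightarrow> t < d \<longrightarrow> \<bar>(?h (t, x) - ?h (0, x)) / t - D x\<bar> \<le> e"
    by (rule flow_derivative) metis
  have far: "f (flow t x) = 0 \<and> f x = 0" if "x \<in> M" "R + r1 < norm x" "0 \<le> t" "t \<le> 1" for t x
    using f(2) norm_flow(2)[OF that(1,3,4)] that r1_nonneg by (auto simp: cs_def)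
  have D0: "D x = 0" if x: "x \<in> M" "R + r1 < norm x" for x
  proof (rule ccontr)
    assume "D x \<noteq> 0"
    then have e: "0 < \<bar>D x\<bar> / 2" by simp
    have "compact {x}" "{x} \<subseteq> M" using x by auto
    from D(2)[OF this e] obtain d where d: "d > 0" "\<And>t. 0 < t \<Longrightarrow> t < d \<Longrightarrow> \<bar>(?h (t, x) - ?h (0, x)) / t - D x\<bar> \<le> \<bar>D x\<bar> / 2"
      by auto
    define t where "t = min (d / 2) 1"
    have t: "0 < t" "t < d" "t \<le> 1" using d(1) by (auto simp: t_def)
    have "?h (t, x) = 0" "?h (0, x) = 0" using far[OF x, of t] t x by (auto simp: flow_eq)
    then show False using d(2)[OF t(1,2)] \<open>D x \<noteq> 0\<close> by simp
  qed
  show thesis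
  proof (rule that)
    show "cs M (R + r1) D" using D(1) D0 by (auto simp: cs_def)
    fix e :: real assume e: "0 < e"
    obtain d where d: "d > 0" "\<forall>x\<in>M \<inter> cball 0 (R + r1). \<forall>t. 0 < t \<longrightarrow> t < d \<longrightarrow> \<bar>(?h (t, x) - ?h (0, x)) / t - D x\<bar> \<le> e"
      using D(2)[OF compact_M_cball _ e, of "R + r1"] by auto
    show "\<exists>d>0. \<forall>t x. 0 < t \<longrightarrow> t \<le> d \<longrightarrow> x \<in> M \<longrightarrow> \<bar>(f (flow t x) - f x) / t - D x\<bar> \<le> e"
    proof (rule exI[of _ "min (d / 2) 1"], intro conjI allI impI)
      fix t x assume t: "0 < t" "t \<le> min (d / 2) 1" and x: "x \<in> M"
      show "\<bar>(f (flow t x) - f x) / t - D x\<bar> \<le> e"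
      proof (cases "norm x \<le> R + r1")
        case True
        then have "\<bar>(?h (t, x) - ?h (0, x)) / t - D x\<bar> \<le> e" using d t x by auto
        then show ?thesis using x t by (simp add: flow_eq)
      next
        case False
        then show ?thesis using far[OF x, of t] D0[OF x] t e by simp
      qed
    qed (use d in auto)
  qed
qed

lemma generator_C1:
  assumes f: "f \<in> C1 M" "cs M R f" and R: "0 \<le> R"
  obtains D where "cs M (R + r1) D"
    "\<And>e. 0 < e \<Longrightarrow> \<exists>d>0. \<forall>t x. 0 < t \<longrightarrow> t \<le> d \<longrightarrow> x \<in> M \<longrightarrow> \<bar>(f (flow t x) - f x) / t - D x\<bar> \<le> e"
    "unif_gen M U f (\<lambda>x. D x + jmp f x)"
proof -
  obtain D where D: "cs M (R + r1) D"
    "\<And>e. 0 < e \<Longrightarrow> \<exists>d>0. \<forall>t x. 0 < t \<longrightarrow> t \<le> d \<longrightarrow> x \<in> M \<longrightarrow> \<bar>(f (flow t x) - f x) / t - D x\<bar> \<le> e"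
    by (rule flow_generator[OF f]) metis
  have "unif_gen M U f (\<lambda>x. D x + jmp f x)"
    unfolding unif_gen_def
  proof (intro allI impI)
    fix e :: real assume e: "0 < e"
    have e2: "0 < e / 2" using e by simp
    obtain d1 where d1: "d1 > 0" "\<And>t x. 0 < t \<Longrightarrow> t \<le> d1 \<Longrightarrow> x \<in> M \<Longrightarrow> \<bar>(f (flow t x) - f x) / t - D x\<bar> \<le> e / 2"
      using D(2)[OF e2] by blast
    obtain d2 where d2: "0 < d2" "\<And>t x. 0 < t \<Longrightarrow> t \<le> d2 \<Longrightarrow> x \<in> M \<Longrightarrow> \<bar>(U f t x - f x) / t - (f (flow t x) - f x) / t - jmp f x\<bar> \<le> e / 2"
      by (rule U_split[OF f(2) R e2]) metis
    show "\<exists>d>0. \<forall>t x. 0 < t \<longrightarrow> t \<le> d \<longrightarrow> x \<in> M \<longrightarrow> \<bar>(U f t x - f x) / t - (D x + jmp f x)\<bar> \<le> e"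
    proof (rule exI[of _ "min d1 d2"], intro conjI allI impI)
      fix t x assume t: "0 < t" "t \<le> min d1 d2" and x: "x \<in> M"
      show "\<bar>(U f t x - f x) / t - (D x + jmp f x)\<bar> \<le> e"
      proof -
        have "\<bar>(f (flow t x) - f x) / t - D x\<bar> \<le> e / 2" by (rule d1(2)) (use t x in auto)
        moreover have "\<bar>(U f t x - f x) / t - (f (flow t x) - f x) / t - jmp f x\<bar> \<le> e / 2" by (rule d2(2)) (use t x in auto)
        ultimately show ?thesis by linarith
      qed
    qed (use d1 d2 in auto)
  qed
  with D show thesis by (rule that)
qed

text \<open>Averaging along the flow: with \<open>\<psi>\<close> a mean of \<open>g1 \<circ> flow (i * h)\<close> over \<open>i < n\<close>, the derivative of \<open>\<psi>\<close>
  along the flow is close to \<open>(g1 \<circ> flow (n * h) - g1) / (n * h)\<close>, which only needs \<open>g1\<close> to be close to \<open>g\<close>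
  uniformly. This replaces control of the gradients of the semigroup.\<close>

lemma C1_approximation:
  assumes g: "cs M R g" and R: "0 \<le> R" and gen: "unif_gen M U g k" and e: "0 < e"
  obtains \<psi> R' k' where "\<psi> \<in> C1 M" "0 \<le> R'" "cs M R' \<psi>" "unif_gen M U \<psi> k'"
    "\<And>x. x \<in> M \<Longrightarrow> \<bar>\<psi> x - g x\<bar> \<le> e" "\<And>x. x \<in> M \<Longrightarrow> \<bar>k' x - k x\<bar> \<le> e"
proof -
  define R1 where "R1 = R + 1 + r1"
  have R1: "0 \<le> R1" "R \<le> R1" using R r1_nonneg by (auto simp: R1_def)
  obtain C where C: "0 \<le> C" "\<And>x. x \<in> M \<Longrightarrow> norm x \<le> R1 + r1 \<Longrightarrow> lam x \<le> C" using rate_compact by metis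
  define e1 where "e1 = e / (8 * (C + 1))"
  have e1: "0 < e1" "C * (2 * e1) \<le> e / 4" "e1 \<le> e"
  proof -
    show "0 < e1" using e C by (simp add: e1_def)
    show "C * (2 * e1) \<le> e / 4" "e1 \<le> e" using e C(1) by (auto simp: e1_def field_simps)
  qed
  have e8: "0 < e / 8" and e12: "0 < e1 / 2" using e e1 by auto
  obtain d1 where d1: "0 < d1" "d1 \<le> 1"
    "\<And>t x. 0 < t \<Longrightarrow> t \<le> d1 \<Longrightarrow> x \<in> M \<Longrightarrow> \<bar>(U g t x - g x) / t - (g (flow t x) - g x) / t - jmp g x\<bar> \<le> e / 8"
    by (rule U_split[OF g R e8]) metis
  obtain d2 where d2: "0 < d2" "\<And>t x. 0 < t \<Longrightarrow> t \<le> d2 \<Longrightarrow> x \<in> M \<Longrightarrow> \<bar>(U g t x - g x) / t - k x\<bar> \<le> e / 8"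
    by (rule unif_genD[OF gen e8]) metis
  obtain d3 where d3: "0 < d3" "d3 \<le> 1" "\<And>t x. 0 \<le> t \<Longrightarrow> t \<le> d3 \<Longrightarrow> x \<in> M \<Longrightarrow> \<bar>g (flow t x) - g x\<bar> \<le> e1 / 2"
    by (rule flow_uniform[OF g e12]) metis
  \<comment> \<open>The one time at which the semigroup quotient of \<open>g\<close>, its flow
    quotient and \<open>k\<close> are compared. It is fixed before \<open>g1\<close> is
    chosen.\<close>
  define \<eta> where "\<eta> = min d1 (min d2 d3)"
  have \<eta>: "0 < \<eta>" "\<eta> \<le> d1" "\<eta> \<le> d2" "\<eta> \<le> d3" "\<eta> \<le> 1" using d1 d2 d3 by (auto simp: \<eta>_def)
  \<comment> \<open>In a quotient at time \<eta> the error of \<open>g1\<close> enters twice and is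
    divided by \<eta>; the factor \<eta> keeps the result below \<open>e / 4\<close>.\<close>
  define \<delta> where "\<delta> = min (e1 / 2) (\<eta> * e / 8)"
  have \<delta>: "0 < \<delta>" "\<delta> \<le> e1 / 2" "\<delta> \<le> \<eta> * e / 8" using e1 \<eta> e by (auto simp: \<delta>_def)
  obtain g1 where g1: "g1 \<in> C1 M" "cs M (R + 1) g1" "\<And>x. x \<in> M \<Longrightarrow> \<bar>g1 x - g x\<bar> \<le> \<delta>"
    by (rule cs_C1_dense[OF closed_M g R \<delta>(1)]) metis
  obtain D1 where D1: "cs M (R + 1 + r1) D1"
    "\<And>e. 0 < e \<Longrightarrow> \<exists>d>0. \<forall>t x. 0 < t \<longrightarrow> t \<le> d \<longrightarrow> x \<in> M \<longrightarrow> \<bar>(g1 (flow t x) - g1 x) / t - D1 x\<bar> \<le> e"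
    by (rule flow_generator[OF g1(1,2)]) metis
  obtain d4 where d4: "0 < d4" "\<And>t x. 0 < t \<Longrightarrow> t \<le> d4 \<Longrightarrow> x \<in> M \<Longrightarrow> \<bar>(g1 (flow t x) - g1 x) / t - D1 x\<bar> \<le> e / 8"
    using D1(2)[OF e8] by blast
  obtain n :: nat where n: "\<eta> / d4 \<le> real n" "0 < n"
  proof -
    obtain m :: nat where "\<eta> / d4 \<le> real m" using real_arch_simple by blast
    then show thesis using that[of "Suc m"] by simp
  qed
  \<comment> \<open>Small enough for the quotients of \<open>g1\<close> at \<open>h\<close> to be
    close to \<open>D1\<close>, and an exact fraction of \<eta> so that their mean
    telescopes.\<close>
  define h where "h = \<eta> / real n"
  have h: "0 < h" "h \<le> d4" "real n * h = \<eta>" using n \<eta>(1) d4(1) by (auto simp: h_def field_simps)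
  have ih: "0 \<le> real i * h" "real i * h \<le> \<eta>" if "i < n" for i
  proof -
    show "0 \<le> real i * h" using h by simp
    have "real i * h \<le> real n * h" using that h by (intro mult_right_mono) auto
    then show "real i * h \<le> \<eta>" using h by simp
  qed
  define mean where "mean u x = (1 / real n) * (\<Sum>i<n. u (flow (real i * h) x))" for u x
  have mean_le: "\<bar>mean u x\<bar> \<le> c" if "\<And>i. i < n \<Longrightarrow> \<bar>u (flow (real i * h) x)\<bar> \<le> c" for u c x
  proof -
    have "\<bar>\<Sum>i<n. u (flow (real i * h) x)\<bar> \<le> (\<Sum>i<n. c)"
      by (rule order_trans[OF sum_abs]) (rule sum_mono, use that in auto)
    then show ?thesis using n by (simp add: mean_def abs_mult field_simps)
  qed
  have mean_diff: "mean u x - mean v x = mean (\<lambda>y. u y - v y) x" for u v x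
    by (simp add: mean_def right_diff_distrib sum_subtractf)
  define \<psi> where "\<psi> = mean g1"
  have \<psi>C1: "\<psi> \<in> C1 M"
    unfolding C1_def \<psi>_def mean_def[abs_def] mem_Collect_eq
  proof (intro C1_on_mult C1_on_const C1_on_sum)
    show "C1_on M (\<lambda>x. g1 (flow (real i * h) x))" for i
      by (rule C1_on_compose[OF flow_C1_slice, where g = g1 and T = M]) (use g1(1) in \<open>auto simp: C1_def\<close>)
  qed simp
  have \<psi>cs: "cs M R1 \<psi>"
    unfolding cs_def
  proof (intro conjI ballI impI)
    show "continuous_on M \<psi>" using \<psi>C1 C1_on_continuous by (auto simp: C1_def)
    fix x assume x: "x \<in> M" "R1 < norm x"
    have "g1 (flow (real i * h) x) = 0" if "i < n" for i
      using norm_flow(2)[OF x(1), of "real i * h"] ih[OF that] \<eta> x g1(2) by (auto simp: cs_def R1_def)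
    then show "\<psi> x = 0" by (simp add: \<psi>_def mean_def)
  qed
  have close: "\<bar>\<psi> x - g x\<bar> \<le> e1" if x: "x \<in> M" for x
  proof -
    have "mean (\<lambda>_. g x) x = g x" using n by (simp add: mean_def)
    then have "\<psi> x - g x = mean (\<lambda>y. g1 y - g x) x"
      using mean_diff[of g1 x "\<lambda>_. g x"] unfolding \<psi>_def by simp
    also have "\<bar>\<dots>\<bar> \<le> e1"
    proof (rule mean_le)
      fix i assume i: "i < n"
      have "\<bar>g1 (flow (real i * h) x) - g (flow (real i * h) x)\<bar> \<le> \<delta>" using g1(3) x by simp
      moreover have "\<bar>g (flow (real i * h) x) - g x\<bar> \<le> e1 / 2" by (rule d3(3)[OF _ _ x]) (use ih[OF i] \<eta> in auto)
      ultimately show "\<bar>g1 (flow (real i * h) x) - g x\<bar> \<le> e1" using \<delta>(2) by linarith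
    qed
    finally show ?thesis .
  qed
  obtain D where D: "cs M (R1 + r1) D"
    "\<And>e. 0 < e \<Longrightarrow> \<exists>d>0. \<forall>t x. 0 < t \<longrightarrow> t \<le> d \<longrightarrow> x \<in> M \<longrightarrow> \<bar>(\<psi> (flow t x) - \<psi> x) / t - D x\<bar> \<le> e"
    "unif_gen M U \<psi> (\<lambda>x. D x + jmp \<psi> x)"
    by (rule generator_C1[OF \<psi>C1 \<psi>cs R1(1)]) metis
  have comm: "flow (real i * h) (flow t x) = flow t (flow (real i * h) x)" if "x \<in> M" "0 \<le> t" "i < n" for i t x
    using flow_flow[of t "real i * h" x] flow_flow[of "real i * h" t x] that ih[OF that(3)] by (simp add: add.commute)
  \<comment> \<open>The flow commutes with itself, so differentiating the mean along the flow
    amounts to averaging the flow derivative of \<open>g1\<close>.\<close>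
  have D_mean: "\<bar>D x - mean D1 x\<bar> \<le> e / 8" if x: "x \<in> M" for x
  proof (rule field_le_epsilon)
    fix a :: real assume a: "0 < a"
    obtain d where d: "0 < d" "\<And>t x. 0 < t \<Longrightarrow> t \<le> d \<Longrightarrow> x \<in> M \<Longrightarrow> \<bar>(\<psi> (flow t x) - \<psi> x) / t - D x\<bar> \<le> a"
      using D(2)[OF a] by blast
    define t where "t = min d d4"
    have t: "0 < t" "t \<le> d" "t \<le> d4" using d d4 by (auto simp: t_def)
    have e1: "\<psi> (flow t x) = mean (\<lambda>y. g1 (flow t y)) x"
      unfolding \<psi>_def mean_def using comm[OF x] t by simp
    have e2: "\<psi> x = mean g1 x" by (simp add: \<psi>_def)
    have "(\<psi> (flow t x) - \<psi> x) / t - mean D1 x = mean (\<lambda>y. (g1 (flow t y) - g1 y) / t - D1 y) x"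
      unfolding e1 e2 by (simp add: mean_def sum_subtractf sum_divide_distrib[symmetric] diff_divide_distrib right_diff_distrib)
    also have "\<bar>\<dots>\<bar> \<le> e / 8" by (rule mean_le) (use d4(2)[OF t(1,3)] x in auto)
    finally show "\<bar>D x - mean D1 x\<bar> \<le> e / 8 + a" using d(2)[OF t(1,2) x] by linarith
  qed
  have tele: "mean (\<lambda>y. (g1 (flow h y) - g1 y) / h) x = (g1 (flow \<eta> x) - g1 x) / \<eta>" if x: "x \<in> M" for x
  proof -
    have "(\<Sum>i<n. g1 (flow h (flow (real i * h) x)) - g1 (flow (real i * h) x)) =
      (\<Sum>i<n. g1 (flow (real (Suc i) * h) x) - g1 (flow (real i * h) x))"
      using h x by (intro sum.cong) (auto simp: flow_flow algebra_simps)
    also have "\<dots> = g1 (flow (real n * h) x) - g1 (flow (real 0 * h) x)"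
      by (rule sum_lessThan_telescope)
    finally have "(\<Sum>i<n. g1 (flow h (flow (real i * h) x)) - g1 (flow (real i * h) x)) = g1 (flow \<eta> x) - g1 x"
      using x h by (simp add: flow_eq)
    then show ?thesis using h n by (simp add: mean_def sum_divide_distrib[symmetric] field_simps)
  qed
  \<comment> \<open>A chain of five comparisons: \<open>D\<close>, the mean of \<open>D1\<close>,
    the flow quotient of \<open>g1\<close> at \<eta>, that of \<open>g\<close>, the semigroup
    quotient of \<open>g\<close> less \<open>jmp g\<close>, and \<open>k - jmp g\<close>. The third
    costs \<open>e / 4\<close> and the others \<open>e / 8\<close> each.\<close>
  have D_bound: "\<bar>D x - (k x - jmp g x)\<bar> \<le> 3 * e / 4" if x: "x \<in> M" for x
  proof -
    have 1: "\<bar>D x - mean D1 x\<bar> \<le> e / 8" by (rule D_mean[OF x])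
    have "\<bar>mean (\<lambda>y. (g1 (flow h y) - g1 y) / h - D1 y) x\<bar> \<le> e / 8"
      by (rule mean_le) (use d4(2)[OF h(1,2)] x in auto)
    then have 2: "\<bar>(g1 (flow \<eta> x) - g1 x) / \<eta> - mean D1 x\<bar> \<le> e / 8"
      using mean_diff[of "\<lambda>y. (g1 (flow h y) - g1 y) / h" x D1] tele[OF x] by simp
    have "\<bar>(g1 (flow \<eta> x) - g1 x) - (g (flow \<eta> x) - g x)\<bar> \<le> \<delta> + \<delta>"
      using g1(3)[of "flow \<eta> x"] g1(3)[OF x] x by (simp add: abs_le_iff)
    also have "\<dots> \<le> (e / 4) * \<eta>" using \<delta>(3) by (simp add: field_simps)
    finally have "\<bar>((g1 (flow \<eta> x) - g1 x) - (g (flow \<eta> x) - g x)) / \<eta>\<bar> \<le> e / 4"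
      using \<eta>(1) by (simp add: abs_divide pos_divide_le_eq)
    then have 3: "\<bar>(g1 (flow \<eta> x) - g1 x) / \<eta> - (g (flow \<eta> x) - g x) / \<eta>\<bar> \<le> e / 4"
      by (simp add: diff_divide_distrib)
    have 4: "\<bar>(U g \<eta> x - g x) / \<eta> - (g (flow \<eta> x) - g x) / \<eta> - jmp g x\<bar> \<le> e / 8" by (rule d1(3)[OF \<eta>(1,2) x])
    have 5: "\<bar>(U g \<eta> x - g x) / \<eta> - k x\<bar> \<le> e / 8" by (rule d2(2)[OF \<eta>(1,3) x])
    show ?thesis using 1 2 3 4 5 by linarith
  qed
  have jmp_bound: "\<bar>jmp \<psi> x - jmp g x\<bar> \<le> e / 4" if x: "x \<in> M" for x
  proof -
    obtain B where B: "0 \<le> B" "\<And>y. y \<in> M \<Longrightarrow> \<bar>g y\<bar> \<le> B" by (rule cs_bounded[OF closed_M g]) metis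
    obtain B' where B': "0 \<le> B'" "\<And>y. y \<in> M \<Longrightarrow> \<bar>\<psi> y\<bar> \<le> B'" by (rule cs_bounded[OF closed_M \<psi>cs]) metis
    have v: "cs M R1 (\<lambda>y. 1 * \<psi> y + (-1) * g y)" by (rule cs_lin[OF \<psi>cs cs_mono[OF g R1(2)]])
    have eq: "jmp \<psi> x - jmp g x = jmp (\<lambda>y. 1 * \<psi> y + (-1) * g y) x"
      using jmp_diff[OF cs_measurable[OF \<psi>cs] B'(2) cs_measurable[OF g] B(2) x, of 1 "-1"] by simp
    show ?thesis
    proof (cases "norm x \<le> R1 + r1")
      case True
      have "\<bar>jmp (\<lambda>y. 1 * \<psi> y + (-1) * g y) x\<bar> \<le> lam x * (2 * e1)"
        by (rule jmp_abs_le[OF cs_measurable[OF v] _ x]) (use close in auto)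
      also have "\<dots> \<le> C * (2 * e1)" using C(2)[OF x True] e1(1) by (intro mult_right_mono) auto
      finally show ?thesis using e1(2) eq by simp
    next
      case False
      then have "jmp (\<lambda>y. 1 * \<psi> y + (-1) * g y) x = 0" using jmp_cs[OF v R1(1)] x by (auto simp: cs_def)
      then show ?thesis using eq e by simp
    qed
  qed
  show thesis
  proof (rule that[OF \<psi>C1 R1(1) \<psi>cs D(3)])
    show "\<bar>\<psi> x - g x\<bar> \<le> e" if "x \<in> M" for x using close[OF that] e1(3) by simp
    show "\<bar>D x + jmp \<psi> x - k x\<bar> \<le> e" if "x \<in> M" for x
      using D_bound[OF that] jmp_bound[OF that] by linarith
  qed
qed

text \<open>Riemann sums \<open>g\<close> of \<open>\<integral>\<^sub>0\<^sup>T exp (- t) U f t dt\<close> almost solve \<open>g - A g = f\<close> for the generator \<open>A\<close>.\<close>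

lemma resolvent_approximation:
  assumes f: "f \<in> C1 M" "cs M R f" and R: "0 \<le> R" and e: "0 < e"
  obtains g k R' where "0 \<le> R'" "cs M R' g" "unif_gen M U g k" "\<And>x. x \<in> M \<Longrightarrow> \<bar>g x - k x - f x\<bar> \<le> e"
proof -
  obtain D where D: "cs M (R + r1) D" "unif_gen M U f (\<lambda>x. D x + jmp f x)"
    by (rule generator_C1[OF f R]) metis
  define k where "k = (\<lambda>x. D x + jmp f x)"
  have kc: "cs M (R + r1) k" using cs_lin[OF D(1) jmp_cs[OF f(2) R], of 1 1] by (simp add: k_def)
  have gen: "unif_gen M U f k" using D(2) by (simp add: k_def)
  have R': "0 \<le> R + r1" using R r1_nonneg by simp
  obtain B where B: "0 \<le> B" "\<And>y. y \<in> M \<Longrightarrow> \<bar>f y\<bar> \<le> B" by (rule cs_bounded[OF closed_M f(2)]) metis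
  obtain C where C: "0 \<le> C" "\<And>y. y \<in> M \<Longrightarrow> \<bar>k y\<bar> \<le> C" by (rule cs_bounded[OF closed_M kc]) metis
  note fm = cs_measurable[OF f(2)] and km = cs_measurable[OF kc]
  have "((\<lambda>t. exp (- t) * B) \<longlongrightarrow> 0 * B) at_top"
    by (intro tendsto_mult_right filterlim_compose[OF exp_at_bot] filterlim_uminus_at_bot_at_top)
  then have "eventually (\<lambda>t. exp (- t) * B < e / 2) at_top" using e by (intro order_tendstoD) auto
  then obtain T0 where T0: "\<And>t. T0 \<le> t \<Longrightarrow> exp (- t) * B < e / 2" unfolding eventually_at_top_linorder by auto
  define T where "T = max T0 1"
  have T: "exp (- T) * B < e / 2" "1 \<le> T" using T0 by (auto simp: T_def)
  \<comment> \<open>The error rate per unit of time: steps of length \<open>h\<close> with error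
    \<open>h * a\<close> accumulate to \<open>a * T = e / 2\<close> up to \<open>T\<close>, and the
    discounted tail beyond \<open>T\<close> takes the other half.\<close>
  define a where "a = e / (2 * T)"
  have a: "0 < a" "a * T = e / 2" using e T by (auto simp: a_def)
  have a2: "0 < a / 2" using a by simp
  obtain d where d: "0 < d" "\<And>t x. 0 < t \<Longrightarrow> t \<le> d \<Longrightarrow> x \<in> M \<Longrightarrow> \<bar>(U f t x - f x) / t - k x\<bar> \<le> a / 2"
    by (rule unif_genD[OF gen a2]) metis
  define d' where "d' = min d (a / (2 * (B + C + 1)))"
  have d': "0 < d'" using d a B C by (auto simp: d'_def)
  obtain n :: nat where n: "T / d' \<le> real n" "0 < n"
  proof -
    obtain m :: nat where "T / d' \<le> real m" using real_arch_simple by blast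
    then show thesis using that[of "Suc m"] by simp
  qed
  define h where "h = T / real n"
  have h: "0 < h" "h \<le> d" "real n * h = T" "(B + C) * h \<le> a / 2"
  proof -
    show "0 < h" "real n * h = T" using n T by (auto simp: h_def)
    have hd: "h \<le> d'" using n d' by (simp add: h_def field_simps)
    then show "h \<le> d" by (simp add: d'_def)
    have "(B + C) * h \<le> (B + C + 1) * (a / (2 * (B + C + 1)))"
      using hd B C \<open>0 < h\<close> a by (intro mult_mono) (auto simp: d'_def)
    also have "\<dots> = a / 2" using B C by (simp add: field_simps)
    finally show "(B + C) * h \<le> a / 2" .
  qed
  have exp_bounds: "0 \<le> 1 - exp (- h)" "1 - exp (- h) \<le> h" "h - (1 - exp (- h)) \<le> h * h" "exp (- h) \<le> 1"
  proof -
    show "exp (- h) \<le> 1" "0 \<le> 1 - exp (- h)" using h by auto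
    show "1 - exp (- h) \<le> h" using exp_ge_add_one_self[of "- h"] by simp
    have "exp (- h) * (1 + h) \<le> exp (- h) * exp h" using exp_ge_add_one_self[of h] by (intro mult_left_mono) auto
    then have e1: "exp (- h) * (1 + h) \<le> 1" by (simp add: exp_add[symmetric])
    have "h * (1 - exp (- h)) \<le> h * h" using \<open>1 - exp (- h) \<le> h\<close> h(1) by (intro mult_left_mono) auto
    with e1 show "h - (1 - exp (- h)) \<le> h * h" by (simp add: algebra_simps)
  qed
  \<comment> \<open>The time derivative of \<open>- exp (- s) * U f s\<close> at 0 is
    \<open>f - k\<close>; this is its discrete form over one step, with error
    \<open>h * a\<close>.\<close>
  have step: "\<bar>h * (f y - k y) - (f y - exp (- h) * U f h y)\<bar> \<le> h * a" if y: "y \<in> M" for y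
  proof -
    have "\<bar>(U f h y - f y) / h - k y\<bar> \<le> a / 2" by (rule d(2)[OF h(1,2) y])
    then have "\<bar>((U f h y - f y) / h - k y) * h\<bar> \<le> (a / 2) * h" unfolding abs_mult using h(1) a(1) by (intro mult_mono) auto
    moreover have "((U f h y - f y) / h - k y) * h = U f h y - f y - h * k y" using h(1) by (simp add: field_simps)
    ultimately have 1: "\<bar>U f h y - f y - h * k y\<bar> \<le> (a / 2) * h" by simp
    have "\<bar>exp (- h) * (U f h y - f y - h * k y)\<bar> \<le> 1 * ((a / 2) * h)"
      unfolding abs_mult using 1 exp_bounds(4) by (intro mult_mono) auto
    moreover have "\<bar>(h - (1 - exp (- h))) * f y\<bar> \<le> (h * h) * B"
      unfolding abs_mult using exp_bounds B(2)[OF y] by (intro mult_mono) auto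
    moreover have "\<bar>(1 - exp (- h)) * (h * k y)\<bar> \<le> h * (h * C)"
      unfolding abs_mult using exp_bounds C(2)[OF y] h(1) by (intro mult_mono) auto
    moreover have "h * (f y - k y) - (f y - exp (- h) * U f h y) =
      exp (- h) * (U f h y - f y - h * k y) + (h - (1 - exp (- h))) * f y - (1 - exp (- h)) * (h * k y)"
      by (simp add: algebra_simps)
    ultimately have "\<bar>h * (f y - k y) - (f y - exp (- h) * U f h y)\<bar> \<le> (a / 2) * h + (h * h) * B + h * (h * C)" by linarith
    also have "\<dots> = h * (a / 2 + (B + C) * h)" by (simp add: algebra_simps)
    also have "\<dots> \<le> h * a" using h(1,4) by (intro mult_left_mono) auto
    finally show ?thesis .
  qed
  \<comment> \<open>The witness \<open>g\<close> is the sum of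
    \<open>h * exp (- i * h) * U f (i * h)\<close> over \<open>i < m\<close>, and \<open>l\<close>
    is its generator. Applying the discounted semigroup to \<open>step\<close> turns each new term
    into a difference of consecutive values of \<open>exp (- s) * U f s\<close>, and these
    telescope.\<close>
  have "\<exists>g l R'. 0 \<le> R' \<and> cs M R' g \<and> cs M R' l \<and> unif_gen M U g l \<and>
    (\<forall>x\<in>M. \<bar>g x - l x - (f x - exp (- (real m * h)) * U f (real m * h) x)\<bar> \<le> real m * (h * a))" for m
  proof (induction m)
    case 0
    have "unif_gen M U (\<lambda>x. 0 * f x + 0 * f x) (\<lambda>x. 0 * k x + 0 * k x)"
      by (rule unif_gen_lin[OF fm B(2) fm B(2) gen gen])
    then show ?case
      using U_0[OF fm B(2)] by (intro exI[of _ "\<lambda>_. 0"] exI[of _ "0::real"]) (auto simp: cs_def)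
  next
    case (Suc m)
    then obtain g l R' where R': "0 \<le> R'" and g: "cs M R' g" and l: "cs M R' l" and ug: "unif_gen M U g l"
      and err: "\<And>x. x \<in> M \<Longrightarrow> \<bar>g x - l x - (f x - exp (- (real m * h)) * U f (real m * h) x)\<bar> \<le> real m * (h * a)"
      by blast
    define t where "t = real m * h"
    have t: "0 \<le> t" using h by (simp add: t_def)
    obtain R1 where R1: "0 \<le> R1" "cs M R1 (U f t)" using U_cs[OF f(2) R t] by auto
    obtain R2 where R2: "0 \<le> R2" "cs M R2 (U k t)" using U_cs[OF kc _ t] R r1_nonneg by auto
    define R3 where "R3 = max R' (max R1 R2)"
    have c: "cs M R3 g" "cs M R3 l" "cs M R3 (U f t)" "cs M R3 (U k t)"
      using g l R1(2) R2(2) by (auto simp: R3_def intro: cs_mono)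
    obtain Bg where Bg: "\<And>y. y \<in> M \<Longrightarrow> \<bar>g y\<bar> \<le> Bg" by (rule cs_bounded[OF closed_M g]) metis
    have Ub: "\<bar>U f s y\<bar> \<le> B" for s y by (rule U_abs_le[OF B(2,1)])
    have uU: "unif_gen M U (U f t) (U k t)" by (rule unif_gen_U[OF fm B(2) km C(2) gen t])
    let ?w = "h * exp (- t)"
    have un: "unif_gen M U (\<lambda>x. 1 * g x + ?w * U f t x) (\<lambda>x. 1 * l x + ?w * U k t x)"
      by (rule unif_gen_lin[OF cs_measurable[OF c(1)] Bg U_slice[OF fm B(2)] Ub ug uU])
    have new: "\<bar>(1 * g x + ?w * U f t x) - (1 * l x + ?w * U k t x) - (f x - exp (- (real (Suc m) * h)) * U f (real (Suc m) * h) x)\<bar>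
      \<le> real (Suc m) * (h * a)" if x: "x \<in> M" for x
    proof -
      have Sm: "real (Suc m) * h = t + h" by (simp add: t_def algebra_simps)
      have sg: "U f (t + h) x = U (U f h) t x" by (rule U_semigroup[OF fm B(2) less_imp_le[OF h(1)] t x])
      have m1: "(\<lambda>y. 1 * f y + (-1) * k y) \<in> borel_measurable N" using fm km by simp
      have b1: "\<bar>1 * f y + (-1) * k y\<bar> \<le> B + C" if "y \<in> M" for y using B(2)[OF that] C(2)[OF that] by linarith
      have m2: "(\<lambda>y. 1 * f y + (- exp (- h)) * U f h y) \<in> borel_measurable N" using fm U_slice[OF fm B(2)] by simp
      have b2: "\<bar>1 * f y + (- exp (- h)) * U f h y\<bar> \<le> B + B" if "y \<in> M" for y
      proof -
        have "\<bar>exp (- h) * U f h y\<bar> \<le> 1 * B" unfolding abs_mult using Ub[of h y] exp_bounds(4) by (intro mult_mono) auto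
        then show ?thesis using B(2)[OF that] by (simp add: abs_le_iff)
      qed
      have "\<bar>U (\<lambda>y. h * (1 * f y + (-1) * k y) + (-1) * (1 * f y + (- exp (- h)) * U f h y)) t x\<bar> \<le> h * a"
      proof (rule U_abs_le)
        fix y assume y: "y \<in> M"
        have "h * (1 * f y + (-1) * k y) + (-1) * (1 * f y + (- exp (- h)) * U f h y) = h * (f y - k y) - (f y - exp (- h) * U f h y)"
          by simp
        then show "\<bar>h * (1 * f y + (-1) * k y) + (-1) * (1 * f y + (- exp (- h)) * U f h y)\<bar> \<le> h * a"
          using step[OF y] by (simp only:)
      qed (use h(1) a(1) in simp)
      moreover have "U (\<lambda>y. h * (1 * f y + (-1) * k y) + (-1) * (1 * f y + (- exp (- h)) * U f h y)) t x =
        h * U (\<lambda>y. 1 * f y + (-1) * k y) t x + (-1) * U (\<lambda>y. 1 * f y + (- exp (- h)) * U f h y) t x"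
        by (rule U_lin[OF m1 b1 m2 b2 t x])
      moreover have "U (\<lambda>y. 1 * f y + (-1) * k y) t x = 1 * U f t x + (-1) * U k t x"
        by (rule U_lin[OF fm B(2) km C(2) t x])
      moreover have "U (\<lambda>y. 1 * f y + (- exp (- h)) * U f h y) t x = 1 * U f t x + (- exp (- h)) * U (U f h) t x"
        by (rule U_lin[OF fm B(2) U_slice[OF fm B(2)] Ub t x])
      ultimately have s: "\<bar>h * (U f t x - U k t x) - (U f t x - exp (- h) * U f (t + h) x)\<bar> \<le> h * a" by (simp add: sg)
      have "\<bar>exp (- t) * (h * (U f t x - U k t x) - (U f t x - exp (- h) * U f (t + h) x))\<bar> \<le> 1 * (h * a)"
        unfolding abs_mult using s t by (intro mult_mono) auto
      moreover have "\<bar>g x - l x - (f x - exp (- t) * U f t x)\<bar> \<le> real m * (h * a)"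
        using err[OF x] by (simp add: t_def)
      moreover have "(1 * g x + ?w * U f t x) - (1 * l x + ?w * U k t x) - (f x - exp (- (t + h)) * U f (t + h) x) =
        (g x - l x - (f x - exp (- t) * U f t x)) + exp (- t) * (h * (U f t x - U k t x) - (U f t x - exp (- h) * U f (t + h) x))"
        by (simp add: algebra_simps exp_add[symmetric])
      moreover have "real (Suc m) * (h * a) = real m * (h * a) + 1 * (h * a)" by (simp add: algebra_simps)
      ultimately show ?thesis unfolding Sm by linarith
    qed
    have c1: "cs M R3 (\<lambda>x. 1 * g x + ?w * U f t x)" by (rule cs_lin[OF c(1,3)])
    have c2: "cs M R3 (\<lambda>x. 1 * l x + ?w * U k t x)" by (rule cs_lin[OF c(2,4)])
    have "0 \<le> R3" using R' by (simp add: R3_def)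
    with c1 c2 un new show ?case by blast
  qed
  from this[of n] obtain g l R' where g: "0 \<le> R'" "cs M R' g" "unif_gen M U g l"
    and err: "\<And>x. x \<in> M \<Longrightarrow> \<bar>g x - l x - (f x - exp (- T) * U f T x)\<bar> \<le> real n * (h * a)"
    unfolding h(3) by blast
  have "\<bar>g x - l x - f x\<bar> \<le> e" if x: "x \<in> M" for x
  proof -
    have "\<bar>exp (- T) * U f T x\<bar> \<le> exp (- T) * B"
      unfolding abs_mult using U_abs_le[of f B T x, OF B(2,1)] by (intro mult_mono) auto
    moreover have "real n * (h * a) = e / 2" using h(3) a(2) by (metis mult.assoc mult.commute)
    ultimately show ?thesis using err[OF x] T(1) by linarith
  qed
  with g show thesis by (rule that)
qed

lemma range_dense:
  assumes f: "f \<in> C1 M" "cs M R f" and R: "0 \<le> R" and e: "0 < e"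
  obtains \<psi> k R' where "\<psi> \<in> C1 M" "0 \<le> R'" "cs M R' \<psi>" "unif_gen M U \<psi> k" "\<And>x. x \<in> M \<Longrightarrow> \<bar>\<psi> x - k x - f x\<bar> \<le> e"
proof -
  have e3: "0 < e / 3" using e by simp
  obtain g l R' where g: "0 \<le> R'" "cs M R' g" "unif_gen M U g l" "\<And>x. x \<in> M \<Longrightarrow> \<bar>g x - l x - f x\<bar> \<le> e / 3"
    by (rule resolvent_approximation[OF f R e3]) metis
  obtain \<psi> R'' k where p: "\<psi> \<in> C1 M" "0 \<le> R''" "cs M R'' \<psi>" "unif_gen M U \<psi> k"
    "\<And>x. x \<in> M \<Longrightarrow> \<bar>\<psi> x - g x\<bar> \<le> e / 3" "\<And>x. x \<in> M \<Longrightarrow> \<bar>k x - l x\<bar> \<le> e / 3"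
    by (rule C1_approximation[OF g(2,1,3) e3]) metis
  show thesis
  proof (rule that[OF p(1-4)])
    show "\<bar>\<psi> x - k x - f x\<bar> \<le> e" if "x \<in> M" for x
      using g(4)[OF that] p(5,6)[OF that] by linarith
  qed
qed

end

section \<open>Functions vanishing at infinity and the supremum norm\<close>

lemma mult_divide_self: "0 < c \<Longrightarrow> c * (e / (k * c)) = e / k" for c e k :: real
  by simp

text \<open>A cutoff with values in [0, 1] changes \<open>f\<close> by at most
  \<open>\<bar>f x\<bar>\<close>, and only off the compact set where \<open>f\<close> may be large.
  In this form the passage to uniform limits is immediate.\<close>

lemma C0_iff_cs:
  assumes "closed M"
  shows "f \<in> C0 M \<longleftrightarrow> (\<forall>e>0. \<exists>R g. 0 \<le> R \<and> cs M R g \<and> (\<forall>x\<in>M. \<bar>f x - g x\<bar> \<le> e))"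
proof
  assume f: "f \<in> C0 M"
  show "\<forall>e>0. \<exists>R g. 0 \<le> R \<and> cs M R g \<and> (\<forall>x\<in>M. \<bar>f x - g x\<bar> \<le> e)"
  proof (intro allI impI)
    fix e :: real assume e: "0 < e"
    have "\<forall>e>0. \<exists>A. compact A \<and> A \<subseteq> M \<and> (\<forall>x\<in>M - A. \<bar>f x\<bar> < e)" using f by (simp add: C0_def)
    from this[rule_format, OF e] obtain A where A: "compact A" "\<And>x. x \<in> M - A \<Longrightarrow> \<bar>f x\<bar> < e" by blast
    obtain R where R: "\<And>x. x \<in> A \<Longrightarrow> norm x \<le> R" using compact_imp_bounded[OF A(1)] unfolding bounded_iff by blast
    define R' where "R' = max 0 R"
    define g where "g x = f x * max 0 (min 1 (R' + 1 - norm x))" for x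
    have "continuous_on M f" using f by (simp add: C0_def)
    then have "cs M (R' + 1) g"
      unfolding cs_def g_def by (auto intro!: continuous_intros)
    moreover have "\<bar>f x - g x\<bar> \<le> e" if x: "x \<in> M" for x
    proof (cases "x \<in> A")
      case True
      then show ?thesis using R[OF True] e by (simp add: g_def R'_def)
    next
      case False
      have "f x - g x = f x * (1 - max 0 (min 1 (R' + 1 - norm x)))" by (simp add: g_def algebra_simps)
      also have "\<bar>\<dots>\<bar> \<le> e * 1" unfolding abs_mult using A(2)[of x] x False by (intro mult_mono) auto
      finally show ?thesis by simp
    qed
    ultimately show "\<exists>R g. 0 \<le> R \<and> cs M R g \<and> (\<forall>x\<in>M. \<bar>f x - g x\<bar> \<le> e)"
      by (intro exI[of _ "R' + 1"] exI[of _ g]) (simp add: R'_def)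
  qed
next
  assume *: "\<forall>e>0. \<exists>R g. 0 \<le> R \<and> cs M R g \<and> (\<forall>x\<in>M. \<bar>f x - g x\<bar> \<le> e)"
  show "f \<in> C0 M"
    unfolding C0_def mem_Collect_eq
  proof (intro conjI allI impI)
    show "continuous_on M f"
      unfolding continuous_on_iff
    proof (intro ballI allI impI)
      fix p and e :: real assume p: "p \<in> M" and e: "0 < e"
      then have e4: "0 < e / 4" by simp
      obtain R g where g: "cs M R g" "\<And>x. x \<in> M \<Longrightarrow> \<bar>f x - g x\<bar> \<le> e / 4" using *[rule_format, OF e4] by blast
      obtain d where d: "d > 0" "\<And>x. x \<in> M \<Longrightarrow> dist x p < d \<Longrightarrow> dist (g x) (g p) < e / 4"
      proof -
        have "continuous_on M g" using g(1) by (simp add: cs_def)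
        then have "\<exists>d>0. \<forall>x\<in>M. dist x p < d \<longrightarrow> dist (g x) (g p) < e / 4"
          using p e4 unfolding continuous_on_iff by blast
        then show thesis using that by blast
      qed
      have "dist (f x) (f p) < e" if x: "x \<in> M" "dist x p < d" for x
        using d(2)[OF x] g(2)[OF x(1)] g(2)[OF p] e unfolding dist_real_def by linarith
      with d(1) show "\<exists>d>0. \<forall>x\<in>M. dist x p < d \<longrightarrow> dist (f x) (f p) < e" by blast
    qed
    fix e :: real assume e: "0 < e"
    then have e2: "0 < e / 2" by simp
    obtain R g where g: "cs M R g" "\<And>x. x \<in> M \<Longrightarrow> \<bar>f x - g x\<bar> \<le> e / 2" using *[rule_format, OF e2] by blast
    show "\<exists>K. compact K \<and> K \<subseteq> M \<and> (\<forall>x\<in>M - K. \<bar>f x\<bar> < e)"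
    proof (rule exI[of _ "M \<inter> cball 0 R"], intro conjI ballI)
      show "compact (M \<inter> cball 0 R)" by (rule closed_Int_compact[OF assms compact_cball])
      show "M \<inter> cball 0 R \<subseteq> M" by simp
      fix x assume "x \<in> M - M \<inter> cball 0 R"
      then have x: "x \<in> M" "R < norm x" by auto
      then have "g x = 0" using g(1) by (simp add: cs_def)
      with x(1) show "\<bar>f x\<bar> < e" using g(2)[of x] e by simp
    qed
  qed
qed

lemma cs_C0:
  assumes "closed M" "cs M R g" "0 \<le> R"
  shows "g \<in> C0 M"
proof -
  have "\<exists>R g'. 0 \<le> R \<and> cs M R g' \<and> (\<forall>x\<in>M. \<bar>g x - g' x\<bar> \<le> e)" if "0 < e" for e
    by (rule exI[of _ R], rule exI[of _ g]) (use assms that in simp)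
  then show ?thesis unfolding C0_iff_cs[OF assms(1)] by blast
qed

lemma C0_bounded:
  assumes "closed M" "f \<in> C0 M"
  obtains B where "0 \<le> B" "\<And>y. y \<in> M \<Longrightarrow> \<bar>f y\<bar> \<le> B"
proof -
  obtain R g where g: "cs M R g" "\<And>x. x \<in> M \<Longrightarrow> \<bar>f x - g x\<bar> \<le> 1"
    using assms C0_iff_cs[of M f] zero_less_one by blast
  obtain B where B: "0 \<le> B" "\<And>y. y \<in> M \<Longrightarrow> \<bar>g y\<bar> \<le> B" by (rule cs_bounded[OF assms(1) g(1)]) metis
  show thesis
  proof (rule that[of "B + 1"])
    show "\<bar>f y\<bar> \<le> B + 1" if "y \<in> M" for y using g(2)[OF that] B(2)[OF that] by linarith
  qed (use B in simp)
qed

lemma C0_measurable: "f \<in> C0 M \<Longrightarrow> f \<in> borel_measurable (borel_of M)"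
  by (auto simp: C0_def intro: borel_measurable_continuous_on_restrict)

lemma C0_lin: "closed M \<Longrightarrow> f \<in> C0 M \<Longrightarrow> g \<in> C0 M \<Longrightarrow> (\<lambda>x. a * f x + b * g x) \<in> C0 M"
proof -
  assume M: "closed M" and f: "f \<in> C0 M" and g: "g \<in> C0 M"
  show ?thesis
    unfolding C0_iff_cs[OF M]
  proof (intro allI impI)
    fix e :: real assume e: "0 < e"
    define e' where "e' = e / (\<bar>a\<bar> + \<bar>b\<bar> + 1)"
    have e': "0 < e'" "(\<bar>a\<bar> + \<bar>b\<bar>) * e' \<le> e" using e by (auto simp: e'_def field_simps)
    obtain R1 u where u: "0 \<le> R1" "cs M R1 u" "\<And>x. x \<in> M \<Longrightarrow> \<bar>f x - u x\<bar> \<le> e'"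
      using f[unfolded C0_iff_cs[OF M], rule_format, OF e'(1)] by blast
    obtain R2 v where v: "0 \<le> R2" "cs M R2 v" "\<And>x. x \<in> M \<Longrightarrow> \<bar>g x - v x\<bar> \<le> e'"
      using g[unfolded C0_iff_cs[OF M], rule_format, OF e'(1)] by blast
    have "cs M (max R1 R2) (\<lambda>x. a * u x + b * v x)"
      by (rule cs_lin[OF cs_mono[OF u(2)] cs_mono[OF v(2)]]) auto
    moreover have "\<bar>(a * f x + b * g x) - (a * u x + b * v x)\<bar> \<le> e" if x: "x \<in> M" for x
    proof -
      have "(a * f x + b * g x) - (a * u x + b * v x) = a * (f x - u x) + b * (g x - v x)" by (simp add: algebra_simps)
      also have "\<bar>\<dots>\<bar> \<le> \<bar>a\<bar> * \<bar>f x - u x\<bar> + \<bar>b\<bar> * \<bar>g x - v x\<bar>" by (metis abs_mult abs_triangle_ineq)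
      also have "\<dots> \<le> \<bar>a\<bar> * e' + \<bar>b\<bar> * e'" using u(3)[OF x] v(3)[OF x] by (intro add_mono mult_left_mono) auto
      finally show ?thesis using e'(2) by (simp add: algebra_simps)
    qed
    moreover have "0 \<le> max R1 R2" using u(1) by simp
    ultimately show "\<exists>R g'. 0 \<le> R \<and> cs M R g' \<and> (\<forall>x\<in>M. \<bar>a * f x + b * g x - g' x\<bar> \<le> e)" by blast
  qed
qed

lemma C1c_iff:
  assumes M: "closed M"
  shows "f \<in> C1c M \<longleftrightarrow> f \<in> C1 M \<and> (\<exists>R\<ge>0. cs M R f)"
proof
  assume f: "f \<in> C1c M"
  then have "bounded (M \<inter> closure {x \<in> M. f x \<noteq> 0})" using compact_imp_bounded by (auto simp: C1c_def)
  then obtain R where R: "\<And>x. x \<in> M \<inter> closure {x \<in> M. f x \<noteq> 0} \<Longrightarrow> norm x \<le> R" unfolding bounded_iff by auto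
  have "cs M (max 0 R) f"
    unfolding cs_def
  proof (intro conjI ballI impI)
    show "continuous_on M f" using f C1_on_continuous by (auto simp: C1c_def C1_def)
    fix x assume "x \<in> M" "max 0 R < norm x"
    then show "f x = 0" using R[of x] closure_subset[of "{x \<in> M. f x \<noteq> 0}"] by auto
  qed
  then show "f \<in> C1 M \<and> (\<exists>R\<ge>0. cs M R f)" using f by (auto simp: C1c_def intro!: exI[of _ "max 0 R"])
next
  assume "f \<in> C1 M \<and> (\<exists>R\<ge>0. cs M R f)"
  then obtain R where f: "f \<in> C1 M" "cs M R f" by auto
  have "closure {x \<in> M. f x \<noteq> 0} \<subseteq> cball 0 R"
    by (rule closure_minimal) (use f in \<open>force simp: cs_def\<close>)+
  then have "bounded (M \<inter> closure {x \<in> M. f x \<noteq> 0})"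
    by (intro bounded_subset[OF bounded_cball[of 0 R]]) auto
  moreover have "closed (M \<inter> closure {x \<in> M. f x \<noteq> 0})" using M by auto
  ultimately show "f \<in> C1c M" using f(1) by (simp add: C1c_def compact_eq_bounded_closed)
qed

lemma sup_norm_tendsto_0_iff:
  "((\<lambda>t. sup_norm M (h t)) \<longlongrightarrow> 0) net \<longleftrightarrow> (\<forall>e>0. eventually (\<lambda>t. \<forall>x\<in>M. \<bar>h t x\<bar> \<le> e) net)"
proof
  assume lim: "((\<lambda>t. sup_norm M (h t)) \<longlongrightarrow> 0) net"
  show "\<forall>e>0. eventually (\<lambda>t. \<forall>x\<in>M. \<bar>h t x\<bar> \<le> e) net"
  proof (intro allI impI)
    fix e :: real assume e: "0 < e"
    then have "eventually (\<lambda>t. sup_norm M (h t) < ennreal e) net"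
      using order_tendstoD(2)[OF lim, of "ennreal e"] by simp
    then show "eventually (\<lambda>t. \<forall>x\<in>M. \<bar>h t x\<bar> \<le> e) net"
    proof eventually_elim
      case (elim t)
      show ?case
      proof
        fix x assume "x \<in> M"
        then have "ennreal \<bar>h t x\<bar> \<le> sup_norm M (h t)" unfolding sup_norm_def by (rule SUP_upper)
        then have "ennreal \<bar>h t x\<bar> \<le> ennreal e" using elim by auto
        then show "\<bar>h t x\<bar> \<le> e" using e by (simp add: ennreal_le_iff)
      qed
    qed
  qed
next
  assume ev: "\<forall>e>0. eventually (\<lambda>t. \<forall>x\<in>M. \<bar>h t x\<bar> \<le> e) net"
  show "((\<lambda>t. sup_norm M (h t)) \<longlongrightarrow> 0) net"
  proof (rule order_tendstoI)
    fix a :: ennreal assume a: "0 < a"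
    obtain e where e: "0 < e" "ennreal e < a"
    proof (cases a)
      case (real r)
      then have "0 < r" using a by simp
      then show thesis using that[of "r / 2"] real by (simp add: ennreal_lessI)
    next
      case top
      then show thesis using that[of 1] by simp
    qed
    from ev[rule_format, OF e(1)] show "eventually (\<lambda>t. sup_norm M (h t) < a) net"
    proof eventually_elim
      case (elim t)
      then have "sup_norm M (h t) \<le> ennreal e" unfolding sup_norm_def by (intro SUP_least ennreal_leI) auto
      then show ?case using e(2) by (rule le_less_trans)
    qed
  qed simp
qed

section \<open>Dissipativity and closedness of the generator\<close>

context pdmp_process
begin

text \<open>\<open>t\<close> times the difference of \<open>f\<close> and its quotient at time
  \<open>t\<close> is \<open>(t + 1) * f - U f t\<close>. Since \<open>U\<close> is a contraction,
  the supremum \<open>S\<close> of \<open>\<bar>f\<bar>\<close> satisfies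
  \<open>(t + 1) * S \<le> t * (c + e) + S\<close>, which is \<open>S \<le> c + e\<close>; no
  maximum has to be attained.\<close>

lemma unif_gen_dissipative:
  assumes f: "f \<in> borel_measurable N" "\<And>y. y \<in> M \<Longrightarrow> \<bar>f y\<bar> \<le> B" and gen: "unif_gen M U f k"
    and c: "\<And>x. x \<in> M \<Longrightarrow> \<bar>f x - k x\<bar> \<le> c" and x: "x \<in> M"
  shows "\<bar>f x\<bar> \<le> c"
proof -
  define S where "S = (SUP y\<in>M. \<bar>f y\<bar>)"
  have bdd: "bdd_above ((\<lambda>y. \<bar>f y\<bar>) ` M)" using f(2) by (auto intro!: bdd_aboveI[of _ B])
  have S: "\<bar>f y\<bar> \<le> S" if "y \<in> M" for y unfolding S_def by (rule cSUP_upper[OF that bdd])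
  have S0: "0 \<le> S" using S[OF x] by simp
  have "S \<le> c"
  proof (rule field_le_epsilon)
    fix e :: real assume e: "0 < e"
    obtain t where t: "0 < t" "\<And>x. x \<in> M \<Longrightarrow> \<bar>(U f t x - f x) / t - k x\<bar> \<le> e"
      by (rule unif_genD[OF gen e]) (metis order_refl)
    have "\<bar>f y\<bar> \<le> (t * (c + e) + S) / (t + 1)" if y: "y \<in> M" for y
    proof -
      have "\<bar>f y - (U f t y - f y) / t\<bar> \<le> c + e" using c[OF y] t(2)[OF y] by linarith
      then have "t * \<bar>f y - (U f t y - f y) / t\<bar> \<le> t * (c + e)" using t(1) by (intro mult_left_mono) auto
      then have "\<bar>t * (f y - (U f t y - f y) / t)\<bar> \<le> t * (c + e)" using t(1) by (simp add: abs_mult)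
      moreover have "t * (f y - (U f t y - f y) / t) = (t + 1) * f y - U f t y" using t(1) by (simp add: field_simps)
      ultimately have "\<bar>(t + 1) * f y - U f t y\<bar> \<le> t * (c + e)" by simp
      moreover have "\<bar>U f t y\<bar> \<le> S" by (rule U_abs_le[OF S S0])
      ultimately have "\<bar>(t + 1) * f y\<bar> \<le> t * (c + e) + S" by linarith
      then show ?thesis using t(1) by (simp add: abs_mult field_simps)
    qed
    then have "S \<le> (t * (c + e) + S) / (t + 1)" unfolding S_def using x by (intro cSUP_least) auto
    then have "t * S \<le> t * (c + e)" using t(1) by (simp add: field_simps)
    then show "S \<le> c + e" using t(1) by simp
  qed
  with S[OF x] show ?thesis by simp
qed

text \<open>The discrete form of the identity that \<open>U f t - f\<close> is the time integral of
  \<open>U g s\<close>: over a step \<open>h\<close> the increment at time \<open>s\<close> is the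
  semigroup at \<open>s\<close> applied to \<open>U f h - f\<close>, which is \<open>h * g\<close>
  up to \<open>h * e\<close>.\<close>

lemma unif_gen_growth:
  assumes f: "f \<in> borel_measurable N" "\<And>y. y \<in> M \<Longrightarrow> \<bar>f y\<bar> \<le> B"
    and g: "g \<in> borel_measurable N" "\<And>y. y \<in> M \<Longrightarrow> \<bar>g y\<bar> \<le> C"
    and gen: "unif_gen M U f g" and t: "0 < t"
    and c: "\<And>s x. 0 \<le> s \<Longrightarrow> s \<le> t \<Longrightarrow> x \<in> M \<Longrightarrow> \<bar>U g s x - g x\<bar> \<le> c" and x: "x \<in> M"
  shows "\<bar>U f t x - f x - t * g x\<bar> \<le> t * c"
proof -
  have B0: "0 \<le> B" using f(2)[OF x] by simp
  have "\<bar>U f t x - f x - t * g x\<bar> \<le> t * (c + e)" if e: "0 < e" for e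
  proof -
    obtain d where d: "0 < d" "\<And>t x. 0 < t \<Longrightarrow> t \<le> d \<Longrightarrow> x \<in> M \<Longrightarrow> \<bar>(U f t x - f x) / t - g x\<bar> \<le> e"
      by (rule unif_genD[OF gen e]) metis
    obtain n :: nat where n: "t / d \<le> real n" "0 < n"
    proof -
      obtain m :: nat where "t / d \<le> real m" using real_arch_simple by blast
      then show thesis using that[of "Suc m"] by simp
    qed
    define h where "h = t / real n"
    have h: "0 < h" "h \<le> d" "real n * h = t" using n t d by (auto simp: h_def field_simps)
    have Uh: "U f h \<in> borel_measurable N" "\<And>y. y \<in> M \<Longrightarrow> \<bar>U f h y\<bar> \<le> B"
      by (auto intro: U_slice[OF f] U_abs_le[OF f(2) B0])
    have fm: "(\<lambda>y. 1 * U f h y + (-1) * f y) \<in> borel_measurable N" using Uh f by simp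
    have fB: "\<bar>1 * U f h y + (-1) * f y\<bar> \<le> 2 * B" if "y \<in> M" for y using Uh(2)[OF that] f(2)[OF that] by simp
    have small: "\<bar>1 * (1 * U f h y + (-1) * f y) + (- h) * g y\<bar> \<le> h * e" if y: "y \<in> M" for y
    proof -
      have "\<bar>h * ((U f h y - f y) / h - g y)\<bar> \<le> h * e"
        unfolding abs_mult using d(2)[OF h(1,2) y] h(1) by (intro mult_mono) auto
      moreover have "h * ((U f h y - f y) / h - g y) = 1 * (1 * U f h y + (-1) * f y) + (- h) * g y"
        using h(1) by (simp add: field_simps)
      ultimately show ?thesis by simp
    qed
    have "\<bar>U f (real i * h) x - f x - real i * h * g x\<bar> \<le> real i * h * (c + e)" if "i \<le> n" for i
      using that
    proof (induction i)
      case 0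
      then show ?case using U_0[OF f x] by simp
    next
      case (Suc i)
      let ?s = "real i * h"
      have s: "0 \<le> ?s" "?s \<le> t"
      proof -
        show "0 \<le> ?s" using h by simp
        have "?s \<le> real n * h" using Suc(2) h by (intro mult_right_mono) auto
        then show "?s \<le> t" using h by simp
      qed
      let ?w = "U (\<lambda>y. 1 * (1 * U f h y + (-1) * f y) + (- h) * g y) ?s x"
      have "U f (real (Suc i) * h) x = U (U f h) ?s x"
        using U_semigroup[OF f _ s(1) x, of h] h by (simp add: algebra_simps)
      moreover have "U (\<lambda>y. 1 * U f h y + (-1) * f y) ?s x = 1 * U (U f h) ?s x + (-1) * U f ?s x"
        by (rule U_lin[OF Uh f s(1) x])
      moreover have "?w = 1 * U (\<lambda>y. 1 * U f h y + (-1) * f y) ?s x + (- h) * U g ?s x"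
        by (rule U_lin[OF fm fB g s(1) x])
      ultimately have "U f (real (Suc i) * h) x = U f ?s x + ?w + h * U g ?s x" by simp
      then have split: "U f (real (Suc i) * h) x - f x - real (Suc i) * h * g x =
          (U f ?s x - f x - ?s * g x) + ?w + h * (U g ?s x - g x)"
        by (simp add: algebra_simps)
      have 1: "\<bar>?w\<bar> \<le> h * e"
        by (rule U_abs_le[OF small]) (use h e in auto)
      have 2: "\<bar>h * (U g ?s x - g x)\<bar> \<le> h * c"
        unfolding abs_mult using c[OF s x] h by (intro mult_mono) auto
      have 3: "\<bar>U f ?s x - f x - ?s * g x\<bar> \<le> ?s * (c + e)" using Suc by simp
      have "\<bar>U f (real (Suc i) * h) x - f x - real (Suc i) * h * g x\<bar> \<le> ?s * (c + e) + h * e + h * c"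
        unfolding split by (intro order_trans[OF abs_triangle_ineq] add_mono 1 2 3)
      also have "\<dots> = real (Suc i) * h * (c + e)" by (simp add: algebra_simps)
      finally show ?case .
    qed
    from this[of n] show ?thesis using h(3) by simp
  qed
  note bound = this
  show ?thesis
  proof (rule field_le_epsilon)
    fix e :: real assume "0 < e"
    then have "\<bar>U f t x - f x - t * g x\<bar> \<le> t * (c + e / t)" by (intro bound) (use t in simp)
    also have "\<dots> = t * c + e" using t by (simp add: field_simps)
    finally show "\<bar>U f t x - f x - t * g x\<bar> \<le> t * c + e" .
  qed
qed

text \<open>The accuracy \<open>a\<close> of the approximants is sent to 0 while \<open>t\<close> is
  fixed, before dividing by \<open>t\<close>. The admissible times therefore depend only on the
  strong continuity at \<open>g\<close>, and not on the approximants.\<close>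

lemma unif_gen_closed:
  assumes f: "f \<in> borel_measurable N" "\<And>y. y \<in> M \<Longrightarrow> \<bar>f y\<bar> \<le> B"
    and g: "g \<in> borel_measurable N" "\<And>y. y \<in> M \<Longrightarrow> \<bar>g y\<bar> \<le> C"
    and strong: "\<And>e. 0 < e \<Longrightarrow> \<exists>d>0. \<forall>t x. 0 \<le> t \<longrightarrow> t \<le> d \<longrightarrow> x \<in> M \<longrightarrow> \<bar>U g t x - g x\<bar> \<le> e"
    and approx: "\<And>e. 0 < e \<Longrightarrow> \<exists>u v Bu Bv. u \<in> borel_measurable N \<and> v \<in> borel_measurable N \<and>
      (\<forall>y\<in>M. \<bar>u y\<bar> \<le> Bu \<and> \<bar>v y\<bar> \<le> Bv \<and> \<bar>u y - f y\<bar> \<le> e \<and> \<bar>v y - g y\<bar> \<le> e) \<and> unif_gen M U u v"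
  shows "unif_gen M U f g"
  unfolding unif_gen_def
proof (intro allI impI)
  fix e :: real assume e: "0 < e"
  obtain d where d: "d > 0" "\<And>t x. 0 \<le> t \<Longrightarrow> t \<le> d \<Longrightarrow> x \<in> M \<Longrightarrow> \<bar>U g t x - g x\<bar> \<le> e" using strong[OF e] by blast
  show "\<exists>d>0. \<forall>t x. 0 < t \<longrightarrow> t \<le> d \<longrightarrow> x \<in> M \<longrightarrow> \<bar>(U f t x - f x) / t - g x\<bar> \<le> e"
  proof (rule exI[of _ d], intro conjI allI impI d(1))
    fix t x assume t: "0 < t" "t \<le> d" and x: "x \<in> M"
    have "\<bar>U f t x - f x - t * g x\<bar> \<le> t * e + a * (2 + 3 * t)" if a: "0 < a" for a
    proof -
      obtain u v Bu Bv where uv: "u \<in> borel_measurable N" "v \<in> borel_measurable N" "\<And>y. y \<in> M \<Longrightarrow> \<bar>u y\<bar> \<le> Bu"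
        "\<And>y. y \<in> M \<Longrightarrow> \<bar>v y\<bar> \<le> Bv" "\<And>y. y \<in> M \<Longrightarrow> \<bar>u y - f y\<bar> \<le> a" "\<And>y. y \<in> M \<Longrightarrow> \<bar>v y - g y\<bar> \<le> a" "unif_gen M U u v"
        using approx[OF a] by blast
      have vg: "\<bar>U v s y - U g s y\<bar> \<le> a" if "0 \<le> s" "y \<in> M" for s y
        by (rule U_diff_le[OF uv(2,4) g uv(6) that(2,1)])
      have "\<bar>U u t x - u x - t * v x\<bar> \<le> t * (e + 2 * a)"
      proof (rule unif_gen_growth[OF uv(1,3,2,4,7) t(1) _ x])
        fix s y assume s: "0 \<le> s" "s \<le> t" and y: "y \<in> M"
        have "\<bar>U g s y - g y\<bar> \<le> e" by (rule d(2)) (use s t y in auto)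
        then show "\<bar>U v s y - v y\<bar> \<le> e + 2 * a" using vg[OF s(1) y] uv(6)[OF y] by linarith
      qed
      moreover have "\<bar>U u t x - U f t x\<bar> \<le> a" by (rule U_diff_le[OF uv(1,3) f uv(5) x less_imp_le[OF t(1)]])
      moreover have "\<bar>t * (v x - g x)\<bar> \<le> t * a" unfolding abs_mult using uv(6)[OF x] t by (intro mult_mono) auto
      moreover have "\<bar>u x - f x\<bar> \<le> a" by (rule uv(5)[OF x])
      moreover have "U f t x - f x - t * g x = (U u t x - u x - t * v x) - (U u t x - U f t x) + (u x - f x) + t * (v x - g x)"
        by (simp add: algebra_simps)
      ultimately have "\<bar>U f t x - f x - t * g x\<bar> \<le> t * (e + 2 * a) + a + a + t * a" by linarith
      also have "\<dots> = t * e + a * (2 + 3 * t)" by (simp add: algebra_simps)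
      finally show ?thesis .
    qed
    note bound = this
    have "\<bar>U f t x - f x - t * g x\<bar> \<le> t * e"
    proof (rule field_le_epsilon)
      fix b :: real assume b: "0 < b"
      have p: "0 < 2 + 3 * t" using t by simp
      have "\<bar>U f t x - f x - t * g x\<bar> \<le> t * e + (b / (2 + 3 * t)) * (2 + 3 * t)"
        by (rule bound) (use b p in simp)
      then show "\<bar>U f t x - f x - t * g x\<bar> \<le> t * e + b" using p by simp
    qed
    moreover have "(U f t x - f x) / t - g x = (U f t x - f x - t * g x) / t" using t by (simp add: field_simps)
    ultimately show "\<bar>(U f t x - f x) / t - g x\<bar> \<le> e" using t by (simp add: abs_divide pos_divide_le_eq mult.commute)
  qed
qed

end

section \<open>Passage to the original semigroup\<close>

locale approximable_pdmp = pdmp_process +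
  assumes approximable: "\<And>\<epsilon>. 0 < \<epsilon> \<Longrightarrow> \<exists>lam' Q' G'. nice_pdmp M \<phi> lam' Q' G' \<and> pdmp_pair M \<phi> lam Q G lam' Q' G' \<epsilon>"
begin

text \<open>The approximating semigroup is handed over as a bare function \<open>S\<close>, so that
  the limit arguments refer neither to its characteristics nor to its displacement radius.\<close>

lemma approximation:
  assumes e: "0 < \<epsilon>"
  obtains S where
    "\<And>f B x t. f \<in> borel_measurable N \<Longrightarrow> (\<And>y. y \<in> M \<Longrightarrow> \<bar>f y\<bar> \<le> B) \<Longrightarrow> x \<in> M \<Longrightarrow> 0 \<le> t \<Longrightarrow> \<bar>S f t x - U f t x\<bar> \<le> \<epsilon> * B * t"
    "\<And>R f t. cs M R f \<Longrightarrow> 0 \<le> R \<Longrightarrow> 0 \<le> t \<Longrightarrow> \<exists>R'\<ge>0. cs M R' (S f t)"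
    "\<And>R f a. cs M R f \<Longrightarrow> 0 \<le> R \<Longrightarrow> 0 < a \<Longrightarrow> \<exists>d>0. \<forall>t x. 0 \<le> t \<longrightarrow> t \<le> d \<longrightarrow> x \<in> M \<longrightarrow> \<bar>S f t x - f x\<bar> \<le> a"
    "\<And>R f. f \<in> C1 M \<Longrightarrow> cs M R f \<Longrightarrow> 0 \<le> R \<Longrightarrow> \<exists>k R'. 0 \<le> R' \<and> cs M R' k \<and> unif_gen M S f k"
    "\<And>R f a. f \<in> C1 M \<Longrightarrow> cs M R f \<Longrightarrow> 0 \<le> R \<Longrightarrow> 0 < a \<Longrightarrow>
       \<exists>\<psi> k R'. \<psi> \<in> C1 M \<and> 0 \<le> R' \<and> cs M R' \<psi> \<and> unif_gen M S \<psi> k \<and> (\<forall>x\<in>M. \<bar>\<psi> x - k x - f x\<bar> \<le> a)"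
    "\<And>f B k c x. f \<in> borel_measurable N \<Longrightarrow> (\<And>y. y \<in> M \<Longrightarrow> \<bar>f y\<bar> \<le> B) \<Longrightarrow> unif_gen M S f k \<Longrightarrow>
       (\<And>x. x \<in> M \<Longrightarrow> \<bar>f x - k x\<bar> \<le> c) \<Longrightarrow> x \<in> M \<Longrightarrow> \<bar>f x\<bar> \<le> c"
proof -
  \<comment> \<open>Compensates the constant 4 of \<open>semigroup_diff\<close>.\<close>
  have e4: "0 < \<epsilon> / 4" using e by simp
  obtain lam' Q' G' where nice: "nice_pdmp M \<phi> lam' Q' G'" and pair: "pdmp_pair M \<phi> lam Q G lam' Q' G' (\<epsilon> / 4)"
    using approximable[OF e4] by blast
  interpret A: nice_pdmp M \<phi> lam' Q' G' by (rule nice)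
  interpret AA: pdmp_pair M \<phi> lam Q G lam' Q' G' "\<epsilon> / 4" by (rule pair)
  show thesis
  proof (rule that[of A.U])
    show "\<bar>A.U f t x - U f t x\<bar> \<le> \<epsilon> * B * t" if "f \<in> borel_measurable N" "\<And>y. y \<in> M \<Longrightarrow> \<bar>f y\<bar> \<le> B" "x \<in> M" "0 \<le> t" for f B x t
      using AA.semigroup_diff[OF that] by simp
    show "\<exists>R'\<ge>0. cs M R' (A.U f t)" if "cs M R f" "0 \<le> R" "0 \<le> t" for R f t by (rule A.U_cs[OF that])
    show "\<exists>d>0. \<forall>t x. 0 \<le> t \<longrightarrow> t \<le> d \<longrightarrow> x \<in> M \<longrightarrow> \<bar>A.U f t x - f x\<bar> \<le> a" if "cs M R f" "0 \<le> R" "0 < a" for R f a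
      by (rule A.U_strong[OF that]) blast
    show "\<exists>k R'. 0 \<le> R' \<and> cs M R' k \<and> unif_gen M A.U f k" if f: "f \<in> C1 M" "cs M R f" "0 \<le> R" for R f
    proof -
      obtain D where D: "cs M (R + A.r1) D" "unif_gen M A.U f (\<lambda>x. D x + A.jmp f x)"
        by (rule A.generator_C1[OF f]) metis
      have "cs M (R + A.r1) (\<lambda>x. D x + A.jmp f x)" using cs_lin[OF D(1) A.jmp_cs[OF f(2,3)], of 1 1] by simp
      moreover have "0 \<le> R + A.r1" using f(3) A.r1_nonneg by simp
      ultimately show ?thesis using D(2) by blast
    qed
    show "\<exists>\<psi> k R'. \<psi> \<in> C1 M \<and> 0 \<le> R' \<and> cs M R' \<psi> \<and> unif_gen M A.U \<psi> k \<and> (\<forall>x\<in>M. \<bar>\<psi> x - k x - f x\<bar> \<le> a)"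
      if "f \<in> C1 M" "cs M R f" "0 \<le> R" "0 < a" for R f a
      by (rule A.range_dense[OF that]) blast
    show "\<bar>f x\<bar> \<le> c" if "f \<in> borel_measurable N" "\<And>y. y \<in> M \<Longrightarrow> \<bar>f y\<bar> \<le> B" "unif_gen M A.U f k"
      "\<And>x. x \<in> M \<Longrightarrow> \<bar>f x - k x\<bar> \<le> c" "x \<in> M" for f B k c x
      by (rule A.unif_gen_dissipative[OF that])
  qed
qed

lemma C0_cs:
  assumes "f \<in> C0 M" "0 < e"
  obtains R g where "0 \<le> R" "cs M R g" "\<And>x. x \<in> M \<Longrightarrow> \<bar>f x - g x\<bar> \<le> e"
  using assms C0_iff_cs[OF closed_M, of f] by blast

lemma U_C0:
  assumes f: "f \<in> C0 M" and t: "0 \<le> t"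
  shows "U f t \<in> C0 M"
  unfolding C0_iff_cs[OF closed_M]
proof (intro allI impI)
  fix e :: real assume e: "0 < e"
  then have e2: "0 < e / 2" by simp
  obtain R g where g: "0 \<le> R" "cs M R g" "\<And>x. x \<in> M \<Longrightarrow> \<bar>f x - g x\<bar> \<le> e / 2" by (rule C0_cs[OF f e2]) metis
  obtain Bf where Bf: "\<And>y. y \<in> M \<Longrightarrow> \<bar>f y\<bar> \<le> Bf" by (rule C0_bounded[OF closed_M f]) metis
  obtain B where B: "0 \<le> B" "\<And>y. y \<in> M \<Longrightarrow> \<bar>g y\<bar> \<le> B" by (rule cs_bounded[OF closed_M g(2)]) metis
  note fm = C0_measurable[OF f] and gm = cs_measurable[OF g(2)]
  define \<epsilon> where "\<epsilon> = e / (2 * (B * t + 1))"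
  have Bt: "0 \<le> B * t" using B(1) t by simp
  have eps: "0 < \<epsilon>" "\<epsilon> * B * t \<le> e / 2"
  proof -
    show "0 < \<epsilon>" using e Bt by (simp add: \<epsilon>_def add_nonneg_pos)
    have "\<epsilon> * B * t = (e / 2) * ((B * t) / (B * t + 1))" by (simp add: \<epsilon>_def)
    also have "\<dots> \<le> (e / 2) * 1" using e Bt by (intro mult_left_mono) auto
    finally show "\<epsilon> * B * t \<le> e / 2" by simp
  qed
  obtain S where S: "\<And>f B x t. f \<in> borel_measurable N \<Longrightarrow> (\<And>y. y \<in> M \<Longrightarrow> \<bar>f y\<bar> \<le> B) \<Longrightarrow> x \<in> M \<Longrightarrow> 0 \<le> t \<Longrightarrow> \<bar>S f t x - U f t x\<bar> \<le> \<epsilon> * B * t"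
    and Scs: "\<And>R f t. cs M R f \<Longrightarrow> 0 \<le> R \<Longrightarrow> 0 \<le> t \<Longrightarrow> \<exists>R'\<ge>0. cs M R' (S f t)"
    by (rule approximation[OF eps(1)]) blast
  obtain R' where R': "0 \<le> R'" "cs M R' (S g t)" using Scs[OF g(2,1) t] by blast
  have "\<bar>U f t x - S g t x\<bar> \<le> e" if x: "x \<in> M" for x
  proof -
    have "\<bar>U f t x - U g t x\<bar> \<le> e / 2" by (rule U_diff_le[OF fm Bf gm B(2) g(3) x t])
    moreover have "\<bar>S g t x - U g t x\<bar> \<le> \<epsilon> * B * t" by (rule S[OF gm B(2) x t])
    ultimately show ?thesis using eps(2) by linarith
  qed
  with R' show "\<exists>R g. 0 \<le> R \<and> cs M R g \<and> (\<forall>x\<in>M. \<bar>U f t x - g x\<bar> \<le> e)" by blast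
qed

lemma U_strong_C0:
  assumes f: "f \<in> C0 M" and e: "0 < e"
  shows "\<exists>d>0. \<forall>t x. 0 \<le> t \<longrightarrow> t \<le> d \<longrightarrow> x \<in> M \<longrightarrow> \<bar>U f t x - f x\<bar> \<le> e"
proof -
  have e4: "0 < e / 4" using e by simp
  obtain R g where g: "0 \<le> R" "cs M R g" "\<And>x. x \<in> M \<Longrightarrow> \<bar>f x - g x\<bar> \<le> e / 4" by (rule C0_cs[OF f e4]) metis
  obtain Bf where Bf: "\<And>y. y \<in> M \<Longrightarrow> \<bar>f y\<bar> \<le> Bf" by (rule C0_bounded[OF closed_M f]) metis
  obtain B where B: "0 \<le> B" "\<And>y. y \<in> M \<Longrightarrow> \<bar>g y\<bar> \<le> B" by (rule cs_bounded[OF closed_M g(2)]) metis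
  note fm = C0_measurable[OF f] and gm = cs_measurable[OF g(2)]
  \<comment> \<open>A fixed accuracy 1 is enough here: the discrepancy is at most
    \<open>B * t\<close> and becomes small with \<open>t\<close>.\<close>
  obtain S where S: "\<And>f B x t. f \<in> borel_measurable N \<Longrightarrow> (\<And>y. y \<in> M \<Longrightarrow> \<bar>f y\<bar> \<le> B) \<Longrightarrow> x \<in> M \<Longrightarrow> 0 \<le> t \<Longrightarrow> \<bar>S f t x - U f t x\<bar> \<le> 1 * B * t"
    and Ss: "\<And>R f a. cs M R f \<Longrightarrow> 0 \<le> R \<Longrightarrow> 0 < a \<Longrightarrow> \<exists>d>0. \<forall>t x. 0 \<le> t \<longrightarrow> t \<le> d \<longrightarrow> x \<in> M \<longrightarrow> \<bar>S f t x - f x\<bar> \<le> a"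
    by (rule approximation[OF zero_less_one]) blast
  obtain d where d: "d > 0" "\<And>t x. 0 \<le> t \<Longrightarrow> t \<le> d \<Longrightarrow> x \<in> M \<Longrightarrow> \<bar>S g t x - g x\<bar> \<le> e / 4" using Ss[OF g(2,1) e4] by blast
  define d' where "d' = min d (e / (4 * (B + 1)))"
  have d': "0 < d'" using d e B by (simp add: d'_def)
  have Bd: "B * d' \<le> e / 4"
  proof -
    have "B * d' \<le> (B + 1) * (e / (4 * (B + 1)))" using B d' by (intro mult_mono) (auto simp: d'_def)
    also have "\<dots> = e / 4" by (rule mult_divide_self) (use B in simp)
    finally show ?thesis .
  qed
  have "\<bar>U f t x - f x\<bar> \<le> e" if t: "0 \<le> t" "t \<le> d'" and x: "x \<in> M" for t x
  proof -
    have "\<bar>U f t x - U g t x\<bar> \<le> e / 4" by (rule U_diff_le[OF fm Bf gm B(2) g(3) x t(1)])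
    moreover have "\<bar>S g t x - U g t x\<bar> \<le> 1 * B * t" by (rule S[OF gm B(2) x t(1)])
    moreover have "B * t \<le> B * d'" using t B by (intro mult_left_mono) auto
    moreover have "\<bar>S g t x - g x\<bar> \<le> e / 4" by (rule d(2)) (use t x in \<open>auto simp: d'_def\<close>)
    moreover have "\<bar>f x - g x\<bar> \<le> e / 4" by (rule g(3)[OF x])
    ultimately show ?thesis using Bd by linarith
  qed
  with d' show ?thesis by blast
qed

lemma unif_gen_perturb:
  assumes f: "f \<in> borel_measurable N" "\<And>y. y \<in> M \<Longrightarrow> \<bar>f y\<bar> \<le> B"
    and S: "\<And>x t. x \<in> M \<Longrightarrow> 0 \<le> t \<Longrightarrow> \<bar>S f t x - U f t x\<bar> \<le> c * t"
    and gen: "unif_gen M S f k" and e: "0 < e"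
  shows "\<exists>d>0. \<forall>t x. 0 < t \<longrightarrow> t \<le> d \<longrightarrow> x \<in> M \<longrightarrow> \<bar>(U f t x - f x) / t - k x\<bar> \<le> c + e"
proof -
  obtain d where d: "0 < d" "\<And>t x. 0 < t \<Longrightarrow> t \<le> d \<Longrightarrow> x \<in> M \<Longrightarrow> \<bar>(S f t x - f x) / t - k x\<bar> \<le> e"
    by (rule unif_genD[OF gen e]) metis
  have "\<bar>(U f t x - f x) / t - k x\<bar> \<le> c + e" if t: "0 < t" "t \<le> d" and x: "x \<in> M" for t x
  proof -
    have "\<bar>(S f t x - U f t x) / t\<bar> \<le> c" using S[OF x, of t] t by (simp add: abs_divide pos_divide_le_eq)
    moreover have "(U f t x - f x) / t - k x = ((S f t x - f x) / t - k x) - (S f t x - U f t x) / t"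
      using t by (simp add: field_simps)
    ultimately show ?thesis using d(2)[OF t x] by linarith
  qed
  with d(1) show ?thesis by blast
qed

text \<open>Divided by \<open>t\<close>, the discrepancy of the semigroups is at most a small
  constant, so for small \<open>t\<close> the quotients of \<open>U f\<close> stay uniformly close
  to the approximating generators \<open>k n\<close>. Comparing two of these at a common time shows
  that they form a uniform Cauchy sequence of compactly supported functions, and its limit is the
  generator at \<open>f\<close>.\<close>

lemma generator_C1c:
  assumes f: "f \<in> C1 M" "cs M R f" "0 \<le> R"
  shows "\<exists>k\<in>C0 M. unif_gen M U f k"
proof -
  obtain B where B: "0 \<le> B" "\<And>y. y \<in> M \<Longrightarrow> \<bar>f y\<bar> \<le> B" by (rule cs_bounded[OF closed_M f(2)]) metis
  note fm = cs_measurable[OF f(2)]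
  have ap: "\<exists>k R'. 0 \<le> R' \<and> cs M R' k \<and> (\<exists>d>0. \<forall>t x. 0 < t \<longrightarrow> t \<le> d \<longrightarrow> x \<in> M \<longrightarrow> \<bar>(U f t x - f x) / t - k x\<bar> \<le> e)"
    if e: "0 < e" for e
  proof -
    define \<epsilon> where "\<epsilon> = e / (2 * (B + 1))"
    have eps: "0 < \<epsilon>" "\<epsilon> * B \<le> e / 2"
    proof -
      show "0 < \<epsilon>" using e B by (simp add: \<epsilon>_def)
      then have "\<epsilon> * B \<le> \<epsilon> * (B + 1)" by (intro mult_left_mono) auto
      also have "\<dots> = e / 2" using mult_divide_self[of "B + 1" e 2] B(1) by (simp add: \<epsilon>_def mult.commute)
      finally show "\<epsilon> * B \<le> e / 2" .
    qed
    obtain S where S: "\<And>f B x t. f \<in> borel_measurable N \<Longrightarrow> (\<And>y. y \<in> M \<Longrightarrow> \<bar>f y\<bar> \<le> B) \<Longrightarrow> x \<in> M \<Longrightarrow> 0 \<le> t \<Longrightarrow> \<bar>S f t x - U f t x\<bar> \<le> \<epsilon> * B * t"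
      and Sg: "\<And>R f. f \<in> C1 M \<Longrightarrow> cs M R f \<Longrightarrow> 0 \<le> R \<Longrightarrow> \<exists>k R'. 0 \<le> R' \<and> cs M R' k \<and> unif_gen M S f k"
      by (rule approximation[OF eps(1)]) blast
    obtain k R' where k: "0 \<le> R'" "cs M R' k" "unif_gen M S f k" using Sg[OF f] by blast
    have e2: "0 < e / 2" using e by simp
    obtain d where d: "d > 0" "\<And>t x. 0 < t \<Longrightarrow> t \<le> d \<Longrightarrow> x \<in> M \<Longrightarrow> \<bar>(U f t x - f x) / t - k x\<bar> \<le> \<epsilon> * B + e / 2"
      using unif_gen_perturb[OF fm B(2) S[OF fm B(2)] k(3) e2] by blast
    have "\<bar>(U f t x - f x) / t - k x\<bar> \<le> e" if "0 < t" "t \<le> d" "x \<in> M" for t x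
      using d(2)[OF that] eps(2) by linarith
    with k(1,2) d(1) show ?thesis by blast
  qed
  have "\<forall>n. \<exists>k. \<exists>R' d. 0 \<le> R' \<and> cs M R' k \<and> 0 < d \<and> (\<forall>t x. 0 < t \<longrightarrow> t \<le> d \<longrightarrow> x \<in> M \<longrightarrow> \<bar>(U f t x - f x) / t - k x\<bar> \<le> inverse (real (Suc n)))"
  proof
    fix n :: nat
    have "0 < inverse (real (Suc n))" by simp
    from ap[OF this] show "\<exists>k. \<exists>R' d. 0 \<le> R' \<and> cs M R' k \<and> 0 < d \<and>
      (\<forall>t x. 0 < t \<longrightarrow> t \<le> d \<longrightarrow> x \<in> M \<longrightarrow> \<bar>(U f t x - f x) / t - k x\<bar> \<le> inverse (real (Suc n)))"
      by blast
  qed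
  then obtain k where k: "\<And>n. \<exists>R' d. 0 \<le> R' \<and> cs M R' (k n) \<and> 0 < d \<and> (\<forall>t x. 0 < t \<longrightarrow> t \<le> d \<longrightarrow> x \<in> M \<longrightarrow> \<bar>(U f t x - f x) / t - k n x\<bar> \<le> inverse (real (Suc n)))"
    by metis
  have kk: "\<bar>k n x - k m x\<bar> \<le> inverse (real (Suc n)) + inverse (real (Suc m))" if x: "x \<in> M" for n m x
  proof -
    obtain d1 where d1: "0 < d1" "\<And>t x. 0 < t \<Longrightarrow> t \<le> d1 \<Longrightarrow> x \<in> M \<Longrightarrow> \<bar>(U f t x - f x) / t - k n x\<bar> \<le> inverse (real (Suc n))" using k[of n] by blast
    obtain d2 where d2: "0 < d2" "\<And>t x. 0 < t \<Longrightarrow> t \<le> d2 \<Longrightarrow> x \<in> M \<Longrightarrow> \<bar>(U f t x - f x) / t - k m x\<bar> \<le> inverse (real (Suc m))" using k[of m] by blast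
    show ?thesis using d1(2)[of "min d1 d2" x] d2(2)[of "min d1 d2" x] d1(1) d2(1) x by linarith
  qed
  have inv0: "(\<lambda>m. inverse (real (Suc m))) \<longlonglongrightarrow> 0" by (rule LIMSEQ_inverse_real_of_nat)
  have conv: "\<exists>l. (\<lambda>n. k n x) \<longlonglongrightarrow> l" if x: "x \<in> M" for x
  proof -
    have "Cauchy (\<lambda>n. k n x)"
    proof (rule metric_CauchyI)
      fix e :: real assume e: "0 < e"
      then have "eventually (\<lambda>m. inverse (real (Suc m)) < e / 2) sequentially"
        by (intro order_tendstoD(2)[OF inv0]) simp
      then obtain m0 where m0: "\<And>m. m0 \<le> m \<Longrightarrow> inverse (real (Suc m)) < e / 2" unfolding eventually_sequentially by blast
      show "\<exists>M. \<forall>m\<ge>M. \<forall>n\<ge>M. dist (k m x) (k n x) < e"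
      proof (rule exI[of _ m0], intro allI impI)
        fix m n assume "m0 \<le> m" "m0 \<le> n"
        then show "dist (k m x) (k n x) < e" using kk[OF x, of m n] m0[of m] m0[of n] unfolding dist_real_def by linarith
      qed
    qed
    then show ?thesis using Cauchy_convergent convergent_def by blast
  qed
  define l where "l x = lim (\<lambda>n. k n x)" for x
  have l: "(\<lambda>n. k n x) \<longlonglongrightarrow> l x" if "x \<in> M" for x
    using conv[OF that] unfolding l_def by (auto simp: convergent_def[symmetric] convergent_LIMSEQ_iff)
  have kl: "\<bar>k n x - l x\<bar> \<le> inverse (real (Suc n))" if x: "x \<in> M" for n x
  proof -
    have "(\<lambda>m. \<bar>k n x - k m x\<bar>) \<longlonglongrightarrow> \<bar>k n x - l x\<bar>" by (intro tendsto_intros l x)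
    moreover have "(\<lambda>m. inverse (real (Suc n)) + inverse (real (Suc m))) \<longlonglongrightarrow> inverse (real (Suc n)) + 0"
      by (intro tendsto_intros inv0)
    ultimately have "\<bar>k n x - l x\<bar> \<le> inverse (real (Suc n)) + 0"
      by (rule LIMSEQ_le) (use kk[OF x] in blast)
    then show ?thesis by simp
  qed
  have pick: "\<exists>n. inverse (real (Suc n)) < e" if "0 < e" for e using reals_Archimedean[OF that] .
  have "l \<in> C0 M"
    unfolding C0_iff_cs[OF closed_M]
  proof (intro allI impI)
    fix e :: real assume "0 < e"
    then obtain n where n: "inverse (real (Suc n)) < e" using pick by blast
    obtain R' where "0 \<le> R'" "cs M R' (k n)" using k[of n] by blast
    moreover have "\<bar>l x - k n x\<bar> \<le> e" if "x \<in> M" for x using kl[OF that, of n] n by linarith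
    ultimately show "\<exists>R g. 0 \<le> R \<and> cs M R g \<and> (\<forall>x\<in>M. \<bar>l x - g x\<bar> \<le> e)" by blast
  qed
  moreover have "unif_gen M U f l"
    unfolding unif_gen_def
  proof (intro allI impI)
    fix e :: real assume "0 < e"
    then have "0 < e / 2" by simp
    then obtain n where n: "inverse (real (Suc n)) < e / 2" using pick by blast
    obtain d where d: "0 < d" "\<And>t x. 0 < t \<Longrightarrow> t \<le> d \<Longrightarrow> x \<in> M \<Longrightarrow> \<bar>(U f t x - f x) / t - k n x\<bar> \<le> inverse (real (Suc n))" using k[of n] by blast
    have "\<bar>(U f t x - f x) / t - l x\<bar> \<le> e" if "0 < t" "t \<le> d" "x \<in> M" for t x
      using d(2)[OF that] kl[OF that(3), of n] n by linarith
    with d(1) show "\<exists>d>0. \<forall>t x. 0 < t \<longrightarrow> t \<le> d \<longrightarrow> x \<in> M \<longrightarrow> \<bar>(U f t x - f x) / t - l x\<bar> \<le> e" by blast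
  qed
  ultimately show ?thesis by blast
qed

text \<open>\<open>\<psi>\<close> is produced by the approximating semigroup and hence depends on
  \<epsilon>, while replacing its generator by the original one costs \<epsilon> times the norm of
  \<open>\<psi>\<close>. Dissipativity of \<open>S\<close> bounds that norm by \<open>B + e\<close>,
  which is known before \<epsilon> is chosen.\<close>

lemma range_dense_C0:
  assumes h: "h \<in> C0 M" and e: "0 < e"
  obtains \<psi> k where "\<psi> \<in> C1c M" "k \<in> C0 M" "unif_gen M U \<psi> k" "\<And>x. x \<in> M \<Longrightarrow> \<bar>\<psi> x - k x - h x\<bar> \<le> e"
proof -
  have e8: "0 < e / 8" and e4: "0 < e / 4" using e by auto
  obtain R0 h0 where h0: "0 \<le> R0" "cs M R0 h0" "\<And>x. x \<in> M \<Longrightarrow> \<bar>h x - h0 x\<bar> \<le> e / 8" by (rule C0_cs[OF h e8]) metis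
  obtain h1 where h1: "h1 \<in> C1 M" "cs M (R0 + 1) h1" "\<And>x. x \<in> M \<Longrightarrow> \<bar>h1 x - h0 x\<bar> \<le> e / 8"
    by (rule cs_C1_dense[OF closed_M h0(2,1) e8]) metis
  have R1: "0 \<le> R0 + 1" using h0 by simp
  obtain B where B: "0 \<le> B" "\<And>y. y \<in> M \<Longrightarrow> \<bar>h1 y\<bar> \<le> B" by (rule cs_bounded[OF closed_M h1(2)]) metis
  \<comment> \<open>Anticipates the bound \<open>B + e\<close> on \<open>\<psi>\<close>, so that
    exchanging the generators costs at most \<open>e / 4\<close>.\<close>
  define \<epsilon> where "\<epsilon> = e / (4 * (B + e))"
  have eps: "0 < \<epsilon>" "\<epsilon> * (B + e) = e / 4"
  proof -
    have p: "0 < B + e" using B e by simp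
    then show "0 < \<epsilon>" using e by (simp add: \<epsilon>_def)
    show "\<epsilon> * (B + e) = e / 4" using mult_divide_self[OF p, of e 4] by (simp add: \<epsilon>_def mult.commute)
  qed
  obtain S where S: "\<And>f B x t. f \<in> borel_measurable N \<Longrightarrow> (\<And>y. y \<in> M \<Longrightarrow> \<bar>f y\<bar> \<le> B) \<Longrightarrow> x \<in> M \<Longrightarrow> 0 \<le> t \<Longrightarrow> \<bar>S f t x - U f t x\<bar> \<le> \<epsilon> * B * t"
    and Sr: "\<And>R f a. f \<in> C1 M \<Longrightarrow> cs M R f \<Longrightarrow> 0 \<le> R \<Longrightarrow> 0 < a \<Longrightarrow>
       \<exists>\<psi> k R'. \<psi> \<in> C1 M \<and> 0 \<le> R' \<and> cs M R' \<psi> \<and> unif_gen M S \<psi> k \<and> (\<forall>x\<in>M. \<bar>\<psi> x - k x - f x\<bar> \<le> a)"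
    and Sd: "\<And>f B k c x. f \<in> borel_measurable N \<Longrightarrow> (\<And>y. y \<in> M \<Longrightarrow> \<bar>f y\<bar> \<le> B) \<Longrightarrow> unif_gen M S f k \<Longrightarrow>
       (\<And>x. x \<in> M \<Longrightarrow> \<bar>f x - k x\<bar> \<le> c) \<Longrightarrow> x \<in> M \<Longrightarrow> \<bar>f x\<bar> \<le> c"
    by (rule approximation[OF eps(1)]) blast
  obtain \<psi> k' R' where p: "\<psi> \<in> C1 M" "0 \<le> R'" "cs M R' \<psi>" "unif_gen M S \<psi> k'" "\<And>x. x \<in> M \<Longrightarrow> \<bar>\<psi> x - k' x - h1 x\<bar> \<le> e / 4"
    using Sr[OF h1(1,2) R1 e4] by blast
  note pm = cs_measurable[OF p(3)]
  obtain Bp where Bp: "\<And>y. y \<in> M \<Longrightarrow> \<bar>\<psi> y\<bar> \<le> Bp" by (rule cs_bounded[OF closed_M p(3)]) metis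
  have \<psi>B: "\<bar>\<psi> x\<bar> \<le> B + e" if x: "x \<in> M" for x
  proof (rule Sd[OF pm Bp p(4) _ x])
    show "\<bar>\<psi> y - k' y\<bar> \<le> B + e" if "y \<in> M" for y using p(5)[OF that] B(2)[OF that] e by linarith
  qed
  obtain k where k: "k \<in> C0 M" "unif_gen M U \<psi> k" using generator_C1c[OF p(1,3,2)] by blast
  have kk: "\<bar>k x - k' x\<bar> \<le> e / 4" if x: "x \<in> M" for x
  proof (rule field_le_epsilon)
    fix a :: real assume "0 < a"
    then have a2: "0 < a / 2" by simp
    obtain d1 where d1: "d1 > 0" "\<And>t x. 0 < t \<Longrightarrow> t \<le> d1 \<Longrightarrow> x \<in> M \<Longrightarrow> \<bar>(U \<psi> t x - \<psi> x) / t - k' x\<bar> \<le> \<epsilon> * (B + e) + a / 2"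
      using unif_gen_perturb[OF pm Bp S[OF pm \<psi>B] p(4) a2] by blast
    obtain d2 where d2: "0 < d2" "\<And>t x. 0 < t \<Longrightarrow> t \<le> d2 \<Longrightarrow> x \<in> M \<Longrightarrow> \<bar>(U \<psi> t x - \<psi> x) / t - k x\<bar> \<le> a / 2"
      by (rule unif_genD[OF k(2) a2]) metis
    show "\<bar>k x - k' x\<bar> \<le> e / 4 + a"
      using d1(2)[of "min d1 d2" x] d2(2)[of "min d1 d2" x] d1(1) d2(1) x eps(2) by linarith
  qed
  show thesis
  proof (rule that[OF _ k])
    show "\<psi> \<in> C1c M" using C1c_iff[OF closed_M] p(1-3) by blast
    show "\<bar>\<psi> x - k x - h x\<bar> \<le> e" if x: "x \<in> M" for x
      using p(5)[OF x] kk[OF x] h0(3)[OF x] h1(3)[OF x] e by linarith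
  qed
qed

section \<open>The Feller property and the core\<close>

abbreviation "P \<equiv> pdmp_operator M \<phi> lam G"

lemma P_eq:
  assumes f: "f \<in> C0 M" and "0 \<le> t" "x \<in> M"
  shows "P t f x = U f t x"
proof -
  obtain B where B: "\<And>y. y \<in> M \<Longrightarrow> \<bar>f y\<bar> \<le> B" by (rule C0_bounded[OF closed_M f]) metis
  show ?thesis by (rule pdmp_operator_eq[OF assms(3,2) C0_measurable[OF f] B])
qed

lemma C0_cong:
  assumes f: "f \<in> C0 M" and fg: "\<And>x. x \<in> M \<Longrightarrow> f x = g x"
  shows "g \<in> C0 M"
  unfolding C0_iff_cs[OF closed_M]
proof (intro allI impI)
  fix e :: real assume "0 < e"
  then obtain R u where u: "0 \<le> R" "cs M R u" "\<And>x. x \<in> M \<Longrightarrow> \<bar>f x - u x\<bar> \<le> e" by (rule C0_cs[OF f]) metis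
  have "\<bar>g x - u x\<bar> \<le> e" if "x \<in> M" for x using u(3)[OF that] fg[OF that] by simp
  with u(1,2) show "\<exists>R u. 0 \<le> R \<and> cs M R u \<and> (\<forall>x\<in>M. \<bar>g x - u x\<bar> \<le> e)" by blast
qed

lemma eventually_at_right_0_iff:
  "eventually Pr (at_right (0::real)) \<longleftrightarrow> (\<exists>d>0. \<forall>t. 0 < t \<longrightarrow> t \<le> d \<longrightarrow> Pr t)"
proof
  assume "eventually Pr (at_right (0::real))"
  then obtain b where b: "b > 0" "\<And>t. 0 < t \<Longrightarrow> t < b \<Longrightarrow> Pr t" unfolding eventually_at_right_field by auto
  then show "\<exists>d>0. \<forall>t. 0 < t \<longrightarrow> t \<le> d \<longrightarrow> Pr t" by (intro exI[of _ "b / 2"]) auto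
next
  assume "\<exists>d>0. \<forall>t. 0 < t \<longrightarrow> t \<le> d \<longrightarrow> Pr t"
  then show "eventually Pr (at_right (0::real))" unfolding eventually_at_right_field by (blast intro: less_imp_le)
qed

lemma strong_generator_iff:
  "(f, g) \<in> strong_generator M P \<longleftrightarrow> f \<in> C0 M \<and> g \<in> C0 M \<and> unif_gen M U f g"
proof (cases "f \<in> C0 M")
  case True
  have eq: "(\<forall>x\<in>M. \<bar>(P t f x - f x) / t - g x\<bar> \<le> e) \<longleftrightarrow> (\<forall>x\<in>M. \<bar>(U f t x - f x) / t - g x\<bar> \<le> e)"
    if t: "0 < t" for t e
    by (intro ball_cong refl) (simp add: P_eq[OF True less_imp_le[OF t]])
  have "(\<exists>d>0. \<forall>t. 0 < t \<longrightarrow> t \<le> d \<longrightarrow> (\<forall>x\<in>M. \<bar>(P t f x - f x) / t - g x\<bar> \<le> e)) \<longleftrightarrow>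
    (\<exists>d>0. \<forall>t x. 0 < t \<longrightarrow> t \<le> d \<longrightarrow> x \<in> M \<longrightarrow> \<bar>(U f t x - f x) / t - g x\<bar> \<le> e)" for e
    by (simp only: eq cong: imp_cong) blast
  then have "((\<lambda>t. sup_norm M (\<lambda>x. (P t f x - f x) / t - g x)) \<longlongrightarrow> 0) (at_right 0) \<longleftrightarrow> unif_gen M U f g"
    unfolding sup_norm_tendsto_0_iff eventually_at_right_0_iff unif_gen_def by (simp only:)
  then show ?thesis using True by (simp add: strong_generator_def)
qed (simp add: strong_generator_def)

lemma feller: "feller M P"
  unfolding feller_def
proof (intro ballI conjI allI impI)
  fix f assume f: "f \<in> C0 M"
  show "((\<lambda>t. sup_norm M (\<lambda>x. P t f x - f x)) \<longlongrightarrow> 0) (at_right 0)"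
    unfolding sup_norm_tendsto_0_iff eventually_at_right_0_iff
  proof (intro allI impI)
    fix e :: real assume "0 < e"
    from U_strong_C0[OF f this] obtain d where d: "d > 0" "\<And>t x. 0 \<le> t \<Longrightarrow> t \<le> d \<Longrightarrow> x \<in> M \<Longrightarrow> \<bar>U f t x - f x\<bar> \<le> e" by blast
    show "\<exists>d>0. \<forall>t. 0 < t \<longrightarrow> t \<le> d \<longrightarrow> (\<forall>x\<in>M. \<bar>P t f x - f x\<bar> \<le> e)"
    proof (rule exI[of _ d], intro conjI allI impI ballI d(1))
      fix t x assume "0 < t" "t \<le> d" "x \<in> M"
      then show "\<bar>P t f x - f x\<bar> \<le> e" using d(2)[of t x] P_eq[OF f, of t x] by simp
    qed
  qed
  fix t :: real assume t: "0 \<le> t"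
  show "P t f \<in> C0 M" by (rule C0_cong[OF U_C0[OF f t]]) (simp add: P_eq[OF f t])
qed

lemma core: "is_core M (C1c M) (strong_generator M P)"
  unfolding is_core_def
proof
  show "C1c M \<subseteq> Domain (strong_generator M P)"
  proof
    fix f assume "f \<in> C1c M"
    then obtain R where f: "f \<in> C1 M" "cs M R f" "0 \<le> R" using C1c_iff[OF closed_M] by blast
    obtain k where "k \<in> C0 M" "unif_gen M U f k" using generator_C1c[OF f] by blast
    then have "(f, k) \<in> strong_generator M P" using strong_generator_iff cs_C0[OF closed_M f(2,3)] by blast
    then show "f \<in> Domain (strong_generator M P)" by blast
  qed
  show "graph_closure M (strong_generator M P \<inter> C1c M \<times> UNIV) = strong_generator M P"
  proof (intro set_eqI iffI)
    fix z assume "z \<in> graph_closure M (strong_generator M P \<inter> C1c M \<times> UNIV)"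
    then obtain f g fs gs where z: "z = (f, g)" and f: "f \<in> C0 M" and g: "g \<in> C0 M"
      and seq: "\<And>n. (fs n, gs n) \<in> strong_generator M P"
      and lf: "(\<lambda>n. sup_norm M (\<lambda>x. fs n x - f x)) \<longlonglongrightarrow> 0" and lg: "(\<lambda>n. sup_norm M (\<lambda>x. gs n x - g x)) \<longlonglongrightarrow> 0"
      unfolding graph_closure_def by blast
    obtain B where B: "\<And>y. y \<in> M \<Longrightarrow> \<bar>f y\<bar> \<le> B" by (rule C0_bounded[OF closed_M f]) metis
    obtain C where C: "\<And>y. y \<in> M \<Longrightarrow> \<bar>g y\<bar> \<le> C" by (rule C0_bounded[OF closed_M g]) metis
    have "unif_gen M U f g"
    proof (rule unif_gen_closed[OF C0_measurable[OF f] B C0_measurable[OF g] C U_strong_C0[OF g]])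
      fix e :: real assume e: "0 < e"
      have "eventually (\<lambda>n. (\<forall>x\<in>M. \<bar>fs n x - f x\<bar> \<le> e) \<and> (\<forall>x\<in>M. \<bar>gs n x - g x\<bar> \<le> e)) sequentially"
        using lf lg e unfolding sup_norm_tendsto_0_iff by (simp add: eventually_conj_iff)
      then obtain n where n: "\<And>x. x \<in> M \<Longrightarrow> \<bar>fs n x - f x\<bar> \<le> e" "\<And>x. x \<in> M \<Longrightarrow> \<bar>gs n x - g x\<bar> \<le> e"
        using eventually_happens'[OF sequentially_bot] by blast
      have c0: "fs n \<in> C0 M" "gs n \<in> C0 M" "unif_gen M U (fs n) (gs n)" using seq[of n] strong_generator_iff by auto
      obtain B1 where B1: "\<And>y. y \<in> M \<Longrightarrow> \<bar>fs n y\<bar> \<le> B1" by (rule C0_bounded[OF closed_M c0(1)]) metis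
      obtain B2 where B2: "\<And>y. y \<in> M \<Longrightarrow> \<bar>gs n y\<bar> \<le> B2" by (rule C0_bounded[OF closed_M c0(2)]) metis
      show "\<exists>u v Bu Bv. u \<in> borel_measurable N \<and> v \<in> borel_measurable N \<and>
        (\<forall>y\<in>M. \<bar>u y\<bar> \<le> Bu \<and> \<bar>v y\<bar> \<le> Bv \<and> \<bar>u y - f y\<bar> \<le> e \<and> \<bar>v y - g y\<bar> \<le> e) \<and> unif_gen M U u v"
        by (rule exI[of _ "fs n"], rule exI[of _ "gs n"], rule exI[of _ B1], rule exI[of _ B2])
          (use C0_measurable[OF c0(1)] C0_measurable[OF c0(2)] B1 B2 n c0(3) in blast)
    qed
    then show "z \<in> strong_generator M P" using strong_generator_iff f g z by blast
  next
    fix z assume "z \<in> strong_generator M P"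
    then obtain f g where z: "z = (f, g)" "(f, g) \<in> strong_generator M P" by (cases z) auto
    then have f: "f \<in> C0 M" and g: "g \<in> C0 M" and gen: "unif_gen M U f g" using strong_generator_iff by auto
    obtain B where B: "\<And>y. y \<in> M \<Longrightarrow> \<bar>f y\<bar> \<le> B" by (rule C0_bounded[OF closed_M f]) metis
    \<comment> \<open>The target for the dense range: if \<open>\<psi> - k\<close> is close to
      \<open>f - g\<close>, dissipativity applied to \<open>\<psi> - f\<close> makes
      \<open>\<psi>\<close> close to \<open>f\<close>, and then \<open>k\<close> is close to
      \<open>g\<close>.\<close>
    have h: "(\<lambda>x. 1 * f x + (-1) * g x) \<in> C0 M" by (rule C0_lin[OF closed_M f g])
    have ap: "\<exists>\<psi> k. (\<psi>, k) \<in> strong_generator M P \<inter> C1c M \<times> UNIV \<and> (\<forall>x\<in>M. \<bar>\<psi> x - f x\<bar> \<le> e \<and> \<bar>k x - g x\<bar> \<le> e)"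
      if e: "0 < e" for e
    proof -
      have e2: "0 < e / 2" using e by simp
      obtain \<psi> k where p: "\<psi> \<in> C1c M" "k \<in> C0 M" "unif_gen M U \<psi> k" "\<And>x. x \<in> M \<Longrightarrow> \<bar>\<psi> x - k x - (1 * f x + (-1) * g x)\<bar> \<le> e / 2"
        by (rule range_dense_C0[OF h e2]) metis
      have p0: "\<psi> \<in> C0 M" using C1c_iff[OF closed_M] p(1) cs_C0[OF closed_M] by blast
      obtain B' where B': "\<And>y. y \<in> M \<Longrightarrow> \<bar>\<psi> y\<bar> \<le> B'" by (rule C0_bounded[OF closed_M p0]) metis
      have m: "(\<lambda>x. 1 * \<psi> x + (-1) * f x) \<in> borel_measurable N" using C0_measurable[OF p0] C0_measurable[OF f] by simp
      have close: "\<bar>1 * \<psi> x + (-1) * f x\<bar> \<le> e / 2" if x: "x \<in> M" for x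
      proof (rule unif_gen_dissipative[OF m, of "B' + B"])
        show "\<bar>1 * \<psi> y + (-1) * f y\<bar> \<le> B' + B" if "y \<in> M" for y using B[OF that] B'[OF that] by linarith
        show "unif_gen M U (\<lambda>x. 1 * \<psi> x + (-1) * f x) (\<lambda>x. 1 * k x + (-1) * g x)"
          by (rule unif_gen_lin[OF C0_measurable[OF p0] B' C0_measurable[OF f] B p(3) gen])
        show "\<bar>1 * \<psi> y + (-1) * f y - (1 * k y + (-1) * g y)\<bar> \<le> e / 2" if "y \<in> M" for y
          using p(4)[OF that] by (simp add: algebra_simps)
      qed (rule x)
      have "\<bar>\<psi> x - f x\<bar> \<le> e \<and> \<bar>k x - g x\<bar> \<le> e" if x: "x \<in> M" for x
        using close[OF x] p(4)[OF x] e by (intro conjI; linarith)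
      moreover have "(\<psi>, k) \<in> strong_generator M P \<inter> C1c M \<times> UNIV" using strong_generator_iff p(1-3) p0 by blast
      ultimately show ?thesis by blast
    qed
    have "\<forall>n. \<exists>p. p \<in> strong_generator M P \<inter> C1c M \<times> UNIV \<and>
      (\<forall>x\<in>M. \<bar>fst p x - f x\<bar> \<le> inverse (real (Suc n)) \<and> \<bar>snd p x - g x\<bar> \<le> inverse (real (Suc n)))"
    proof
      fix n
      obtain \<psi> k where "(\<psi>, k) \<in> strong_generator M P \<inter> C1c M \<times> UNIV"
        "\<forall>x\<in>M. \<bar>\<psi> x - f x\<bar> \<le> inverse (real (Suc n)) \<and> \<bar>k x - g x\<bar> \<le> inverse (real (Suc n))"
        using ap[of "inverse (real (Suc n))"] by auto
      then show "\<exists>p. p \<in> strong_generator M P \<inter> C1c M \<times> UNIV \<and>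
        (\<forall>x\<in>M. \<bar>fst p x - f x\<bar> \<le> inverse (real (Suc n)) \<and> \<bar>snd p x - g x\<bar> \<le> inverse (real (Suc n)))"
        by (intro exI[of _ "(\<psi>, k)"]) simp
    qed
    then obtain p where p: "\<And>n. p n \<in> strong_generator M P \<inter> C1c M \<times> UNIV"
      "\<And>n x. x \<in> M \<Longrightarrow> \<bar>fst (p n) x - f x\<bar> \<le> inverse (real (Suc n))"
      "\<And>n x. x \<in> M \<Longrightarrow> \<bar>snd (p n) x - g x\<bar> \<le> inverse (real (Suc n))"
      by metis
    have lim: "(\<lambda>n. sup_norm M (\<lambda>x. u n x - v x)) \<longlonglongrightarrow> 0"
      if "\<And>n x. x \<in> M \<Longrightarrow> \<bar>u n x - v x\<bar> \<le> inverse (real (Suc n))" for u :: "nat \<Rightarrow> 'a \<Rightarrow> real" and v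
      unfolding sup_norm_tendsto_0_iff
    proof (intro allI impI)
      fix e :: real assume e: "0 < e"
      have "eventually (\<lambda>n. inverse (real (Suc n)) < e) sequentially"
        by (rule order_tendstoD(2)[OF LIMSEQ_inverse_real_of_nat e])
      then show "eventually (\<lambda>n. \<forall>x\<in>M. \<bar>u n x - v x\<bar> \<le> e) sequentially"
        by eventually_elim (meson less_imp_le order_trans that)
    qed
    show "z \<in> graph_closure M (strong_generator M P \<inter> C1c M \<times> UNIV)"
      unfolding graph_closure_def z(1) mem_Collect_eq prod.case
    proof (intro conjI f g, rule exI[of _ "\<lambda>n. fst (p n)"], rule exI[of _ "\<lambda>n. snd (p n)"], intro conjI)
      show "\<forall>n. (fst (p n), snd (p n)) \<in> strong_generator M P \<inter> C1c M \<times> UNIV" using p(1) by simp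
      show "(\<lambda>n. sup_norm M (\<lambda>x. fst (p n) x - f x)) \<longlonglongrightarrow> 0" by (rule lim) (rule p(2))
      show "(\<lambda>n. sup_norm M (\<lambda>x. snd (p n) x - g x)) \<longlonglongrightarrow> 0" by (rule lim) (rule p(3))
    qed
  qed
qed

end

theorem theorem21:
  fixes M :: "'a::euclidean_space set"
    and \<phi> :: "real \<Rightarrow> 'a \<Rightarrow> 'a"
    and lam :: "'a \<Rightarrow> real"
    and Q :: "'a \<Rightarrow> 'a measure"
    and G :: "'a \<times> real \<Rightarrow> 'a"
  assumes "smooth_submanifold M" and "closed M"
    and "characteristics M \<phi> lam Q"
    and "represents_kernel M Q G"
    and "non_explosive M \<phi> lam G"
    and "smoothly_compactly_approximable M \<phi> lam Q"
  shows "feller M (pdmp_operator M \<phi> lam G) \<and>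
         is_core M (C1c M) (strong_generator M (pdmp_operator M \<phi> lam G))"
proof -
  have proc: "pdmp_process M \<phi> lam Q G"
    by unfold_locales (use assms in auto)
  interpret approximable_pdmp M \<phi> lam Q G
  proof (rule approximable_pdmp.intro[OF proc], unfold_locales)
    fix \<epsilon> :: real assume "0 < \<epsilon>"
    then obtain lam' Q' where c: "characteristics M \<phi> lam' Q'" and bd: "bounded_displacement M \<phi> lam' Q'"
      and st: "stability M \<phi> lam' Q'"
      and close: "\<And>x A. x \<in> M \<Longrightarrow> A \<in> sets (borel_of M) \<Longrightarrow>
        min (lam' x) (lam x) * \<bar>measure (Q' x) A - measure (Q x) A\<bar> + \<bar>lam' x - lam x\<bar> \<le> \<epsilon>"
      using assms(6) unfolding smoothly_compactly_approximable_def by metis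
    \<comment> \<open>Each approximation brings its own representation of the kernel, whose
      existence is part of \<open>bounded_displacement\<close>; the representation \<open>G\<close>
      of the original kernel stays the given one.\<close>
    obtain G' where G': "represents_kernel M Q' G'" "non_explosive M \<phi> lam' G'"
      "\<And>T. 0 \<le> T \<Longrightarrow> \<exists>r\<ge>0. \<forall>x\<in>M. \<forall>t\<in>{0..T}. supp M (pdmp_semigroup M \<phi> lam' G' t x) \<subseteq> riem_cball M x r"
      using bd unfolding bounded_displacement_def by blast
    have proc': "pdmp_process M \<phi> lam' Q' G'"
      by unfold_locales (use assms(2) c G' in auto)
    have "nice_pdmp M \<phi> lam' Q' G'"
    proof (rule nice_pdmp.intro[OF proc'], unfold_locales)
      show "C1_on ({0..} \<times> M) (\<lambda>(t, x). \<phi> t x)" using st by (simp add: stability_def)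
      show "continuous_on M lam'" using st by (intro C1_on_continuous) (simp add: stability_def C1_def)
      show "continuous_on M (jump_op lam' Q' f)" if "f \<in> C1 M" for f
        using st that by (intro C1_on_continuous) (simp add: stability_def C1_def)
    qed (rule G'(3))
    moreover have "pdmp_pair M \<phi> lam Q G lam' Q' G' \<epsilon>"
      by (rule pdmp_pair.intro[OF proc proc'], unfold_locales) (rule close)
    ultimately show "\<exists>lam' Q' G'. nice_pdmp M \<phi> lam' Q' G' \<and> pdmp_pair M \<phi> lam Q G lam' Q' G' \<epsilon>" by blast
  qed
  show ?thesis using feller core by blast
qed

end
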